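(* For every $\alpha \in (0,1)$, $\beta,\gamma \in [\alpha,1]$, and $\eta > 0$ there exist $\delta_{0},\epsilon > 0$ such that the following holds for all $\delta \in 2^{-\mathbb{N}} \cap (0,\delta_{0}]$. Let $A,B,C \subset \delta \mathbb{Z} \cap [0,1]$ be sets satisfying: (A) $A$ is a Katz-Tao $(\delta,\alpha)$-set; (B) $B$ is a Katz-Tao $(\delta,\beta)$-set; (C) $C$ is a Katz-Tao $(\delta,\gamma)$-set; ($\Pi$) $|B|^{\gamma}|C|^{\beta}\delta^{\beta\gamma} \geq \delta^{-\eta}$. Then there exists $c \in C$ such that \[ |\{a + cb : (a,b) \in G\}|_{\delta} \geq \delta^{-\epsilon}|A| \quad \text{for every } G \subset A \times B \text{ with } |G| \geq \delta^{\epsilon}|A||B|. \]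
   Context: For $\delta \in 2^{-\mathbb{N}}$ and $H \subset \mathbb{R}^{d}$, $|H|_{\delta}$ denotes the number of dyadic $\delta$-cubes intersecting $H$; $|H|$ denotes cardinality. For $s \geq 0$, $C>0$, $\delta \in 2^{-\mathbb{N}}$, a set $P \subset \mathbb{R}^{d}$ is a Katz-Tao $(\delta,s,C)$-set if $|P \cap B(x,r)|_{\delta} \leq C (r/\delta)^{s}$ for all $x \in \mathbb{R}^{d}$ and $r \geq \delta$; a Katz-Tao $(\delta,s)$-set means a Katz-Tao $(\delta,s,1)$-set. *)

theory Defs
  imports "HOL-Analysis.Analysis"
begin

definition dyadic_scales :: "real set" where
  "dyadic_scales = {1 / 2 ^ n | n :: nat. True}"

definition dyadic_cubes :: "real \<Rightarrow> ('a::euclidean_space) set set" where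
  "dyadic_cubes \<delta> =
     {{x. \<forall>b\<in>Basis. \<delta> * of_int (k b) \<le> x \<bullet> b \<and> x \<bullet> b < \<delta> * (of_int (k b) + 1)}
      | k :: 'a \<Rightarrow> int. True}"

text \<open>
  Below, this is applied to bounded sets only, which meet finitely many cubes; the convention
  that the cardinality of an infinite set is 0 therefore plays no role.
\<close>

definition dyadic_number :: "real \<Rightarrow> ('a::euclidean_space) set \<Rightarrow> nat" where
  "dyadic_number \<delta> H = card {Q \<in> dyadic_cubes \<delta>. Q \<inter> H \<noteq> {}}"

definition katz_tao_const :: "real \<Rightarrow> real \<Rightarrow> real \<Rightarrow> ('a::euclidean_space) set \<Rightarrow> bool" where
  "katz_tao_const \<delta> s K P \<longleftrightarrow>
     (\<forall>x r. r \<ge> \<delta> \<longrightarrow> real (dyadic_number \<delta> (P \<inter> cball x r)) \<le> K * (r / \<delta>) powr s)"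

definition katz_tao :: "real \<Rightarrow> real \<Rightarrow> ('a::euclidean_space) set \<Rightarrow> bool" where
  "katz_tao \<delta> s P \<longleftrightarrow> katz_tao_const \<delta> s 1 P"

definition scaled_ints :: "real \<Rightarrow> real set" where
  "scaled_ints \<delta> = {\<delta> * of_int k | k :: int. True}"

end

theory Submission
  imports Defs
begin

text \<open>
  Suppose every \<open>c \<in> C\<close> fails. Cauchy--Schwarz turns each failure into many triples \<open>(a, b, b')\<close> for which
  \<open>a + c (b' - b)\<close> is, up to rounding, again a point of \<open>A\<close>; write \<open>twist\<close> for this point. Hence a dense set \<open>H\<close>
  of triples works simultaneously for any tuple \<open>c\<^sub>0, \<dots>, c\<^sub>k\<close> chosen suitably from a dense subset of \<open>C\<close>, and
  alternating between consecutive \<open>c\<^sub>i\<close> produces many walks \<open>a\<^sub>0, \<dots>, a\<^sub>k\<close> in \<open>A\<close> whose total displacement is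
  \<open>\<Sum>\<^sub>i (c\<^sub>i\<^sub>+\<^sub>1 - c\<^sub>i) (b\<^sub>i' - b\<^sub>i)\<close>. Given the start, the number of walks is at most the number of end points,
  which the Katz--Tao condition on \<open>A\<close> bounds by \<open>r powr \<alpha>\<close>, times the concentration of this random sum.

  After passing to uniform subtrees of \<open>B\<close> and \<open>C\<close>, suitably localised, the levels at which the two trees branch have
  lower densities \<open>\<sigma>\<close> and \<open>\<tau>\<close> with \<open>\<sigma> + \<tau> > \<alpha>\<close>; this is where the product hypothesis on the sizes of \<open>B\<close> and
  \<open>C\<close> enters. If the \<open>c\<^sub>i\<close> zigzag between two branches at level \<open>l\<close> of \<open>C\<close>, then the branching of \<open>B\<close> at level \<open>s\<close>
  spreads the sum out at scale \<open>s + l\<close> by a Littlewood--Offord estimate, with almost the optimal gain. Finitely many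
  levels \<open>l\<close>, chosen greedily, suffice, by an approximate version of Mann's theorem, to make the set of scales \<open>s + l\<close>
  of density greater than \<open>\<alpha>\<close>. The gain then beats the number of end points, a contradiction.
\<close>

section \<open>Fibres and averages\<close>

definition fibre :: "'s set \<Rightarrow> ('s \<Rightarrow> 'l) \<Rightarrow> 'l \<Rightarrow> 's set" where
  "fibre S r l = {s\<in>S. r s = l}"

definition saturated :: "'s set \<Rightarrow> ('s \<Rightarrow> 'l) \<Rightarrow> 's set \<Rightarrow> bool" where
  "saturated S r T \<longleftrightarrow> (\<forall>s\<in>S. \<forall>s'\<in>S. r s = r s' \<longrightarrow> s \<in> T \<longrightarrow> s' \<in> T)"

lemma saturatedD: "saturated S r T \<Longrightarrow> s \<in> S \<Longrightarrow> s' \<in> S \<Longrightarrow> r s = r s' \<Longrightarrow> s \<in> T \<Longrightarrow> s' \<in> T"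
  unfolding saturated_def by blast

definition fibre_avg :: "'s set \<Rightarrow> ('s \<Rightarrow> 'l) \<Rightarrow> ('s \<Rightarrow> real) \<Rightarrow> 's \<Rightarrow> real" where
  "fibre_avg S r f s = (\<Sum>s'\<in>fibre S r (r s). f s') / card (fibre S r (r s))"

lemma finite_fibre: "finite S \<Longrightarrow> finite (fibre S r l)"
  by (simp add: fibre_def)

lemma card_fibre_pos: "finite S \<Longrightarrow> s \<in> S \<Longrightarrow> card (fibre S r (r s)) > 0"
  by (auto simp: card_gt_0_iff fibre_def)

lemma sum_by_fibres: "finite S \<Longrightarrow> (\<Sum>s\<in>S. g s) = (\<Sum>l\<in>r ` S. \<Sum>s\<in>fibre S r l. g s)"
  unfolding fibre_def by (rule sum.image_gen)

lemma card_by_fibres: "finite S \<Longrightarrow> card S = (\<Sum>l\<in>r ` S. card (fibre S r l))"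
  using sum_by_fibres[of S "\<lambda>_. 1::nat" r] by simp

lemma card_le_fibres:
  assumes "finite S" and "\<And>l. l \<in> r ` S \<Longrightarrow> real (card (fibre S r l)) \<le> c"
  shows "real (card S) \<le> real (card (r ` S)) * c"
proof -
  have "real (card S) = (\<Sum>l\<in>r ` S. real (card (fibre S r l)))"
    using card_by_fibres[OF assms(1), of r] by simp
  also have "\<dots> \<le> (\<Sum>l\<in>r ` S. c)" using assms(2) by (rule sum_mono)
  finally show ?thesis by simp
qed

lemma sum_indicat_real: "finite A \<Longrightarrow> (\<Sum>x\<in>A. indicat_real B x) = card (A \<inter> B)"
  by (simp add: indicator_def)

lemma card_le_by_fibres:
  assumes fin: "finite S" "finite T" and le: "\<And>l. l \<in> r ` S \<Longrightarrow> card (fibre S r l) \<le> c * card (fibre T r l)"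
  shows "card S \<le> c * card T"
proof -
  have "card S \<le> (\<Sum>l\<in>r ` S. c * card (fibre T r l))"
    unfolding card_by_fibres[OF fin(1), of r] using le by (rule sum_mono)
  also have "\<dots> \<le> (\<Sum>l\<in>r ` S \<union> r ` T. c * card (fibre T r l))" using fin by (intro sum_mono2) auto
  also have "\<dots> = (\<Sum>l\<in>r ` T. c * card (fibre T r l))"
    using fin by (intro sum.mono_neutral_right) (auto simp: fibre_def)
  finally show ?thesis using card_by_fibres[OF fin(2), of r] by (simp add: sum_distrib_left)
qed

lemma exists_ge_average:
  fixes f :: "'a \<Rightarrow> real" and c :: real
  assumes "finite S" "S \<noteq> {}" "c * card S \<le> (\<Sum>s\<in>S. f s)"
  shows "\<exists>s\<in>S. c \<le> f s"
proof (rule ccontr)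
  assume "\<not> ?thesis"
  then have "(\<Sum>s\<in>S. f s) < (\<Sum>s\<in>S. c)" using assms by (intro sum_strict_mono) (auto simp: not_le)
  then show False using assms by (simp add: mult.commute)
qed

lemma card_large_values_le:
  fixes f :: "'a \<Rightarrow> real" and t :: real
  assumes "finite S" "\<And>s. s \<in> S \<Longrightarrow> 0 \<le> f s"
  shows "card {s\<in>S. t < f s} * t \<le> (\<Sum>s\<in>S. f s)"
proof -
  have "card {s\<in>S. t < f s} * t \<le> (\<Sum>s\<in>{s\<in>S. t < f s}. f s)" by (rule sum_bounded_below) auto
  also have "\<dots> \<le> (\<Sum>s\<in>S. f s)" using assms by (intro sum_mono2) auto
  finally show ?thesis .
qed

lemma popular_value:
  fixes g :: "'a \<Rightarrow> 'b"
  assumes "finite H" "finite L" "L \<noteq> {}" and g: "\<And>h. h \<in> H \<Longrightarrow> g h \<in> L"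
  shows "\<exists>i\<in>L. real (card H) / card L \<le> card (fibre H g i)"
proof (rule exists_ge_average[OF assms(2,3)])
  have "card H = (\<Sum>i\<in>L. card (fibre H g i))"
    using sum.group[OF assms(1,2), of g "\<lambda>_. 1::nat"] g assms(1) by (simp add: image_subset_iff fibre_def)
  moreover have "card L > 0" using assms by (simp add: card_gt_0_iff)
  ultimately show "real (card H) / card L * card L \<le> (\<Sum>i\<in>L. real (card (fibre H g i)))" by simp
qed

lemma popular_point:
  fixes S :: "'h \<Rightarrow> 'f set" and \<kappa> :: real
  assumes "finite H" "finite Z" "Z \<noteq> {}" and S: "\<And>h. h \<in> H \<Longrightarrow> S h \<subseteq> Z" "\<And>h. h \<in> H \<Longrightarrow> \<kappa> * card Z \<le> card (S h)"
  shows "\<exists>f\<in>Z. \<kappa> * card H \<le> card {h\<in>H. f \<in> S h}"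
proof (rule exists_ge_average[OF assms(2,3)])
  have "\<kappa> * card H * card Z = (\<Sum>h\<in>H. \<kappa> * card Z)" by simp
  also have "\<dots> \<le> (\<Sum>h\<in>H. real (card {f\<in>Z. f \<in> S h}))"
  proof (rule sum_mono)
    fix h assume h: "h \<in> H"
    have "{f\<in>Z. f \<in> S h} = S h" using S(1)[OF h] by blast
    then show "\<kappa> * card Z \<le> card {f\<in>Z. f \<in> S h}" using S(2)[OF h] by simp
  qed
  also have "\<dots> = real (\<Sum>f\<in>Z. card {h\<in>H. f \<in> S h})"
    using sum_multicount_gen[OF assms(1,2), of "\<lambda>h f. f \<in> S h" "\<lambda>f. card {h\<in>H. f \<in> S h}"]
    by (simp flip: of_nat_sum)
  finally show "\<kappa> * card H * card Z \<le> (\<Sum>f\<in>Z. real (card {h\<in>H. f \<in> S h}))" by simp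
qed

lemma sum_fibre_avg_mult:
  assumes fin: "finite S" and meas: "\<And>s s'. s \<in> S \<Longrightarrow> s' \<in> S \<Longrightarrow> r s = r s' \<Longrightarrow> g s = g s'"
  shows "(\<Sum>s\<in>S. fibre_avg S r f s * g s) = (\<Sum>s\<in>S. f s * g s)"
proof -
  have "(\<Sum>s\<in>fibre S r l. fibre_avg S r f s * g s) = (\<Sum>s\<in>fibre S r l. f s * g s)" if "l \<in> r ` S" for l
  proof -
    obtain s0 where s0: "s0 \<in> S" "r s0 = l" using \<open>l \<in> r ` S\<close> by blast
    let ?F = "fibre S r l"
    have g: "g s = g s0" if "s \<in> ?F" for s using meas[of s s0] that s0 by (auto simp: fibre_def)
    have avg: "fibre_avg S r f s = (\<Sum>s'\<in>?F. f s') / card ?F" if "s \<in> ?F" for s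
      using that by (simp add: fibre_avg_def fibre_def)
    have "(\<Sum>s\<in>?F. fibre_avg S r f s * g s) = (\<Sum>s\<in>?F. (\<Sum>s'\<in>?F. f s') / card ?F * g s0)"
      by (intro sum.cong refl) (simp add: avg g)
    also have "\<dots> = (\<Sum>s'\<in>?F. f s') * g s0" using card_fibre_pos[OF fin s0(1), of r] s0(2) by simp
    also have "\<dots> = (\<Sum>s\<in>?F. f s * g s)" by (simp add: sum_distrib_right g)
    finally show ?thesis .
  qed
  then show ?thesis by (simp add: sum_by_fibres[OF fin, of _ r])
qed

lemma sum_fibre_avg:
  assumes "finite S"
  shows "(\<Sum>s\<in>S. fibre_avg S r f s) = (\<Sum>s\<in>S. f s)"
  using sum_fibre_avg_mult[OF assms, where g = "\<lambda>_. 1"] by simp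

lemma sum_fibre_avg_saturated:
  assumes "finite S" "T \<subseteq> S" and sat: "saturated S r T"
  shows "(\<Sum>s\<in>T. fibre_avg S r f s) = (\<Sum>s\<in>T. f s)"
proof -
  have "(\<Sum>s\<in>S. fibre_avg S r f s * indicat_real T s) = (\<Sum>s\<in>S. f s * indicat_real T s)"
    using sat by (intro sum_fibre_avg_mult[OF assms(1)]) (metis indicator_simps saturated_def)
  moreover have "(\<Sum>s\<in>S. h s * indicat_real T s) = (\<Sum>s\<in>T. h s)" for h
    using assms(1,2) by (intro sum.mono_neutral_cong_right) auto
  ultimately show ?thesis by simp
qed

lemma fibre_avg_const: "r s = r s' \<Longrightarrow> fibre_avg S r f s = fibre_avg S r f s'"
  by (simp add: fibre_avg_def)

lemma fibre_avg_pythagoras: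
  assumes fin: "finite S" and ref: "\<And>s s'. s \<in> S \<Longrightarrow> s' \<in> S \<Longrightarrow> r' s = r' s' \<Longrightarrow> r s = r s'"
  shows "(\<Sum>s\<in>S. (fibre_avg S r' f s)^2) = (\<Sum>s\<in>S. (fibre_avg S r f s)^2)
    + (\<Sum>s\<in>S. (fibre_avg S r' f s - fibre_avg S r f s)^2)"
proof -
  let ?a = "fibre_avg S r f" and ?b = "fibre_avg S r' f"
  have "(\<Sum>s\<in>S. ?b s * ?a s) = (\<Sum>s\<in>S. f s * ?a s)"
    by (intro sum_fibre_avg_mult[OF fin] fibre_avg_const ref)
  also have "\<dots> = (\<Sum>s\<in>S. ?a s * ?a s)"
    by (intro sum_fibre_avg_mult[OF fin, symmetric] fibre_avg_const)
  finally have "(\<Sum>s\<in>S. ?b s * ?a s) = (\<Sum>s\<in>S. ?a s * ?a s)" .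
  moreover have "(\<Sum>s\<in>S. (?b s - ?a s)^2) = (\<Sum>s\<in>S. (?b s)^2) + (\<Sum>s\<in>S. ?a s * ?a s) - 2 * (\<Sum>s\<in>S. ?b s * ?a s)"
    unfolding power2_diff by (simp add: sum.distrib sum_subtractf sum_distrib_left power2_eq_square mult.assoc)
  ultimately show ?thesis by (simp add: power2_eq_square)
qed

lemma fibre_avg_bounds:
  assumes "finite S" "s \<in> S"
    and bounds: "\<And>s'. s' \<in> fibre S r (r s) \<Longrightarrow> a \<le> f s'" "\<And>s'. s' \<in> fibre S r (r s) \<Longrightarrow> f s' \<le> b"
  shows "a \<le> fibre_avg S r f s" "fibre_avg S r f s \<le> b"
proof -
  let ?F = "fibre S r (r s)"
  have pos: "real (card ?F) > 0" using card_fibre_pos[OF assms(1,2), of r] by simp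
  have "real (card ?F) * a \<le> (\<Sum>s'\<in>?F. f s')"
    by (rule sum_bounded_below) (rule bounds)
  then show "a \<le> fibre_avg S r f s" using pos by (simp add: fibre_avg_def pos_le_divide_eq mult.commute)
  have "(\<Sum>s'\<in>?F. f s') \<le> real (card ?F) * b"
    by (rule sum_bounded_above) (rule bounds)
  then show "fibre_avg S r f s \<le> b" using pos by (simp add: fibre_avg_def pos_divide_le_eq mult.commute)
qed

section \<open>Regularity and triangle removal\<close>

definition edge_density :: "('v \<times> 'v) set \<Rightarrow> 'v set \<Rightarrow> 'v set \<Rightarrow> real" where
  "edge_density G U W = card (G \<inter> U \<times> W) / (card U * card W)"

definition irregularity_witness ::
  "real \<Rightarrow> ('v \<times> 'v) set \<Rightarrow> 'v set \<Rightarrow> 'v set \<Rightarrow> 'v set \<Rightarrow> 'v set \<Rightarrow> bool" where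
  "irregularity_witness \<theta> G X Y U W \<longleftrightarrow> U \<subseteq> X \<and> W \<subseteq> Y \<and> \<theta> * card X \<le> card U \<and> \<theta> * card Y \<le> card W \<and>
     \<theta> < \<bar>edge_density G U W - edge_density G X Y\<bar>"

definition regular_pair :: "real \<Rightarrow> ('v \<times> 'v) set \<Rightarrow> 'v set \<Rightarrow> 'v set \<Rightarrow> bool" where
  "regular_pair \<theta> G X Y \<longleftrightarrow> (\<forall>U W. \<not> irregularity_witness \<theta> G X Y U W)"

abbreviation block_density :: "'v set \<Rightarrow> ('v \<times> 'v) set \<Rightarrow> ('v \<Rightarrow> nat) \<Rightarrow> 'v \<times> 'v \<Rightarrow> real" where
  "block_density V G p \<equiv> fibre_avg (V \<times> V) (map_prod p p) (indicat_real G)"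

definition energy :: "'v set \<Rightarrow> ('v \<times> 'v) set \<Rightarrow> ('v \<Rightarrow> nat) \<Rightarrow> real" where
  "energy V G p = (\<Sum>s\<in>V \<times> V. (block_density V G p s)^2)"

definition irregular_pairs :: "real \<Rightarrow> 'v set \<Rightarrow> ('v \<times> 'v) set \<Rightarrow> ('v \<Rightarrow> nat) \<Rightarrow> ('v \<times> 'v) set" where
  "irregular_pairs \<theta> V G p =
     {(x, y). x \<in> V \<and> y \<in> V \<and> \<not> regular_pair \<theta> G (fibre V p (p x)) (fibre V p (p y))}"

lemma finite_irregular_pairs: "finite V \<Longrightarrow> finite (irregular_pairs \<theta> V G p)"
  by (rule finite_subset[of _ "V \<times> V"]) (auto simp: irregular_pairs_def)

lemma energy_nonneg: "0 \<le> energy V G p"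
  by (simp add: energy_def sum_nonneg)

lemma energy_le:
  assumes "finite V"
  shows "energy V G p \<le> (card V)^2"
proof -
  have "energy V G p \<le> (\<Sum>s\<in>V \<times> V. 1)"
    unfolding energy_def
  proof (rule sum_mono)
    fix s assume "s \<in> V \<times> V"
    then have "0 \<le> block_density V G p s" "block_density V G p s \<le> 1"
      using assms by (auto intro!: fibre_avg_bounds indicator_le_1)
    then show "(block_density V G p s)^2 \<le> 1" by (simp add: power_le_one)
  qed
  then show ?thesis by (simp add: card_cartesian_product power2_eq_square)
qed

lemma block_density_eq:
  assumes "finite V"
  shows "block_density V G p (x, y) = edge_density G (fibre V p (p x)) (fibre V p (p y))"
proof -
  have block: "fibre (V \<times> V) (map_prod p p) (p x, p y) = fibre V p (p x) \<times> fibre V p (p y)"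
    by (auto simp: fibre_def)
  show ?thesis
    unfolding fibre_avg_def edge_density_def map_prod_simp block
    by (simp add: sum_indicat_real finite_fibre[OF assms] card_cartesian_product Int_commute)
qed

lemma sum_block_density_rectangle:
  assumes fin: "finite V" and UW: "U \<subseteq> V" "W \<subseteq> V" and sat: "saturated V q U" "saturated V q W"
  shows "(\<Sum>s\<in>U \<times> W. block_density V G q s) = card (G \<inter> U \<times> W)"
proof -
  have "saturated (V \<times> V) (map_prod q q) (U \<times> W)"
    unfolding saturated_def
  proof (intro ballI impI)
    fix s s' assume "s \<in> V \<times> V" "s' \<in> V \<times> V" "map_prod q q s = map_prod q q s'" "s \<in> U \<times> W"
    then show "s' \<in> U \<times> W"
      using saturatedD[OF sat(1), of "fst s" "fst s'"] saturatedD[OF sat(2), of "snd s" "snd s'"]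
      by (cases s; cases s') simp
  qed
  then have "(\<Sum>s\<in>U \<times> W. block_density V G q s) = (\<Sum>s\<in>U \<times> W. indicat_real G s)"
    using fin UW by (intro sum_fibre_avg_saturated) auto
  also have "\<dots> = card (G \<inter> U \<times> W)"
    using finite_subset[OF UW(1) fin] finite_subset[OF UW(2) fin]
    by (simp add: sum_indicat_real Int_commute)
  finally show ?thesis .
qed

lemma irregular_block_increment:
  fixes p q :: "'v \<Rightarrow> nat" and \<theta> :: real
  assumes fin: "finite V" and \<theta>: "0 < \<theta>" and xy: "x \<in> V" "y \<in> V"
    and XY: "X = fibre V p (p x)" "Y = fibre V p (p y)"
    and wit: "irregularity_witness \<theta> G X Y U W" and sat: "saturated V q U" "saturated V q W"
  shows "\<theta>^4 * (card X * card Y) \<le> (\<Sum>s\<in>X \<times> Y. (block_density V G q s - block_density V G p s)^2)"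
proof -
  have sub: "U \<subseteq> X" "W \<subseteq> Y" and large: "\<theta> * card X \<le> card U" "\<theta> * card Y \<le> card W"
    and deviation: "\<theta> < \<bar>edge_density G U W - edge_density G X Y\<bar>"
    using wit by (auto simp: irregularity_witness_def)
  have subV: "U \<subseteq> V" "W \<subseteq> V" using sub by (auto simp: XY fibre_def)
  define N where "N = real (card U) * real (card W)"
  have "(\<theta> * card X) * (\<theta> * card Y) \<le> N"
    unfolding N_def using large \<theta> by (intro mult_mono) auto
  then have N_large: "\<theta>^2 * (card X * card Y) \<le> N" by (simp add: power2_eq_square mult_ac)
  have "0 < \<theta>^2 * (card X * card Y)"
    using \<theta> card_fibre_pos[OF fin xy(1), of p] card_fibre_pos[OF fin xy(2), of p] by (simp add: XY)
  then have N: "N > 0" using N_large by linarith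
  let ?diff = "\<lambda>s. block_density V G q s - block_density V G p s"
  have "block_density V G p s = edge_density G X Y" if "s \<in> U \<times> W" for s
  proof -
    obtain u w where "s = (u, w)" "p u = p x" "p w = p y" using \<open>s \<in> U \<times> W\<close> sub by (auto simp: XY fibre_def)
    then show ?thesis by (simp add: XY block_density_eq[OF fin])
  qed
  then have "(\<Sum>s\<in>U \<times> W. ?diff s) = card (G \<inter> U \<times> W) - N * edge_density G X Y"
    by (simp add: sum_subtractf sum_block_density_rectangle[OF fin subV sat] card_cartesian_product N_def)
  also have "\<dots> = N * (edge_density G U W - edge_density G X Y)"
    using N by (auto simp: edge_density_def N_def right_diff_distrib zero_less_mult_iff)
  finally have "(N * \<theta>)^2 \<le> (\<Sum>s\<in>U \<times> W. ?diff s)^2"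
    using deviation \<theta> N by (auto intro!: abs_le_square_iff[THEN iffD1] simp: abs_mult)
  also have "\<dots> \<le> (\<Sum>s\<in>U \<times> W. (?diff s)^2) * N"
    using sum_squared_le_sum_of_squares[of ?diff "U \<times> W"] by (simp add: card_cartesian_product N_def)
  finally have "(\<theta>^2 * N) * N \<le> (\<Sum>s\<in>U \<times> W. (?diff s)^2) * N" by (simp add: power2_eq_square mult_ac)
  then have "\<theta>^2 * N \<le> (\<Sum>s\<in>U \<times> W. (?diff s)^2)" using N by simp
  also have "\<dots> \<le> (\<Sum>s\<in>X \<times> Y. (?diff s)^2)"
    using sub fin by (intro sum_mono2) (auto simp: XY finite_fibre)
  finally have "\<theta>^2 * N \<le> (\<Sum>s\<in>X \<times> Y. (?diff s)^2)" .
  moreover have "\<theta>^2 * (\<theta>^2 * (card X * card Y)) \<le> \<theta>^2 * N"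
    using N_large by (intro mult_left_mono) auto
  ultimately show ?thesis by (simp add: power4_eq_xxxx power2_eq_square mult_ac)
qed

lemma energy_increment:
  fixes p q :: "'v \<Rightarrow> nat" and \<theta> :: real
  assumes fin: "finite V" and \<theta>: "0 < \<theta>"
    and ref: "\<And>x y. x \<in> V \<Longrightarrow> y \<in> V \<Longrightarrow> q x = q y \<Longrightarrow> p x = p y"
    and wit: "\<And>x y. (x, y) \<in> irregular_pairs \<theta> V G p \<Longrightarrow>
      \<exists>U W. irregularity_witness \<theta> G (fibre V p (p x)) (fibre V p (p y)) U W \<and> saturated V q U \<and> saturated V q W"
  shows "energy V G p + \<theta>^4 * card (irregular_pairs \<theta> V G p) \<le> energy V G q"
proof -
  let ?S = "V \<times> V" and ?I = "irregular_pairs \<theta> V G p" and ?pp = "map_prod p p"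
  let ?diff = "\<lambda>s. block_density V G q s - block_density V G p s"
  have finS: "finite ?S" using fin by simp
  have block: "\<theta>^4 * card (fibre ?I ?pp l) \<le> (\<Sum>s\<in>fibre ?S ?pp l. (?diff s)^2)" if l: "l \<in> ?pp ` ?I" for l
  proof -
    obtain x y where xy: "(x, y) \<in> ?I" "l = (p x, p y)" using l by auto
    then have V: "x \<in> V" "y \<in> V" by (auto simp: irregular_pairs_def)
    let ?X = "fibre V p (p x)" and ?Y = "fibre V p (p y)"
    have XY: "fibre ?S ?pp l = ?X \<times> ?Y" using xy by (auto simp: fibre_def)
    have "card (fibre ?I ?pp l) \<le> card (?X \<times> ?Y)"
      using fin by (intro card_mono) (auto simp: finite_fibre xy fibre_def irregular_pairs_def)
    then have "\<theta>^4 * card (fibre ?I ?pp l) \<le> \<theta>^4 * (card ?X * card ?Y)"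
      using \<theta> by (intro mult_left_mono) (auto simp: card_cartesian_product simp flip: of_nat_mult)
    also have "\<dots> \<le> (\<Sum>s\<in>?X \<times> ?Y. (?diff s)^2)"
      using wit[OF xy(1)] irregular_block_increment[OF fin \<theta> V refl refl] by blast
    finally show ?thesis unfolding XY .
  qed
  have "\<theta>^4 * card ?I = (\<Sum>l\<in>?pp ` ?I. \<theta>^4 * card (fibre ?I ?pp l))"
    using card_by_fibres[OF finite_irregular_pairs[OF fin], of \<theta> G p ?pp] by (simp add: sum_distrib_left)
  also have "\<dots> \<le> (\<Sum>l\<in>?pp ` ?I. \<Sum>s\<in>fibre ?S ?pp l. (?diff s)^2)"
    using block by (rule sum_mono)
  also have "\<dots> \<le> (\<Sum>l\<in>?pp ` ?S. \<Sum>s\<in>fibre ?S ?pp l. (?diff s)^2)"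
    using finS by (intro sum_mono2) (auto simp: irregular_pairs_def intro!: sum_nonneg)
  also have "\<dots> = (\<Sum>s\<in>?S. (?diff s)^2)" by (rule sum_by_fibres[OF finS, symmetric])
  also have "\<dots> = energy V G q - energy V G p"
    unfolding energy_def using fibre_avg_pythagoras[OF finS, of "map_prod q q" ?pp "indicat_real G"] ref by auto
  finally show ?thesis by simp
qed

lemma common_refinement:
  fixes p :: "'v \<Rightarrow> nat"
  assumes p: "p ` V \<subseteq> {..<K}" and T: "finite T"
  obtains q :: "'v \<Rightarrow> nat" where "q ` V \<subseteq> {..<K * 2 ^ card T}"
    and "\<And>x y. x \<in> V \<Longrightarrow> y \<in> V \<Longrightarrow> q x = q y \<Longrightarrow> p x = p y" and "\<And>t. t \<in> T \<Longrightarrow> saturated V q (U t)"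
proof -
  define \<phi> where "\<phi> x = (p x, {t\<in>T. x \<in> U t})" for x
  let ?R = "{..<K} \<times> Pow T"
  have card_R: "card ?R = K * 2 ^ card T" using T by (simp add: card_cartesian_product card_Pow)
  obtain h where h: "bij_betw h ?R {0..<card ?R}" using ex_bij_betw_finite_nat[of ?R] T by auto
  have \<phi>_R: "\<phi> x \<in> ?R" if "x \<in> V" for x using that p by (auto simp: \<phi>_def)
  have \<phi>_eq: "\<phi> x = \<phi> y" if "x \<in> V" "y \<in> V" "h (\<phi> x) = h (\<phi> y)" for x y
    using inj_onD[OF bij_betw_imp_inj_on[OF h] that(3) \<phi>_R[OF that(1)] \<phi>_R[OF that(2)]] .
  show ?thesis
  proof (rule that[of "\<lambda>x. h (\<phi> x)"])
    show "(\<lambda>x. h (\<phi> x)) ` V \<subseteq> {..<K * 2 ^ card T}"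
      using bspec[OF bij_betwE[OF h] \<phi>_R] by (auto simp: card_R)
    show "p x = p y" if "x \<in> V" "y \<in> V" "h (\<phi> x) = h (\<phi> y)" for x y
      using \<phi>_eq[OF that] by (simp add: \<phi>_def)
    show "saturated V (\<lambda>x. h (\<phi> x)) (U t)" if "t \<in> T" for t
      unfolding saturated_def using \<phi>_eq that unfolding \<phi>_def prod.inject set_eq_iff by blast
  qed
qed

lemma energy_increasing_refinement:
  fixes p :: "'v \<Rightarrow> nat" and G :: "nat \<Rightarrow> ('v \<times> 'v) set" and \<theta> :: real
  assumes fin: "finite V" and \<theta>: "0 < \<theta>" and p: "p ` V \<subseteq> {..<K}"
  obtains q where "q ` V \<subseteq> {..<K * 2 ^ (2 * m * K^2)}"
    and "\<And>g. g < m \<Longrightarrow> energy V (G g) p + \<theta>^4 * card (irregular_pairs \<theta> V (G g) p) \<le> energy V (G g) q"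
proof -
  let ?wit = "\<lambda>(g, i, j) UW. irregularity_witness \<theta> (G g) (fibre V p i) (fibre V p j) (UW True) (UW False)"
  have "\<exists>UW. (case t of (g, i, j) \<Rightarrow> \<not> regular_pair \<theta> (G g) (fibre V p i) (fibre V p j)) \<longrightarrow> ?wit t UW" for t
  proof (cases t)
    case (fields g i j)
    then show ?thesis by (auto simp: regular_pair_def intro: exI[of _ "\<lambda>b. if b then U else W" for U W])
  qed
  then obtain UW :: "nat \<times> nat \<times> nat \<Rightarrow> bool \<Rightarrow> 'v set" where UW:
    "\<not> regular_pair \<theta> (G g) (fibre V p i) (fibre V p j) \<Longrightarrow> ?wit (g, i, j) (UW (g, i, j))" for g i j
    by (metis (no_types, lifting) case_prod_conv)
  define T where "T = ({..<m} \<times> {..<K} \<times> {..<K}) \<times> (UNIV :: bool set)"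
  have T: "finite T" "card T = 2 * m * K^2"
    by (auto simp: T_def card_cartesian_product power2_eq_square)
  obtain q where q: "q ` V \<subseteq> {..<K * 2 ^ (2 * m * K^2)}" "\<And>x y. x \<in> V \<Longrightarrow> y \<in> V \<Longrightarrow> q x = q y \<Longrightarrow> p x = p y"
    and sat: "\<And>t. t \<in> T \<Longrightarrow> saturated V q (case_prod UW t)"
    using common_refinement[OF p T(1), of "case_prod UW"] unfolding T(2) by blast
  show ?thesis
  proof (rule that[OF q(1)], rule energy_increment[OF fin \<theta> q(2)])
    fix g x y assume g: "g < m" and xy: "(x, y) \<in> irregular_pairs \<theta> V (G g) p"
    then have "((g, p x, p y), b) \<in> T" for b using p by (auto simp: T_def irregular_pairs_def)
    then have "saturated V q (UW (g, p x, p y) b)" for b using sat by fastforce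
    then show "\<exists>U W. irregularity_witness \<theta> (G g) (fibre V p (p x)) (fibre V p (p y)) U W \<and>
        saturated V q U \<and> saturated V q W"
      using UW[of g "p x" "p y"] xy by (auto simp: irregular_pairs_def)
  qed
qed

fun regularity_bound :: "nat \<Rightarrow> nat \<Rightarrow> nat" where
  "regularity_bound m 0 = 1"
| "regularity_bound m (Suc t) = regularity_bound m t * 2 ^ (2 * m * (regularity_bound m t)^2)"

definition regular_labelling :: "real \<Rightarrow> 'v set \<Rightarrow> nat \<Rightarrow> (nat \<Rightarrow> ('v \<times> 'v) set) \<Rightarrow> ('v \<Rightarrow> nat) \<Rightarrow> bool" where
  "regular_labelling \<theta> V m G p \<longleftrightarrow> (\<forall>g<m. real (card (irregular_pairs \<theta> V (G g) p)) \<le> \<theta> * real ((card V)^2))"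

lemma regularity_iteration:
  fixes \<theta> :: real and V :: "'v set"
  assumes fin: "finite V" and \<theta>: "0 < \<theta>"
  shows "\<exists>p. p ` V \<subseteq> {..<regularity_bound m t} \<and>
    (regular_labelling \<theta> V m G p \<or> t * \<theta>^5 * (card V)^2 \<le> (\<Sum>g<m. energy V (G g) p))"
proof (induction t)
  case 0
  have "0 \<le> (\<Sum>g<m. energy V (G g) (\<lambda>_. 0))" by (simp add: sum_nonneg energy_nonneg)
  then show ?case by (intro exI[of _ "\<lambda>_. 0"]) auto
next
  case (Suc t)
  then obtain p where p: "p ` V \<subseteq> {..<regularity_bound m t}"
    and alt: "regular_labelling \<theta> V m G p \<or> t * \<theta>^5 * (card V)^2 \<le> (\<Sum>g<m. energy V (G g) p)" by blast
  show ?case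
  proof (cases "regular_labelling \<theta> V m G p")
    case True
    have "regularity_bound m t \<le> regularity_bound m (Suc t)" by simp
    then have "p ` V \<subseteq> {..<regularity_bound m (Suc t)}" using p by (meson lessThan_subset_iff order_trans)
    then show ?thesis using True by blast
  next
    case False
    then obtain g0 where g0: "g0 < m" "\<theta> * (card V)^2 < card (irregular_pairs \<theta> V (G g0) p)"
      by (auto simp: regular_labelling_def not_le)
    obtain q where q: "q ` V \<subseteq> {..<regularity_bound m (Suc t)}"
      "\<And>g. g < m \<Longrightarrow> energy V (G g) p + \<theta>^4 * card (irregular_pairs \<theta> V (G g) p) \<le> energy V (G g) q"
      using energy_increasing_refinement[OF fin \<theta> p, of m G] by auto
    have "\<theta>^5 * (card V)^2 = \<theta>^4 * (\<theta> * (card V)^2)" by (simp add: eval_nat_numeral)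
    also have "\<dots> \<le> \<theta>^4 * card (irregular_pairs \<theta> V (G g0) p)" using g0 \<theta> by (intro mult_left_mono) auto
    also have "\<dots> \<le> (\<Sum>g<m. \<theta>^4 * card (irregular_pairs \<theta> V (G g) p))"
      using g0 \<theta> by (intro member_le_sum) auto
    also have "\<dots> \<le> (\<Sum>g<m. energy V (G g) q) - (\<Sum>g<m. energy V (G g) p)"
      unfolding sum_subtractf[symmetric] using q(2) by (intro sum_mono) (force simp: algebra_simps)
    finally have "Suc t * \<theta>^5 * (card V)^2 \<le> (\<Sum>g<m. energy V (G g) q)"
      using alt False by (simp add: algebra_simps)
    then show ?thesis using q(1) by blast
  qed
qed

theorem regularity_lemma:
  fixes \<theta> :: real
  assumes \<theta>: "0 < \<theta>"
  obtains K :: nat where "K > 0"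
    "\<And>(V::'v set) G. finite V \<Longrightarrow> \<exists>p. p ` V \<subseteq> {..<K} \<and> regular_labelling \<theta> V m G p"
proof -
  define T where "T = nat \<lceil>m / \<theta>^5\<rceil> + 1"
  have "m / \<theta>^5 < T" unfolding T_def by linarith
  then have T: "T * \<theta>^5 > m" using \<theta> by (simp add: field_simps)
  have "\<exists>p. p ` V \<subseteq> {..<regularity_bound m T} \<and> regular_labelling \<theta> V m G p" if fin: "finite V" for V :: "'v set" and G
  proof -
    obtain p where p: "p ` V \<subseteq> {..<regularity_bound m T}"
      and alt: "regular_labelling \<theta> V m G p \<or> T * \<theta>^5 * (card V)^2 \<le> (\<Sum>g<m. energy V (G g) p)"
      using regularity_iteration[OF fin \<theta>] by blast
    have "(\<Sum>g<m. energy V (G g) p) \<le> m * (card V)^2"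
      using sum_bounded_above[of "{..<m}" "\<lambda>g. energy V (G g) p" "(card V)^2"] energy_le[OF fin] by simp
    moreover have "m * (card V)^2 < T * \<theta>^5 * (card V)^2" if "V \<noteq> {}"
      using T fin that by (simp add: card_gt_0_iff)
    ultimately have "regular_labelling \<theta> V m G p \<or> V = {}" using alt by linarith
    then show ?thesis using p by (auto simp: regular_labelling_def irregular_pairs_def)
  qed
  moreover have "regularity_bound m t > 0" for t by (induction t) auto
  ultimately show ?thesis using that by blast
qed

definition neighbours :: "('v \<times> 'v) set \<Rightarrow> 'v set \<Rightarrow> 'v \<Rightarrow> 'v set" where
  "neighbours G Y x = {y\<in>Y. (x, y) \<in> G}"

lemma regular_pairD:
  assumes "regular_pair \<theta> G X Y" "U \<subseteq> X" "W \<subseteq> Y" "\<theta> * card X \<le> card U" "\<theta> * card Y \<le> card W"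
  shows "edge_density G X Y - \<theta> \<le> edge_density G U W"
proof -
  have "\<not> \<theta> < \<bar>edge_density G U W - edge_density G X Y\<bar>"
    using assms unfolding regular_pair_def irregularity_witness_def by blast
  then show ?thesis by linarith
qed

lemma regular_pair_low_degree:
  fixes \<theta> :: real
  assumes fin: "finite X" "finite Y" and ne: "X \<noteq> {}" "Y \<noteq> {}"
    and reg: "regular_pair \<theta> G X Y" "2 * \<theta> \<le> edge_density G X Y" and \<theta>: "0 < \<theta>" "\<theta> \<le> 1"
  shows "card {x\<in>X. card (neighbours G Y x) < \<theta> * card Y} < \<theta> * card X"
proof (rule ccontr)
  define X' where "X' = {x\<in>X. card (neighbours G Y x) < \<theta> * card Y}"
  assume "\<not> ?thesis"
  then have big: "\<theta> * card X \<le> card X'" by (auto simp: X'_def)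
  have X': "X' \<subseteq> X" "finite X'" using fin by (auto simp: X'_def)
  have "0 < \<theta> * card X" using ne fin \<theta> by (simp add: card_gt_0_iff)
  then have X'_pos: "card X' > 0" using big by linarith
  have Y_pos: "card Y > 0" using fin ne by (simp add: card_gt_0_iff)
  have "G \<inter> X' \<times> Y = Sigma X' (neighbours G Y)" by (auto simp: neighbours_def)
  then have "real (card (G \<inter> X' \<times> Y)) = (\<Sum>x\<in>X'. real (card (neighbours G Y x)))"
    using X' fin by (simp add: card_SigmaI neighbours_def)
  also have "\<dots> < (\<Sum>x\<in>X'. \<theta> * card Y)"
    using X' X'_pos by (intro sum_strict_mono) (auto simp: X'_def card_gt_0_iff)
  finally have "edge_density G X' Y < \<theta>" using X'_pos Y_pos by (simp add: edge_density_def field_simps)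
  moreover have "edge_density G X Y - \<theta> \<le> edge_density G X' Y"
    using \<theta> by (intro regular_pairD[OF reg(1) X'(1) order_refl big]) (simp add: mult_left_le_one_le)
  ultimately show False using reg(2) by linarith
qed

lemma regular_pair_edges:
  fixes \<theta> :: real
  assumes reg: "regular_pair \<theta> G X Y" "2 * \<theta> \<le> edge_density G X Y" and \<theta>: "0 < \<theta>"
    and sub: "U \<subseteq> X" "W \<subseteq> Y" and large: "\<theta> * card X \<le> card U" "\<theta> * card Y \<le> card W"
  shows "\<theta>^3 * card X * card Y \<le> card (G \<inter> U \<times> W)"
proof -
  have dense: "\<theta> \<le> edge_density G U W" using regular_pairD[OF reg(1) sub large] reg(2) by linarith
  then have pos: "card U * card W > 0" using \<theta> by (auto simp: edge_density_def intro!: Nat.gr0I)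
  have "(\<theta> * card X) * (\<theta> * card Y) \<le> card U * card W"
    unfolding of_nat_mult using large \<theta> by (intro mult_mono) auto
  then have "\<theta> * ((\<theta> * card X) * (\<theta> * card Y)) \<le> \<theta> * (card U * card W)"
    using \<theta> by (intro mult_left_mono) auto
  also have "\<dots> \<le> card (G \<inter> U \<times> W)"
    using dense pos by (simp add: edge_density_def field_simps flip: of_nat_mult)
  finally show ?thesis by (simp add: power3_eq_cube algebra_simps)
qed

definition triangles :: "('v \<times> 'v) set \<Rightarrow> ('v \<times> 'v) set \<Rightarrow> ('v \<times> 'v) set \<Rightarrow> ('v \<times> 'v \<times> 'v) set" where
  "triangles G1 G2 G3 = {(x, y, z). (x, y) \<in> G1 \<and> (y, z) \<in> G2 \<and> (x, z) \<in> G3}"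

lemma triangle_counting:
  fixes X Y Z :: "'v set" and \<theta> :: real
  assumes fin: "finite X" "finite Y" "finite Z" and ne: "X \<noteq> {}" "Y \<noteq> {}" "Z \<noteq> {}"
    and reg: "regular_pair \<theta> G1 X Y" "regular_pair \<theta> G2 Y Z" "regular_pair \<theta> G3 X Z"
    and dens: "2 * \<theta> \<le> edge_density G1 X Y" "2 * \<theta> \<le> edge_density G2 Y Z" "2 * \<theta> \<le> edge_density G3 X Z"
    and \<theta>: "0 < \<theta>" "\<theta> \<le> 1/4"
  shows "\<theta>^3 / 2 * card X * card Y * card Z \<le> card (triangles G1 G2 G3 \<inter> X \<times> Y \<times> Z)"
proof -
  let ?NY = "neighbours G1 Y" and ?NZ = "neighbours G3 Z"
  define low where "low = {x\<in>X. card (?NY x) < \<theta> * card Y} \<union> {x\<in>X. card (?NZ x) < \<theta> * card Z}"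
  define X' where "X' = X - low"
  have low: "low \<subseteq> X" by (auto simp: low_def)
  have "card low \<le> card {x\<in>X. card (?NY x) < \<theta> * card Y} + card {x\<in>X. card (?NZ x) < \<theta> * card Z}"
    unfolding low_def by (rule card_Un_le)
  then have "card low \<le> 2 * \<theta> * card X"
    using regular_pair_low_degree[OF fin(1,2) ne(1,2) reg(1) dens(1)]
      regular_pair_low_degree[OF fin(1,3) ne(1,3) reg(3) dens(3)] \<theta> by linarith
  also have "\<dots> \<le> 1/2 * card X" using \<theta> by (intro mult_right_mono) auto
  finally have X': "card X / 2 \<le> card X'"
    using fin low card_mono[OF fin(1) low] by (simp add: X'_def card_Diff_subset finite_subset of_nat_diff)
  have link: "\<theta>^3 * card Y * card Z \<le> card (G2 \<inter> ?NY x \<times> ?NZ x)" if "x \<in> X'" for x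
    using that by (intro regular_pair_edges[OF reg(2) dens(2) \<theta>(1)])
      (auto simp: X'_def low_def neighbours_def not_less)
  have finX': "finite X'" using fin by (simp add: X'_def)
  have "\<theta>^3 / 2 * card X * card Y * card Z = (card X / 2) * (\<theta>^3 * card Y * card Z)" by simp
  also have "\<dots> \<le> card X' * (\<theta>^3 * card Y * card Z)" using X' \<theta> by (intro mult_right_mono) auto
  also have "\<dots> = (\<Sum>x\<in>X'. \<theta>^3 * card Y * card Z)" by simp
  also have "\<dots> \<le> (\<Sum>x\<in>X'. real (card (G2 \<inter> ?NY x \<times> ?NZ x)))" using link by (rule sum_mono)
  also have "\<dots> = card (SIGMA x:X'. G2 \<inter> ?NY x \<times> ?NZ x)"
    using finX' fin by (subst card_SigmaI) (auto simp: neighbours_def)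
  also have "\<dots> \<le> card (triangles G1 G2 G3 \<inter> X \<times> Y \<times> Z)"
    by (intro of_nat_mono card_mono) (use fin in \<open>auto simp: X'_def neighbours_def triangles_def\<close>)
  finally show ?thesis .
qed

definition discarded_edges :: "real \<Rightarrow> real \<Rightarrow> 'v set \<Rightarrow> ('v \<Rightarrow> nat) \<Rightarrow> ('v \<times> 'v) set \<Rightarrow> ('v \<times> 'v) set" where
  "discarded_edges \<theta> c V p H = {(x, y). x \<in> V \<and> y \<in> V \<and> (x, y) \<in> H \<and>
     (let X = fibre V p (p x); Y = fibre V p (p y)
      in \<not> regular_pair \<theta> H X Y \<or> edge_density H X Y < 2 * \<theta> \<or> real (card X) < c \<or> real (card Y) < c)}"

lemma card_small_fibres:
  fixes p :: "'v \<Rightarrow> nat" and c :: real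
  assumes fin: "finite V" and p: "p ` V \<subseteq> {..<K}" and c: "0 \<le> c"
  shows "card {x\<in>V. card (fibre V p (p x)) < c} \<le> K * c"
proof -
  let ?S = "{x\<in>V. card (fibre V p (p x)) < c}"
  have small: "card (fibre ?S p l) \<le> c" if l: "l \<in> p ` ?S" for l
  proof -
    have "card (fibre ?S p l) \<le> card (fibre V p l)"
      using fin by (intro card_mono finite_fibre) (auto simp: fibre_def)
    then show ?thesis using l by force
  qed
  have "real (card ?S) \<le> card (p ` ?S) * c" by (rule card_le_fibres[OF _ small]) (use fin in simp)
  also have "card (p ` ?S) \<le> card {..<K}" using p by (intro card_mono) auto
  then have "card (p ` ?S) * c \<le> K * c" using c by (intro mult_right_mono) auto
  finally show ?thesis .
qed

lemma card_sparse_edges: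
  fixes p :: "'v \<Rightarrow> nat" and d :: real
  assumes fin: "finite V" and d: "0 \<le> d"
    and T: "T = {(x, y). x \<in> V \<and> y \<in> V \<and> edge_density H (fibre V p (p x)) (fibre V p (p y)) < d}"
  shows "card (T \<inter> H) \<le> d * (card V)^2"
proof -
  have T_sub: "T \<subseteq> V \<times> V" and finT: "finite T"
    using fin finite_subset[of T "V \<times> V"] by (auto simp: T)
  have "real (card (T \<inter> H)) = (\<Sum>s\<in>T. indicat_real H s)"
    using finT by (simp add: sum_indicat_real)
  also have "\<dots> = (\<Sum>s\<in>T. block_density V H p s)"
    using fin T_sub by (intro sum_fibre_avg_saturated[symmetric]) (auto simp: saturated_def T)
  also have "\<dots> \<le> (\<Sum>s\<in>T. d)"
    by (intro sum_mono) (auto simp: T block_density_eq[OF fin])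
  also have "\<dots> \<le> (\<Sum>s\<in>V \<times> V. d)" using fin T_sub d by (intro sum_mono2) auto
  finally show ?thesis by (simp add: card_cartesian_product power2_eq_square mult.commute)
qed

lemma card_discarded_edges:
  fixes p :: "'v \<Rightarrow> nat" and \<theta> :: real
  assumes fin: "finite V" and \<theta>: "0 \<le> \<theta>" and p: "p ` V \<subseteq> {..<K}" "K > 0"
    and irr: "card (irregular_pairs \<theta> V H p) \<le> \<theta> * (card V)^2"
  shows "card (discarded_edges \<theta> (\<theta> * card V / K) V p H) \<le> 5 * \<theta> * (card V)^2"
proof -
  define c where "c = \<theta> * card V / K"
  define S where "S = {x\<in>V. card (fibre V p (p x)) < c}"
  define T where "T = {(x, y). x \<in> V \<and> y \<in> V \<and> edge_density H (fibre V p (p x)) (fibre V p (p y)) < 2 * \<theta>}"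
  have "card S \<le> K * c" unfolding S_def using \<theta> by (intro card_small_fibres[OF fin p(1)]) (simp add: c_def)
  then have "card S \<le> \<theta> * card V" using p by (simp add: c_def)
  from mult_right_mono[OF this, of "card V"]
  have small: "card (S \<times> V) \<le> \<theta> * (card V)^2" "card (V \<times> S) \<le> \<theta> * (card V)^2"
    by (simp_all add: card_cartesian_product power2_eq_square mult_ac)
  have sparse: "card (T \<inter> H) \<le> 2 * \<theta> * (card V)^2"
    using card_sparse_edges[OF fin _ T_def] \<theta> by simp
  have finT: "finite T" by (rule finite_subset[of _ "V \<times> V"]) (use fin in \<open>auto simp: T_def\<close>)
  have "discarded_edges \<theta> c V p H \<subseteq> irregular_pairs \<theta> V H p \<union> (T \<inter> H) \<union> (S \<times> V) \<union> (V \<times> S)"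
    by (auto simp: discarded_edges_def irregular_pairs_def T_def S_def Let_def)
  then have "card (discarded_edges \<theta> c V p H) \<le> card (irregular_pairs \<theta> V H p \<union> (T \<inter> H) \<union> (S \<times> V) \<union> (V \<times> S))"
    using finT fin finite_irregular_pairs[OF fin] by (intro card_mono) (auto simp: S_def)
  also have "\<dots> \<le> card (irregular_pairs \<theta> V H p) + card (T \<inter> H) + card (S \<times> V) + card (V \<times> S)"
    by (meson add_le_mono card_Un_le le_refl le_trans)
  finally have "real (card (discarded_edges \<theta> c V p H)) \<le>
      card (irregular_pairs \<theta> V H p) + card (T \<inter> H) + card (S \<times> V) + card (V \<times> S)" by linarith
  then show ?thesis using irr sparse small unfolding c_def by linarith
qed

lemma triangle_of_kept_edges:
  fixes \<theta> c :: real
  assumes fin: "finite V" and G: "G1 \<subseteq> V \<times> V" "G2 \<subseteq> V \<times> V" "G3 \<subseteq> V \<times> V" and \<theta>: "0 < \<theta>" "\<theta> \<le> 1/4" and c: "0 \<le> c"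
    and kept: "(x, y) \<in> G1 - discarded_edges \<theta> c V p G1" "(y, z) \<in> G2 - discarded_edges \<theta> c V p G2"
      "(x, z) \<in> G3 - discarded_edges \<theta> c V p G3"
  shows "\<theta>^3 / 2 * c^3 \<le> card (triangles G1 G2 G3)"
proof -
  let ?X = "fibre V p (p x)" and ?Y = "fibre V p (p y)" and ?Z = "fibre V p (p z)"
  have V: "x \<in> V" "y \<in> V" "z \<in> V" using kept G by auto
  have good: "regular_pair \<theta> G1 ?X ?Y" "2 * \<theta> \<le> edge_density G1 ?X ?Y" "regular_pair \<theta> G2 ?Y ?Z"
      "2 * \<theta> \<le> edge_density G2 ?Y ?Z" "regular_pair \<theta> G3 ?X ?Z" "2 * \<theta> \<le> edge_density G3 ?X ?Z"
    and large: "c \<le> card ?X" "c \<le> card ?Y" "c \<le> card ?Z"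
    using kept V by (auto simp: discarded_edges_def Let_def)
  have ne: "?X \<noteq> {}" "?Y \<noteq> {}" "?Z \<noteq> {}" using V by (auto simp: fibre_def)
  have "\<theta>^3 / 2 * c^3 = \<theta>^3 / 2 * c * c * c" by (simp add: power3_eq_cube)
  also have "\<dots> \<le> \<theta>^3 / 2 * card ?X * card ?Y * card ?Z" using large \<theta> c by (intro mult_mono) auto
  also have "\<dots> \<le> card (triangles G1 G2 G3 \<inter> ?X \<times> ?Y \<times> ?Z)"
    using fin by (intro triangle_counting ne good \<theta> finite_fibre)
  also have "\<dots> \<le> card (triangles G1 G2 G3)"
    by (intro of_nat_mono card_mono finite_subset[of "triangles G1 G2 G3" "V \<times> V \<times> V"])
      (use fin G in \<open>auto simp: triangles_def\<close>)
  finally show ?thesis .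
qed

theorem triangle_removal:
  fixes \<eta> :: real
  assumes \<eta>: "0 < \<eta>"
  obtains \<epsilon> :: real where "\<epsilon> > 0"
    and "\<And>(V::'v set) G1 G2 G3. finite V \<Longrightarrow> G1 \<subseteq> V \<times> V \<Longrightarrow> G2 \<subseteq> V \<times> V \<Longrightarrow> G3 \<subseteq> V \<times> V \<Longrightarrow>
      card (triangles G1 G2 G3) \<le> \<epsilon> * (card V)^3 \<Longrightarrow>
      \<exists>R1 R2 R3. (\<forall>R\<in>{R1, R2, R3}. R \<subseteq> V \<times> V \<and> card R \<le> \<eta> * (card V)^2) \<and>
        triangles (G1 - R1) (G2 - R2) (G3 - R3) = {}"
proof -
  define \<theta> where "\<theta> = min (\<eta> / 5) (1/4)"
  have \<theta>: "0 < \<theta>" "\<theta> \<le> 1/4" "5 * \<theta> \<le> \<eta>" using \<eta> by (auto simp: \<theta>_def)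
  obtain K :: nat where K: "K > 0"
    "\<And>(V::'v set) G. finite V \<Longrightarrow> \<exists>p. p ` V \<subseteq> {..<K} \<and> regular_labelling \<theta> V 3 G p"
    using regularity_lemma[OF \<theta>(1)] by blast
  define \<epsilon> where "\<epsilon> = \<theta>^6 / (4 * K^3)"
  have \<epsilon>: "\<epsilon> > 0" using \<theta> K by (simp add: \<epsilon>_def)
  have removal: "\<exists>R1 R2 R3. (\<forall>R\<in>{R1, R2, R3}. R \<subseteq> V \<times> V \<and> card R \<le> \<eta> * (card V)^2) \<and>
      triangles (G1 - R1) (G2 - R2) (G3 - R3) = {}"
    if fin: "finite V" and G: "G1 \<subseteq> V \<times> V" "G2 \<subseteq> V \<times> V" "G3 \<subseteq> V \<times> V"
      and few: "card (triangles G1 G2 G3) \<le> \<epsilon> * (card V)^3" for V :: "'v set" and G1 G2 G3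
  proof -
    define G where "G g = (if g = 0 then G1 else if g = 1 then G2 else G3)" for g :: nat
    obtain p where p: "p ` V \<subseteq> {..<K}" and reg: "regular_labelling \<theta> V 3 G p" using K(2)[OF fin, of G] by blast
    define c where "c = \<theta> * card V / K"
    let ?R = "discarded_edges \<theta> c V p"
    have "card (irregular_pairs \<theta> V H p) \<le> \<theta> * (card V)^2" if "H \<in> {G1, G2, G3}" for H
      using reg[unfolded regular_labelling_def, rule_format, of 0] reg[unfolded regular_labelling_def, rule_format, of 1]
        reg[unfolded regular_labelling_def, rule_format, of 2] that by (auto simp: G_def)
    then have "card (?R H) \<le> 5 * \<theta> * (card V)^2" if "H \<in> {G1, G2, G3}" for H
      unfolding c_def using that \<theta>(1) by (intro card_discarded_edges[OF fin _ p K(1)]) auto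
    moreover have "5 * \<theta> * (card V)^2 \<le> \<eta> * (card V)^2" using \<theta> by (intro mult_right_mono) auto
    ultimately have card_R: "card (?R H) \<le> \<eta> * (card V)^2" if "H \<in> {G1, G2, G3}" for H
      using that by (meson order_trans)
    have "triangles (G1 - ?R G1) (G2 - ?R G2) (G3 - ?R G3) = {}"
    proof (rule ccontr)
      assume "triangles (G1 - ?R G1) (G2 - ?R G2) (G3 - ?R G3) \<noteq> {}"
      then obtain x y z where xyz: "(x, y) \<in> G1 - ?R G1" "(y, z) \<in> G2 - ?R G2" "(x, z) \<in> G3 - ?R G3"
        by (auto simp: triangles_def)
      then have "card V > 0" using G fin by (auto simp: card_gt_0_iff)
      have "\<theta>^3 / 2 * c^3 \<le> card (triangles G1 G2 G3)"
        using \<theta> by (intro triangle_of_kept_edges[OF fin G _ _ _ xyz]) (auto simp: c_def)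
      moreover have "\<theta>^3 / 2 * c^3 = 2 * \<epsilon> * (card V)^3"
        by (simp add: \<epsilon>_def c_def power_divide power_mult_distrib flip: power_add)
      ultimately have "2 * \<epsilon> * (card V)^3 \<le> \<epsilon> * (card V)^3" using few by linarith
      with \<open>card V > 0\<close> show False using \<epsilon> by simp
    qed
    moreover have "?R H \<subseteq> V \<times> V" for H by (auto simp: discarded_edges_def)
    ultimately show ?thesis using card_R by (intro exI[of _ "?R G1"] exI[of _ "?R G2"] exI[of _ "?R G3"]) auto
  qed
  show ?thesis by (rule that[OF \<epsilon> removal])
qed

section \<open>Mann's theorem\<close>

definition count_upto :: "nat set \<Rightarrow> nat \<Rightarrow> nat" where
  "count_upto A t = card (A \<inter> {1..t})"

lemma count_upto_mono: "s \<le> t \<Longrightarrow> count_upto A s \<le> count_upto A t"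
  unfolding count_upto_def by (intro card_mono) auto

lemma count_upto_shift:
  assumes "0 \<in> A" "1 \<le> b" and shift: "\<And>a. a \<in> A \<Longrightarrow> a \<le> r \<Longrightarrow> a + b \<in> S"
  shows "count_upto S (b - 1) + 1 + count_upto A r \<le> count_upto S (r + b)"
proof -
  let ?A = "insert 0 (A \<inter> {1..r})"
  have "(S \<inter> {1..b-1}) \<union> (\<lambda>a. a + b) ` ?A \<subseteq> S \<inter> {1..r+b}"
    using assms shift[of 0] by auto
  then have "card ((S \<inter> {1..b-1}) \<union> (\<lambda>a. a + b) ` ?A) \<le> count_upto S (r + b)"
    unfolding count_upto_def by (intro card_mono) auto
  moreover have "card ((S \<inter> {1..b-1}) \<union> (\<lambda>a. a + b) ` ?A) = card (S \<inter> {1..b-1}) + card ((\<lambda>a. a + b) ` ?A)"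
    using assms(2) by (intro card_Un_disjoint) auto
  moreover have "card ((\<lambda>a. a + b) ` ?A) = card ?A" by (intro card_image) (auto simp: inj_on_def)
  moreover have "card ?A = 1 + card (A \<inter> {1..r})" by (subst card_insert_disjoint) auto
  ultimately show ?thesis by (simp add: count_upto_def)
qed

lemma density_split:
  fixes g :: real
  assumes "g \<le> 1" "1 \<le> b"
  shows "g * real (r + b) \<le> g * real (b - 1) + 1 + g * r"
  using assms by (simp add: of_nat_diff algebra_simps)

lemma count_upto_closed:
  fixes A B :: "nat set" and g :: real
  assumes "0 \<in> A" and "g \<le> 1"
    and dens: "\<And>t. 1 \<le> t \<Longrightarrow> t \<le> n \<Longrightarrow> g * t \<le> count_upto A t + count_upto B t"
    and closed: "\<And>a b. a \<in> A \<Longrightarrow> b \<in> B \<Longrightarrow> a + b \<le> n \<Longrightarrow> a + b \<in> A"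
  shows "t \<le> n \<Longrightarrow> g * t \<le> count_upto A t"
proof (induction t rule: less_induct)
  case (less t)
  show ?case
  proof (cases "B \<inter> {1..t} = {}")
    case True
    then show ?thesis using dens[of t] less.prems by (cases "t = 0") (auto simp: count_upto_def)
  next
    case False
    define b where "b = Min (B \<inter> {1..t})"
    have b: "b \<in> B" "1 \<le> b" "b \<le> t"
      using Min_in[OF _ False] unfolding b_def by auto
    have "x \<notin> B" if "1 \<le> x" "x \<le> b - 1" for x
      using Min_le[of "B \<inter> {1..t}" x] that b unfolding b_def[symmetric] by force
    then have "B \<inter> {1..b-1} = {}" by auto
    then have "g * (b - 1) \<le> count_upto A (b - 1)"
      using dens[of "b - 1"] less.prems b by (cases "b = 1") (auto simp: count_upto_def)
    moreover have "g * (t - b) \<le> count_upto A (t - b)" using less.IH[of "t - b"] less.prems b by auto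
    moreover have "count_upto A (b - 1) + 1 + count_upto A (t - b) \<le> count_upto A (t - b + b)"
      using b less.prems closed by (intro count_upto_shift assms(1)) auto
    ultimately show ?thesis using density_split[OF assms(2) b(2), of "t - b"] b(3) by simp
  qed
qed

locale dyson_transform =
  fixes A B :: "nat set" and n e :: nat
  assumes zero: "0 \<in> A" "0 \<in> B" and e: "e \<in> A"
    and closed_below: "\<And>a b. a \<in> A \<Longrightarrow> a < e \<Longrightarrow> b \<in> B \<Longrightarrow> a + b \<le> n \<Longrightarrow> a + b \<in> A"
begin

definition moved :: "nat set" where
  "moved = {b\<in>B. e + b \<le> n \<and> e + b \<notin> A}"

definition grown :: "nat set" where
  "grown = A \<union> (+) e ` moved"

definition shrunk :: "nat set" where
  "shrunk = B - moved"

lemma finite_moved: "finite moved"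
  by (rule finite_subset[of _ "{..n}"]) (auto simp: moved_def)

lemma moved_pos: "b \<in> moved \<Longrightarrow> 1 \<le> b"
  using e by (cases b) (auto simp: moved_def)

lemma count_grown: "count_upto grown t = count_upto A t + card {b\<in>moved. e + b \<le> t}"
proof -
  have "1 \<le> e + b" if "b \<in> moved" for b using moved_pos[OF that] by simp
  then have "grown \<inter> {1..t} = (A \<inter> {1..t}) \<union> (+) e ` {b\<in>moved. e + b \<le> t}"
    unfolding grown_def by auto
  moreover have "(A \<inter> {1..t}) \<inter> (+) e ` {b\<in>moved. e + b \<le> t} = {}" by (auto simp: moved_def)
  moreover have "card ((+) e ` {b\<in>moved. e + b \<le> t}) = card {b\<in>moved. e + b \<le> t}"
    by (intro card_image) (auto simp: inj_on_def)
  ultimately show ?thesis unfolding count_upto_def using finite_moved by (simp add: card_Un_disjoint)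
qed

lemma count_shrunk: "count_upto B t = count_upto shrunk t + card {b\<in>moved. b \<le> t}"
proof -
  have "b \<in> B" "1 \<le> b" if "b \<in> moved" for b using moved_pos[OF that] that by (simp_all add: moved_def)
  then have "B \<inter> {1..t} = (shrunk \<inter> {1..t}) \<union> {b\<in>moved. b \<le> t}" unfolding shrunk_def by auto
  moreover have "(shrunk \<inter> {1..t}) \<inter> {b\<in>moved. b \<le> t} = {}" by (auto simp: shrunk_def)
  ultimately show ?thesis unfolding count_upto_def using finite_moved by (simp add: card_Un_disjoint)
qed

lemma sumset_decreases: "(grown + shrunk) \<inter> {1..n} \<subseteq> (A + B) \<inter> {1..n}"
proof -
  have "a + b \<in> A + B" if ab: "a \<in> grown" "b \<in> shrunk" "a + b \<le> n" for a b
  proof (cases "a \<in> A")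
    case True
    then show ?thesis using ab by (auto simp: shrunk_def)
  next
    case False
    then obtain b' where b': "b' \<in> moved" "a = e + b'" using ab by (auto simp: grown_def)
    then have "e + b \<in> A" "b' \<in> B" using ab by (auto simp: shrunk_def moved_def)
    then have "(e + b) + b' \<in> A + B" by (rule set_plus_intro)
    then show ?thesis using b'(2) by (simp add: ac_simps)
  qed
  then show ?thesis by (auto elim!: set_plus_elim)
qed

lemma density_preserved:
  fixes g :: real
  assumes "g \<le> 1" and dens: "\<And>t. 1 \<le> t \<Longrightarrow> t \<le> n \<Longrightarrow> g * t \<le> count_upto A t + count_upto B t"
  shows "t \<le> n \<Longrightarrow> g * t \<le> count_upto grown t + count_upto shrunk t"
proof (induction t rule: less_induct)
  case (less t)
  show ?case
  proof (cases "\<exists>b\<in>moved. t < e + b \<and> b \<le> t")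
    case False
    then have "{b\<in>moved. e + b \<le> t} = {b\<in>moved. b \<le> t}" by force
    then have "count_upto grown t + count_upto shrunk t = count_upto A t + count_upto B t"
      using count_grown[of t] count_shrunk[of t] by simp
    then show ?thesis using dens[of t] less.prems by (cases "t = 0") auto
  next
    case True
    then obtain b where b: "b \<in> moved" "t < e + b" "b \<le> t" by blast
    have b_ge_1: "1 \<le> b" using moved_pos[OF b(1)] .
    define r where "r = t - b"
    have r: "r < e" "r + b = t" using b by (auto simp: r_def)
    have "g * r \<le> count_upto A r"
      using dens closed_below r less.prems by (intro count_upto_closed[where n = r and B = B, OF zero(1) assms(1)]) auto
    moreover have "g * (b - 1) \<le> count_upto grown (b - 1) + count_upto shrunk (b - 1)"
      using less.IH[of "b - 1"] b b_ge_1 less.prems by auto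
    moreover have "count_upto grown (b - 1) + 1 + count_upto A r \<le> count_upto grown (r + b)"
      using closed_below r less.prems b
      by (intro count_upto_shift zero(1) b_ge_1) (auto simp: grown_def moved_def)
    moreover have "count_upto shrunk (b - 1) \<le> count_upto shrunk t" using b by (intro count_upto_mono) simp
    ultimately show ?thesis using density_split[OF assms(1) b_ge_1, of r] r(2) by simp
  qed
qed

end

theorem mann_theorem:
  fixes A B :: "nat set" and g :: real
  assumes "0 \<in> A" "0 \<in> B" and "g \<le> 1"
    and "\<And>t. 1 \<le> t \<Longrightarrow> t \<le> n \<Longrightarrow> g * t \<le> count_upto A t + count_upto B t"
  shows "g * n \<le> count_upto (A + B) n"
  using assms
proof (induction "count_upto B n" arbitrary: A B rule: less_induct)
  case less
  note zero = less.prems(1,2) and dens = less.prems(4)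
  define fails where "fails a \<longleftrightarrow> a \<in> A \<and> (\<exists>b\<in>B. a + b \<le> n \<and> a + b \<notin> A)" for a
  show ?case
  proof (cases "\<exists>a. fails a")
    case False
    then have "g * n \<le> count_upto A n"
      by (intro count_upto_closed[OF zero(1) \<open>g \<le> 1\<close> dens]) (auto simp: fails_def)
    also have "count_upto A n \<le> count_upto (A + B) n"
      unfolding count_upto_def using zero(2) set_zero_plus2[OF zero(2), of A]
      by (intro card_mono) (auto simp: add.commute)
    finally show ?thesis by simp
  next
    case True
    define e where "e = (LEAST a. fails a)"
    have fails_e: "fails e" unfolding e_def using True by (rule LeastI_ex)
    interpret dyson_transform A B n e
    proof
      show "a + b \<in> A" if "a \<in> A" "a < e" "b \<in> B" "a + b \<le> n" for a b
        using not_less_Least[of a fails] that unfolding e_def[symmetric] by (auto simp: fails_def)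
    qed (use zero fails_e in \<open>auto simp: fails_def\<close>)
    obtain b where b: "b \<in> moved" using fails_e by (auto simp: fails_def moved_def)
    then have "count_upto shrunk n < count_upto B n"
      unfolding count_shrunk[of n] using finite_moved by (auto simp: card_gt_0_iff moved_def)
    moreover have "0 \<in> grown" "0 \<in> shrunk" using zero moved_pos by (auto simp: grown_def shrunk_def)
    ultimately have "g * n \<le> count_upto (grown + shrunk) n"
      using less.hyps[OF _ _ _ \<open>g \<le> 1\<close>] density_preserved[OF \<open>g \<le> 1\<close> dens] by blast
    also have "count_upto (grown + shrunk) n \<le> count_upto (A + B) n"
      unfolding count_upto_def using sumset_decreases by (intro card_mono) auto
    finally show ?thesis by simp
  qed
qed

section \<open>Arithmetic removal\<close>

definition bad_sums :: "nat \<Rightarrow> nat set \<Rightarrow> nat set \<Rightarrow> nat set \<Rightarrow> (nat \<times> nat) set" where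
  "bad_sums n A B E = {(a, b). a \<in> A \<and> b \<in> B \<and> a + b < n \<and> a + b \<notin> E}"

definition difference_edges :: "nat \<Rightarrow> nat set \<Rightarrow> (nat \<times> nat) set" where
  "difference_edges N S = {(x, y). x < N \<and> x \<le> y \<and> y - x \<in> S}"

definition occurrences :: "nat \<Rightarrow> (nat \<times> nat) set \<Rightarrow> nat \<Rightarrow> nat set" where
  "occurrences N R a = {x\<in>{..<N}. (x, x + a) \<in> R}"

lemma difference_edges_subset:
  assumes "S \<subseteq> {..<n}" "N + n \<le> M"
  shows "difference_edges N S \<subseteq> {..<M} \<times> {..<M}"
proof
  fix p assume "p \<in> difference_edges N S"
  then obtain x y where p: "p = (x, y)" "x < N" "x \<le> y" "y - x \<in> S" by (auto simp: difference_edges_def)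
  moreover have "y - x < n" using assms p by blast
  ultimately show "p \<in> {..<M} \<times> {..<M}" using assms(2) by simp
qed

lemma card_triangles_difference_edges:
  assumes "A \<subseteq> {..<n}" "B \<subseteq> {..<n}"
  shows "card (triangles (difference_edges n A) (difference_edges N B) (difference_edges n ({..<n} - E)))
    \<le> n * card (bad_sums n A B E)" (is "card ?T \<le> _")
proof -
  have "finite (bad_sums n A B E)"
    by (rule finite_subset[of _ "{..<n} \<times> {..<n}"]) (use assms in \<open>auto simp: bad_sums_def\<close>)
  then have "card ?T \<le> card ({..<n} \<times> bad_sums n A B E)"
  proof (intro card_inj_on_le[of "\<lambda>(x, y, z). (x, y - x, z - y)"])
    show "inj_on (\<lambda>(x, y, z). (x, y - x, z - y)) ?T"
      unfolding inj_on_def triangles_def difference_edges_def by auto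
    show "(\<lambda>(x, y, z). (x, y - x, z - y)) ` ?T \<subseteq> {..<n} \<times> bad_sums n A B E"
      by (auto simp: triangles_def difference_edges_def bad_sums_def)
  qed simp
  then show ?thesis by (simp add: card_cartesian_product)
qed

lemma card_frequent_shifts:
  fixes m :: real
  assumes "finite S" "finite R" and freq: "\<And>a. a \<in> S \<Longrightarrow> m \<le> card (occurrences N R a)"
  shows "card S * m \<le> card R"
proof -
  have "card S * m = (\<Sum>a\<in>S. m)" by simp
  also have "\<dots> \<le> (\<Sum>a\<in>S. real (card (occurrences N R a)))" using freq by (rule sum_mono)
  also have "\<dots> = card (Sigma S (occurrences N R))" using assms(1) by (simp add: occurrences_def)
  also have "\<dots> \<le> card R"
    by (intro of_nat_mono card_inj_on_le[of "\<lambda>(a, x). (x, x + a)"] assms(2)) (auto simp: inj_on_def occurrences_def)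
  finally show ?thesis .
qed

lemma rare_shifts_avoidance:
  assumes rare: "card (occurrences n R1 a) < n / 3" "card (occurrences N R2 b) < n / 3"
      "card (occurrences n R3 (a + b)) < n / 3" and "n + a \<le> N"
  obtains x where "x < n" "(x, x + a) \<notin> R1" "(x + a, x + a + b) \<notin> R2" "(x, x + a + b) \<notin> R3"
proof -
  let ?X1 = "occurrences n R1 a" and ?X2 = "{x\<in>{..<n}. x + a \<in> occurrences N R2 b}"
    and ?X3 = "occurrences n R3 (a + b)"
  have "card ?X2 \<le> card (occurrences N R2 b)"
    by (rule card_inj_on_le[of "\<lambda>x. x + a"]) (auto simp: inj_on_def occurrences_def)
  moreover have "card (?X1 \<union> ?X2 \<union> ?X3) \<le> card ?X1 + card ?X2 + card ?X3"
    by (meson add_le_mono card_Un_le le_refl le_trans)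
  ultimately have "card (?X1 \<union> ?X2 \<union> ?X3) < card {..<n}" using rare by simp
  then have "\<not> {..<n} \<subseteq> ?X1 \<union> ?X2 \<union> ?X3" using card_mono[of "?X1 \<union> ?X2 \<union> ?X3" "{..<n}"]
    by (auto simp: occurrences_def)
  then obtain x where "x < n" "x \<notin> ?X1" "x \<notin> ?X2" "x \<notin> ?X3" by blast
  then show ?thesis using that[of x] assms(4) by (auto simp: occurrences_def add.assoc)
qed

lemma bad_sums_removal:
  fixes m :: real
  assumes n: "n > 0" and sub: "A \<subseteq> {..<n}" "B \<subseteq> {..<n}"
    and R: "\<And>R. R \<in> {R1, R2, R3} \<Longrightarrow> finite R \<and> card R \<le> m * (n / 3)"
    and triangle_free: "triangles (difference_edges n A - R1) (difference_edges (2 * n) B - R2)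
      (difference_edges n ({..<n} - E) - R3) = {}"
  shows "\<exists>A' B' E'. A' \<subseteq> A \<and> B' \<subseteq> B \<and> card (A - A') \<le> m \<and> card (B - B') \<le> m \<and>
    finite E' \<and> card E' \<le> m \<and> bad_sums n A' B' (E \<union> E') = {}"
proof -
  have frequent: "card S \<le> m"
    if "finite S" "R \<in> {R1, R2, R3}" "\<And>a. a \<in> S \<Longrightarrow> n / 3 \<le> card (occurrences N R a)" for S R N
  proof -
    have "card S * (n / 3) \<le> card R" using that R by (intro card_frequent_shifts) auto
    also have "\<dots> \<le> m * (n / 3)" using R that(2) by blast
    finally show ?thesis using n by simp
  qed
  define A' where "A' = {a\<in>A. card (occurrences n R1 a) < n / 3}"
  define B' where "B' = {b\<in>B. card (occurrences (2 * n) R2 b) < n / 3}"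
  define Z where "Z = {c\<in>{..<n}. n / 3 \<le> card (occurrences n R3 c)}"
  have "finite A" "finite B" "finite Z" using sub finite_subset[of _ "{..<n}"] by (auto simp: Z_def)
  then have small: "card (A - A') \<le> m" "card (B - B') \<le> m" "card Z \<le> m"
    by (intro frequent[where R = R1] frequent[where R = R2] frequent[where R = R3];
      auto simp: A'_def B'_def Z_def not_less)+
  have "bad_sums n A' B' (E \<union> Z) = {}"
  proof (rule ccontr)
    assume "bad_sums n A' B' (E \<union> Z) \<noteq> {}"
    then obtain a b where ab: "a \<in> A'" "b \<in> B'" "a + b < n" "a + b \<notin> E" "a + b \<notin> Z"
      by (auto simp: bad_sums_def)
    then obtain x where "x < n" "(x, x + a) \<notin> R1" "(x + a, x + a + b) \<notin> R2" "(x, x + a + b) \<notin> R3"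
      using rare_shifts_avoidance[of n R1 a "2 * n" R2 b R3] by (auto simp: A'_def B'_def Z_def not_le)
    then have "(x, x + a, x + a + b) \<in> triangles (difference_edges n A - R1)
        (difference_edges (2 * n) B - R2) (difference_edges n ({..<n} - E) - R3)"
      using ab by (auto simp: triangles_def difference_edges_def A'_def B'_def)
    then show False using triangle_free by blast
  qed
  then show ?thesis using small \<open>finite Z\<close>
    by (intro exI[of _ A'] exI[of _ B'] exI[of _ Z]) (auto simp: A'_def B'_def)
qed

theorem arithmetic_removal:
  fixes \<eta> :: real
  assumes \<eta>: "0 < \<eta>"
  obtains \<epsilon> :: real where "\<epsilon> > 0"
    and "\<And>n A B E. n > 0 \<Longrightarrow> A \<subseteq> {..<n} \<Longrightarrow> B \<subseteq> {..<n} \<Longrightarrow> card (bad_sums n A B E) \<le> \<epsilon> * (real n)^2 \<Longrightarrow>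
      \<exists>A' B' E'. A' \<subseteq> A \<and> B' \<subseteq> B \<and> card (A - A') \<le> \<eta> * n \<and> card (B - B') \<le> \<eta> * n \<and>
        finite E' \<and> card E' \<le> \<eta> * n \<and> bad_sums n A' B' (E \<union> E') = {}"
proof -
  have "0 < \<eta> / 27" using \<eta> by simp
  from triangle_removal[OF this, where 'v = nat] obtain \<epsilon> :: real where \<epsilon>: "\<epsilon> > 0" and removal:
    "\<And>(V::nat set) G1 G2 G3. finite V \<Longrightarrow> G1 \<subseteq> V \<times> V \<Longrightarrow> G2 \<subseteq> V \<times> V \<Longrightarrow> G3 \<subseteq> V \<times> V \<Longrightarrow>
      card (triangles G1 G2 G3) \<le> \<epsilon> * (card V)^3 \<Longrightarrow>
      \<exists>R1 R2 R3. (\<forall>R\<in>{R1, R2, R3}. R \<subseteq> V \<times> V \<and> card R \<le> \<eta> / 27 * (card V)^2) \<and>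
        triangles (G1 - R1) (G2 - R2) (G3 - R3) = {}" by metis
  have arithmetic: "\<exists>A' B' E'. A' \<subseteq> A \<and> B' \<subseteq> B \<and> card (A - A') \<le> \<eta> * n \<and> card (B - B') \<le> \<eta> * n \<and>
        finite E' \<and> card E' \<le> \<eta> * n \<and> bad_sums n A' B' (E \<union> E') = {}"
    if n: "n > 0" and A: "A \<subseteq> {..<n}" and B: "B \<subseteq> {..<n}" and few: "card (bad_sums n A B E) \<le> \<epsilon> * (real n)^2"
    for n A B E
  proof -
    define V where "V = {..<3*n}"
    let ?G1 = "difference_edges n A" and ?G2 = "difference_edges (2 * n) B"
      and ?G3 = "difference_edges n ({..<n} - E)"
    have "real (card (triangles ?G1 ?G2 ?G3)) \<le> n * card (bad_sums n A B E)"
      using card_triangles_difference_edges[OF A B] by (simp only: of_nat_le_iff)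
    also have "\<dots> \<le> n * (\<epsilon> * (real n)^2)" using few by (simp add: mult_left_mono)
    also have "\<dots> \<le> \<epsilon> * (card V)^3" using \<epsilon> by (simp add: V_def power2_eq_square power3_eq_cube)
    finally obtain R1 R2 R3 where R: "\<forall>R\<in>{R1, R2, R3}. R \<subseteq> V \<times> V \<and> card R \<le> \<eta> / 27 * (card V)^2"
       and triangle_free: "triangles (?G1 - R1) (?G2 - R2) (?G3 - R3) = {}"
      using removal[of V ?G1 ?G2 ?G3] A B
        difference_edges_subset[of _ n n "3 * n"] difference_edges_subset[of _ n "2 * n" "3 * n"]
      by (auto simp: V_def)
    have "finite R \<and> card R \<le> (\<eta> * n) * (n / 3)" if "R \<in> {R1, R2, R3}" for R
    proof -
      have "R \<subseteq> V \<times> V" "card R \<le> \<eta> / 27 * (card V)^2" using R that by auto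
      then show ?thesis using finite_subset[of R "V \<times> V"] by (simp add: V_def power2_eq_square)
    qed
    then show ?thesis by (rule bad_sums_removal[OF n A B _ triangle_free])
  qed
  show ?thesis by (rule that[OF \<epsilon> arithmetic])
qed

section \<open>An approximate form of Mann's theorem\<close>

definition thick :: "nat \<Rightarrow> nat \<Rightarrow> nat set \<Rightarrow> nat set" where
  "thick n P A = {x. x < n \<and> (\<exists>a\<in>A. a \<le> x \<and> x < a + P)}"

definition thick_core :: "nat \<Rightarrow> nat \<Rightarrow> nat set \<Rightarrow> nat set" where
  "thick_core n P A = {x. x < n \<and> (\<exists>a. a \<le> x \<and> x < a + P \<and> (\<forall>z. a \<le> z \<and> z < a + P \<and> z < n \<longrightarrow> z \<in> A))}"

definition almost_dense :: "nat \<Rightarrow> real \<Rightarrow> real \<Rightarrow> nat set \<Rightarrow> bool" where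
  "almost_dense n \<epsilon> \<sigma> A \<longleftrightarrow> A \<subseteq> {..<n} \<and> (\<forall>t\<le>n. \<sigma> * real t - \<epsilon> * real n \<le> real (card (A \<inter> {..<t})))"

definition dense_from :: "nat \<Rightarrow> nat \<Rightarrow> real \<Rightarrow> nat set \<Rightarrow> nat \<Rightarrow> bool" where
  "dense_from n P s S a \<longleftrightarrow> a < n \<and> (\<forall>z. a \<le> z \<and> z < a + P \<and> z < n \<longrightarrow> z \<in> S) \<and>
     (\<forall>t. a + t \<le> n \<longrightarrow> s * real t \<le> real (card (S \<inter> {a..<a + t})))"

definition mann_bound :: "real \<Rightarrow> real \<Rightarrow> nat \<Rightarrow> real \<Rightarrow> nat \<Rightarrow> bool" where
  "mann_bound \<zeta> \<sigma>\<^sub>0 P \<epsilon> n \<longleftrightarrow> (\<forall>A B E \<sigma> \<tau>. almost_dense n \<epsilon> \<sigma> A \<longrightarrow> almost_dense n \<epsilon> \<tau> B \<longrightarrow> finite E \<longrightarrow>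
     \<sigma>\<^sub>0 \<le> \<sigma> \<longrightarrow> \<sigma>\<^sub>0 \<le> \<tau> \<longrightarrow> (\<forall>b\<in>B. real (card (thick n (2 * P) ((+) b ` A) - E)) \<le> \<epsilon> * real n) \<longrightarrow>
     (min 1 (\<sigma> + \<tau>) - \<zeta>) * real n \<le> real (card E))"

lemma thick_subset: "thick n P A \<subseteq> {..<n}"
  by (auto simp: thick_def)

lemma finite_thick: "finite (thick n P A)"
  using finite_subset[OF thick_subset] by simp

lemma thick_core_subset: "thick_core n P A \<subseteq> A \<inter> {..<n}"
  by (auto simp: thick_core_def)

lemma card_thick_core:
  "card (thick n P A - thick_core n P A') \<le> 2 * P * card (thick n P A - A')"
proof -
  let ?D = "thick n P A - A'"
  have "thick n P A - thick_core n P A' \<subseteq> (\<Union>z\<in>?D. {z - P..<z + P})"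
  proof
    fix x assume x: "x \<in> thick n P A - thick_core n P A'"
    then obtain a where a: "a \<in> A" "a \<le> x" "x < a + P" "x < n" by (auto simp: thick_def)
    then obtain z where z: "a \<le> z" "z < a + P" "z < n" "z \<notin> A'"
      using x by (auto simp: thick_core_def)
    then have "z \<in> ?D" using a by (auto simp: thick_def)
    moreover have "x \<in> {z - P..<z + P}" using a z by auto
    ultimately show "x \<in> (\<Union>z\<in>?D. {z - P..<z + P})" by blast
  qed
  then have "card (thick n P A - thick_core n P A') \<le> card (\<Union>z\<in>?D. {z - P..<z + P})"
    using finite_thick by (intro card_mono) auto
  also have "\<dots> \<le> (\<Sum>z\<in>?D. card {z - P..<z + P})" using finite_thick by (intro card_UN_le) auto
  also have "\<dots> \<le> (\<Sum>z\<in>?D. 2 * P)" by (intro sum_mono) auto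
  finally show ?thesis by (simp add: mult.commute)
qed

lemma almost_dense_thick_core:
  fixes \<rho> \<epsilon> \<eta> :: real
  assumes P: "P > 0" and dens: "almost_dense n \<epsilon> \<rho> A"
    and A': "card (thick n P A - A') \<le> \<eta> * n"
  shows "almost_dense n (\<epsilon> + 2 * real P * \<eta>) \<rho> (thick_core n P A')"
  unfolding almost_dense_def
proof (intro conjI allI impI)
  show "thick_core n P A' \<subseteq> {..<n}" using thick_core_subset by blast
  fix t assume "t \<le> n"
  let ?S = "thick_core n P A'" and ?T = "thick n P A"
  have "A \<inter> {..<t} \<subseteq> (?S \<inter> {..<t}) \<union> (?T - ?S)"
    using dens P by (auto simp: thick_def almost_dense_def)
  then have "card (A \<inter> {..<t}) \<le> card ((?S \<inter> {..<t}) \<union> (?T - ?S))"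
    using finite_thick by (intro card_mono) auto
  also have "\<dots> \<le> card (?S \<inter> {..<t}) + 2 * P * card (?T - A')"
    using card_Un_le[of "?S \<inter> {..<t}" "?T - ?S"] card_thick_core[of n P A A'] by linarith
  finally have "real (card (A \<inter> {..<t})) \<le> real (card (?S \<inter> {..<t}) + 2 * P * card (?T - A'))"
    by (simp only: of_nat_le_iff)
  moreover have "2 * real P * real (card (?T - A')) \<le> 2 * real P * (\<eta> * n)"
    using A' by (intro mult_left_mono) auto
  moreover have "\<rho> * t - \<epsilon> * n \<le> card (A \<inter> {..<t})" using dens \<open>t \<le> n\<close> by (simp add: almost_dense_def)
  ultimately show "\<rho> * real t - (\<epsilon> + 2 * real P * \<eta>) * real n \<le> real (card (?S \<inter> {..<t}))"
    by (simp add: algebra_simps)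
qed

lemma thick_core_window:
  assumes a: "a \<in> thick_core n P A" "a = 0 \<or> a - 1 \<notin> thick_core n P A" and z: "a \<le> z" "z < a + P" "z < n"
  shows "z \<in> thick_core n P A"
proof -
  obtain c where c: "c \<le> a" "a < c + P" and window: "\<And>z. c \<le> z \<Longrightarrow> z < c + P \<Longrightarrow> z < n \<Longrightarrow> z \<in> A"
    using a(1) unfolding thick_core_def by blast
  have core: "z \<in> thick_core n P A" if "c \<le> z" "z < c + P" "z < n" for z
    unfolding thick_core_def using window that by blast
  have "c = a"
  proof (rule ccontr)
    assume "c \<noteq> a"
    then have "a - 1 \<in> thick_core n P A" "a \<noteq> 0" using core[of "a - 1"] c a by (auto simp: thick_core_def)
    then show False using a(2) by simp
  qed
  then show ?thesis using core z by simp
qed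

lemma last_minimiser:
  fixes F :: "nat \<Rightarrow> real"
  obtains a where "a \<le> n" "\<And>t. t \<le> n \<Longrightarrow> F a \<le> F t" "\<And>t. a < t \<Longrightarrow> t \<le> n \<Longrightarrow> F a < F t"
proof -
  define m where "m = Min (F ` {..n})"
  have m_le: "m \<le> F t" if "t \<le> n" for t unfolding m_def using that by (intro Min_le) auto
  have "m \<in> F ` {..n}" unfolding m_def by (intro Min_in) auto
  then have ne: "{t. t \<le> n \<and> F t = m} \<noteq> {}" by auto
  define a where "a = Max {t. t \<le> n \<and> F t = m}"
  have a: "a \<le> n" "F a = m" using Max_in[OF _ ne] unfolding a_def by auto
  have "F a < F t" if "a < t" "t \<le> n" for t
  proof -
    have "F t \<noteq> m" using that Max_ge[of "{t. t \<le> n \<and> F t = m}" t] unfolding a_def[symmetric] by auto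
    then show ?thesis using m_le[OF that(2)] a by simp
  qed
  then show ?thesis using that a m_le by blast
qed

lemma almost_dense_le_1:
  assumes "almost_dense n \<kappa> \<sigma> S" "n > 0"
  shows "\<sigma> - \<kappa> \<le> 1"
proof -
  have "card (S \<inter> {..<n}) \<le> card {..<n}" by (intro card_mono) auto
  moreover have "(\<sigma> - \<kappa>) * n \<le> card (S \<inter> {..<n})"
    using assms(1) by (simp add: almost_dense_def left_diff_distrib)
  ultimately have "(\<sigma> - \<kappa>) * real n \<le> 1 * real n" by simp
  then show ?thesis using assms(2) by (simp only: mult_le_cancel_right)
qed

text \<open>Shifting to the last minimiser of the drift-corrected counting function turns an approximate
  density lower bound into one that is exact at every scale.\<close>

lemma exists_dense_start:
  fixes \<sigma> \<xi> \<kappa> :: real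
  assumes n: "n > 0" and \<xi>: "\<xi> < \<sigma>" and \<kappa>: "0 \<le> \<kappa>" "\<kappa> < \<xi>" and dens: "almost_dense n \<kappa> \<sigma> (thick_core n P A)"
  obtains a where "a \<le> \<kappa> / \<xi> * n" "dense_from n P (\<sigma> - \<xi>) (thick_core n P A) a"
proof -
  let ?S = "thick_core n P A"
  define F where "F t = card (?S \<inter> {..<t}) - (\<sigma> - \<xi>) * t" for t :: nat
  have F_Suc: "F (Suc t) = F t + (if t \<in> ?S then 1 else 0) - (\<sigma> - \<xi>)" for t
    by (simp add: F_def lessThan_Suc Int_insert_right algebra_simps)
  obtain a where a: "a \<le> n" "\<And>t. t \<le> n \<Longrightarrow> F a \<le> F t" "\<And>t. a < t \<Longrightarrow> t \<le> n \<Longrightarrow> F a < F t"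
    using last_minimiser by blast
  have \<xi>_pos: "0 < \<xi>" using \<kappa> by linarith
  have "\<sigma> * a - \<kappa> * n \<le> card (?S \<inter> {..<a})" using dens a(1) by (simp add: almost_dense_def)
  then have "\<xi> * a - \<kappa> * n \<le> F a" by (simp add: F_def algebra_simps)
  also have "F a \<le> 0" using a(2)[of 0] by (simp add: F_def)
  finally have \<xi>a: "\<xi> * a \<le> \<kappa> * n" by simp
  also have "\<kappa> * n < \<xi> * n" using \<kappa> n by simp
  finally have an: "a < n" using \<xi>_pos by simp
  have a_core: "a \<in> ?S" using a(3)[of "Suc a"] an F_Suc[of a] \<xi> by (auto split: if_splits)
  have "a = 0 \<or> a - 1 \<notin> ?S"
    using a(2)[of "a - 1"] an F_Suc[of "a - 1"] almost_dense_le_1[OF dens n] \<kappa> by (cases a) (auto split: if_splits)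
  then have window: "z \<in> ?S" if "a \<le> z" "z < a + P" "z < n" for z
    using thick_core_window[OF a_core] that by blast
  have "(\<sigma> - \<xi>) * t \<le> card (?S \<inter> {a..<a + t})" if t: "a + t \<le> n" for t
  proof -
    have "?S \<inter> {..<a + t} = (?S \<inter> {..<a}) \<union> (?S \<inter> {a..<a + t})" by auto
    moreover have "card ((?S \<inter> {..<a}) \<union> (?S \<inter> {a..<a + t})) = card (?S \<inter> {..<a}) + card (?S \<inter> {a..<a + t})"
      by (intro card_Un_disjoint) auto
    ultimately show ?thesis using a(2)[OF t] by (simp add: F_def algebra_simps)
  qed
  then have "dense_from n P (\<sigma> - \<xi>) ?S a" using an window by (simp add: dense_from_def)
  moreover have "a \<le> \<kappa> / \<xi> * n" using \<xi>a \<xi>_pos by (simp add: field_simps)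
  ultimately show ?thesis using that by blast
qed

lemma count_upto_dense_from:
  assumes "P > 0" "0 < s" and dens: "dense_from n P s S a" and t: "a + t < n"
  shows "count_upto ((+) a -` S) t = t \<or> (s - 1 / P) * t \<le> count_upto ((+) a -` S) t"
proof (cases "t < P")
  case True
  then have "(+) a -` S \<inter> {1..t} = {1..t}" using dens t by (auto simp: dense_from_def)
  then show ?thesis by (simp add: count_upto_def)
next
  case False
  let ?T = "(+) a -` S \<inter> {1..t}"
  have "S \<inter> {a..<a + (t + 1)} \<subseteq> insert a ((+) a ` ?T)"
  proof
    fix z assume "z \<in> S \<inter> {a..<a + (t + 1)}"
    then show "z \<in> insert a ((+) a ` ?T)" by (cases "z = a") (auto intro!: image_eqI[of _ _ "z - a"])
  qed
  then have "card (S \<inter> {a..<a + (t + 1)}) \<le> card (insert a ((+) a ` ?T))" by (intro card_mono) auto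
  also have "\<dots> \<le> 1 + count_upto ((+) a -` S) t"
    unfolding count_upto_def using card_image_le[of ?T "(+) a"] by (simp add: card_insert_if)
  finally have "card (S \<inter> {a..<a + (t + 1)}) \<le> 1 + count_upto ((+) a -` S) t" .
  moreover have "s * real (t + 1) \<le> card (S \<inter> {a..<a + (t + 1)})"
    using dens t unfolding dense_from_def by (metis Suc_eq_plus1 Suc_leI add_Suc_right)
  moreover have "1 \<le> t / P" using False \<open>P > 0\<close> by (simp add: field_simps)
  ultimately show ?thesis using \<open>0 < s\<close> by (simp add: algebra_simps)
qed

lemma mann_dense_from:
  fixes s s' :: real
  assumes P: "P > 0" and pos: "0 < s" "0 < s'" and A: "dense_from n P s A a" and B: "dense_from n P s' B b"
    and E: "finite E" "bad_sums n A B E = {}"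
  shows "min 1 (s + s' - 2 / P) * (n - a - b - 1 :: nat) \<le> card E"
proof -
  define g N where "g = min 1 (s + s' - 2 / P)" and "N = n - a - b - 1"
  let ?A = "(+) a -` A" and ?B = "(+) b -` B"
  have "g * N \<le> count_upto (?A + ?B) N"
  proof (rule mann_theorem)
    show "0 \<in> ?A" "0 \<in> ?B" "g \<le> 1" using A B P by (auto simp: dense_from_def g_def)
    fix t assume t: "1 \<le> t" "t \<le> N"
    then have "a + t < n" "b + t < n" by (auto simp: N_def)
    note counts = count_upto_dense_from[OF P pos(1) A this(1)] count_upto_dense_from[OF P pos(2) B this(2)]
    have "g * t \<le> t" using mult_right_mono[of g 1 "real t"] by (simp add: g_def)
    moreover have "g * t \<le> (s - 1 / P) * t + (s' - 1 / P) * t"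
      unfolding distrib_right[symmetric] g_def by (intro mult_right_mono) (auto simp: field_simps)
    ultimately show "g * t \<le> count_upto ?A t + count_upto ?B t" using counts by auto
  qed
  also have "count_upto (?A + ?B) N \<le> card E"
    unfolding count_upto_def
  proof (rule card_inj_on_le[of "\<lambda>x. x + a + b"])
    show "(\<lambda>x. x + a + b) ` ((?A + ?B) \<inter> {1..N}) \<subseteq> E"
    proof (clarsimp elim!: set_plus_elim)
      fix u v assume uv: "a + u \<in> A" "b + v \<in> B" "u + v \<le> N" "Suc 0 \<le> u + v"
      then have "(a + u, b + v) \<notin> bad_sums n A B E" "(a + u) + (b + v) < n" using E by (auto simp: N_def)
      then show "u + v + a + b \<in> E" using uv by (simp add: bad_sums_def algebra_simps)
    qed
  qed (use E in \<open>auto simp: inj_on_def\<close>)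
  finally show ?thesis by (simp add: g_def N_def)
qed

lemma card_bad_sums_thick:
  fixes \<delta> :: real
  assumes \<delta>: "0 \<le> \<delta>" and absorb: "\<And>b. b \<in> B \<Longrightarrow> card (thick n (2 * P) ((+) b ` A) - E) \<le> \<delta>"
  shows "card (bad_sums n (thick n P A) (thick n P B) E) \<le> n * \<delta>"
proof -
  let ?fibre = "\<lambda>y. {a\<in>thick n P A. a + y < n \<and> a + y \<notin> E}"
  have fin_fibre: "finite (?fibre y)" for y using finite_thick by simp
  have card_fibre: "card (?fibre y) \<le> \<delta>" if y: "y \<in> thick n P B" for y
  proof -
    obtain b where b: "b \<in> B" "b \<le> y" "y < b + P" using y by (auto simp: thick_def)
    have "card (?fibre y) \<le> card (thick n (2 * P) ((+) b ` A) - E)"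
    proof (rule card_inj_on_le[of "\<lambda>a. a + y"])
      show "(\<lambda>a. a + y) ` ?fibre y \<subseteq> thick n (2 * P) ((+) b ` A) - E"
      proof clarsimp
        fix x assume "x \<in> thick n P A" "x + y < n" "x + y \<notin> E"
        then obtain a where "a \<in> A" "a \<le> x" "x < a + P" by (auto simp: thick_def)
        then show "x + y \<in> thick n (2 * P) ((+) b ` A)"
          using b \<open>x + y < n\<close> by (auto simp: thick_def intro!: bexI[of _ a])
      qed
    qed (auto simp: inj_on_def finite_thick)
    then show ?thesis using absorb[OF b(1)] by linarith
  qed
  have "card (bad_sums n (thick n P A) (thick n P B) E) \<le> card (Sigma (thick n P B) ?fibre)"
    by (rule card_inj_on_le[of prod.swap]) (auto simp: bad_sums_def finite_thick fin_fibre)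
  then have "real (card (bad_sums n (thick n P A) (thick n P B) E)) \<le> (\<Sum>y\<in>thick n P B. real (card (?fibre y)))"
    using finite_thick fin_fibre by (simp add: card_SigmaI flip: of_nat_sum)
  also have "\<dots> \<le> card (thick n P B) * \<delta>"
    using sum_bounded_above[of "thick n P B" "\<lambda>y. real (card (?fibre y))" \<delta>] card_fibre by simp
  also have "\<dots> \<le> n * \<delta>"
    using card_mono[OF _ thick_subset[of n P B]] \<delta> by (intro mult_right_mono) auto
  finally show ?thesis .
qed

lemma density_after_losses:
  fixes g m \<zeta> n N E E' :: real
  assumes \<zeta>: "0 < \<zeta>" and g: "g \<le> 1" "m \<le> g + \<zeta> / 2" and n: "0 \<le> n" and E: "0 \<le> E" "E' \<le> E + \<zeta> / 8 * n"
    and N: "n - 3 / 16 * \<zeta> * n \<le> N" "g * N \<le> E'"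
  shows "(m - \<zeta>) * n \<le> E"
proof (cases "g \<le> 0")
  case True
  then have "(m - \<zeta>) * n \<le> 0" using g \<zeta> n by (intro mult_nonpos_nonneg) auto
  then show ?thesis using E by linarith
next
  case False
  then have "g * (n - 3 / 16 * \<zeta> * n) \<le> g * N" using N by (intro mult_left_mono) auto
  moreover have "g * (3 / 16 * \<zeta> * n) \<le> 1 * (3 / 16 * \<zeta> * n)" using g \<zeta> n by (intro mult_right_mono) auto
  moreover have "m * n \<le> (g + \<zeta> / 2) * n" using g n by (intro mult_right_mono) auto
  moreover have "0 \<le> \<zeta> * n" using \<zeta> n by simp
  ultimately show ?thesis using N E by (simp add: algebra_simps)
qed

lemma exists_dense_start_after_removal:
  fixes \<sigma> \<xi> \<kappa> \<epsilon> \<eta> :: real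
  assumes "P > 0" "n > 0" and dens: "almost_dense n \<epsilon> \<sigma> A"
    and A': "card (thick n P A - A') \<le> \<eta> * n"
    and constants: "\<epsilon> + 2 * real P * \<eta> \<le> \<kappa>" "0 \<le> \<kappa>" "\<kappa> < \<xi>" "\<xi> < \<sigma>"
  obtains a where "a \<le> \<kappa> / \<xi> * n" "dense_from n P (\<sigma> - \<xi>) (thick_core n P A') a"
proof -
  have "(\<epsilon> + 2 * real P * \<eta>) * n \<le> \<kappa> * n" using constants by (intro mult_right_mono) auto
  then have "almost_dense n \<kappa> \<sigma> (thick_core n P A')"
    using almost_dense_thick_core[OF assms(1) dens A'] unfolding almost_dense_def by force
  then show ?thesis using exists_dense_start[OF assms(2)] constants that by metis
qed

lemma mann_bound_of_removal:
  fixes \<zeta> \<xi> \<kappa> \<eta> \<epsilon> \<sigma>\<^sub>0 :: real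
  assumes P: "P > 0" "1 / P \<le> \<zeta> / 8" and n: "n > 0" "1 \<le> \<zeta> / 8 * n" and \<zeta>: "0 < \<zeta>" and \<xi>: "\<xi> \<le> \<zeta> / 8" "\<xi> < \<sigma>\<^sub>0"
    and \<kappa>: "0 \<le> \<kappa>" "\<kappa> < \<xi>" "\<kappa> / \<xi> \<le> \<zeta> / 32" and \<eta>: "\<eta> \<le> \<zeta> / 8" and \<epsilon>: "0 < \<epsilon>" "\<epsilon> + 2 * real P * \<eta> \<le> \<kappa>"
    and removal: "\<And>A B E. A \<subseteq> {..<n} \<Longrightarrow> B \<subseteq> {..<n} \<Longrightarrow> card (bad_sums n A B E) \<le> \<epsilon> * (real n)^2 \<Longrightarrow>
      \<exists>A' B' E'. A' \<subseteq> A \<and> B' \<subseteq> B \<and> card (A - A') \<le> \<eta> * n \<and> card (B - B') \<le> \<eta> * n \<and>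
        finite E' \<and> card E' \<le> \<eta> * n \<and> bad_sums n A' B' (E \<union> E') = {}"
  shows "mann_bound \<zeta> \<sigma>\<^sub>0 P \<epsilon> n"
  unfolding mann_bound_def
proof (intro allI impI)
  fix A B E :: "nat set" and \<sigma> \<tau> :: real
  assume A: "almost_dense n \<epsilon> \<sigma> A" and B: "almost_dense n \<epsilon> \<tau> B" and E: "finite E"
    and \<sigma>: "\<sigma>\<^sub>0 \<le> \<sigma>" and \<tau>: "\<sigma>\<^sub>0 \<le> \<tau>"
    and absorb: "\<forall>b\<in>B. real (card (thick n (2 * P) ((+) b ` A) - E)) \<le> \<epsilon> * real n"
  have "card (bad_sums n (thick n P A) (thick n P B) E) \<le> n * (\<epsilon> * n)"
    using absorb \<epsilon> by (intro card_bad_sums_thick) auto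
  then have "card (bad_sums n (thick n P A) (thick n P B) E) \<le> \<epsilon> * (real n)^2"
    by (simp add: power2_eq_square mult_ac)
  then obtain A' B' E' where A': "card (thick n P A - A') \<le> \<eta> * n" and B': "card (thick n P B - B') \<le> \<eta> * n"
    and E': "finite E'" "card E' \<le> \<eta> * n" "bad_sums n A' B' (E \<union> E') = {}"
    using removal[OF thick_subset thick_subset] by metis
  obtain a where a: "a \<le> \<kappa> / \<xi> * n" "dense_from n P (\<sigma> - \<xi>) (thick_core n P A') a"
    using exists_dense_start_after_removal[OF P(1) n(1) A A' \<epsilon>(2) \<kappa>(1,2)] \<xi> \<sigma> by force
  obtain b where b: "b \<le> \<kappa> / \<xi> * n" "dense_from n P (\<tau> - \<xi>) (thick_core n P B') b"
    using exists_dense_start_after_removal[OF P(1) n(1) B B' \<epsilon>(2) \<kappa>(1,2)] \<xi> \<tau> by force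
  define g where "g = min 1 ((\<sigma> - \<xi>) + (\<tau> - \<xi>) - 2 / P)"
  have gN: "g * (n - a - b - 1 :: nat) \<le> card (E \<union> E')"
    unfolding g_def using E E' \<xi> \<sigma> \<tau> thick_core_subset
    by (intro mann_dense_from[OF P(1) _ _ a(2) b(2)]) (fastforce simp: bad_sums_def)+
  show "(min 1 (\<sigma> + \<tau>) - \<zeta>) * real n \<le> real (card E)"
  proof (rule density_after_losses[OF \<zeta> _ _ _ _ _ _ gN])
    show "min 1 (\<sigma> + \<tau>) \<le> g + \<zeta> / 2" using \<xi> P \<zeta> by (auto simp: g_def min_def)
    have "\<eta> * n \<le> \<zeta> / 8 * n" using \<eta> by (intro mult_right_mono) auto
    then show "real (card (E \<union> E')) \<le> card E + \<zeta> / 8 * n" using card_Un_le[of E E'] E'(2) by linarith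
    have "\<kappa> / \<xi> * n \<le> \<zeta> / 32 * n" using \<kappa> by (intro mult_right_mono) auto
    then show "real n - 3 / 16 * \<zeta> * real n \<le> (n - a - b - 1 :: nat)" using a(1) b(1) n(2) by linarith
  qed (auto simp: g_def)
qed

theorem approximate_mann:
  fixes \<zeta> \<sigma>\<^sub>0 :: real
  assumes \<zeta>: "0 < \<zeta>" and \<sigma>\<^sub>0: "0 < \<sigma>\<^sub>0"
  obtains \<epsilon> :: real and n\<^sub>0 P :: nat where "\<epsilon> > 0" "\<And>n. n\<^sub>0 \<le> n \<Longrightarrow> mann_bound \<zeta> \<sigma>\<^sub>0 P \<epsilon> n"
proof -
  define P where "P = nat \<lceil>8 / \<zeta>\<rceil>"
  have "8 / \<zeta> \<le> P" unfolding P_def by linarith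
  moreover have "0 < 8 / \<zeta>" using \<zeta> by simp
  ultimately have "P > 0" by linarith
  then have P: "P > 0" "1 / P \<le> \<zeta> / 8" using \<open>8 / \<zeta> \<le> P\<close> \<zeta> by (auto simp: field_simps)
  define \<xi> where "\<xi> = min (\<zeta> / 8) (\<sigma>\<^sub>0 / 2)"
  have \<xi>: "0 < \<xi>" "\<xi> \<le> \<zeta> / 8" "\<xi> < \<sigma>\<^sub>0" using \<zeta> \<sigma>\<^sub>0 by (auto simp: \<xi>_def)
  define \<kappa> where "\<kappa> = min (\<xi> / 2) (\<xi> * \<zeta> / 32)"
  have \<kappa>: "0 < \<kappa>" "\<kappa> < \<xi>" "\<kappa> / \<xi> \<le> \<zeta> / 32" using \<xi> \<zeta> by (auto simp: \<kappa>_def field_simps min_def)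
  define \<eta> where "\<eta> = min (\<zeta> / 8) (\<kappa> / (4 * P))"
  have \<eta>: "0 < \<eta>" "\<eta> \<le> \<zeta> / 8" "2 * real P * \<eta> \<le> \<kappa> / 2"
    using \<zeta> \<kappa> P by (auto simp: \<eta>_def min_def field_simps)
  obtain \<epsilon>\<^sub>1 :: real where \<epsilon>\<^sub>1: "\<epsilon>\<^sub>1 > 0" and removal: "\<And>n A B E. n > 0 \<Longrightarrow> A \<subseteq> {..<n} \<Longrightarrow> B \<subseteq> {..<n} \<Longrightarrow>
      card (bad_sums n A B E) \<le> \<epsilon>\<^sub>1 * (real n)^2 \<Longrightarrow>
      \<exists>A' B' E'. A' \<subseteq> A \<and> B' \<subseteq> B \<and> card (A - A') \<le> \<eta> * n \<and> card (B - B') \<le> \<eta> * n \<and>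
        finite E' \<and> card E' \<le> \<eta> * n \<and> bad_sums n A' B' (E \<union> E') = {}"
    using arithmetic_removal[OF \<eta>(1)] by blast
  define \<epsilon> where "\<epsilon> = min \<epsilon>\<^sub>1 (\<kappa> / 2)"
  have \<epsilon>: "\<epsilon> > 0" "\<epsilon> \<le> \<epsilon>\<^sub>1" "\<epsilon> + 2 * real P * \<eta> \<le> \<kappa>" using \<epsilon>\<^sub>1 \<kappa> \<eta> by (auto simp: \<epsilon>_def)
  have "mann_bound \<zeta> \<sigma>\<^sub>0 P \<epsilon> n" if "nat \<lceil>8 / \<zeta>\<rceil> + 1 \<le> n" for n
  proof -
    have "8 / \<zeta> \<le> n" using that by linarith
    then have n: "n > 0" "1 \<le> \<zeta> / 8 * n" using \<zeta> that by (simp_all add: field_simps)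
    have \<epsilon>_le: "\<epsilon> * (real n)^2 \<le> \<epsilon>\<^sub>1 * (real n)^2" using \<epsilon> by (intro mult_right_mono) auto
    show ?thesis
      by (rule mann_bound_of_removal[OF P n \<zeta> \<xi>(2,3) less_imp_le[OF \<kappa>(1)] \<kappa>(2,3) \<eta>(2) \<epsilon>(1,3)])
        (rule removal[OF n(1)], assumption, assumption, erule order_trans[OF _ \<epsilon>_le])
  qed
  then show ?thesis by (rule that[OF \<epsilon>(1)])
qed

section \<open>A Littlewood--Offord inequality\<close>

fun lo_count :: "nat \<Rightarrow> nat \<Rightarrow> nat" where
  "lo_count 0 r = (if r = 0 then 0 else 1)"
| "lo_count (Suc q) 0 = 0"
| "lo_count (Suc q) (Suc r) = lo_count q (Suc (Suc r)) + lo_count q r"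

definition ibinom :: "nat \<Rightarrow> int \<Rightarrow> nat" where
  "ibinom q j = (if j < 0 then 0 else q choose (nat j))"

lemma ibinom_Suc: "ibinom (Suc q) j = ibinom q j + ibinom q (j - 1)"
proof (cases "j \<le> 0")
  case True then show ?thesis by (auto simp: ibinom_def)
next
  case False
  then have "nat j = Suc (nat (j - 1))" by simp
  then show ?thesis using False by (simp add: ibinom_def)
qed

lemma lo_count_le_ibinom:
  "2 * a + int r - 1 - int q \<in> {0, 1} \<Longrightarrow> lo_count q r \<le> (\<Sum>j\<in>{a..<a + int r}. ibinom q j)"
proof (induction q arbitrary: a r)
  case 0
  show ?case
  proof (cases "r = 0")
    case False
    then have "0 \<in> {a..<a + int r}" using 0 by auto
    then have "ibinom 0 0 \<le> (\<Sum>j\<in>{a..<a + int r}. ibinom 0 j)"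
      by (intro member_le_sum) auto
    then show ?thesis by (simp add: ibinom_def)
  qed auto
next
  case (Suc q)
  show ?case
  proof (cases r)
    case 0 then show ?thesis by simp
  next
    case (Suc r')
    let ?S = "\<lambda>X. \<Sum>j\<in>X. ibinom q j"
    have "lo_count q (Suc (Suc r')) \<le> ?S {a-1..<a - 1 + int (Suc (Suc r'))}" "lo_count q r' \<le> ?S {a..<a + int r'}"
      using Suc.prems Suc by (intro Suc.IH; auto)+
    moreover have "{a-1..<a - 1 + int (Suc (Suc r'))} = insert (a-1) {a..<a + int r}" using Suc by auto
    ultimately have "lo_count (Suc q) r \<le> ?S {a..<a + int r} + (ibinom q (a-1) + ?S {a..<a + int r'})"
      using Suc by simp
    also have "ibinom q (a-1) + ?S {a..<a + int r'} = ?S (insert (a-1) {a..<a + int r'})" by simp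
    also have "insert (a-1) {a..<a + int r'} = {a-1..<a - 1 + int r}" using Suc by auto
    also have "?S {a-1..<a - 1 + int r} = (\<Sum>j\<in>{a..<a + int r}. ibinom q (j - 1))"
      by (rule sum.reindex_bij_witness[of _ "\<lambda>j. j - 1" "\<lambda>j. j + 1"]) auto
    also have "?S {a..<a + int r} + \<dots> = (\<Sum>j\<in>{a..<a + int r}. ibinom (Suc q) j)"
      by (simp add: ibinom_Suc sum.distrib)
    finally show ?thesis .
  qed
qed

lemma lo_count_central: "lo_count (2 * u) 1 \<le> (2 * u) choose u"
proof -
  have "{int u..<int u + int 1} = {int u}" by auto
  then show ?thesis using lo_count_le_ibinom[of "int u" 1 "2*u"] by (simp add: ibinom_def)
qed

lemma Suc_times_central_binomial:
  "Suc u * ((2 * Suc u) choose Suc u) = 2 * (2 * u + 1) * ((2 * u) choose u)"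
proof -
  let ?X = "Suc (Suc (2*u)) choose Suc u" and ?Z = "Suc (2*u) choose u"
  have X: "Suc u * ?X = Suc (Suc (2*u)) * ?Z" by (rule Suc_times_binomial)
  have "Suc (2*u) choose Suc u = ?Z"
    using binomial_symmetric[of u "Suc (2*u)"] by (simp del: binomial_Suc_Suc)
  then have Z: "Suc u * ?Z = Suc (2*u) * ((2 * u) choose u)"
    using Suc_times_binomial[of u "2*u"] by (simp only:)
  have "Suc u * (Suc u * ?X) = Suc (Suc (2*u)) * (Suc u * ?Z)"
    unfolding X by (rule mult.left_commute)
  also have "\<dots> = Suc u * (2 * Suc (2*u) * ((2 * u) choose u))" unfolding Z by simp
  finally have "Suc u * ?X = 2 * Suc (2*u) * ((2 * u) choose u)" by (subst (asm) mult_cancel1) simp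
  moreover have "2 * Suc u = Suc (Suc (2*u))" by simp
  ultimately show ?thesis by (simp del: binomial_Suc_Suc)
qed

lemma central_binomial_square_upper: "real ((2 * u) choose u) ^ 2 * (2 * real u + 1) \<le> 16 ^ u"
proof (induction u)
  case (Suc u)
  define x y U where "x = real ((2 * Suc u) choose Suc u)" and "y = real ((2 * u) choose u)" and "U = real u"
  have "real (Suc u * ((2 * Suc u) choose Suc u)) = real (2 * (2 * u + 1) * ((2 * u) choose u))"
    by (simp only: Suc_times_central_binomial)
  then have xy: "(U + 1) * x = 2 * (2 * U + 1) * y"
    by (simp add: x_def y_def U_def algebra_simps del: binomial_Suc_Suc)
  have IH: "y^2 * (2 * U + 1) \<le> 16 ^ u" using Suc by (simp add: y_def U_def)
  have U: "U \<ge> 0" by (simp add: U_def)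
  have "(U + 1)^2 * (x^2 * (2 * U + 3)) = ((U + 1) * x)^2 * (2 * U + 3)"
    by (simp add: power_mult_distrib)
  also have "\<dots> = 4 * ((2 * U + 1) * (2 * U + 3)) * (y^2 * (2 * U + 1))"
    unfolding xy power2_eq_square by algebra
  also have "\<dots> \<le> 4 * (4 * (U + 1)^2) * 16 ^ u"
    by (rule mult_mono[OF _ IH]) (use U in \<open>auto simp: power2_eq_square algebra_simps\<close>)
  finally have "(U + 1)^2 * (x^2 * (2 * U + 3)) \<le> (U + 1)^2 * 16 ^ Suc u" by simp
  then have "x^2 * (2 * U + 3) \<le> 16 ^ Suc u" using U by (simp add: mult_le_cancel_left_pos)
  then show ?case by (simp add: x_def U_def algebra_simps del: binomial_Suc_Suc)
qed auto

lemma central_binomial_upper: "real ((2 * u) choose u) \<le> 2 ^ (2 * u) / sqrt (2 * real u + 1)"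
proof -
  have "(real ((2 * u) choose u) * sqrt (2 * real u + 1))^2 \<le> (2 ^ (2 * u))^2"
  proof -
    have "((2::real) ^ (2 * u))^2 = 16 ^ u"
      by (simp add: power_mult power2_eq_square flip: power_mult_distrib)
    then show ?thesis using central_binomial_square_upper[of u] by (simp add: power_mult_distrib)
  qed
  then have "real ((2 * u) choose u) * sqrt (2 * real u + 1) \<le> 2 ^ (2 * u)" by (rule power2_le_imp_le) auto
  then show ?thesis by (simp add: field_simps)
qed

definition cells :: "real \<Rightarrow> real set \<Rightarrow> real set" where
  "cells d L = (\<Union>z\<in>L. {z..<z + d})"

definition cell_count ::
  "real \<Rightarrow> 'i set \<Rightarrow> ('i \<Rightarrow> 'a set) \<Rightarrow> ('i \<Rightarrow> 'a \<Rightarrow> real) \<Rightarrow> real set \<Rightarrow> real" where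
  "cell_count d I V g L = (\<Sum>b\<in>PiE I V. indicat_real (cells d L) (\<Sum>i\<in>I. g i (b i)))"

definition split_pairs :: "real \<Rightarrow> ('a \<Rightarrow> real) \<Rightarrow> 'a set \<Rightarrow> bool" where
  "split_pairs d g V \<longleftrightarrow> (\<exists>V1 V2 \<pi>. V = V1 \<union> V2 \<and> V1 \<inter> V2 = {} \<and> bij_betw \<pi> V1 V2 \<and>
     (\<forall>v\<in>V1. d \<le> \<bar>g (\<pi> v) - g v\<bar>))"

lemma sum_PiE_insert:
  fixes f :: "('i \<Rightarrow> 'a) \<Rightarrow> 'b::comm_monoid_add"
  assumes "i \<notin> I"
  shows "(\<Sum>b\<in>PiE (insert i I) V. f b) = (\<Sum>v\<in>V i. \<Sum>b\<in>PiE I V. f (b(i := v)))"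
proof -
  have "(\<Sum>b\<in>PiE (insert i I) V. f b) = (\<Sum>b\<in>(\<lambda>(y, g). g(i := y)) ` (V i \<times> PiE I V). f b)"
    by (simp add: PiE_insert_eq)
  also have "\<dots> = (\<Sum>(v, b)\<in>V i \<times> PiE I V. f (b(i := v)))"
    by (subst sum.reindex[OF inj_combinator[OF assms]]) (simp add: case_prod_unfold o_def)
  finally show ?thesis by (simp add: sum.cartesian_product)
qed

lemma sum_split_pairs_le:
  fixes F :: "real \<Rightarrow> real" and c :: real
  assumes fin: "finite V" and split: "split_pairs d g V" and le: "\<And>x y. d \<le> \<bar>y - x\<bar> \<Longrightarrow> F x + F y \<le> c"
  shows "2 * (\<Sum>v\<in>V. F (g v)) \<le> card V * c"
proof -
  obtain V1 V2 \<pi> where V: "V = V1 \<union> V2" "V1 \<inter> V2 = {}" "bij_betw \<pi> V1 V2" "\<forall>v\<in>V1. d \<le> \<bar>g (\<pi> v) - g v\<bar>"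
    using split unfolding split_pairs_def by auto
  have finV: "finite V1" "finite V2" using fin V(1) by auto
  have "(\<Sum>v\<in>V. F (g v)) = (\<Sum>v\<in>V1. F (g v)) + (\<Sum>v\<in>V2. F (g v))"
    unfolding V(1) using finV V(2) by (simp add: sum.union_disjoint)
  also have "(\<Sum>v\<in>V2. F (g v)) = (\<Sum>v\<in>V1. F (g (\<pi> v)))"
    using sum.reindex_bij_betw[OF V(3), of "\<lambda>v. F (g v)"] by simp
  also have "(\<Sum>v\<in>V1. F (g v)) + \<dots> \<le> card V1 * c"
    unfolding sum.distrib[symmetric] using V(4) le by (intro sum_bounded_above) auto
  finally show ?thesis
    using finV V(2) bij_betw_same_card[OF V(3)] by (simp add: V(1) card_Un_disjoint)
qed

lemma cells_shift: "x + s \<in> cells d L \<longleftrightarrow> x \<in> cells d ((\<lambda>z. z - s) ` L)"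
  by (auto simp: cells_def algebra_simps)

lemma cell_count_empty: "cell_count d I V g {} = 0"
  by (simp add: cell_count_def cells_def)

lemma cell_count_insert:
  assumes "finite I" "i \<notin> I"
  shows "cell_count d (insert i I) V g L = (\<Sum>v\<in>V i. cell_count d I V g ((\<lambda>z. z - g i v) ` L))"
proof -
  have "(\<Sum>j\<in>insert i I. g j ((b(i := v)) j)) = (\<Sum>j\<in>I. g j (b j)) + g i v" for b v
  proof -
    have "(\<Sum>j\<in>I. g j ((b(i := v)) j)) = (\<Sum>j\<in>I. g j (b j))" using assms by (intro sum.cong) auto
    then show ?thesis using assms by simp
  qed
  then show ?thesis
    unfolding cell_count_def sum_PiE_insert[OF assms(2)] by (simp add: indicator_def cells_shift)
qed

lemma indicator_cells_exchange:
  fixes d s x :: real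
  assumes "finite L" "d \<le> s"
  shows "indicat_real (cells d L) x + indicat_real (cells d ((\<lambda>z. z - s) ` L)) x
     \<le> indicat_real (cells d (insert (Max L) ((\<lambda>z. z - s) ` L))) x + indicat_real (cells d (L - {Max L})) x"
proof -
  have insert: "cells d (insert (Max L) ((\<lambda>z. z - s) ` L)) = {Max L..<Max L + d} \<union> cells d ((\<lambda>z. z - s) ` L)"
    by (auto simp: cells_def)
  have remove: "x \<in> {Max L..<Max L + d} \<or> x \<in> cells d (L - {Max L})" if "x \<in> cells d L"
    using that by (force simp: cells_def)
  show ?thesis
  proof (cases "x \<in> {Max L..<Max L + d}")
    case True
    have "x \<notin> cells d ((\<lambda>z. z - s) ` L)"
    proof
      assume "x \<in> cells d ((\<lambda>z. z - s) ` L)"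
      then obtain z where "z \<in> L" "x < z - s + d" by (auto simp: cells_def)
      then show False using True Max_ge[OF assms(1), of z] assms(2) by auto
    qed
    then show ?thesis using True unfolding insert by (auto simp: indicator_def)
  next
    case False
    then show ?thesis using remove unfolding insert by (auto simp: indicator_def)
  qed
qed

lemma cell_count_exchange:
  fixes d s :: real
  assumes "finite L" "d \<le> s"
  shows "cell_count d I V g L + cell_count d I V g ((\<lambda>z. z - s) ` L)
     \<le> cell_count d I V g (insert (Max L) ((\<lambda>z. z - s) ` L)) + cell_count d I V g (L - {Max L})"
  unfolding cell_count_def sum.distrib[symmetric] by (intro sum_mono indicator_cells_exchange assms)

lemma cell_count_pair_le:
  fixes d x y p :: real
  assumes L: "finite L" "card L \<le> r" and d: "d \<le> \<bar>y - x\<bar>" and p: "0 \<le> p"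
    and bound: "\<And>L' r'. finite L' \<Longrightarrow> card L' \<le> r' \<Longrightarrow> cell_count d I V g L' \<le> p * lo_count q r'"
  shows "cell_count d I V g ((\<lambda>z. z - x) ` L) + cell_count d I V g ((\<lambda>z. z - y) ` L) \<le> p * lo_count (Suc q) r"
proof -
  have "cell_count d I V g ((\<lambda>z. z - x) ` L) + cell_count d I V g ((\<lambda>z. z - y) ` L) \<le> p * lo_count (Suc q) r"
    if le: "d \<le> y - x" for x y
  proof (cases "L = {}")
    case True
    then show ?thesis using p by (simp add: cell_count_empty)
  next
    case False
    then obtain r' where r: "r = Suc r'" using L by (cases r) auto
    define L' where "L' = (\<lambda>z. z - x) ` L"
    have L': "finite L'" "L' \<noteq> {}" "card L' \<le> Suc r'"
      using L False card_image_le[of L "\<lambda>z. z - x"] by (auto simp: L'_def r)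
    have shift: "(\<lambda>z. z - y) ` L = (\<lambda>z. z - (y - x)) ` L'" by (force simp: L'_def)
    have "card (insert (Max L') ((\<lambda>z. z - (y - x)) ` L')) \<le> Suc (Suc r')"
      using L' card_image_le[of L' "\<lambda>z. z - (y - x)"] by (simp add: card_insert_if)
    moreover have "card (L' - {Max L'}) \<le> r'" using L' by simp
    ultimately have "cell_count d I V g (insert (Max L') ((\<lambda>z. z - (y - x)) ` L')) + cell_count d I V g (L' - {Max L'})
        \<le> p * lo_count q (Suc (Suc r')) + p * lo_count q r'"
      using L' by (intro add_mono bound) auto
    then show ?thesis
      using cell_count_exchange[OF L'(1) le, of I V g] unfolding shift L'_def[symmetric] r
      by (simp add: distrib_left)
  qed
  from this[of x y] this[of y x] show ?thesis using d by (cases "x \<le> y") (auto simp: add.commute)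
qed

theorem littlewood_offord:
  fixes g :: "'i \<Rightarrow> 'a \<Rightarrow> real"
  assumes "finite I" "Q \<subseteq> I" "\<And>i. i \<in> I \<Longrightarrow> finite (V i)" and d: "0 < d"
    and "\<And>i. i \<in> Q \<Longrightarrow> split_pairs d (g i) (V i)" and "finite L" "card L \<le> r"
  shows "cell_count d I V g L \<le> (\<Prod>i\<in>I. real (card (V i))) / 2 ^ card Q * lo_count (card Q) r"
  using assms(1-3,5-)
proof (induction I arbitrary: Q L r rule: finite_induct)
  case empty
  have "cell_count d {} V g L \<le> lo_count 0 r"
    using empty.prems by (cases "r = 0") (auto simp: cell_count_def cells_def indicator_def)
  then show ?case using empty.prems by simp
next
  case (insert i I)
  let ?P = "\<Prod>i\<in>I. real (card (V i))" and ?cc = "cell_count d I V g"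
  define q where "q = card (Q - {i})"
  define p where "p = ?P / 2 ^ q"
  have p: "0 \<le> p" by (simp add: p_def prod_nonneg)
  have IH: "?cc L' \<le> p * lo_count q r'" if "finite L'" "card L' \<le> r'" for L' r'
    unfolding p_def q_def using insert.prems that by (intro insert.IH) auto
  have prod: "(\<Prod>j\<in>insert i I. real (card (V j))) = real (card (V i)) * ?P" using insert.hyps by simp
  show ?case
  proof (cases "i \<in> Q")
    case False
    have "?cc ((\<lambda>z. z - g i v) ` L) \<le> p * lo_count q r" for v
      using insert.prems card_image_le[of L] le_trans by (intro IH) blast+
    then have "(\<Sum>v\<in>V i. ?cc ((\<lambda>z. z - g i v) ` L)) \<le> card (V i) * (p * lo_count q r)"
      by (intro sum_bounded_above)
    then show ?thesis using False insert.hyps by (simp add: cell_count_insert prod p_def q_def)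
  next
    case True
    have "finite Q" using insert.prems(1) insert.hyps finite_subset by blast
    then have card_Q: "card Q = Suc q" unfolding q_def using True by (metis card_Suc_Diff1)
    have "2 * (\<Sum>v\<in>V i. ?cc ((\<lambda>z. z - g i v) ` L)) \<le> card (V i) * (p * lo_count (Suc q) r)"
      using insert.prems True
      by (intro sum_split_pairs_le[where d = d and F = "\<lambda>x. ?cc ((\<lambda>z. z - x) ` L)"] cell_count_pair_le[OF _ _ _ p IH]) auto
    then show ?thesis using insert.hyps by (simp add: cell_count_insert prod p_def card_Q field_simps)
  qed
qed

lemma card_in_cell_le:
  fixes g :: "'i \<Rightarrow> 'a \<Rightarrow> real"
  assumes "finite I" "Q \<subseteq> I" and fin: "\<And>i. i \<in> I \<Longrightarrow> finite (V i)" and d: "0 < d"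
    and split: "\<And>i. i \<in> Q \<Longrightarrow> split_pairs d (g i) (V i)" and Q: "card Q = 2 * u"
  shows "card {b\<in>PiE I V. (\<Sum>i\<in>I. g i (b i)) \<in> {z..<z + d}} \<le> (\<Prod>i\<in>I. real (card (V i))) / sqrt (2 * real u + 1)"
proof -
  let ?P = "\<Prod>i\<in>I. real (card (V i))"
  have P: "0 \<le> ?P" by (simp add: prod_nonneg)
  have "finite (PiE I V)" using assms(1) fin by (intro finite_PiE) auto
  then have "real (card {b\<in>PiE I V. (\<Sum>i\<in>I. g i (b i)) \<in> {z..<z + d}}) = cell_count d I V g {z}"
    by (simp add: cell_count_def cells_def indicator_def Int_def)
  also have "\<dots> \<le> ?P / 2 ^ (2 * u) * lo_count (2 * u) 1"
    using littlewood_offord[OF assms(1,2) fin d split, where L = "{z}" and r = 1] Q by simp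
  also have "real (lo_count (2 * u) 1) \<le> 2 ^ (2 * u) / sqrt (2 * real u + 1)"
    using lo_count_central[of u] central_binomial_upper[of u] by linarith
  then have "?P / 2 ^ (2 * u) * lo_count (2 * u) 1 \<le> ?P / 2 ^ (2 * u) * (2 ^ (2 * u) / sqrt (2 * real u + 1))"
    using P by (intro mult_left_mono) auto
  finally show ?thesis by simp
qed

section \<open>The potential of a random sum\<close>

lemma sum_half_power_int:
  assumes "finite (X :: int set)"
  shows "(\<Sum>r\<in>X. (1/2::real) ^ nat \<bar>r\<bar>) \<le> 4"
proof -
  have geometric: "(\<Sum>j\<in>J. (1/2::real) ^ j) \<le> 2" if "finite J" for J :: "nat set"
  proof -
    have "(\<Sum>j\<in>J. (1/2::real) ^ j) \<le> (\<Sum>j. (1/2) ^ j)"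
      using that by (intro sum_le_suminf) (auto simp: summable_geometric)
    also have "\<dots> = 2" by (simp add: suminf_geometric)
    finally show ?thesis .
  qed
  have half: "(\<Sum>r\<in>Y. (1/2::real) ^ nat \<bar>r\<bar>) \<le> 2" if "finite Y" "inj_on (\<lambda>r. nat \<bar>r\<bar>) Y" for Y :: "int set"
    using geometric[of "(\<lambda>r. nat \<bar>r\<bar>) ` Y"] that by (simp add: sum.reindex)
  have "(\<Sum>r\<in>X. (1/2::real) ^ nat \<bar>r\<bar>) = (\<Sum>r\<in>X \<inter> {0..}. (1/2) ^ nat \<bar>r\<bar>) + (\<Sum>r\<in>X - {0..}. (1/2) ^ nat \<bar>r\<bar>)"
    by (rule sum.Int_Diff[OF assms])
  also have "\<dots> \<le> 2 + 2"
    using assms by (intro add_mono half) (auto simp: inj_on_def)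
  finally show ?thesis by simp
qed

lemma sum_exp_neg_abs_le:
  fixes v :: "'b \<Rightarrow> real" and d c :: real
  assumes fin: "finite X" and d: "0 < d" and c: "0 \<le> c" and card: "\<And>k::int. card {b\<in>X. v b \<in> {d * k..<d * k + d}} \<le> c"
  shows "(\<Sum>b\<in>X. exp (- \<bar>v b\<bar> / d)) \<le> 12 * c"
proof -
  define r where "r b = \<lfloor>v b / d\<rfloor>" for b
  have fibre: "fibre X r k = {b\<in>X. v b \<in> {d * k..<d * k + d}}" for k
    using d by (auto simp: fibre_def r_def floor_eq_iff field_simps)
  have exp_le: "exp (- \<bar>v b\<bar> / d) \<le> 3 * (1/2) ^ nat \<bar>r b\<bar>" for b
  proof -
    define t where "t = real_of_int \<bar>r b\<bar>"
    have "r b \<le> v b / d" "v b / d < r b + 1" unfolding r_def by linarith+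
    moreover have "\<bar>v b\<bar> / d = \<bar>v b / d\<bar>" using d by simp
    ultimately have "t - 1 \<le> \<bar>v b\<bar> / d" unfolding t_def by linarith
    then have "exp (- \<bar>v b\<bar> / d) \<le> exp (1 - t)" by simp
    also have "\<dots> = exp 1 * exp (- 1) ^ nat \<bar>r b\<bar>" by (simp add: t_def flip: exp_of_nat_mult exp_add)
    also have "\<dots> \<le> 3 * (1/2) ^ nat \<bar>r b\<bar>"
    proof (intro mult_mono power_mono)
      show "exp (- 1) \<le> (1/2::real)" using exp_ge_add_one_self[of 1] by (simp add: exp_minus field_simps)
    qed (use exp_le in auto)
    finally show ?thesis .
  qed
  have "(\<Sum>b\<in>X. exp (- \<bar>v b\<bar> / d)) \<le> (\<Sum>b\<in>X. 3 * (1/2) ^ nat \<bar>r b\<bar>)" using exp_le by (rule sum_mono)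
  also have "\<dots> = (\<Sum>k\<in>r ` X. card (fibre X r k) * (3 * (1/2) ^ nat \<bar>k\<bar>))"
    unfolding sum_by_fibres[OF fin, of _ r] by (intro sum.cong refl) (simp add: fibre_def)
  also have "\<dots> \<le> (\<Sum>k\<in>r ` X. c * (3 * (1/2) ^ nat \<bar>k\<bar>))"
    using card unfolding fibre by (intro sum_mono mult_right_mono) auto
  also have "\<dots> = 3 * c * (\<Sum>k\<in>r ` X. (1/2) ^ nat \<bar>k\<bar>)" by (simp add: sum_distrib_left algebra_simps)
  also have "\<dots> \<le> 3 * c * 4" using c fin by (intro mult_left_mono sum_half_power_int) auto
  finally show ?thesis by simp
qed

lemma concentration_exp_sum:
  fixes g :: "'i \<Rightarrow> 'a \<Rightarrow> real" and d y :: real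
  assumes "finite I" "Q \<subseteq> I" and fin: "\<And>i. i \<in> I \<Longrightarrow> finite (V i)" and d: "0 < d"
    and split: "\<And>i. i \<in> Q \<Longrightarrow> split_pairs d (g i) (V i)" and Q: "card Q = 2 * u"
  shows "(\<Sum>b\<in>PiE I V. exp (- \<bar>y + (\<Sum>i\<in>I. g i (b i))\<bar> / d)) \<le> 12 * ((\<Prod>i\<in>I. real (card (V i))) / sqrt (2 * real u + 1))"
proof (rule sum_exp_neg_abs_le[OF _ d])
  show "finite (PiE I V)" using assms(1) fin by (intro finite_PiE) auto
  fix k :: int
  have "y + s \<in> {d * k..<d * k + d} \<longleftrightarrow> s \<in> {(d * k - y)..<(d * k - y) + d}" for s by auto
  then show "card {b\<in>PiE I V. y + (\<Sum>i\<in>I. g i (b i)) \<in> {d * k..<d * k + d}} \<le>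
      (\<Prod>i\<in>I. real (card (V i))) / sqrt (2 * real u + 1)"
    using card_in_cell_le[OF assms(1,2) fin d split Q, where z = "d * k - y"] by simp
qed (simp add: prod_nonneg)

lemma exp_le_quadratic:
  assumes "\<bar>x::real\<bar> \<le> 1"
  shows "exp x \<le> 1 + x + x^2"
proof (cases "x \<ge> 0")
  case True
  then show ?thesis using exp_bound[of x] assms by simp
next
  case False
  have "(1 + x + x^2) * (1 - x) = 1 + (-x)^3" by (simp add: algebra_simps power2_eq_square power3_eq_cube)
  moreover have "(-x)^3 \<ge> 0" using False by simp
  ultimately have "1 \<le> (1 + x + x^2) * (1 - x)" by linarith
  also have "\<dots> \<le> (1 + x + x^2) * exp (- x)"
  proof (intro mult_left_mono)
    show "1 - x \<le> exp (- x)" using exp_ge_add_one_self[of "- x"] by simp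
    show "0 \<le> 1 + x + x^2" using assms by (smt (verit) zero_le_power2)
  qed
  finally show ?thesis by (simp add: exp_minus field_simps)
qed

lemma sum_exp_mean_zero_le:
  fixes f :: "'a \<Rightarrow> real"
  assumes zero: "(\<Sum>v\<in>V. f v) = 0" and bound: "\<And>v. v \<in> V \<Longrightarrow> \<bar>f v\<bar> \<le> c" and c: "c \<le> 1"
  shows "(\<Sum>v\<in>V. exp (f v)) \<le> card V * exp (c^2)"
proof -
  have "(\<Sum>v\<in>V. exp (f v)) \<le> (\<Sum>v\<in>V. 1 + f v + c^2)"
  proof (rule sum_mono)
    fix v assume v: "v \<in> V"
    have "exp (f v) \<le> 1 + f v + (f v)^2" using bound[OF v] c by (intro exp_le_quadratic) auto
    moreover have "(f v)^2 \<le> c^2" using bound[OF v] by (simp add: abs_le_square_iff[symmetric])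
    ultimately show "exp (f v) \<le> 1 + f v + c^2" by linarith
  qed
  also have "\<dots> = card V * (1 + c^2)" using zero by (simp add: sum.distrib algebra_simps)
  also have "\<dots> \<le> card V * exp (c^2)" using exp_ge_add_one_self[of "c^2"] by (intro mult_left_mono) auto
  finally show ?thesis .
qed

lemma exp_moment_bound:
  fixes f :: "'i \<Rightarrow> 'a \<Rightarrow> real" and c :: real
  assumes I: "finite I" "I \<noteq> {}" and fin: "\<And>i. i \<in> I \<Longrightarrow> finite (V i)"
    and zero: "\<And>i. i \<in> I \<Longrightarrow> (\<Sum>v\<in>V i. f i v) = 0"
    and bound: "\<And>i v. i \<in> I \<Longrightarrow> v \<in> V i \<Longrightarrow> \<bar>f i v\<bar> \<le> c" and c: "card I * c^2 \<le> 1"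
  shows "(\<Sum>b\<in>PiE I V. exp (\<Sum>i\<in>I. f i (b i))) \<le> 3 * (\<Prod>i\<in>I. real (card (V i)))"
proof -
  have "1 * c^2 \<le> card I * c^2" using I by (intro mult_right_mono) (auto simp: Suc_leI card_gt_0_iff)
  then have "c^2 \<le> 1^2" using c by simp
  then have c_le_1: "c \<le> 1" using abs_le_square_iff[of c 1] by simp
  have "(\<Sum>b\<in>PiE I V. exp (\<Sum>i\<in>I. f i (b i))) = (\<Prod>i\<in>I. \<Sum>v\<in>V i. exp (f i v))"
    using I(1) fin by (simp add: prod_sum_PiE exp_sum)
  also have "\<dots> \<le> (\<Prod>i\<in>I. card (V i) * exp (c^2))"
    using sum_exp_mean_zero_le[OF zero bound c_le_1] by (intro prod_mono) (auto intro!: sum_nonneg)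
  also have "\<dots> = (\<Prod>i\<in>I. real (card (V i))) * exp (card I * c^2)"
    by (simp add: prod.distrib exp_of_nat_mult)
  also have "\<dots> \<le> (\<Prod>i\<in>I. real (card (V i))) * 3"
  proof (intro mult_left_mono prod_nonneg)
    have "exp (card I * c^2) \<le> exp 1" using c by simp
    then show "exp (card I * c^2) \<le> 3" using exp_le by linarith
  qed auto
  finally show ?thesis by simp
qed

text \<open>Where the increment \<open>D\<close> is small compared with \<open>\<tau>'\<close> the first term dominates, elsewhere the second one.\<close>

lemma exp_potential_split:
  fixes y D s h \<tau> \<tau>' d :: real
  assumes \<tau>: "0 < \<tau>" "2 * \<tau> \<le> d" "2 * \<tau> \<le> \<tau>'" and h: "0 < h" and s: "0 \<le> s"
  defines "\<mu> \<equiv> (1 + h) / \<tau>'"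
  shows "exp (- \<bar>y + D\<bar> / \<tau>) \<le> exp (- \<bar>y\<bar> / \<tau>') *
      (exp s * exp (- \<bar>y + D\<bar> / d) + exp (- h * s) * (exp (\<mu> * D) + exp (- \<mu> * D)))"
proof -
  let ?w = "\<bar>y + D\<bar>"
  have pos: "0 < d" "0 < \<tau>'" using \<tau> by linarith+
  have "?w / d \<le> ?w / (2 * \<tau>)" "?w / \<tau>' \<le> ?w / (2 * \<tau>)" using \<tau> pos by (intro divide_left_mono; auto)+
  moreover have "\<bar>y\<bar> / \<tau>' \<le> ?w / \<tau>' + \<bar>D\<bar> / \<tau>'"
    using pos by (simp add: divide_right_mono flip: add_divide_distrib)
  moreover have "?w / \<tau> = ?w / (2 * \<tau>) + ?w / (2 * \<tau>)" using \<tau> by (simp add: field_simps)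
  ultimately have exponent: "- ?w / \<tau> \<le> - \<bar>y\<bar> / \<tau>' + (\<bar>D\<bar> / \<tau>' - ?w / d)" by linarith
  show ?thesis
  proof (cases "\<bar>D\<bar> / \<tau>' \<le> s")
    case True
    have "exp (- ?w / \<tau>) \<le> exp (- \<bar>y\<bar> / \<tau>' + (s - ?w / d))" using exponent True by simp
    also have "\<dots> = exp (- \<bar>y\<bar> / \<tau>') * (exp s * exp (- ?w / d))" by (simp flip: exp_add)
    also have "\<dots> \<le> exp (- \<bar>y\<bar> / \<tau>') * (exp s * exp (- ?w / d) + exp (- h * s) * (exp (\<mu> * D) + exp (- \<mu> * D)))"
      by (intro mult_left_mono) auto
    finally show ?thesis .
  next
    case False
    have "h * s \<le> h * (\<bar>D\<bar> / \<tau>')" using False h by (intro mult_left_mono) auto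
    then have "\<bar>D\<bar> / \<tau>' \<le> - h * s + \<mu> * \<bar>D\<bar>" by (simp add: \<mu>_def algebra_simps add_divide_distrib)
    moreover have "?w / d \<ge> 0" using pos by simp
    ultimately have "exp (- ?w / \<tau>) \<le> exp (- \<bar>y\<bar> / \<tau>' + (- h * s + \<mu> * \<bar>D\<bar>))" using exponent by simp
    also have "\<dots> = exp (- \<bar>y\<bar> / \<tau>') * (exp (- h * s) * exp (\<mu> * \<bar>D\<bar>))" by (simp flip: exp_add)
    also have "\<dots> \<le> exp (- \<bar>y\<bar> / \<tau>') * (exp s * exp (- ?w / d) + exp (- h * s) * (exp (\<mu> * D) + exp (- \<mu> * D)))"
    proof -
      have "exp (\<mu> * \<bar>D\<bar>) \<le> exp (\<mu> * D) + exp (- \<mu> * D)" by (cases "D \<ge> 0") (auto simp: abs_if)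
      then show ?thesis by (intro mult_left_mono[OF add_increasing[OF _ mult_left_mono]]) auto
    qed
    finally show ?thesis .
  qed
qed

definition decay_factor :: "nat \<Rightarrow> real \<Rightarrow> real \<Rightarrow> real" where
  "decay_factor u h s = 12 * exp s / sqrt (2 * real u + 1) + 6 * exp (- h * s)"

lemma decay_factor_nonneg: "0 \<le> decay_factor u h s"
  by (simp add: decay_factor_def)

theorem potential_step:
  fixes g :: "'i \<Rightarrow> 'a \<Rightarrow> real" and d y R h s \<tau> \<tau>' :: real
  assumes I: "finite I" "I \<noteq> {}" "Q \<subseteq> I" and fin: "\<And>i. i \<in> I \<Longrightarrow> finite (V i)"
    and zero: "\<And>i. i \<in> I \<Longrightarrow> (\<Sum>v\<in>V i. g i v) = 0"
    and bound: "\<And>i v. i \<in> I \<Longrightarrow> v \<in> V i \<Longrightarrow> \<bar>g i v\<bar> \<le> R"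
    and split: "\<And>i. i \<in> Q \<Longrightarrow> split_pairs d (g i) (V i)" and Q: "card Q = 2 * u"
    and \<tau>: "0 < \<tau>" "2 * \<tau> \<le> d" "2 * \<tau> \<le> \<tau>'" and \<tau>': "\<tau>' = (1 + h) * (sqrt (card I) * R)" and h: "h > 0" and s: "s \<ge> 0"
  shows "(\<Sum>b\<in>PiE I V. exp (- \<bar>y + (\<Sum>i\<in>I. g i (b i))\<bar> / \<tau>))
     \<le> decay_factor u h s * (\<Prod>i\<in>I. real (card (V i))) * exp (- \<bar>y\<bar> / \<tau>')"
proof -
  define P where "P = (\<Prod>i\<in>I. real (card (V i)))"
  define D where "D b = (\<Sum>i\<in>I. g i (b i))" for b
  define \<mu> where "\<mu> = (1 + h) / \<tau>'"
  have pos: "0 < d" "0 < \<tau>'" using \<tau> by linarith+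
  have "card I * (\<mu> * R)^2 = (\<mu> * (sqrt (card I) * R))^2" by (simp add: power_mult_distrib)
  also have "\<mu> * (sqrt (card I) * R) = 1" using pos by (simp add: \<mu>_def \<tau>'[symmetric])
  finally have \<mu>R: "card I * (\<mu> * R)^2 \<le> 1" by simp
  have moment: "(\<Sum>b\<in>PiE I V. exp (\<nu> * D b)) \<le> 3 * P" if "\<bar>\<nu>\<bar> = \<mu>" for \<nu>
    unfolding D_def P_def sum_distrib_left
  proof (rule exp_moment_bound[OF I(1,2) fin _ _ \<mu>R])
    show "\<bar>\<nu> * g i v\<bar> \<le> \<mu> * R" if "i \<in> I" "v \<in> V i" for i v
      using bound[OF that] \<open>\<bar>\<nu>\<bar> = \<mu>\<close> by (auto simp: abs_mult intro!: mult_left_mono)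
  qed (simp_all add: zero flip: sum_distrib_left)
  have \<mu>0: "0 < \<mu>" using h pos by (simp add: \<mu>_def)
  have "(\<Sum>b\<in>PiE I V. exp (- \<bar>y + D b\<bar> / \<tau>)) \<le> (\<Sum>b\<in>PiE I V. exp (- \<bar>y\<bar> / \<tau>') *
      (exp s * exp (- \<bar>y + D b\<bar> / d) + exp (- h * s) * (exp (\<mu> * D b) + exp (- \<mu> * D b))))"
    unfolding \<mu>_def by (intro sum_mono exp_potential_split \<tau> h s)
  also have "\<dots> = exp (- \<bar>y\<bar> / \<tau>') * (exp s * (\<Sum>b\<in>PiE I V. exp (- \<bar>y + D b\<bar> / d))
      + exp (- h * s) * ((\<Sum>b\<in>PiE I V. exp (\<mu> * D b)) + (\<Sum>b\<in>PiE I V. exp (- \<mu> * D b))))"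
    by (simp add: sum.distrib sum_distrib_left algebra_simps)
  also have "\<dots> \<le> exp (- \<bar>y\<bar> / \<tau>') * (exp s * (12 * (P / sqrt (2 * real u + 1))) + exp (- h * s) * (3 * P + 3 * P))"
    using concentration_exp_sum[OF I(1,3) fin pos(1) split Q, where y = y] moment[of \<mu>] moment[of "- \<mu>"] \<mu>0
    by (intro mult_left_mono add_mono) (auto simp: D_def P_def)
  also have "\<dots> = decay_factor u h s * P * exp (- \<bar>y\<bar> / \<tau>')"
    by (simp add: decay_factor_def algebra_simps)
  finally show ?thesis by (simp add: D_def P_def)
qed

section \<open>Uniform trees\<close>

text \<open>A finite set of naturals is viewed as the set of leaves of a \<open>D\<close>-adic tree, heights being counted from the
  leaves; \<open>node D X i x\<close> consists of the leaves below the node of height \<open>i\<close> above \<open>x\<close>.\<close>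

definition node :: "nat \<Rightarrow> nat set \<Rightarrow> nat \<Rightarrow> nat \<Rightarrow> nat set" where
  "node D X i x = fibre X (\<lambda>y. y div D ^ i) (x div D ^ i)"

definition children :: "nat \<Rightarrow> nat set \<Rightarrow> nat \<Rightarrow> nat \<Rightarrow> nat set" where
  "children D X i x = (\<lambda>y. y div D ^ i) ` node D X (Suc i) x"

definition leaf_count :: "(nat \<Rightarrow> nat) \<Rightarrow> nat \<Rightarrow> nat" where
  "leaf_count a i = 2 ^ (\<Sum>j<i. a j)"

lemma leaf_count_Suc: "leaf_count a (Suc i) = 2 ^ a i * leaf_count a i"
  by (simp add: leaf_count_def power_add)

lemma leaf_count_pos: "0 < leaf_count a i"
  by (simp add: leaf_count_def)

lemma node_iff: "y \<in> node D X i x \<longleftrightarrow> y \<in> X \<and> y div D ^ i = x div D ^ i"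
  by (simp add: node_def fibre_def)

lemma node_refl: "x \<in> X \<Longrightarrow> x \<in> node D X i x"
  by (simp add: node_iff)

lemma node_subset: "node D X i x \<subseteq> X"
  by (auto simp: node_iff)

lemma finite_node: "finite X \<Longrightarrow> finite (node D X i x)"
  by (simp add: node_def finite_fibre)

lemma node_eq: "y \<in> node D X i x \<Longrightarrow> node D X i y = node D X i x"
  by (simp add: node_def fibre_def)

lemma children_eq: "y \<in> node D X (Suc i) x \<Longrightarrow> children D X i y = children D X i x"
  unfolding children_def using node_eq by metis

lemma value_in_children: "x \<in> X \<Longrightarrow> x div D ^ i \<in> children D X i x"
  unfolding children_def by (rule imageI) (rule node_refl)

lemma finite_children: "finite X \<Longrightarrow> finite (children D X i x)"
  by (simp add: children_def finite_node)

lemma div_pow_Suc: "x div (D::nat) ^ Suc i = (x div D ^ i) div D"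
  by (metis div_mult2_eq power_Suc2)

lemma div_pow_mono:
  assumes "i \<le> j" "x div (D::nat) ^ i = y div D ^ i"
  shows "x div D ^ j = y div D ^ j"
  using assms by (induction j rule: dec_induct) (auto simp: div_pow_Suc simp del: power_Suc)

lemma fibre_of_node:
  assumes "i \<le> j" "z \<in> node D X j x"
  shows "fibre (node D X j x) (\<lambda>y. y div D ^ i) (z div D ^ i) = node D X i z"
proof -
  have "y div D ^ j = x div D ^ j" if "y div D ^ i = z div D ^ i" for y
    using div_pow_mono[OF assms(1) that] assms(2) by (simp add: node_iff)
  then show ?thesis unfolding set_eq_iff fibre_def mem_Collect_eq node_iff by blast
qed

lemma children_card_le:
  assumes "D > 0"
  shows "card (children D X i x) \<le> D"
proof -
  define v where "v = x div D ^ Suc i"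
  have "children D X i x \<subseteq> {v * D..<v * D + D}"
  proof
    fix c assume "c \<in> children D X i x"
    then have "c div D = v" by (auto simp: children_def node_iff v_def div_pow_Suc simp del: power_Suc)
    then have "c = v * D + c mod D" using div_mult_mod_eq[of c D] by simp
    moreover have "c mod D < D" using assms by simp
    ultimately show "c \<in> {v * D..<v * D + D}" by auto
  qed
  then show ?thesis using card_mono[of "{v * D..<v * D + D}"] by simp
qed

lemma card_leaves_of_children:
  assumes fin: "finite X" and S: "S \<subseteq> children D X i x" and m: "\<And>z. z \<in> X \<Longrightarrow> card (node D X i z) = m"
  shows "card {y\<in>node D X (Suc i) x. y div D ^ i \<in> S} = card S * m"
proof -
  let ?A = "{y\<in>node D X (Suc i) x. y div D ^ i \<in> S}" and ?r = "\<lambda>y. y div D ^ i"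
  have image: "?r ` ?A = S" using S by (auto simp: children_def)
  have "card (fibre ?A ?r c) = m" if c: "c \<in> S" for c
  proof -
    obtain z where z: "z \<in> node D X (Suc i) x" "c = z div D ^ i" using c S by (auto simp: children_def)
    have "fibre ?A ?r c = fibre (node D X (Suc i) x) ?r c" using c by (auto simp: fibre_def)
    also have "\<dots> = node D X i z" unfolding z(2) by (rule fibre_of_node[OF _ z(1)]) simp
    finally show ?thesis using m[of z] z(1) by (simp add: node_iff)
  qed
  then show ?thesis using card_by_fibres[of ?A ?r] fin by (simp add: image finite_node)
qed

locale uniform_tree =
  fixes D :: nat and X :: "nat set" and a :: "nat \<Rightarrow> nat" and n :: nat
  assumes finite_leaves: "finite X" and D_pos: "D > 0"
    and card_children: "\<And>i x. i < n \<Longrightarrow> x \<in> X \<Longrightarrow> card (children D X i x) = 2 ^ a i"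
    and same_parity: "\<And>i x y. i < n \<Longrightarrow> x \<in> X \<Longrightarrow> y \<in> node D X (Suc i) x \<Longrightarrow>
      (y div D ^ i) mod 2 = (x div D ^ i) mod 2"
begin

lemma card_node: "i \<le> n \<Longrightarrow> x \<in> X \<Longrightarrow> card (node D X i x) = leaf_count a i"
proof (induction i arbitrary: x)
  case 0
  then have "node D X 0 x = {x}" by (auto simp: node_iff)
  then show ?case by (simp add: leaf_count_def)
next
  case (Suc i)
  have "node D X (Suc i) x = {y\<in>node D X (Suc i) x. y div D ^ i \<in> children D X i x}"
    by (auto simp: children_def)
  then have "card (node D X (Suc i) x) = card (children D X i x) * leaf_count a i"
    using card_leaves_of_children[OF finite_leaves order_refl, of D i "leaf_count a i" x] Suc by simp
  then show ?case using Suc.prems card_children[of i x] by (simp add: leaf_count_Suc)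
qed

lemma card_leaves:
  assumes "i \<le> n" "S \<subseteq> children D X i x"
  shows "card {y\<in>node D X (Suc i) x. y div D ^ i \<in> S} = card S * leaf_count a i"
  by (rule card_leaves_of_children[OF finite_leaves assms(2)]) (simp add: card_node assms(1))

lemma card_node_values:
  assumes "i \<le> n"
  shows "card ((\<lambda>c. c div D ^ i) ` X) * leaf_count a i = card X"
proof -
  have "card (fibre X (\<lambda>c. c div D ^ i) v) = leaf_count a i" if "v \<in> (\<lambda>c. c div D ^ i) ` X" for v
    using that card_node[OF assms] by (auto simp: node_def)
  then show ?thesis using card_by_fibres[OF finite_leaves, of "\<lambda>c. c div D ^ i"] by simp
qed

lemma card_le_node_values:
  assumes YX: "Y \<subseteq> X" and i: "i \<le> n"
  shows "card Y \<le> card ((\<lambda>c. c div D ^ i) ` Y) * leaf_count a i"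
proof -
  have "card (fibre Y (\<lambda>c. c div D ^ i) v) \<le> leaf_count a i" if v: "v \<in> (\<lambda>c. c div D ^ i) ` Y" for v
  proof -
    obtain c where c: "c \<in> Y" "v = c div D ^ i" using v by blast
    have "card (fibre Y (\<lambda>c. c div D ^ i) v) \<le> card (node D X i c)"
      by (rule card_mono[OF finite_node[OF finite_leaves]]) (use YX in \<open>auto simp: fibre_def node_iff c(2)\<close>)
    then show ?thesis using card_node[OF i] c(1) YX by auto
  qed
  then show ?thesis
    using card_by_fibres[OF finite_subset[OF YX finite_leaves], of "\<lambda>c. c div D ^ i"]
      sum_bounded_above[of "(\<lambda>c. c div D ^ i) ` Y" "\<lambda>v. card (fibre Y (\<lambda>c. c div D ^ i) v)"] by simp
qed

lemma leaf_count_Suc_le: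
  assumes "i < n" "X \<noteq> {}"
  shows "leaf_count a (Suc i) \<le> D * leaf_count a i"
proof -
  obtain x where "x \<in> X" using assms(2) by blast
  then have "2 ^ a i \<le> D" using card_children[OF assms(1)] children_card_le[OF D_pos] by metis
  then show ?thesis unfolding leaf_count_Suc by (rule mult_le_mono1)
qed

lemma uniform_tree_saturated:
  assumes Z: "Z \<subseteq> X" "saturated X (\<lambda>y. y div D ^ i) Z" and i: "i \<le> n"
  shows "uniform_tree D Z a i"
proof -
  have node: "node D Z j x = node D X j x" if "x \<in> Z" "j \<le> i" for j x
  proof -
    have "y \<in> Z" if "y \<in> X" "y div D ^ j = x div D ^ j" for y
      using saturatedD[OF Z(2), of x y] div_pow_mono[OF \<open>j \<le> i\<close> that(2)] that(1) \<open>x \<in> Z\<close> Z(1) by auto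
    then show ?thesis using Z(1) unfolding set_eq_iff node_iff by blast
  qed
  show ?thesis
  proof
    show "finite Z" using Z(1) finite_leaves by (rule finite_subset)
    fix j x assume j: "j < i" and x: "x \<in> Z"
    then have Suc_node: "node D Z (Suc j) x = node D X (Suc j) x" by (intro node) auto
    show "card (children D Z j x) = 2 ^ a j"
      using card_children[of j x] j i x Z(1) unfolding children_def Suc_node by auto
    show "(y div D ^ j) mod 2 = (x div D ^ j) mod 2" if "y \<in> node D Z (Suc j) x" for y
      using same_parity[of j x y] that j i x Z(1) unfolding Suc_node by auto
  qed (rule D_pos)
qed

lemma uniform_tree_node: "i \<le> n \<Longrightarrow> uniform_tree D (node D X i x) a i"
  by (rule uniform_tree_saturated) (auto simp: node_subset saturated_def node_iff)

lemma uniform_tree_Suc: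
  assumes "\<And>x. x \<in> X \<Longrightarrow> card (children D X n x) = 2 ^ w"
    and "\<And>x y. x \<in> X \<Longrightarrow> y \<in> node D X (Suc n) x \<Longrightarrow> (y div D ^ n) mod 2 = (x div D ^ n) mod 2"
  shows "uniform_tree D X (a(n := w)) (Suc n)"
proof
  fix i x assume "i < Suc n" "x \<in> X"
  then consider "i = n" | "i < n" by linarith
  then show "card (children D X i x) = 2 ^ (a(n := w)) i"
    by cases (simp_all add: assms(1) card_children \<open>x \<in> X\<close>)
next
  fix i x y assume "i < Suc n" and xy: "x \<in> X" "y \<in> node D X (Suc i) x"
  then consider "i = n" | "i < n" by linarith
  then show "(y div D ^ i) mod 2 = (x div D ^ i) mod 2"
    using xy by cases (simp_all add: assms(2) same_parity del: power_Suc)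
qed (rule finite_leaves, rule D_pos)

end

locale rooted_uniform_tree = uniform_tree +
  assumes root: "\<And>x y. x \<in> X \<Longrightarrow> y \<in> X \<Longrightarrow> x div D ^ n = y div D ^ n" and nonempty: "X \<noteq> {}"
begin

lemma node_root: "x \<in> X \<Longrightarrow> S \<subseteq> X \<Longrightarrow> node D S n x = S"
  unfolding set_eq_iff node_iff using root by blast

end

definition trimming :: "nat set \<Rightarrow> nat set \<Rightarrow> nat \<Rightarrow> bool" where
  "trimming S T e \<longleftrightarrow> T \<subseteq> S \<and> card T = 2 ^ e \<and> card S \<le> 4 * card T \<and> (\<forall>x\<in>T. \<forall>y\<in>T. x mod 2 = y mod 2)"

lemma exists_trimming:
  assumes fin: "finite S" "S \<noteq> {}"
  shows "\<exists>T e. trimming S T e"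
proof -
  obtain e where e: "card S / 2 \<le> card (fibre S (\<lambda>x. x mod 2) e)"
    using popular_value[OF fin(1), of "{..<2}" "\<lambda>x. x mod 2"] by (auto simp: lessThan_empty_iff)
  let ?R = "fibre S (\<lambda>x. x mod 2) e"
  have "card S > 0" using fin by (simp add: card_gt_0_iff)
  then have "1 \<le> card ?R" using e by linarith
  then obtain a where a: "2 ^ a \<le> card ?R" "card ?R < 2 ^ Suc a"
    using ex_power_ivl1[of 2 "card ?R"] by auto
  obtain T where T: "T \<subseteq> ?R" "card T = 2 ^ a" using obtain_subset_with_card_n[OF a(1)] by metis
  have "card S \<le> 2 * card ?R" using e by linarith
  then have "card S \<le> 4 * card T" using a(2) T(2) by simp
  then show ?thesis using T by (intro exI[of _ T] exI[of _ a]) (auto simp: trimming_def fibre_def)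
qed

definition trimmed :: "nat \<Rightarrow> nat set \<Rightarrow> nat \<Rightarrow> (nat set \<Rightarrow> nat set) \<Rightarrow> nat set" where
  "trimmed D X i T = {y\<in>X. y div D ^ i \<in> T (children D X i y)}"

lemma trimmed_node:
  "{z\<in>trimmed D X i T. z div D ^ Suc i = y div D ^ Suc i} = {z\<in>node D X (Suc i) y. z div D ^ i \<in> T (children D X i y)}"
  using children_eq[of _ D X i y] by (auto simp: trimmed_def node_iff simp del: power_Suc)

context uniform_tree
begin

lemma card_le_trimmed:
  assumes trim: "\<And>x. x \<in> X \<Longrightarrow> trimming (children D X n x) (T (children D X n x)) (e x)"
  shows "card X \<le> 4 * card (trimmed D X n T)"
proof (rule card_le_by_fibres[where r = "\<lambda>y. y div D ^ Suc n"])
  fix l assume "l \<in> (\<lambda>y. y div D ^ Suc n) ` X"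
  then obtain x where x: "x \<in> X" "l = x div D ^ Suc n" by blast
  let ?ch = "children D X n x"
  have T: "T ?ch \<subseteq> ?ch" "card ?ch \<le> 4 * card (T ?ch)" using trim[OF x(1)] by (simp_all add: trimming_def)
  have "fibre X (\<lambda>y. y div D ^ Suc n) l = {z\<in>node D X (Suc n) x. z div D ^ n \<in> ?ch}"
    by (auto simp: x(2) node_def children_def)
  then have "card (fibre X (\<lambda>y. y div D ^ Suc n) l) = card ?ch * leaf_count a n"
    by (simp add: card_leaves del: power_Suc)
  also have "\<dots> \<le> 4 * (card (T ?ch) * leaf_count a n)" using T(2) by simp
  also have "card (T ?ch) * leaf_count a n = card (fibre (trimmed D X n T) (\<lambda>y. y div D ^ Suc n) l)"
    using T(1) by (simp add: card_leaves trimmed_node fibre_def x(2) del: power_Suc)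
  finally show "card (fibre X (\<lambda>y. y div D ^ Suc n) l) \<le> 4 * card (fibre (trimmed D X n T) (\<lambda>y. y div D ^ Suc n) l)" .
qed (auto simp: finite_leaves trimmed_def)

lemma fibre_trimmed:
  assumes trim: "\<And>x. x \<in> X \<Longrightarrow> trimming (children D X n x) (T (children D X n x)) (e (children D X n x))"
    and Y_def: "Y = fibre (trimmed D X n T) (\<lambda>y. e (children D X n y)) w"
  shows "saturated X (\<lambda>y. y div D ^ n) Y"
    and "\<And>y. y \<in> Y \<Longrightarrow> card (children D Y n y) = 2 ^ w"
    and "\<And>y z. y \<in> Y \<Longrightarrow> z \<in> node D Y (Suc n) y \<Longrightarrow> (z div D ^ n) mod 2 = (y div D ^ n) mod 2"
proof -
  let ?ch = "children D X n" and ?Y' = "trimmed D X n T"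
  have YY': "Y \<subseteq> ?Y'" by (auto simp: Y_def fibre_def)
  have Y: "y \<in> X" "y div D ^ n \<in> T (?ch y)" "e (?ch y) = w" if "y \<in> Y" for y
    using that by (simp_all add: Y_def trimmed_def fibre_def)
  have Y_cong: "z \<in> Y" if "y \<in> Y" "z \<in> ?Y'" "z div D ^ Suc n = y div D ^ Suc n" for y z
  proof -
    have "?ch z = ?ch y" using that by (intro children_eq) (simp add: trimmed_def node_iff del: power_Suc)
    then show ?thesis using Y[OF that(1)] that(2) by (simp add: Y_def fibre_def)
  qed
  show "saturated X (\<lambda>y. y div D ^ n) Y"
    unfolding saturated_def
  proof (intro ballI impI)
    fix y z assume "y \<in> X" "z \<in> X" and same: "y div D ^ n = z div D ^ n" and y: "y \<in> Y"
    then have parent: "z div D ^ Suc n = y div D ^ Suc n" using div_pow_mono[of n "Suc n" z D y] by simp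
    then have "?ch z = ?ch y" using \<open>z \<in> X\<close> by (intro children_eq) (simp add: node_iff del: power_Suc)
    then have "z \<in> ?Y'" using Y[OF y] \<open>z \<in> X\<close> same by (simp add: trimmed_def)
    then show "z \<in> Y" by (rule Y_cong[OF y _ parent])
  qed
  fix y assume y: "y \<in> Y"
  have T: "T (?ch y) \<subseteq> ?ch y" "card (T (?ch y)) = 2 ^ w" "\<forall>u\<in>T (?ch y). \<forall>v\<in>T (?ch y). u mod 2 = v mod 2"
    using trim[OF Y(1)[OF y]] unfolding trimming_def Y(3)[OF y] by blast+
  have "node D Y (Suc n) y = {z\<in>?Y'. z div D ^ Suc n = y div D ^ Suc n}"
  proof (intro set_eqI iffI)
    fix z
    show "z \<in> {z\<in>?Y'. z div D ^ Suc n = y div D ^ Suc n}" if "z \<in> node D Y (Suc n) y"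
      using that YY' by (auto simp: node_iff simp del: power_Suc)
    show "z \<in> node D Y (Suc n) y" if "z \<in> {z\<in>?Y'. z div D ^ Suc n = y div D ^ Suc n}"
      using that Y_cong[OF y] by (simp add: node_iff del: power_Suc)
  qed
  then have node_Y: "node D Y (Suc n) y = {z\<in>node D X (Suc n) y. z div D ^ n \<in> T (?ch y)}"
    by (simp only: trimmed_node)
  have "children D Y n y = T (?ch y)"
    using T(1) unfolding children_def[of D Y] node_Y by (auto simp: children_def)
  then show "card (children D Y n y) = 2 ^ w" using T(2) by simp
  show "(z div D ^ n) mod 2 = (y div D ^ n) mod 2" if "z \<in> node D Y (Suc n) y" for z
  proof -
    have "z div D ^ n \<in> T (?ch y)" using that by (simp add: node_Y)
    then show ?thesis using T(3) Y(2)[OF y] by blast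
  qed
qed

text \<open>The children of every node of height \<open>n + 1\<close> are trimmed to a power of two of equal parity, and only the nodes with
  the most popular exponent are kept.\<close>

lemma exists_uniform_trim:
  assumes D: "D = 2 ^ W"
  obtains Y w where "Y \<subseteq> X" "card X \<le> 4 * (W + 1) * card Y" "saturated X (\<lambda>y. y div D ^ n) Y"
    and "\<And>y. y \<in> Y \<Longrightarrow> card (children D Y n y) = 2 ^ w"
    and "\<And>y z. y \<in> Y \<Longrightarrow> z \<in> node D Y (Suc n) y \<Longrightarrow> (z div D ^ n) mod 2 = (y div D ^ n) mod 2"
proof -
  let ?ch = "children D X n"
  obtain T e where trimming: "\<And>S. finite S \<Longrightarrow> S \<noteq> {} \<Longrightarrow> trimming S (T S) (e S)" using exists_trimming by metis
  have trim: "trimming (?ch x) (T (?ch x)) (e (?ch x))" if "x \<in> X" for x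
  proof (rule trimming[OF finite_children[OF finite_leaves]])
    show "?ch x \<noteq> {}" using value_in_children[OF that, of D n] by blast
  qed
  let ?Y' = "trimmed D X n T"
  have "e (?ch y) \<le> W" if "y \<in> ?Y'" for y
  proof -
    have "2 ^ e (?ch y) \<le> card (?ch y)"
      using trim[of y] that card_mono[OF finite_children[OF finite_leaves], of "T (?ch y)" D n y]
      by (simp add: trimming_def trimmed_def)
    also have "\<dots> \<le> 2 ^ W" using children_card_le[OF D_pos] D by simp
    finally show ?thesis by simp
  qed
  then obtain w where "real (card ?Y') / (W + 1) \<le> card (fibre ?Y' (\<lambda>y. e (?ch y)) w)"
    using popular_value[of ?Y' "{..W}" "\<lambda>y. e (?ch y)"] finite_leaves by (auto simp: trimmed_def)
  moreover define Y where "Y = fibre ?Y' (\<lambda>y. e (?ch y)) w"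
  ultimately have "real (card X) \<le> real (4 * (W + 1) * card Y)"
    using card_le_trimmed[OF trim] by (simp add: field_simps)
  then have card_Y: "card X \<le> 4 * (W + 1) * card Y" by (simp only: of_nat_le_iff)
  have "Y \<subseteq> X" by (auto simp: Y_def trimmed_def fibre_def)
  then show ?thesis using fibre_trimmed[OF trim Y_def] card_Y by (intro that[of Y w])
qed

end

theorem uniform_subset:
  assumes fin: "finite X" "X \<noteq> {}" and D: "D = 2 ^ W"
  shows "\<exists>Y a. Y \<subseteq> X \<and> Y \<noteq> {} \<and> uniform_tree D Y a n \<and> card X \<le> (4 * (W + 1)) ^ n * card Y"
proof (induction n)
  case 0
  have "uniform_tree D X (\<lambda>_. 0) 0" using fin D by unfold_locales auto
  then show ?case using fin by auto
next
  case (Suc n)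
  then obtain Y a where Y: "Y \<subseteq> X" "Y \<noteq> {}" "uniform_tree D Y a n" "card X \<le> (4 * (W + 1)) ^ n * card Y" by blast
  interpret uniform_tree D Y a n by (rule Y(3))
  obtain Z w where Z: "Z \<subseteq> Y" "card Y \<le> 4 * (W + 1) * card Z" "saturated Y (\<lambda>y. y div D ^ n) Z"
    and top: "\<And>y. y \<in> Z \<Longrightarrow> card (children D Z n y) = 2 ^ w"
      "\<And>y z. y \<in> Z \<Longrightarrow> z \<in> node D Z (Suc n) y \<Longrightarrow> (z div D ^ n) mod 2 = (y div D ^ n) mod 2"
    using exists_uniform_trim[OF D] by blast
  have "card Y > 0" using Y(2) finite_leaves by (simp add: card_gt_0_iff)
  then have "Z \<noteq> {}" using Z(2) by auto
  moreover have "uniform_tree D Z (a(n := w)) (Suc n)"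
    using uniform_tree_saturated[OF Z(1,3) order_refl] top by (rule uniform_tree.uniform_tree_Suc)
  moreover have "card X \<le> (4 * (W + 1)) ^ n * (4 * (W + 1) * card Z)"
    using Y(4) mult_le_mono2[OF Z(2), of "(4 * (W + 1)) ^ n"] by linarith
  then have "card X \<le> (4 * (W + 1)) ^ Suc n * card Z" by (simp only: power_Suc2 mult.assoc)
  ultimately show ?case using Z(1) Y(1) by blast
qed

lemma div_interval:
  fixes x D :: nat
  assumes "D > 0"
  shows "real (x div D ^ i) * D ^ i \<le> x" "x < real (x div D ^ i) * D ^ i + D ^ i"
proof -
  have "x = (x div D ^ i) * D ^ i + x mod D ^ i" by (rule div_mult_mod_eq[symmetric])
  moreover have "x mod D ^ i < D ^ i" using assms by simp
  ultimately have "(x div D ^ i) * D ^ i \<le> x" "x < (x div D ^ i) * D ^ i + D ^ i" by linarith+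
  then show "real (x div D ^ i) * D ^ i \<le> x" "x < real (x div D ^ i) * D ^ i + D ^ i"
    by (metis of_nat_mult of_nat_le_iff of_nat_power, metis of_nat_add of_nat_mult of_nat_less_iff of_nat_power)
qed

lemma same_node_diff:
  fixes x y D :: nat
  assumes "D > 0" "x div D ^ i = y div D ^ i"
  shows "\<bar>real x - real y\<bar> < D ^ i"
  using div_interval[OF assms(1), of x i] div_interval[OF assms(1), of y i] assms(2) by (simp add: abs_if)

lemma separated_values:
  fixes p q :: real and c d D :: nat
  assumes parity: "c mod 2 = d mod 2" "c \<noteq> d"
    and p: "real c * D ^ i \<le> p" "p \<le> real c * D ^ i + D ^ i" and q: "real d * D ^ i \<le> q" "q \<le> real d * D ^ i + D ^ i"
  shows "D ^ i \<le> \<bar>p - q\<bar>"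
proof -
  have scale: "real x * D ^ i + 2 * D ^ i \<le> real y * D ^ i" if "x + 2 \<le> y" for x y :: nat
    using mult_right_mono[of "real x + 2" "real y" "real D ^ i"] that by (simp add: algebra_simps)
  have "c \<noteq> Suc d" "d \<noteq> Suc c" using parity(1) by (auto simp: mod_Suc split: if_splits)
  then have "c + 2 \<le> d \<or> d + 2 \<le> c" using parity(2) by linarith
  then show ?thesis using scale[of c d] scale[of d c] p q by fastforce
qed

lemma (in uniform_tree) node_split_pairs:
  fixes G :: "nat \<Rightarrow> real" and r s c :: real
  assumes x: "x \<in> X" and i: "i < n" "1 \<le> a i"
    and G: "\<And>v. v \<in> node D X (Suc i) x \<Longrightarrow> real (v div D ^ i) * D ^ i \<le> G v \<and> G v \<le> real (v div D ^ i) * D ^ i + D ^ i"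
    and s: "s \<le> \<bar>r\<bar> * D ^ i"
  shows "split_pairs s (\<lambda>v. r * (G v - c)) (node D X (Suc i) x)"
proof -
  let ?V = "node D X (Suc i) x" and ?Ch = "children D X i x"
  obtain b where b: "a i = Suc b" using i(2) by (cases "a i") auto
  have card_Ch: "card ?Ch = 2 * 2 ^ b" using card_children[OF i(1) x] b by simp
  then have "2 ^ b \<le> card ?Ch" by simp
  then obtain S where S: "S \<subseteq> ?Ch" "card S = 2 ^ b" by (metis obtain_subset_with_card_n)
  define V1 V2 where "V1 = {v\<in>?V. v div D ^ i \<in> S}" and "V2 = {v\<in>?V. v div D ^ i \<in> ?Ch - S}"
  have "card (?Ch - S) = 2 ^ b"
    using S card_Ch finite_children[OF finite_leaves] by (simp add: card_Diff_subset finite_subset)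
  then have "card V1 = card V2"
    using card_leaves[of i S x] card_leaves[of i "?Ch - S" x] S i(1) by (simp add: V1_def V2_def)
  moreover have "finite V1" "finite V2" using finite_node[OF finite_leaves] by (auto simp: V1_def V2_def)
  ultimately obtain \<pi> where \<pi>: "bij_betw \<pi> V1 V2" using finite_same_card_bij by blast
  have "?V = V1 \<union> V2" "V1 \<inter> V2 = {}" by (auto simp: V1_def V2_def children_def)
  moreover have "s \<le> \<bar>r * (G (\<pi> v) - c) - r * (G v - c)\<bar>" if v: "v \<in> V1" for v
  proof -
    have \<pi>v: "\<pi> v \<in> V2" using \<pi> v bij_betwE by blast
    then have mem: "v \<in> ?V" "\<pi> v \<in> ?V" and "\<pi> v div D ^ i \<noteq> v div D ^ i"
      using v by (auto simp: V1_def V2_def)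
    then have "D ^ i \<le> \<bar>G (\<pi> v) - G v\<bar>"
      using G[OF mem(1)] G[OF mem(2)] same_parity[OF i(1) x mem(1)] same_parity[OF i(1) x mem(2)]
      by (intro separated_values) auto
    then have "\<bar>r\<bar> * D ^ i \<le> \<bar>r\<bar> * \<bar>G (\<pi> v) - G v\<bar>" by (intro mult_left_mono) auto
    also have "\<dots> = \<bar>r * (G (\<pi> v) - c) - r * (G v - c)\<bar>"
      by (simp add: abs_mult[symmetric] algebra_simps)
    finally show ?thesis using s by linarith
  qed
  ultimately show ?thesis unfolding split_pairs_def using \<pi> by blast
qed

section \<open>Selecting levels\<close>

definition top_height :: "(nat \<Rightarrow> real) \<Rightarrow> nat \<Rightarrow> real \<Rightarrow> nat" where
  "top_height g n s = (LEAST i. i \<le> n \<and> (\<forall>i'\<le>n. g i' - s * i' \<le> g i - s * i))"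

lemma top_height:
  shows top_height_le: "top_height g n s \<le> n"
    and top_height_max: "\<And>i. i \<le> n \<Longrightarrow> g i - s * i \<le> g (top_height g n s) - s * top_height g n s"
    and top_height_slope: "\<And>i. i < top_height g n s \<Longrightarrow> s * (real (top_height g n s) - i) < g (top_height g n s) - g i"
proof -
  let ?max = "\<lambda>i. i \<le> n \<and> (\<forall>i'\<le>n. g i' - s * i' \<le> g i - s * i)"
  define F where "F i = g i - s * i" for i :: nat
  have "Max (F ` {..n}) \<in> F ` {..n}" by (intro Max_in) auto
  then obtain i0 where i0: "i0 \<le> n" "F i0 = Max (F ` {..n})" by (metis (no_types) atMost_iff imageE)
  have "F i' \<le> F i0" if "i' \<le> n" for i' unfolding i0(2) using that by (intro Max_ge) auto
  then have "?max i0" using i0(1) unfolding F_def by blast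
  then have "?max (top_height g n s)" unfolding top_height_def by (rule LeastI)
  then show le: "top_height g n s \<le> n"
    and max: "\<And>i. i \<le> n \<Longrightarrow> g i - s * i \<le> g (top_height g n s) - s * top_height g n s" by auto
  fix i assume i: "i < top_height g n s"
  then have "\<not> ?max i" unfolding top_height_def by (rule not_less_Least)
  then obtain i' where "i' \<le> n" "g i - s * i < g i' - s * i'" using i le by (auto simp: not_le)
  then show "s * (real (top_height g n s) - i) < g (top_height g n s) - g i"
    using max[of i'] by (simp add: algebra_simps)
qed

lemma sum_top_heights:
  fixes s :: real and R :: nat
  assumes "\<And>i. i \<le> n \<Longrightarrow> g i \<le> s * i" and "R > 0"
  shows "g n \<le> s / R * (\<Sum>j<R. top_height g n (s * j / R))"
proof -
  define \<phi> where "\<phi> t = g (top_height g n t) - t * top_height g n t" for t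
  have "\<phi> (s * j / R) - \<phi> (s * (Suc j) / R) \<le> s / R * top_height g n (s * j / R)" for j
  proof -
    define h \<theta> where "h = real (top_height g n (s * j / R))" and "\<theta> = s * j / R"
    have next_slope: "s * (Suc j) / R = \<theta> + s / R" by (simp add: \<theta>_def add_divide_distrib algebra_simps)
    have "g (top_height g n \<theta>) - (\<theta> + s / R) * h \<le> \<phi> (\<theta> + s / R)"
      unfolding \<phi>_def h_def \<theta>_def by (intro top_height_max top_height_le)
    then show ?thesis unfolding next_slope unfolding \<theta>_def[symmetric] unfolding \<phi>_def[of \<theta>]
      unfolding \<theta>_def h_def[symmetric] distrib_right by linarith
  qed
  then have "(\<Sum>j<R. \<phi> (s * j / R) - \<phi> (s * (Suc j) / R)) \<le> (\<Sum>j<R. s / R * top_height g n (s * j / R))"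
    by (intro sum_mono) auto
  moreover have "(\<Sum>j<R. \<phi> (s * j / R) - \<phi> (s * (Suc j) / R)) = \<phi> (s * real 0 / R) - \<phi> (s * R / R)"
    by (rule sum_lessThan_telescope')
  moreover have "g n \<le> \<phi> (s * real 0 / R)" unfolding \<phi>_def using top_height_max[of n n g 0] by simp
  moreover have "\<phi> (s * R / R) \<le> 0"
    unfolding \<phi>_def using assms(1)[OF top_height_le] \<open>R > 0\<close> by simp
  ultimately show ?thesis by (simp add: sum_distrib_left)
qed

lemma exists_large_interior_value:
  fixes z :: "nat \<Rightarrow> real" and \<eta> N :: real
  assumes sum: "(1 + \<eta>) * N * R \<le> (\<Sum>j<R. z j)" and z: "\<And>j. z j \<le> 2 * N" and R: "2 \<le> R" "8 < \<eta> * R" and N: "0 < N"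
  obtains j where "1 \<le> j" "j + 2 \<le> R" "(1 + \<eta> / 2) * N \<le> z j"
proof -
  have "{..<R} = insert 0 (insert (R - 1) {1..<R - 1})" using R(1) by auto
  then have "(\<Sum>j<R. z j) = z 0 + (z (R - 1) + (\<Sum>j\<in>{1..<R - 1}. z j))" using R(1) by simp
  then have interior: "(1 + \<eta>) * N * R - 4 * N \<le> (\<Sum>j\<in>{1..<R - 1}. z j)" using sum z[of 0] z[of "R - 1"] by linarith
  have \<eta>: "0 \<le> \<eta>" using R(2) by (smt (verit) mult_nonpos_nonneg of_nat_0_le_iff)
  have "4 * N \<le> \<eta> * R / 2 * N" using R(2) N by (intro mult_right_mono) auto
  moreover have "0 \<le> \<eta> * N" using \<eta> N by simp
  moreover have "(1 + \<eta> / 2) * N * (real R - 2) = (1 + \<eta>) * N * R - \<eta> * R / 2 * N - 2 * N - \<eta> * N"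
    by (simp add: field_simps)
  ultimately have average: "(1 + \<eta> / 2) * N * (real R - 2) \<le> (\<Sum>j\<in>{1..<R - 1}. z j)"
    using interior N by linarith
  have "R \<noteq> 2"
  proof
    assume "R = 2"
    then have "8 * N < 2 * \<eta> * N" using R(2) N by simp
    then show False using interior N \<open>R = 2\<close> by (simp add: algebra_simps)
  qed
  then have "{1..<R - 1} \<noteq> {}" using R(1) by auto
  then obtain j where "j \<in> {1..<R - 1}" "(1 + \<eta> / 2) * N \<le> z j"
    using exists_ge_average[of "{1..<R - 1}" "(1 + \<eta> / 2) * N" z] average R(1) by (auto simp: of_nat_diff)
  then show ?thesis using that[of j] by auto
qed

lemma level_selection:
  fixes s t \<eta> :: real and R :: nat
  assumes f: "\<And>i. i \<le> n \<Longrightarrow> f i \<le> s * i" and g: "\<And>i. i \<le> n \<Longrightarrow> g i \<le> t * i"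
    and st: "s > 0" "t > 0" and big: "(1 + \<eta>) * n \<le> f n / s + g n / t" and R: "R \<ge> 2" "8 < \<eta> * R" and n: "n > 0"
  obtains j where "1 \<le> j" "j + 2 \<le> R"
    "(1 + \<eta> / 2) * n \<le> top_height f n (s * j / R) + top_height g n (t * (R - 1 - j) / R)"
proof -
  have R_pos: "R > 0" using R by simp
  let ?x = "\<lambda>j. real (top_height f n (s * j / R))" and ?y = "\<lambda>j. real (top_height g n (t * j / R))"
  have "f n / s \<le> (\<Sum>j<R. ?x j) / R" "g n / t \<le> (\<Sum>j<R. ?y j) / R"
    using sum_top_heights[OF f R_pos] sum_top_heights[OF g R_pos] st R_pos by (simp_all add: field_simps)
  moreover have "(\<Sum>j<R. ?y j) = (\<Sum>j<R. ?y (R - 1 - j))"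
    using sum.nat_diff_reindex[of ?y R] by simp
  ultimately have "(1 + \<eta>) * n \<le> (\<Sum>j<R. ?x j + ?y (R - 1 - j)) / R"
    using big by (simp add: sum.distrib add_divide_distrib)
  then have "(1 + \<eta>) * real n * R \<le> (\<Sum>j<R. ?x j + ?y (R - 1 - j))" using R_pos by (simp add: field_simps)
  moreover have "?x j + ?y (R - 1 - j) \<le> 2 * real n" for j
    using top_height_le[of f n "s * j / R"] top_height_le[of g n "t * (R - 1 - j) / R"] by linarith
  ultimately obtain j where "1 \<le> j" "j + 2 \<le> R" "(1 + \<eta> / 2) * real n \<le> ?x j + ?y (R - 1 - j)"
    by (rule exists_large_interior_value[OF _ _ R]) (use n in simp)
  then show ?thesis using that by simp
qed

section \<open>Zigzags\<close>

definition zigzags :: "nat \<Rightarrow> nat \<Rightarrow> nat \<Rightarrow> nat set \<Rightarrow> (nat \<Rightarrow> nat) set" where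
  "zigzags D q i S = {f\<in>PiE {..q} (\<lambda>_. S). (\<forall>j\<le>q. f j div D ^ Suc i = f 0 div D ^ Suc i) \<and>
     (\<forall>j<q. f j div D ^ i \<noteq> f (Suc j) div D ^ i)}"

lemma finite_zigzags: "finite S \<Longrightarrow> finite (zigzags D q i S)"
  unfolding zigzags_def by (rule finite_subset[of _ "PiE {..q} (\<lambda>_. S)"]) (auto intro!: finite_PiE)

lemma zigzags_mono: "S \<subseteq> T \<Longrightarrow> zigzags D q i S \<subseteq> zigzags D q i T"
  unfolding zigzags_def using PiE_mono[of "{..q}" "\<lambda>_. S" "\<lambda>_. T"] by blast

lemma zigzag_mem: "f \<in> zigzags D q i S \<Longrightarrow> j \<le> q \<Longrightarrow> f j \<in> S"
  by (auto simp: zigzags_def PiE_iff)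

lemma zigzag_same_parent:
  assumes "f \<in> zigzags D q i S" "j \<le> q" "j' \<le> q"
  shows "f j div D ^ Suc i = f j' div D ^ Suc i"
proof -
  have parent: "f i' div D ^ Suc i = f 0 div D ^ Suc i" if "i' \<le> q" for i'
    using assms(1) that unfolding zigzags_def by blast
  show ?thesis unfolding parent[OF assms(2)] parent[OF assms(3)] ..
qed

lemma (in uniform_tree) card_zigzags_le:
  assumes i: "i < n"
  shows "card (zigzags D q i X) \<le> card X * leaf_count a (Suc i) ^ q"
proof -
  let ?Z = "\<lambda>c. PiE {..q} (\<lambda>j. if j = 0 then {c} else node D X (Suc i) c)"
  have "zigzags D q i X \<subseteq> (\<Union>c\<in>X. ?Z c)"
  proof
    fix f assume f: "f \<in> zigzags D q i X"
    then have "f j \<in> node D X (Suc i) (f 0)" if "j \<le> q" for j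
      using zigzag_mem[OF f that] zigzag_same_parent[OF f that, of 0] by (simp add: node_iff del: power_Suc)
    then have "f \<in> ?Z (f 0)" using f by (auto simp: zigzags_def PiE_iff)
    moreover have "f 0 \<in> X" using zigzag_mem[OF f] by simp
    ultimately show "f \<in> (\<Union>c\<in>X. ?Z c)" by blast
  qed
  moreover have "finite (?Z c)" for c by (intro finite_PiE) (auto simp: finite_node finite_leaves)
  ultimately have "card (zigzags D q i X) \<le> card (\<Union>c\<in>X. ?Z c)"
    using finite_leaves by (intro card_mono) auto
  also have "\<dots> \<le> (\<Sum>c\<in>X. card (?Z c))" using finite_leaves by (rule card_UN_le)
  also have "\<dots> = (\<Sum>c\<in>X. leaf_count a (Suc i) ^ q)"
  proof (rule sum.cong[OF refl])
    fix c assume c: "c \<in> X"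
    have "card (?Z c) = (\<Prod>j\<in>{..q}. card (if j = 0 then {c} else node D X (Suc i) c))" by (rule card_PiE) simp
    also have "\<dots> = (\<Prod>j\<in>{1..q}. card (node D X (Suc i) c))" by (rule prod.mono_neutral_cong_right) auto
    also have "\<dots> = leaf_count a (Suc i) ^ q" using card_node[OF _ c, of "Suc i"] i by simp
    finally show "card (?Z c) = leaf_count a (Suc i) ^ q" .
  qed
  finally show ?thesis by simp
qed

lemma (in uniform_tree) zigzag_gap:
  assumes i: "i < n" and f: "f \<in> zigzags D q i X" and j: "j < q"
  shows "real D ^ i \<le> \<bar>real (f (Suc j)) - real (f j)\<bar>"
proof -
  have "f (Suc j) \<in> node D X (Suc i) (f j)"
    using zigzag_mem[OF f, of "Suc j"] zigzag_same_parent[OF f, of "Suc j" j] j by (simp add: node_iff del: power_Suc)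
  then have "f (Suc j) div D ^ i mod 2 = f j div D ^ i mod 2"
    using same_parity[OF i zigzag_mem[OF f]] j by simp
  moreover have "f (Suc j) div D ^ i \<noteq> f j div D ^ i" using f j unfolding zigzags_def by force
  ultimately show ?thesis
    using div_interval[OF D_pos, of "f (Suc j)" i] div_interval[OF D_pos, of "f j" i]
      separated_values[of "f (Suc j) div D ^ i" "f j div D ^ i" D i "real (f (Suc j))" "real (f j)"] by simp
qed

lemma alternating_zigzag:
  assumes uv: "u div D ^ Suc i = v div D ^ Suc i" "u div D ^ i \<noteq> v div D ^ i"
    and f: "f \<in> PiE {..q} (\<lambda>j. node D S i (if even j then u else v))"
  shows "f \<in> zigzags D q i S" "f 0 div D ^ Suc i = u div D ^ Suc i"
proof -
  have mem: "f j \<in> S" "f j div D ^ i = (if even j then u else v) div D ^ i" if "j \<le> q" for j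
    using PiE_mem[OF f, of j] that by (simp_all add: node_iff)
  have parent: "f j div D ^ Suc i = u div D ^ Suc i" if "j \<le> q" for j
    using div_pow_mono[OF _ mem(2)[OF that], of "Suc i"] uv(1) by (simp del: power_Suc)
  then show "f 0 div D ^ Suc i = u div D ^ Suc i" by simp
  have "f j div D ^ i \<noteq> f (Suc j) div D ^ i" if "j < q" for j
    using mem(2)[of j] mem(2)[of "Suc j"] that uv(2) by (auto split: if_splits)
  then show "f \<in> zigzags D q i S"
    using f mem(1) parent parent[of 0] by (simp add: zigzags_def PiE_iff del: power_Suc)
qed

definition only_child :: "nat \<Rightarrow> nat set \<Rightarrow> nat \<Rightarrow> nat \<Rightarrow> bool" where
  "only_child D S i c \<longleftrightarrow> children D S i c \<subseteq> {c div D ^ i}"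

lemma card_zigzags_ge:
  fixes m :: real
  assumes fin: "finite S" and sub: "Y \<subseteq> S'" "S' \<subseteq> S" and branching: "\<And>c. c \<in> Y \<Longrightarrow> \<not> only_child D S' i c"
    and rich: "\<And>x. x \<in> S' \<Longrightarrow> m \<le> card (node D S i x)" and m: "0 \<le> m"
  shows "card ((\<lambda>c. c div D ^ Suc i) ` Y) * m ^ Suc q \<le> card (zigzags D q i S)"
proof -
  define K where "K = (\<lambda>c. c div D ^ Suc i) ` Y"
  have finK: "finite K" using finite_subset[OF sub(1) finite_subset[OF sub(2) fin]] by (simp add: K_def)
  have "\<exists>u v. u \<in> S' \<and> v \<in> S' \<and> u div D ^ Suc i = k \<and> v div D ^ Suc i = k \<and> u div D ^ i \<noteq> v div D ^ i" if k: "k \<in> K" for k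
  proof -
    obtain c where c: "c \<in> Y" "k = c div D ^ Suc i" using k unfolding K_def by blast
    then obtain v where "v \<in> node D S' (Suc i) c" "v div D ^ i \<noteq> c div D ^ i"
      using branching by (auto simp: only_child_def children_def)
    then show ?thesis using c sub(1) by (intro exI[of _ c] exI[of _ v]) (auto simp: node_iff simp del: power_Suc)
  qed
  then obtain u v where mem: "\<And>k. k \<in> K \<Longrightarrow> u k \<in> S'" "\<And>k. k \<in> K \<Longrightarrow> v k \<in> S'"
    and parent: "\<And>k. k \<in> K \<Longrightarrow> u k div D ^ Suc i = k" "\<And>k. k \<in> K \<Longrightarrow> v k div D ^ Suc i = k"
    and differ: "\<And>k. k \<in> K \<Longrightarrow> u k div D ^ i \<noteq> v k div D ^ i" by metis
  define Z where "Z k = PiE {..q} (\<lambda>j. node D S i (if even j then u k else v k))" for k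
  have Z: "f \<in> zigzags D q i S" "f 0 div D ^ Suc i = k" if "k \<in> K" "f \<in> Z k" for k f
    using alternating_zigzag[of "u k" D i "v k" f q S] that parent differ by (simp_all add: Z_def del: power_Suc)
  have card_Z: "m ^ Suc q \<le> card (Z k)" if k: "k \<in> K" for k
  proof -
    have "m ^ Suc q = (\<Prod>j\<in>{..q}. m)" by simp
    also have "\<dots> \<le> (\<Prod>j\<in>{..q}. real (card (node D S i (if even j then u k else v k))))"
      using rich mem[OF k] m by (intro prod_mono) auto
    finally show ?thesis by (simp add: Z_def card_PiE)
  qed
  have "real (card K) * m ^ Suc q = (\<Sum>k\<in>K. m ^ Suc q)" by simp
  also have "\<dots> \<le> (\<Sum>k\<in>K. real (card (Z k)))" using card_Z by (rule sum_mono)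
  also have "\<dots> = card (\<Union>k\<in>K. Z k)"
  proof (subst card_UN_disjoint[OF finK])
    show "\<forall>k\<in>K. finite (Z k)" using fin by (auto simp: Z_def finite_node intro!: finite_PiE)
    show "\<forall>k\<in>K. \<forall>k'\<in>K. k \<noteq> k' \<longrightarrow> Z k \<inter> Z k' = {}" using Z(2) by blast
  qed simp
  also have "\<dots> \<le> card (zigzags D q i S)" using Z(1) finite_zigzags[OF fin] by (intro of_nat_mono card_mono) auto
  finally show ?thesis by (simp add: K_def)
qed

definition branch_weight :: "nat \<Rightarrow> nat set \<Rightarrow> nat set \<Rightarrow> nat \<Rightarrow> nat \<Rightarrow> nat" where
  "branch_weight D S L h x = 2 ^ card {i\<in>L. i < h \<and> only_child D S i x}"

lemma only_child_node:
  assumes "c \<in> S" "x \<in> node D S (Suc h) c"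
  shows "only_child D S h x \<longleftrightarrow> only_child D S h c"
proof -
  have "x \<in> S" using assms(2) by (simp add: node_iff)
  from value_in_children[OF this, of D h] have "x div D ^ h \<in> children D S h c"
    by (simp only: children_eq[OF assms(2)])
  moreover have "c div D ^ h \<in> children D S h c" using assms(1) by (rule value_in_children)
  ultimately have "children D S h c \<subseteq> {x div D ^ h} \<longleftrightarrow> children D S h c \<subseteq> {c div D ^ h}"
    by (auto simp: subset_singleton_iff)
  then show ?thesis unfolding only_child_def children_eq[OF assms(2)] .
qed

lemma branch_weight_Suc:
  assumes "c \<in> S" "x \<in> node D S (Suc h) c"
  shows "branch_weight D S L (Suc h) x = (if h \<in> L \<and> only_child D S h c then 2 else 1) * branch_weight D S L h x"
proof -
  have "finite {i\<in>L. i < h \<and> only_child D S i x}" by (rule finite_subset[of _ "{..<h}"]) auto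
  moreover have "{i\<in>L. i < Suc h \<and> only_child D S i x} =
      {i\<in>L. i < h \<and> only_child D S i x} \<union> (if h \<in> L \<and> only_child D S h c then {h} else {})"
    using only_child_node[OF assms] by (auto simp: less_Suc_eq)
  ultimately show ?thesis by (simp add: branch_weight_def)
qed

lemma sum_node_le_children:
  fixes f :: "nat \<Rightarrow> nat"
  assumes fin: "finite S" and le: "\<And>z. z \<in> node D S (Suc h) c \<Longrightarrow> (\<Sum>x\<in>node D S h z. f x) \<le> m"
  shows "(\<Sum>x\<in>node D S (Suc h) c. f x) \<le> card (children D S h c) * m"
proof -
  let ?V = "node D S (Suc h) c" and ?r = "\<lambda>y. y div D ^ h"
  have "(\<Sum>x\<in>fibre ?V ?r d. f x) \<le> m" if d: "d \<in> children D S h c" for d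
  proof -
    obtain z where z: "z \<in> ?V" "d = z div D ^ h" using d by (auto simp: children_def)
    then have "fibre ?V ?r d = node D S h z" using fibre_of_node[of h "Suc h" z] by simp
    then show ?thesis using le[OF z(1)] by simp
  qed
  then have "(\<Sum>d\<in>children D S h c. \<Sum>x\<in>fibre ?V ?r d. f x) \<le> (\<Sum>d\<in>children D S h c. m)" by (rule sum_mono)
  then show ?thesis
    using sum_by_fibres[OF finite_node[OF fin, of D "Suc h" c], of f ?r] by (simp add: children_def)
qed

lemma (in uniform_tree) kraft_weight:
  assumes SX: "S \<subseteq> X" and active: "\<And>i. i \<in> L \<Longrightarrow> 1 \<le> a i"
  shows "h \<le> n \<Longrightarrow> c \<in> S \<Longrightarrow> (\<Sum>x\<in>node D S h c. branch_weight D S L h x) \<le> leaf_count a h"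
proof (induction h arbitrary: c)
  case 0
  have "node D S 0 c = {c}" using 0 by (auto simp: node_iff)
  then show ?case by (simp add: branch_weight_def leaf_count_def)
next
  case (Suc h)
  let ?V = "node D S (Suc h) c" and ?ch = "children D S h c" and ?w = "branch_weight D S L h"
  let ?factor = "if h \<in> L \<and> only_child D S h c then 2 else (1::nat)"
  have finS: "finite S" using finite_leaves SX finite_subset by blast
  have sum_w: "(\<Sum>x\<in>?V. ?w x) \<le> card ?ch * leaf_count a h"
    using Suc by (intro sum_node_le_children[OF finS]) (simp add: node_iff)
  have c: "c \<in> X" and h: "h < n" using Suc.prems SX by auto
  have "?ch \<subseteq> children D X h c" using SX by (auto simp: children_def node_iff)
  then have card_ch: "card ?ch \<le> 2 ^ a h"
    using card_children[OF h c] card_mono[OF finite_children[OF finite_leaves]] by metis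
  have "?factor * card ?ch \<le> 2 ^ a h"
  proof (cases "h \<in> L \<and> only_child D S h c")
    case True
    then have "card ?ch \<le> 1" using card_mono[of "{c div D ^ h}" ?ch] by (simp add: only_child_def)
    moreover have "2 \<le> (2::nat) ^ a h" using active[of h] True power_increasing[of 1 "a h" "2::nat"] by simp
    ultimately show ?thesis using True by simp
  next
    case False
    then show ?thesis using card_ch by auto
  qed
  have "(\<Sum>x\<in>?V. branch_weight D S L (Suc h) x) = ?factor * (\<Sum>x\<in>?V. ?w x)"
    unfolding sum_distrib_left by (intro sum.cong refl branch_weight_Suc Suc.prems(2))
  also have "\<dots> \<le> (?factor * card ?ch) * leaf_count a h" unfolding mult.assoc using sum_w by (rule mult_le_mono2)
  also have "\<dots> \<le> 2 ^ a h * leaf_count a h" by (rule mult_le_mono1) fact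
  finally show ?case by (simp add: leaf_count_Suc)
qed

context rooted_uniform_tree
begin

lemma card_X_pos: "card X > 0"
  using finite_leaves nonempty by (simp add: card_gt_0_iff)

lemma card_X: "card X = leaf_count a n"
proof -
  obtain x where "x \<in> X" using nonempty by blast
  then show ?thesis using card_node[OF order_refl] node_root by fastforce
qed

lemma sum_branch_weight_le:
  assumes SX: "S \<subseteq> X" and L: "L \<subseteq> {..<n}" "\<And>i. i \<in> L \<Longrightarrow> 1 \<le> a i"
  shows "(\<Sum>x\<in>S. 2 ^ card {i\<in>L. only_child D S i x}) \<le> card X"
proof (cases "S = {}")
  case False
  then obtain c where c: "c \<in> S" by blast
  have "node D S n c = S" using node_root SX c by blast
  moreover have "{i\<in>L. i < n \<and> only_child D S i x} = {i\<in>L. only_child D S i x}" for x using L(1) by auto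
  ultimately show ?thesis
    using kraft_weight[where S = S and L = L and h = n and c = c, OF SX L(2) order_refl c]
    by (simp add: branch_weight_def card_X)
qed simp

lemma exists_branching_level:
  fixes \<rho> :: real
  assumes SX: "S \<subseteq> X" and \<rho>: "0 < \<rho>" "\<rho> / 2 * card X \<le> card S"
    and L: "L \<subseteq> {..<n}" "\<And>i. i \<in> L \<Longrightarrow> 1 \<le> a i" "(4 / \<rho>)^2 \<le> 2 ^ card L"
  obtains i where "i \<in> L" "\<rho> / 8 * card X \<le> card {x\<in>S. \<not> only_child D S i x}"
proof -
  have finS: "finite S" using SX finite_leaves finite_subset by blast
  have finL: "finite L" using L finite_subset by blast
  define w where "w x = card {i\<in>L. only_child D S i x}" for x
  define Y where "Y = {x\<in>S. 2 ^ w x \<le> 4 / \<rho>}"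
  have finY: "finite Y" using finS by (simp add: Y_def)
  have "card {x\<in>S. 4 / \<rho> < 2 ^ w x} * (4 / \<rho>) \<le> (\<Sum>x\<in>S. 2 ^ w x)" using finS by (intro card_large_values_le) auto
  also have "\<dots> = real (\<Sum>x\<in>S. 2 ^ w x)" by simp
  also have "\<dots> \<le> card X" using sum_branch_weight_le[OF SX L(1,2)] unfolding w_def by (simp only: of_nat_le_iff)
  also have "{x\<in>S. 4 / \<rho> < 2 ^ w x} = S - Y" by (auto simp: Y_def)
  finally have "card (S - Y) \<le> \<rho> / 4 * card X" using \<rho> by (simp add: field_simps)
  moreover have "card S = card Y + card (S - Y)" using finS by (simp add: Y_def card_Diff_subset card_mono)
  ultimately have Y: "\<rho> / 4 * card X \<le> card Y" using \<rho> by (simp add: field_simps)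
  have half: "1 / 2 * card L \<le> card {i\<in>L. \<not> only_child D S i x}" if "x \<in> Y" for x
  proof -
    have "((2::real) ^ w x)^2 \<le> (4 / \<rho>)^2" using that by (intro power_mono) (auto simp: Y_def)
    then have "(2::real) ^ (2 * w x) \<le> 2 ^ card L" using L(3) by (simp add: power_mult mult.commute)
    then have "2 * w x \<le> card L" by simp
    moreover have "card L \<le> w x + card {i\<in>L. \<not> only_child D S i x}"
      using card_Un_le[of "{i\<in>L. only_child D S i x}" "{i\<in>L. \<not> only_child D S i x}"]
      by (simp add: w_def Collect_disj_eq[symmetric] flip: conj_disj_distribL)
    ultimately show ?thesis by linarith
  qed
  have "L \<noteq> {}"
  proof
    assume "L = {}"
    have "\<rho> / 2 * card X \<le> 1 * real (card X)" using \<rho>(2) card_mono[OF finite_leaves SX] by linarith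
    then have "\<rho> / 2 \<le> 1" using card_X_pos by (subst (asm) mult_le_cancel_right) auto
    then have "2 \<le> 4 / \<rho>" using \<rho>(1) by (simp add: field_simps)
    then have "2^2 \<le> (4 / \<rho>)^2" by (rule power_mono) simp
    then show False using L(3) \<open>L = {}\<close> by simp
  qed
  then obtain i where "i \<in> L" "1 / 2 * card Y \<le> card {x\<in>Y. i \<in> {i\<in>L. \<not> only_child D S i x}}"
    using popular_point[OF finY finL, of "\<lambda>x. {i\<in>L. \<not> only_child D S i x}" "1 / 2"] half by auto
  moreover have "card {x\<in>Y. i \<in> {i\<in>L. \<not> only_child D S i x}} \<le> card {x\<in>S. \<not> only_child D S i x}"
    using finS by (intro card_mono) (auto simp: Y_def)
  ultimately show ?thesis using that[of i] Y by linarith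
qed

end

definition rich_points :: "nat \<Rightarrow> nat set \<Rightarrow> (nat \<Rightarrow> nat) \<Rightarrow> nat \<Rightarrow> real \<Rightarrow> nat set" where
  "rich_points D S a n t = {c\<in>S. \<forall>i\<le>n. t * leaf_count a i \<le> card (node D S i c)}"

context uniform_tree
begin

lemma card_poor_points:
  fixes t :: real
  assumes SX: "S \<subseteq> X" and t: "0 \<le> t" and i: "i \<le> n"
  shows "card {c\<in>S. card (node D S i c) < t * leaf_count a i} \<le> t * card X" (is "real (card ?B) \<le> _")
proof -
  let ?r = "\<lambda>c. c div D ^ i"
  have finS: "finite S" using SX finite_leaves finite_subset by blast
  have "card (fibre ?B ?r v) \<le> t * leaf_count a i" if v: "v \<in> ?r ` ?B" for v
  proof -
    obtain c where c: "c \<in> ?B" "v = c div D ^ i" using v by blast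
    have "card (fibre ?B ?r v) \<le> card (node D S i c)"
      by (rule card_mono[OF finite_node[OF finS]]) (auto simp: fibre_def node_iff c(2))
    then show ?thesis using c(1) by simp
  qed
  then have "card ?B \<le> card (?r ` ?B) * (t * leaf_count a i)" using finS by (intro card_le_fibres) auto
  also have "\<dots> \<le> card (?r ` X) * (t * leaf_count a i)"
    using finite_leaves SX t by (intro mult_right_mono of_nat_mono card_mono) auto
  also have "\<dots> = t * real (card (?r ` X) * leaf_count a i)" by simp
  finally show ?thesis unfolding card_node_values[OF i] .
qed

lemma card_rich_points:
  fixes t :: real
  assumes SX: "S \<subseteq> X" and t: "0 \<le> t"
  shows "card S - (real n + 1) * t * card X \<le> card (rich_points D S a n t)"
proof -
  let ?poor = "\<lambda>i. {c\<in>S. card (node D S i c) < t * leaf_count a i}" and ?rich = "rich_points D S a n t"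
  have finS: "finite S" using SX finite_leaves finite_subset by blast
  have "card S \<le> card (?rich \<union> (\<Union>i\<in>{..n}. ?poor i))"
    using finS by (intro card_mono) (auto simp: rich_points_def not_le)
  also have "\<dots> \<le> card ?rich + (\<Sum>i\<le>n. card (?poor i))"
    using card_Un_le[of ?rich "\<Union>i\<in>{..n}. ?poor i"] card_UN_le[of "{..n}" ?poor] by simp
  finally have "real (card S) \<le> card ?rich + (\<Sum>i\<le>n. real (card (?poor i)))"
    by (simp flip: of_nat_sum of_nat_add)
  also have "(\<Sum>i\<le>n. real (card (?poor i))) \<le> real (n + 1) * (t * card X)"
    using sum_bounded_above[of "{..n}" "\<lambda>i. real (card (?poor i))" "t * card X"] card_poor_points[OF SX t] by simp
  finally show ?thesis by (simp add: algebra_simps)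
qed

end

definition zigzag_share :: "real \<Rightarrow> nat \<Rightarrow> nat \<Rightarrow> nat \<Rightarrow> real" where
  "zigzag_share \<rho> n D q = \<rho> / 8 * (\<rho> / (2 * (real n + 1) * real D)) ^ Suc q"

lemma zigzag_share_pos: "0 < \<rho> \<Longrightarrow> 0 < D \<Longrightarrow> 0 < zigzag_share \<rho> n D q"
  by (simp add: zigzag_share_def)

theorem (in rooted_uniform_tree) many_zigzags:
  fixes \<rho> :: real
  assumes SX: "S \<subseteq> X" and \<rho>: "0 < \<rho>" "\<rho> * card X \<le> card S"
    and L: "L \<subseteq> {..<n}" "\<And>i. i \<in> L \<Longrightarrow> 1 \<le> a i" "(4 / \<rho>)^2 \<le> 2 ^ card L"
  obtains i where "i \<in> L"
    "zigzag_share \<rho> n D q * (card X * leaf_count a (Suc i) ^ q) \<le> card (zigzags D q i S)"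
proof -
  define t where "t = \<rho> / (2 * (real n + 1))"
  define S' where "S' = rich_points D S a n t"
  have t: "0 < t" "(real n + 1) * t = \<rho> / 2" using \<rho>(1) by (simp_all add: t_def field_simps)
  have finS: "finite S" using SX finite_leaves finite_subset by blast
  have sub: "S' \<subseteq> S" "S' \<subseteq> X" using SX by (auto simp: S'_def rich_points_def)
  have "\<rho> / 2 * card X \<le> card S'"
    using card_rich_points[OF SX, of t] t(1) \<rho>(2) unfolding S'_def t(2) by simp
  then obtain i where i: "i \<in> L" and many: "\<rho> / 8 * card X \<le> card {x\<in>S'. \<not> only_child D S' i x}"
    using exists_branching_level[OF sub(2) \<rho>(1) _ L] by blast
  have in_range: "i < n" using i L(1) by auto
  define Y where "Y = {x\<in>S'. \<not> only_child D S' i x}"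
  define lc where "lc = real (leaf_count a (Suc i))"
  have lc: "0 < lc" by (simp add: lc_def leaf_count_pos)
  define K where "K = (\<lambda>c. c div D ^ Suc i) ` Y"
  have YX: "Y \<subseteq> X" using sub(2) by (auto simp: Y_def)
  have card_Y: "card Y \<le> card K * lc"
    using card_le_node_values[OF YX, of "Suc i"] in_range unfolding K_def lc_def
    by (simp flip: of_nat_mult del: power_Suc)
  have "lc \<le> D * leaf_count a i"
    unfolding lc_def of_nat_mult[symmetric] by (intro of_nat_mono leaf_count_Suc_le in_range nonempty)
  then have "t / D * lc \<le> t / D * (D * leaf_count a i)" using t by (intro mult_left_mono) auto
  also have "\<dots> = t * leaf_count a i" using D_pos by simp
  finally have lc_le: "t / D * lc \<le> t * leaf_count a i" .
  have rich: "t / D * lc \<le> card (node D S i x)" if "x \<in> S'" for x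
    by (rule order_trans[OF lc_le]) (use that in_range in \<open>auto simp: S'_def rich_points_def\<close>)
  have "zigzag_share \<rho> n D q * (card X * lc ^ q) = (\<rho> / 8 * card X) * ((t / D) ^ Suc q * lc ^ q)"
    by (simp add: zigzag_share_def t_def)
  also have "\<dots> \<le> (card K * lc) * ((t / D) ^ Suc q * lc ^ q)"
    using many card_Y t lc by (intro mult_right_mono) (auto simp: Y_def)
  also have "\<dots> = card K * (t / D * lc) ^ Suc q"
    unfolding power_mult_distrib[of "t / D"] by (simp only: power_Suc mult_ac)
  also have "\<dots> \<le> card (zigzags D q i S)"
    unfolding K_def using t lc by (intro card_zigzags_ge[OF finS _ sub(1) _ rich]) (auto simp: Y_def)
  finally show ?thesis using that[OF i] by (simp add: lc_def)
qed

section \<open>Walks\<close>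

lemma exists_popular_subset:
  fixes t :: real and \<phi> :: "nat \<Rightarrow> 'h \<Rightarrow> 'a"
  assumes "finite H" and t: "t \<ge> 0" and "t * (\<Sum>i\<le>k. card (\<phi> i ` H)) < card H"
  shows "\<exists>H'\<subseteq>H. H' \<noteq> {} \<and> (\<forall>i\<le>k. \<forall>h\<in>H'. t \<le> card (fibre H' (\<phi> i) (\<phi> i h)))"
  using assms(1,3)
proof (induction "card H" arbitrary: H rule: less_induct)
  case less
  note fin = less.prems(1) and big = less.prems(2)
  show ?case
  proof (cases "\<forall>i\<le>k. \<forall>h\<in>H. t \<le> card (fibre H (\<phi> i) (\<phi> i h))")
    case True
    moreover have "H \<noteq> {}" using big t by auto
    ultimately show ?thesis by blast
  next
    case False
    then obtain i h where ih: "i \<le> k" "h \<in> H" "card (fibre H (\<phi> i) (\<phi> i h)) < t" by (meson not_le)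
    define K where "K = fibre H (\<phi> i) (\<phi> i h)"
    have K: "K \<subseteq> H" "h \<in> K" using ih(2) by (auto simp: K_def fibre_def)
    have smaller: "card (H - K) < card H" using K fin by (intro psubset_card_mono) auto
    have "card (\<phi> j ` (H - K)) \<le> card (\<phi> j ` H)" for j using fin by (intro card_mono) auto
    moreover have "card (\<phi> i ` (H - K)) < card (\<phi> i ` H)"
    proof (rule psubset_card_mono)
      have "\<phi> i h \<notin> \<phi> i ` (H - K)" by (auto simp: K_def fibre_def)
      then show "\<phi> i ` (H - K) \<subset> \<phi> i ` H" using ih(2) by blast
    qed (use fin in simp)
    ultimately have "(\<Sum>j\<le>k. card (\<phi> j ` (H - K))) < (\<Sum>j\<le>k. card (\<phi> j ` H))"
      using ih(1) by (intro sum_strict_mono_ex1) auto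
    then have "real (\<Sum>j\<le>k. card (\<phi> j ` (H - K))) + 1 \<le> real (\<Sum>j\<le>k. card (\<phi> j ` H))" by linarith
    then have "t * (real (\<Sum>j\<le>k. card (\<phi> j ` (H - K))) + 1) \<le> t * real (\<Sum>j\<le>k. card (\<phi> j ` H))"
      using t by (rule mult_left_mono)
    moreover have "real (card (H - K)) = real (card H) - real (card K)"
      using K(1) fin by (simp add: card_Diff_subset finite_subset card_mono of_nat_diff)
    ultimately have "t * real (\<Sum>j\<le>k. card (\<phi> j ` (H - K))) < card (H - K)"
      using big ih(3) by (simp only: distrib_left mult_1_right K_def)
    then obtain H' where "H' \<subseteq> H - K" "H' \<noteq> {}" "\<forall>i\<le>k. \<forall>h\<in>H'. t \<le> card (fibre H' (\<phi> i) (\<phi> i h))"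
      using less.hyps[OF smaller] fin by blast
    then show ?thesis by blast
  qed
qed

definition walks :: "(nat \<Rightarrow> 'h \<Rightarrow> 'a) \<Rightarrow> 'h set \<Rightarrow> 'a \<Rightarrow> nat \<Rightarrow> (nat \<Rightarrow> 'h) set" where
  "walks \<phi> H a k = {f\<in>PiE {..<k} (\<lambda>_. H). (0 < k \<longrightarrow> \<phi> 0 (f 0) = a) \<and>
     (\<forall>i. Suc i < k \<longrightarrow> \<phi> (Suc i) (f (Suc i)) = \<phi> (Suc i) (f i))}"

lemma finite_walks: "finite H \<Longrightarrow> finite (walks \<phi> H a k)"
  unfolding walks_def by (rule finite_subset[of _ "PiE {..<k} (\<lambda>_. H)"]) (auto intro!: finite_PiE)

lemma walk_mem: "f \<in> walks \<phi> H a k \<Longrightarrow> i < k \<Longrightarrow> f i \<in> H"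
  by (auto simp: walks_def PiE_iff)

lemma walk_start: "f \<in> walks \<phi> H a k \<Longrightarrow> 0 < k \<Longrightarrow> \<phi> 0 (f 0) = a"
  by (simp add: walks_def)

lemma walk_step: "f \<in> walks \<phi> H a k \<Longrightarrow> Suc i < k \<Longrightarrow> \<phi> (Suc i) (f (Suc i)) = \<phi> (Suc i) (f i)"
  by (simp add: walks_def)

lemma walk_extend:
  assumes w: "w \<in> walks \<phi> H a k" and h: "h \<in> H" "\<phi> k h = (if k = 0 then a else \<phi> k (w (k - 1)))"
  shows "w(k := h) \<in> walks \<phi> H a (Suc k)"
proof -
  have "w(k := h) \<in> PiE {..<Suc k} (\<lambda>_. H)"
    using w h(1) by (auto simp: walks_def PiE_iff extensional_def)
  moreover have "\<phi> 0 ((w(k := h)) 0) = a" using w h(2) walk_start by fastforce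
  moreover have "\<phi> (Suc i) ((w(k := h)) (Suc i)) = \<phi> (Suc i) ((w(k := h)) i)" if "Suc i < Suc k" for i
    using that h(2) walk_step[OF w, of i] by (cases "Suc i = k") auto
  ultimately show ?thesis unfolding walks_def by blast
qed

lemma card_walks_ge:
  fixes t :: real
  assumes fin: "finite H" and t: "t \<ge> 0" and h0: "h0 \<in> H"
    and popular: "\<And>i h. i < k \<Longrightarrow> h \<in> H \<Longrightarrow> t \<le> card (fibre H (\<phi> i) (\<phi> i h))"
  shows "t ^ k \<le> card (walks \<phi> H (\<phi> 0 h0) k)"
  using popular
proof (induction k)
  case 0
  have "walks \<phi> H (\<phi> 0 h0) 0 = {\<lambda>_. undefined}" by (auto simp: walks_def)
  then show ?case by simp
next
  case (Suc k)
  let ?W = "walks \<phi> H (\<phi> 0 h0)"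
  define last where "last w = (if k = 0 then h0 else w (k - 1))" for w
  define N where "N w = fibre H (\<phi> k) (\<phi> k (last w))" for w
  have last_mem: "last w \<in> H" if "w \<in> ?W k" for w
    using h0 walk_mem[OF that, of "k - 1"] by (auto simp: last_def)
  have "t ^ Suc k \<le> card (?W k) * t" using Suc t by (simp add: mult.commute mult_left_mono)
  also have "\<dots> \<le> (\<Sum>w\<in>?W k. real (card (N w)))"
    unfolding N_def using Suc.prems last_mem by (intro sum_bounded_below) auto
  also have "\<dots> = card (Sigma (?W k) N)"
    by (subst card_SigmaI) (simp_all add: N_def fin finite_walks finite_fibre)
  also have "\<dots> \<le> card (?W (Suc k))"
  proof (rule of_nat_mono, rule card_inj_on_le)
    show "inj_on (\<lambda>(w, h). w(k := h)) (Sigma (?W k) N)"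
    proof (rule inj_onI, clarify)
      fix w h w' h' assume "w \<in> ?W k" "h \<in> N w" "w' \<in> ?W k" "h' \<in> N w'" and "w(k := h) = w'(k := h')"
      then show "w = w' \<and> h = h'"
        using inj_onD[OF inj_combinator[of k "{..<k}" "\<lambda>_. H"], of "(h, w)" "(h', w')"]
        by (simp add: walks_def N_def fibre_def)
    qed
    have "w(k := h) \<in> ?W (Suc k)" if "w \<in> ?W k" "h \<in> N w" for w h
      using that by (intro walk_extend) (auto simp: N_def fibre_def last_def)
    then show "(\<lambda>(w, h). w(k := h)) ` Sigma (?W k) N \<subseteq> ?W (Suc k)" by auto
  qed (rule finite_walks[OF fin])
  finally show ?case .
qed

text \<open>\<open>twist M c (a, b, b')\<close> is the point \<open>a + c (b' - b)\<close>, with the two products rounded to multiples of \<open>M\<close>.\<close>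

definition twist :: "nat \<Rightarrow> nat \<Rightarrow> int \<times> nat \<times> nat \<Rightarrow> int" where
  "twist M c h = fst h + int (c * snd (snd h) div M) - int (c * fst (snd h) div M)"

definition slope :: "nat \<Rightarrow> (nat \<Rightarrow> nat) \<Rightarrow> nat \<Rightarrow> real" where
  "slope M c i = (real (c (Suc i)) - real (c i)) / real M"

definition close_tuples :: "nat set \<Rightarrow> nat \<Rightarrow> (nat \<Rightarrow> real) \<Rightarrow> real \<Rightarrow> (nat \<Rightarrow> nat) set" where
  "close_tuples B k x z = {b\<in>PiE {..<k} (\<lambda>_. B). \<bar>(\<Sum>i<k. x i * real (b i)) - z\<bar> \<le> 2 * real k}"

lemma walk_endpoint:
  assumes f: "f \<in> walks (\<lambda>i. twist M (c i)) H a (Suc k)"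
  shows "twist M (c (Suc k)) (f k) = a + (\<Sum>i\<le>k. twist M (c (Suc i)) (f i) - twist M (c i) (f i))"
proof -
  have "twist M (c (Suc j)) (f j) = a + (\<Sum>i\<le>j. twist M (c (Suc i)) (f i) - twist M (c i) (f i))" if "j \<le> k" for j
    using that
  proof (induction j)
    case 0
    then show ?case using walk_start[OF f] by simp
  next
    case (Suc j)
    then show ?case using walk_step[OF f, of j] by simp
  qed
  then show ?thesis by simp
qed

lemma walk_determined:
  assumes f: "f \<in> walks (\<lambda>i. twist M (c i)) H a k" and g: "g \<in> walks (\<lambda>i. twist M (c i)) H a k"
    and eq: "\<And>i. i < k \<Longrightarrow> snd (f i) = snd (g i)"
  shows "f = g"
proof
  fix j
  have "f j = g j" if "j < k" using that
  proof (induction j)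
    case 0
    then show ?case using walk_start[OF f] walk_start[OF g] eq[OF 0] by (auto simp: twist_def prod_eq_iff)
  next
    case (Suc j)
    then show ?case using walk_step[OF f, of j] walk_step[OF g, of j] eq[OF Suc.prems]
      by (auto simp: twist_def prod_eq_iff)
  qed
  moreover have "f j = g j" if "\<not> j < k" using f g that by (auto simp: walks_def PiE_iff extensional_def)
  ultimately show "f j = g j" by blast
qed

lemma twist_difference:
  assumes M: "M > 0"
  shows "\<bar>real_of_int (twist M (c (Suc i)) h - twist M (c i) h) -
      slope M c i * (real (snd (snd h)) - real (fst (snd h)))\<bar> \<le> 2"
proof -
  have floor: "real (x * y) / M - 1 \<le> real (x * y div M)" "real (x * y div M) \<le> real (x * y) / M" for x y
  proof -
    have "real (x * y div M) = of_int \<lfloor>real (x * y) / real M\<rfloor>" unfolding floor_divide_of_nat_eq by simp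
    then show "real (x * y) / M - 1 \<le> real (x * y div M)" "real (x * y div M) \<le> real (x * y) / M" by linarith+
  qed
  define b b' d d' where "b = fst (snd h)" and "b' = snd (snd h)" and "d = c i" and "d' = c (Suc i)"
  note unfold_defs = b_def[symmetric] b'_def[symmetric] d_def[symmetric] d'_def[symmetric]
  have "real_of_int (twist M d' h - twist M d h) =
      real (d' * b' div M) - real (d' * b div M) - real (d * b' div M) + real (d * b div M)"
    by (simp add: twist_def unfold_defs)
  moreover have "(real d' - real d) / M * (real b' - real b) =
      real (d' * b') / M - real (d' * b) / M - real (d * b') / M + real (d * b) / M"
    using M by (simp add: field_simps)
  ultimately show ?thesis using floor[of d' b'] floor[of d' b] floor[of d b'] floor[of d b]
    unfolding slope_def unfold_defs by linarith
qed

lemma walk_displacement: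
  assumes M: "M > 0" and k: "k > 0" and f: "f \<in> walks (\<lambda>i. twist M (c i)) H a k"
  shows "\<bar>real_of_int (twist M (c k) (f (k - 1)) - a) -
    (\<Sum>i<k. slope M c i * (real (snd (snd (f i))) - real (fst (snd (f i)))))\<bar> \<le> 2 * k"
proof -
  obtain k' where k': "k = Suc k'" using k by (cases k) auto
  have "real_of_int (twist M (c k) (f (k - 1)) - a) =
      (\<Sum>i<k. real_of_int (twist M (c (Suc i)) (f i) - twist M (c i) (f i)))"
    using walk_endpoint[of f M c H a k'] f by (simp add: k' lessThan_Suc_atMost)
  then have "real_of_int (twist M (c k) (f (k - 1)) - a) -
      (\<Sum>i<k. slope M c i * (real (snd (snd (f i))) - real (fst (snd (f i))))) =
      (\<Sum>i<k. real_of_int (twist M (c (Suc i)) (f i) - twist M (c i) (f i)) -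
        slope M c i * (real (snd (snd (f i))) - real (fst (snd (f i)))))"
    by (simp only: sum_subtractf)
  also have "\<bar>\<dots>\<bar> \<le> (\<Sum>i<k. 2)" by (intro order_trans[OF sum_abs] sum_mono twist_difference M)
  finally show ?thesis by simp
qed

lemma walk_ends_close:
  fixes r :: real and A :: "int set" and B :: "nat set"
  assumes f: "f \<in> walks (\<lambda>i. twist M (c i)) H a k" and H: "H \<subseteq> UNIV \<times> B \<times> B" and M: "M > 0" and k: "k > 0"
    and r: "\<And>i b b'. i < k \<Longrightarrow> b \<in> B \<Longrightarrow> b' \<in> B \<Longrightarrow> \<bar>slope M c i * (real b' - real b)\<bar> \<le> r"
  defines "e \<equiv> twist M (c k) (f (k - 1))" and "b \<equiv> \<lambda>i\<in>{..<k}. fst (snd (f i))" and "b' \<equiv> \<lambda>i\<in>{..<k}. snd (snd (f i))"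
  shows "b \<in> PiE {..<k} (\<lambda>_. B)" "\<bar>real_of_int e - real_of_int a\<bar> \<le> k * (r + 2)"
    "b' \<in> close_tuples B k (slope M c) (real_of_int (e - a) + (\<Sum>i<k. slope M c i * real (b i)))"
proof -
  have mem: "fst (snd (f i)) \<in> B" "snd (snd (f i)) \<in> B" if "i < k" for i
    using walk_mem[OF f that] H by auto
  then show "b \<in> PiE {..<k} (\<lambda>_. B)" by (auto simp: b_def)
  have b': "b' \<in> PiE {..<k} (\<lambda>_. B)" using mem by (auto simp: b'_def)
  have close: "\<bar>real_of_int (e - a) - (\<Sum>i<k. slope M c i * (real (b' i) - real (b i)))\<bar> \<le> 2 * k"
    using walk_displacement[OF M k f] by (simp add: e_def b_def b'_def)
  then show "b' \<in> close_tuples B k (slope M c) (real_of_int (e - a) + (\<Sum>i<k. slope M c i * real (b i)))"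
    using b' by (auto simp: close_tuples_def right_diff_distrib sum_subtractf algebra_simps)
  have "\<bar>\<Sum>i<k. slope M c i * (real (b' i) - real (b i))\<bar> \<le> k * r"
    using mem r by (intro order_trans[OF sum_abs] order_trans[OF sum_bounded_above[of "{..<k}" _ r]])
      (auto simp: b_def b'_def)
  then show "\<bar>real_of_int e - real_of_int a\<bar> \<le> k * (r + 2)" using close by (simp add: distrib_left mult.commute)
qed

lemma card_walks_le:
  fixes r U :: real and A :: "int set" and B :: "nat set"
  assumes fin: "finite A" "finite B" "finite H" and H: "H \<subseteq> UNIV \<times> B \<times> B" and M: "M > 0" and k: "k > 0"
    and image: "\<And>h. h \<in> H \<Longrightarrow> twist M (c k) h \<in> A"
    and r: "\<And>i b b'. i < k \<Longrightarrow> b \<in> B \<Longrightarrow> b' \<in> B \<Longrightarrow> \<bar>slope M c i * (real b' - real b)\<bar> \<le> r"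
    and U: "\<And>z. card (close_tuples B k (slope M c) z) \<le> U"
  shows "card (walks (\<lambda>i. twist M (c i)) H a k) \<le> card {x\<in>A. \<bar>real_of_int x - a\<bar> \<le> k * (r + 2)} * card B ^ k * U"
proof -
  let ?W = "walks (\<lambda>i. twist M (c i)) H a k" and ?E = "{x\<in>A. \<bar>real_of_int x - a\<bar> \<le> k * (r + 2)}"
    and ?BB = "PiE {..<k} (\<lambda>_. B)"
  define ends where "ends e b = close_tuples B k (slope M c) (real_of_int (e - a) + (\<Sum>i<k. slope M c i * real (b i)))"
    for e b
  define trace where "trace f = (twist M (c k) (f (k - 1)), (\<lambda>i\<in>{..<k}. fst (snd (f i))), (\<lambda>i\<in>{..<k}. snd (snd (f i))))"
    for f :: "nat \<Rightarrow> int \<times> nat \<times> nat"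
  have finBB: "finite ?BB" using fin by (intro finite_PiE) auto
  then have finS: "finite (ends e b)" for e b by (simp add: ends_def close_tuples_def)
  have "card ?W \<le> card (SIGMA e:?E. SIGMA b:?BB. ends e b)"
  proof (rule card_inj_on_le)
    show "inj_on trace ?W"
    proof (rule inj_onI)
      fix f g assume fg: "f \<in> ?W" "g \<in> ?W" and eq: "trace f = trace g"
      have "snd (f i) = snd (g i)" if "i < k" for i
      proof (rule prod_eqI)
        show "fst (snd (f i)) = fst (snd (g i))" "snd (snd (f i)) = snd (snd (g i))"
          using eq that unfolding trace_def prod.inject by (metis lessThan_iff restrict_apply')+
      qed
      then show "f = g" using fg by (intro walk_determined[where k = k])
    qed
    show "trace ` ?W \<subseteq> (SIGMA e:?E. SIGMA b:?BB. ends e b)"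
    proof (rule image_subsetI)
      fix f assume f: "f \<in> ?W"
      have "twist M (c k) (f (k - 1)) \<in> A" using image walk_mem[OF f, of "k - 1"] k by simp
      then show "trace f \<in> (SIGMA e:?E. SIGMA b:?BB. ends e b)"
        using walk_ends_close[OF f H M k r] by (simp add: trace_def ends_def)
    qed
  qed (use fin finBB finS in simp)
  then have "real (card ?W) \<le> (\<Sum>e\<in>?E. \<Sum>b\<in>?BB. real (card (ends e b)))"
    using fin finBB finS by (simp add: card_SigmaI flip: of_nat_sum)
  also have "\<dots> \<le> (\<Sum>e\<in>?E. \<Sum>b\<in>?BB. U)" unfolding ends_def by (intro sum_mono U)
  finally show ?thesis by (simp add: card_PiE)
qed

theorem walk_count:
  fixes t r U :: real and c :: "nat \<Rightarrow> nat" and A :: "int set" and B :: "nat set"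
  assumes fin: "finite A" "finite B" "finite H" and H: "H \<subseteq> UNIV \<times> B \<times> B" and M: "M > 0" and k: "k > 0" and t: "t \<ge> 0"
    and image: "\<And>i h. i \<le> k \<Longrightarrow> h \<in> H \<Longrightarrow> twist M (c i) h \<in> A"
    and big: "t * ((k + 1) * card A) < card H"
    and r: "\<And>i b b'. i < k \<Longrightarrow> b \<in> B \<Longrightarrow> b' \<in> B \<Longrightarrow> \<bar>slope M c i * (real b' - real b)\<bar> \<le> r"
    and U: "\<And>z. card (close_tuples B k (slope M c) z) \<le> U"
  shows "\<exists>a\<in>A. t ^ k \<le> card {x\<in>A. \<bar>real_of_int x - real_of_int a\<bar> \<le> k * (r + 2)} * card B ^ k * U"
proof -
  let ?\<phi> = "\<lambda>i. twist M (c i)"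
  have "(\<Sum>i\<le>k. card (?\<phi> i ` H)) \<le> (\<Sum>i\<le>k. card A)"
    using image fin by (intro sum_mono card_mono) auto
  then have "t * real (\<Sum>i\<le>k. card (?\<phi> i ` H)) \<le> t * real ((k + 1) * card A)"
    using t by (intro mult_left_mono of_nat_mono) auto
  then have "t * real (\<Sum>i\<le>k. card (?\<phi> i ` H)) < card H" using big by linarith
  then obtain H' where H': "H' \<subseteq> H" "H' \<noteq> {}" "\<forall>i\<le>k. \<forall>h\<in>H'. t \<le> card (fibre H' (?\<phi> i) (?\<phi> i h))"
    using exists_popular_subset[OF fin(3) t, of ?\<phi> k] by blast
  obtain h0 where h0: "h0 \<in> H'" using H'(2) by blast
  have finH': "finite H'" using H'(1) fin(3) by (rule finite_subset)
  have "t ^ k \<le> card (walks ?\<phi> H' (?\<phi> 0 h0) k)"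
    using H'(3) by (intro card_walks_ge[OF finH' t h0]) simp
  also have "\<dots> \<le> card {x\<in>A. \<bar>real_of_int x - real_of_int (?\<phi> 0 h0)\<bar> \<le> k * (r + 2)} * card B ^ k * U"
    using H'(1) H image by (intro card_walks_le fin(1,2) finH' M k r U) auto
  finally show ?thesis using image[of 0 h0] h0 H'(1) by blast
qed

section \<open>Anticoncentration\<close>

definition node_mean :: "nat \<Rightarrow> nat set \<Rightarrow> nat \<Rightarrow> nat \<Rightarrow> real" where
  "node_mean D B e = fibre_avg B (\<lambda>b. b div D ^ e) real"

lemma sum_node_tuples:
  fixes f f' :: "('i \<Rightarrow> nat) \<Rightarrow> real"
  assumes fin: "finite B" "finite I"
    and le: "\<And>b. b \<in> PiE I (\<lambda>_. B) \<Longrightarrow>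
      (\<Sum>b'\<in>PiE I (\<lambda>i. node D B (e i) (b i)). f' b') \<le> K * (\<Sum>b'\<in>PiE I (\<lambda>i. node D B (e i) (b i)). f b')"
  shows "(\<Sum>b\<in>PiE I (\<lambda>_. B). f' b) \<le> K * (\<Sum>b\<in>PiE I (\<lambda>_. B). f b)"
proof -
  let ?BB = "PiE I (\<lambda>_. B)"
  define r where "r b = (\<lambda>i\<in>I. b i div D ^ e i)" for b :: "'i \<Rightarrow> nat"
  have finBB: "finite ?BB" using fin by (intro finite_PiE) auto
  have cell: "fibre ?BB r (r b) = PiE I (\<lambda>i. node D B (e i) (b i))" for b
  proof -
    have "r b' = r b \<longleftrightarrow> (\<forall>i\<in>I. b' i div D ^ e i = b i div D ^ e i)" for b'
      by (auto simp: r_def fun_eq_iff restrict_def)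
    then have "b' \<in> fibre ?BB r (r b) \<longleftrightarrow> b' \<in> PiE I (\<lambda>i. node D B (e i) (b i))" for b'
      by (simp only: fibre_def mem_Collect_eq PiE_iff node_iff) blast
    then show ?thesis by blast
  qed
  have "(\<Sum>b\<in>?BB. f' b) = (\<Sum>l\<in>r ` ?BB. \<Sum>b\<in>fibre ?BB r l. f' b)" by (rule sum_by_fibres[OF finBB])
  also have "\<dots> \<le> (\<Sum>l\<in>r ` ?BB. K * (\<Sum>b\<in>fibre ?BB r l. f b))"
    using le by (intro sum_mono) (auto simp: cell)
  also have "\<dots> = K * (\<Sum>b\<in>?BB. f b)" by (simp only: sum_distrib_left[symmetric] sum_by_fibres[OF finBB, of f r])
  finally show ?thesis .
qed

context uniform_tree
begin

lemma node_mean_interval: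
  assumes x: "x \<in> X" and e: "e' \<le> e"
  shows "real (x div D ^ e) * D ^ e \<le> node_mean D X e' x" "node_mean D X e' x \<le> real (x div D ^ e) * D ^ e + D ^ e"
proof -
  have same: "y div D ^ e = x div D ^ e" if "y \<in> fibre X (\<lambda>b. b div D ^ e') (x div D ^ e')" for y
    using that by (intro div_pow_mono[OF e]) (simp add: fibre_def)
  have "real (x div D ^ e) * D ^ e \<le> y" "y \<le> real (x div D ^ e) * D ^ e + D ^ e"
    if "y \<in> fibre X (\<lambda>b. b div D ^ e') (x div D ^ e')" for y
    using div_interval[OF D_pos, of y e] by (simp_all add: same[OF that])
  then show "real (x div D ^ e) * D ^ e \<le> node_mean D X e' x" "node_mean D X e' x \<le> real (x div D ^ e) * D ^ e + D ^ e"
    unfolding node_mean_def by (intro fibre_avg_bounds finite_leaves x; blast)+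
qed

lemma node_mean_diff:
  assumes "x \<in> X" "y \<in> X" "x div D ^ e = y div D ^ e" and "e' \<le> e"
  shows "\<bar>node_mean D X e' x - node_mean D X e y\<bar> \<le> D ^ e"
  using node_mean_interval[OF assms(1,4)] node_mean_interval[OF assms(2) order_refl, of e] assms(3) by simp

lemma sum_node_mean:
  assumes e: "e' \<le> e" and x: "x \<in> X"
  shows "(\<Sum>v\<in>node D X e x. node_mean D X e' v - node_mean D X e x) = 0"
proof -
  have "saturated X (\<lambda>b. b div D ^ e') (node D X e x)"
    unfolding saturated_def node_iff using div_pow_mono[OF e] by metis
  then have "(\<Sum>v\<in>node D X e x. node_mean D X e' v) = (\<Sum>v\<in>node D X e x. real v)"
    unfolding node_mean_def by (rule sum_fibre_avg_saturated[OF finite_leaves node_subset])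
  moreover have "card (node D X e x) > 0"
    unfolding node_def by (rule card_fibre_pos[OF finite_leaves x])
  ultimately show ?thesis unfolding sum_subtractf by (simp add: node_mean_def fibre_avg_def node_def)
qed

end

definition wide_gap :: "nat \<Rightarrow> real \<Rightarrow> nat \<Rightarrow> nat \<Rightarrow> bool" where
  "wide_gap D h k g \<longleftrightarrow> 2 * (1 + h) * sqrt (real k) * real D ^ 3 \<le> real D ^ g"

lemma wide_gap_mono:
  assumes "wide_gap D h k g" "k' \<le> k" "0 < h"
  shows "wide_gap D h k' g"
proof -
  have "2 * (1 + h) * sqrt (real k') * real D ^ 3 \<le> 2 * (1 + h) * sqrt (real k) * real D ^ 3"
    using assms(2,3) by (intro mult_right_mono mult_left_mono) auto
  then show ?thesis using assms(1) unfolding wide_gap_def by linarith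
qed

locale weighted_tree_sum = uniform_tree +
  fixes x :: "nat \<Rightarrow> real" and l :: "nat \<Rightarrow> nat" and k :: nat and R h :: real
  assumes coefficient: "\<And>i. i < k \<Longrightarrow> \<bar>x i\<bar> * real D ^ n \<le> R / real D ^ l i"
    and D_gt_1: "D > 1" and k_pos: "k > 0" and R_pos: "R > 0" and h_pos: "h > 0"
begin

text \<open>At time \<open>t\<close> the coordinate \<open>b i\<close> is known up to its node of height \<open>n - (t - l i)\<close>, so that every
  summand \<open>x i * b i\<close> is known with the same precision \<open>R / D ^ t\<close>.\<close>

definition height :: "nat \<Rightarrow> nat \<Rightarrow> nat" where
  "height t i = n - (t - l i)"

definition precision :: "nat \<Rightarrow> real" where
  "precision t = R / real D ^ t"

definition width :: "nat \<Rightarrow> real" where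
  "width t = (1 + h) * (sqrt (real k) * precision t)"

definition approximation :: "nat \<Rightarrow> (nat \<Rightarrow> nat) \<Rightarrow> real" where
  "approximation t b = (\<Sum>i<k. x i * node_mean D X (height t i) (b i))"

definition potential :: "real \<Rightarrow> nat \<Rightarrow> (nat \<Rightarrow> nat) \<Rightarrow> real" where
  "potential z t b = exp (- \<bar>approximation t b - z\<bar> / width t)"

definition checkpoint :: "nat \<Rightarrow> nat \<Rightarrow> bool" where
  "checkpoint v t \<longleftrightarrow> (\<exists>Q e. Q \<subseteq> {..<k} \<and> card Q = 2 * v \<and> e < n \<and> 1 \<le> a (n - 1 - e) \<and>
     (\<forall>i\<in>Q. l i + e = t \<and> R / real D ^ (l i + 2) \<le> \<bar>x i\<bar> * real D ^ n))"

lemma precision_pos: "0 < precision t"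
  using R_pos D_pos by (simp add: precision_def)

lemma precision_le_width: "precision t \<le> width t"
proof -
  have "1 * 1 \<le> (1 + h) * sqrt k" using h_pos k_pos by (intro mult_mono) auto
  then show ?thesis
    unfolding width_def using mult_right_mono[of 1 "(1 + h) * sqrt k" "precision t"] precision_pos[of t] by simp
qed

lemma width_pos: "0 < width t"
  using precision_le_width[of t] precision_pos[of t] by linarith

lemma precision_antimono: "t \<le> t' \<Longrightarrow> precision t' \<le> precision t"
  unfolding precision_def using R_pos D_gt_1 by (intro divide_left_mono power_increasing) auto

lemma height_antimono: "t \<le> t' \<Longrightarrow> height t' i \<le> height t i"
  by (auto simp: height_def)

lemma coefficient_height:
  assumes i: "i < k" and t: "t \<le> n"
  shows "\<bar>x i\<bar> * real D ^ height t i \<le> precision t"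
proof (cases "l i \<le> t")
  case True
  have "real D ^ n = D ^ height t i * D ^ (t - l i)" using t by (simp add: height_def flip: power_add)
  then have "\<bar>x i\<bar> * real D ^ height t i = \<bar>x i\<bar> * real D ^ n / real D ^ (t - l i)" using D_pos by simp
  also have "\<dots> \<le> R / real D ^ l i / real D ^ (t - l i)" using coefficient[OF i] by (intro divide_right_mono) auto
  also have "\<dots> = precision t" using True by (simp add: precision_def flip: power_add)
  finally show ?thesis .
next
  case False
  have "\<bar>x i\<bar> * real D ^ height t i \<le> precision (l i)" using coefficient[OF i] False by (simp add: height_def precision_def)
  also have "\<dots> \<le> precision t" using False by (intro precision_antimono) simp
  finally show ?thesis .
qed

lemma width_gap:
  assumes gap: "wide_gap D h k g" and t: "t + g \<le> t'"
  shows "2 * width t' \<le> precision t / real D ^ 3"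
proof -
  have "2 * width t' = 2 * (1 + h) * sqrt k * precision t'" by (simp add: width_def)
  also have "\<dots> \<le> 2 * (1 + h) * sqrt k * precision (t + g)"
    using precision_antimono[OF t] h_pos by (intro mult_left_mono) auto
  also have "\<dots> = (2 * (1 + h) * sqrt k) / real D ^ g * precision t" by (simp add: precision_def power_add)
  also have "\<dots> \<le> 1 / real D ^ 3 * precision t"
    using gap D_pos precision_pos[of t] by (intro mult_right_mono) (simp_all add: wide_gap_def divide_simps)
  finally show ?thesis by simp
qed

lemma increment_split_pairs:
  assumes b: "b \<in> X" and e: "e < n" "1 \<le> a (n - 1 - e)" and t: "l i + e = t" "t < t'"
    and large: "R / real D ^ (l i + 2) \<le> \<bar>x i\<bar> * real D ^ n"
  shows "split_pairs (precision t / real D ^ 3) (\<lambda>w. x i * (node_mean D X (height t' i) w - c)) (node D X (height t i) b)"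
proof -
  define j where "j = n - 1 - e"
  have j: "j < n" "height t i = Suc j" "height t' i \<le> j" using e t by (auto simp: height_def j_def)
  have "precision t / real D ^ 3 = R / real D ^ (l i + 2) / real D ^ (e + 1)"
    unfolding precision_def t(1)[symmetric] by (simp add: power_add power2_eq_square power3_eq_cube)
  also have "\<dots> \<le> \<bar>x i\<bar> * real D ^ n / real D ^ (e + 1)" using large by (intro divide_right_mono) auto
  also have "real D ^ n = real D ^ j * real D ^ (e + 1)" using e(1) by (simp add: j_def flip: power_add power_Suc)
  then have "\<bar>x i\<bar> * real D ^ n / real D ^ (e + 1) = \<bar>x i\<bar> * real D ^ j" using D_pos by simp
  finally have "precision t / real D ^ 3 \<le> \<bar>x i\<bar> * real D ^ j" .
  moreover have "real (w div D ^ j) * D ^ j \<le> node_mean D X (height t' i) w \<and>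
      node_mean D X (height t' i) w \<le> real (w div D ^ j) * D ^ j + D ^ j" if "w \<in> node D X (Suc j) b" for w
    using node_mean_interval[OF _ j(3)] that by (simp add: node_iff)
  ultimately show ?thesis
    unfolding j(2) using e(2) by (intro node_split_pairs[OF b j(1)]) (auto simp: j_def)
qed

definition increment :: "nat \<Rightarrow> nat \<Rightarrow> (nat \<Rightarrow> nat) \<Rightarrow> nat \<Rightarrow> nat \<Rightarrow> real" where
  "increment t t' b i w = x i * (node_mean D X (height t' i) w - node_mean D X (height t i) (b i))"

lemma sum_increment:
  assumes "t \<le> t'" "b i \<in> X"
  shows "(\<Sum>w\<in>node D X (height t i) (b i). increment t t' b i w) = 0"
  unfolding increment_def sum_distrib_left[symmetric] using sum_node_mean[OF height_antimono assms(2)] assms(1) by simp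

lemma abs_increment_le:
  assumes i: "i < k" and t: "t \<le> t'" "t \<le> n" and b: "b i \<in> X" and w: "w \<in> node D X (height t i) (b i)"
  shows "\<bar>increment t t' b i w\<bar> \<le> precision t"
proof -
  have "\<bar>node_mean D X (height t' i) w - node_mean D X (height t i) (b i)\<bar> \<le> D ^ height t i"
    using w t(1) b by (intro node_mean_diff height_antimono) (auto simp: node_iff)
  then have "\<bar>increment t t' b i w\<bar> \<le> \<bar>x i\<bar> * D ^ height t i"
    unfolding increment_def abs_mult by (intro mult_left_mono) auto
  then show ?thesis using coefficient_height[OF i t(2)] by simp
qed

lemma approximation_increment:
  "approximation t' b' - z = approximation t b - z + (\<Sum>i\<in>{..<k}. increment t t' b i (b' i))"
  unfolding approximation_def increment_def by (simp add: right_diff_distrib sum_subtractf)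

lemma potential_node_cong:
  assumes "b' \<in> PiE {..<k} (\<lambda>i. node D X (height t i) (b i))"
  shows "potential z t b' = potential z t b"
proof -
  have "node_mean D X (height t i) (b' i) = node_mean D X (height t i) (b i)" if "i < k" for i
    unfolding node_mean_def using PiE_mem[OF assms, of i] that by (intro fibre_avg_const) (simp add: node_iff)
  then show ?thesis by (simp add: potential_def approximation_def)
qed

lemma potential_node_step:
  assumes check: "checkpoint v t" and gap: "wide_gap D h k g" and t: "t + g \<le> t'" "t \<le> n" and s: "0 \<le> s"
    and b: "b \<in> PiE {..<k} (\<lambda>_. X)"
  defines "V \<equiv> \<lambda>i. node D X (height t i) (b i)"
  shows "(\<Sum>b'\<in>PiE {..<k} V. potential z t' b') \<le> decay_factor v h s * (\<Sum>b'\<in>PiE {..<k} V. potential z t b')"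
proof -
  obtain Q e where Q: "Q \<subseteq> {..<k}" "card Q = 2 * v" and e: "e < n" "1 \<le> a (n - 1 - e)"
    and Q_level: "\<And>i. i \<in> Q \<Longrightarrow> l i + e = t" "\<And>i. i \<in> Q \<Longrightarrow> R / real D ^ (l i + 2) \<le> \<bar>x i\<bar> * real D ^ n"
    using check unfolding checkpoint_def by blast
  have bX: "b i \<in> X" if "i < k" for i using b that by (auto simp: PiE_iff)
  have "precision t / real D ^ 3 \<le> precision t" using precision_pos[of t] D_gt_1 by (simp add: divide_le_eq)
  then have widths: "2 * width r \<le> width t" if "t + g \<le> r" for r
    using width_gap[OF gap that] precision_le_width[of t] by linarith
  from widths[of t] have "g \<noteq> 0" using width_pos[of t] by (cases "g = 0") auto
  then have tt': "t < t'" using t(1) by simp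
  have split: "split_pairs (precision t / real D ^ 3) (increment t t' b i) (V i)" if "i \<in> Q" for i
    unfolding increment_def V_def
    by (rule increment_split_pairs[OF bX e Q_level(1)[OF that] tt' Q_level(2)[OF that]]) (use that Q(1) in auto)
  have "(\<Sum>b'\<in>PiE {..<k} V. potential z t' b') =
      (\<Sum>b'\<in>PiE {..<k} V. exp (- \<bar>approximation t b - z + (\<Sum>i\<in>{..<k}. increment t t' b i (b' i))\<bar> / width t'))"
    by (simp only: potential_def approximation_increment[of t' _ z t b])
  also have "\<dots> \<le> decay_factor v h s * (\<Prod>i\<in>{..<k}. real (card (V i))) * exp (- \<bar>approximation t b - z\<bar> / width t)"
    using Q split widths[OF t(1)] width_gap[OF gap t(1)] k_pos h_pos s finite_node[OF finite_leaves] width_pos[of t']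
      sum_increment[of t t' b] abs_increment_le[of _ t t' b] bX tt' t(2)
    by (intro potential_step[where Q = Q and d = "precision t / real D ^ 3" and R = "precision t"])
      (auto simp: width_def[of t] V_def)
  also have "\<dots> = decay_factor v h s * (\<Sum>b'\<in>PiE {..<k} V. potential z t b)"
    by (simp add: card_PiE potential_def)
  also have "\<dots> = decay_factor v h s * (\<Sum>b'\<in>PiE {..<k} V. potential z t b')"
    using potential_node_cong[where b = b and t = t] by (simp add: V_def)
  finally show ?thesis .
qed

lemma sum_potential_le:
  assumes gap: "wide_gap D h k g" and s: "0 \<le> s"
    and T: "\<And>r. r < N \<Longrightarrow> T r + g \<le> T (Suc r)" "\<And>r. r < N \<Longrightarrow> checkpoint v (T r)" "T N \<le> n"
  shows "r \<le> N \<Longrightarrow> (\<Sum>b\<in>PiE {..<k} (\<lambda>_. X). potential z (T r) b) \<le> decay_factor v h s ^ r * card X ^ k"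
proof (induction r)
  case 0
  have "(\<Sum>b\<in>PiE {..<k} (\<lambda>_. X). potential z (T 0) b) \<le> (\<Sum>b\<in>PiE {..<k} (\<lambda>_. X). 1)"
    using width_pos[of "T 0"] by (intro sum_mono) (simp add: potential_def)
  then show ?case by (simp add: card_PiE)
next
  case (Suc r)
  have "T r \<le> T N" if "r \<le> N" for r
    using that
  proof (induction rule: inc_induct)
    case (step r)
    then show ?case using T(1)[of r] by linarith
  qed simp
  from this[of r] Suc.prems have "T r \<le> n" using T(3) by linarith
  then have "(\<Sum>b\<in>PiE {..<k} (\<lambda>_. X). potential z (T (Suc r)) b) \<le>
      decay_factor v h s * (\<Sum>b\<in>PiE {..<k} (\<lambda>_. X). potential z (T r) b)"
    using Suc.prems T(1,2) gap s finite_leaves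
    by (intro sum_node_tuples[where D = D and e = "height (T r)"] potential_node_step[where g = g]) auto
  also have "\<dots> \<le> decay_factor v h s * (decay_factor v h s ^ r * card X ^ k)"
    using Suc decay_factor_nonneg by (intro mult_left_mono) auto
  finally show ?case by simp
qed

lemma potential_close_tuple:
  assumes b: "b \<in> close_tuples X k x z" and t: "t \<le> n" "real D ^ t \<le> R"
  shows "1 \<le> exp (3 * k) * potential z t b"
proof -
  have precision: "1 \<le> precision t" using t(2) D_pos by (simp add: precision_def)
  have "\<bar>x i * (node_mean D X (height t i) (b i) - real (b i))\<bar> \<le> precision t" if i: "i < k" for i
  proof -
    have "b i \<in> X" using b i by (auto simp: close_tuples_def PiE_iff)
    then have "\<bar>node_mean D X (height t i) (b i) - real (b i)\<bar> \<le> D ^ height t i"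
      using node_mean_interval[OF _ order_refl, of "b i" "height t i"] div_interval[OF D_pos, of "b i" "height t i"]
      unfolding abs_le_iff by linarith
    then have "\<bar>x i * (node_mean D X (height t i) (b i) - real (b i))\<bar> \<le> \<bar>x i\<bar> * real D ^ height t i"
      unfolding abs_mult by (intro mult_left_mono) auto
    then show ?thesis using coefficient_height[OF i t(1)] by linarith
  qed
  then have "(\<Sum>i<k. \<bar>x i * (node_mean D X (height t i) (b i) - real (b i))\<bar>) \<le> real (card {..<k}) * precision t"
    by (intro sum_bounded_above) auto
  then have "\<bar>approximation t b - (\<Sum>i<k. x i * real (b i))\<bar> \<le> k * precision t"
    using sum_abs[of "\<lambda>i. x i * (node_mean D X (height t i) (b i) - real (b i))" "{..<k}"]
    by (simp add: approximation_def right_diff_distrib sum_subtractf)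
  moreover have "\<bar>(\<Sum>i<k. x i * real (b i)) - z\<bar> \<le> 2 * k" using b by (simp add: close_tuples_def)
  ultimately have "\<bar>approximation t b - z\<bar> \<le> k * precision t + 2 * k" by linarith
  also have "\<dots> \<le> 3 * k * precision t" using mult_left_mono[OF precision, of "real k"] by simp
  also have "\<dots> \<le> 3 * k * width t" using precision_le_width[of t] by (intro mult_left_mono) auto
  finally have "\<bar>approximation t b - z\<bar> / width t \<le> 3 * k" using width_pos[of t] by (simp add: field_simps)
  then have "exp 0 \<le> exp (3 * k + - \<bar>approximation t b - z\<bar> / width t)" by (subst exp_le_cancel_iff) simp
  then show ?thesis unfolding potential_def exp_add by simp
qed

theorem anticoncentration:
  assumes gap: "wide_gap D h k g" and s: "0 \<le> s"
    and T: "\<And>r. r < N \<Longrightarrow> T r + g \<le> T (Suc r)" "\<And>r. r < N \<Longrightarrow> checkpoint v (T r)" "T N \<le> n" "real D ^ T N \<le> R"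
  shows "card (close_tuples X k x z) \<le> exp (3 * k) * decay_factor v h s ^ N * card X ^ k"
proof -
  let ?BB = "PiE {..<k} (\<lambda>_. X)"
  have "finite ?BB" using finite_leaves by (intro finite_PiE) auto
  have "real (card (close_tuples X k x z)) \<le> (\<Sum>b\<in>close_tuples X k x z. exp (3 * k) * potential z (T N) b)"
    unfolding real_of_card by (intro sum_mono potential_close_tuple T(3,4))
  also have "\<dots> \<le> (\<Sum>b\<in>?BB. exp (3 * k) * potential z (T N) b)"
    using \<open>finite ?BB\<close> by (intro sum_mono2) (auto simp: close_tuples_def potential_def)
  also have "\<dots> = exp (3 * k) * (\<Sum>b\<in>?BB. potential z (T N) b)" by (simp only: sum_distrib_left)
  also have "\<dots> \<le> exp (3 * k) * (decay_factor v h s ^ N * card X ^ k)"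
    using sum_potential_le[OF gap s T(1-3) order_refl] by (intro mult_left_mono) auto
  finally show ?thesis by (simp only: mult.assoc)
qed

end

section \<open>Greedy choice of levels\<close>

definition stage_loss :: "real \<Rightarrow> nat \<Rightarrow> nat \<Rightarrow> nat \<Rightarrow> real" where
  "stage_loss \<rho> n D q = zigzag_share \<rho> n D q / (real n + 1)"

lemma stage_loss_pos: "0 < \<rho> \<Longrightarrow> 0 < D \<Longrightarrow> 0 < stage_loss \<rho> n D q"
  by (simp add: stage_loss_def zigzag_share_pos)

lemma stage_loss_le_1:
  assumes \<rho>: "0 < \<rho>" "\<rho> \<le> 1" and D: "0 < D"
  shows "stage_loss \<rho> n D q \<le> 1"
proof -
  have "1 * 1 \<le> (2 * (real n + 1)) * real D" using D by (intro mult_mono) auto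
  then have "\<rho> / (2 * (real n + 1) * real D) \<le> 1" using \<rho> by (simp add: divide_le_eq_1)
  then have "(\<rho> / (2 * (real n + 1) * real D)) ^ Suc q \<le> 1" using \<rho> by (intro power_le_one) auto
  then have "zigzag_share \<rho> n D q \<le> 1 * 1"
    unfolding zigzag_share_def using \<rho> by (intro mult_mono) auto
  then show ?thesis by (simp add: stage_loss_def divide_le_eq_1)
qed

lemma (in rooted_uniform_tree) common_zigzag:
  fixes S :: "'h \<Rightarrow> nat set" and \<rho> :: real
  assumes H: "finite H" "H \<noteq> {}" and \<rho>: "0 < \<rho>"
    and S: "\<And>h. h \<in> H \<Longrightarrow> S h \<subseteq> X" "\<And>h. h \<in> H \<Longrightarrow> \<rho> * card X \<le> card (S h)"
    and L: "L \<subseteq> {..<n}" "\<And>i. i \<in> L \<Longrightarrow> 1 \<le> a i" "(4 / \<rho>)\<^sup>2 \<le> 2 ^ card L"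
  obtains i f where "i \<in> L" "f \<in> zigzags D q i X" "stage_loss \<rho> n D q * card H \<le> card {h\<in>H. \<forall>j\<le>q. f j \<in> S h}"
proof -
  define \<kappa> where "\<kappa> = zigzag_share \<rho> n D q"
  have \<kappa>: "0 < \<kappa>" using \<rho> D_pos by (simp add: \<kappa>_def zigzag_share_pos)
  define size where "size i = real (card X * leaf_count a (Suc i) ^ q)" for i
  have "\<exists>i\<in>L. \<kappa> * size i \<le> card (zigzags D q i (S h))" if h: "h \<in> H" for h
    by (rule many_zigzags[OF S(1)[OF h] \<rho> S(2)[OF h] L, of q]) (auto simp: \<kappa>_def size_def)
  then obtain g where g: "\<And>h. h \<in> H \<Longrightarrow> g h \<in> L" "\<And>h. h \<in> H \<Longrightarrow> \<kappa> * size (g h) \<le> card (zigzags D q (g h) (S h))"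
    by metis
  have finL: "finite L" "L \<noteq> {}" using L(1) finite_subset H(2) g(1) by auto
  obtain i where i: "i \<in> L" and popular: "card H / card L \<le> card (fibre H g i)"
    using popular_value[OF H(1) finL, of g] g(1) by blast
  let ?H = "fibre H g i" and ?Z = "zigzags D q i X"
  have card_pos: "0 < card L" "0 < card H" using finL H by (simp_all add: card_gt_0_iff)
  have "card L \<le> n" using card_mono[OF _ L(1)] by simp
  then have "card H / (real n + 1) \<le> card H / card L" using card_pos by (intro divide_left_mono) auto
  then have card_Hi: "card H / (real n + 1) \<le> card ?H" using popular by linarith
  moreover have "0 < card H / (real n + 1)" using card_pos by simp
  ultimately have "?H \<noteq> {}" by (metis card.empty of_nat_0 not_le)
  then obtain h where h: "h \<in> ?H" by blast
  have sub: "zigzags D q i (S h) \<subseteq> ?Z" if "h \<in> ?H" for h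
    using that S(1) by (intro zigzags_mono) (auto simp: fibre_def)
  have share: "\<kappa> * size i \<le> card (zigzags D q i (S h))" if "h \<in> ?H" for h
    using that g(2)[of h] by (auto simp: fibre_def)
  have "card ?Z \<le> size i"
    unfolding size_def using card_zigzags_le[of i q] i L(1) by (intro of_nat_mono) auto
  then have "\<kappa> * card ?Z \<le> \<kappa> * size i" using \<kappa> by simp
  then have popular_share: "\<kappa> * card ?Z \<le> card (zigzags D q i (S h))" if "h \<in> ?H" for h using share[OF that] by linarith
  have "0 < \<kappa> * size i" using \<kappa> card_X_pos by (simp add: size_def leaf_count_pos)
  then have "?Z \<noteq> {}" using share[OF h] sub[OF h] by auto
  then have "\<exists>f\<in>?Z. \<kappa> * card ?H \<le> card {h\<in>?H. f \<in> zigzags D q i (S h)}"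
    by (intro popular_point finite_fibre[OF H(1)] finite_zigzags[OF finite_leaves] sub popular_share)
  then obtain f where f: "f \<in> ?Z" "\<kappa> * card ?H \<le> card {h\<in>?H. f \<in> zigzags D q i (S h)}" by blast
  have "stage_loss \<rho> n D q * card H = \<kappa> * (card H / (real n + 1))" by (simp add: stage_loss_def \<kappa>_def)
  also have "\<dots> \<le> \<kappa> * card ?H" using card_Hi \<kappa> by (intro mult_left_mono) auto
  also have "\<dots> \<le> card {h\<in>?H. f \<in> zigzags D q i (S h)}" by (rule f(2))
  also have "\<dots> \<le> card {h\<in>H. \<forall>j\<le>q. f j \<in> S h}"
    using H(1) zigzag_mem by (intro of_nat_mono card_mono) (auto simp: fibre_def)
  finally show ?thesis by (rule that[OF i f(1)])
qed

text \<open>Levels are counted from the root: level \<open>l\<close> consists of the nodes of height \<open>n - 1 - l\<close>.\<close>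

definition shared_zigzags :: "nat \<Rightarrow> nat \<Rightarrow> nat \<Rightarrow> nat set \<Rightarrow> ('h \<Rightarrow> nat set) \<Rightarrow> nat set \<Rightarrow> (nat \<Rightarrow> nat \<Rightarrow> nat) \<Rightarrow> 'h set \<Rightarrow> bool" where
  "shared_zigzags D q n X S F f H \<longleftrightarrow>
     (\<forall>l\<in>F. f l \<in> zigzags D q (n - 1 - l) X \<and> (\<forall>h\<in>H. \<forall>j\<le>q. f l j \<in> S h))"

lemma (in rooted_uniform_tree) extend_shared_zigzags:
  fixes S :: "'h \<Rightarrow> nat set" and \<rho> :: real
  assumes H: "finite H" "H \<noteq> {}" and \<rho>: "0 < \<rho>"
    and S: "\<And>h. h \<in> H \<Longrightarrow> S h \<subseteq> X" "\<And>h. h \<in> H \<Longrightarrow> \<rho> * card X \<le> card (S h)"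
    and L: "L \<subseteq> {..<n}" "\<And>l. l \<in> L \<Longrightarrow> 1 \<le> a (n - 1 - l)" "(4 / \<rho>)\<^sup>2 \<le> 2 ^ card L"
    and shared: "shared_zigzags D q n X S F f H"
  obtains l H' f' where "l \<in> L" "H' \<subseteq> H" "stage_loss \<rho> n D q * card H \<le> card H'"
    "shared_zigzags D q n X S (insert l F) f' H'"
proof -
  have "inj_on (\<lambda>l. n - 1 - l) L"
  proof (rule inj_onI)
    fix x y assume "x \<in> L" "y \<in> L" "n - 1 - x = n - 1 - y"
    moreover from this have "x < n" "y < n" using L(1) by auto
    ultimately show "x = y" by linarith
  qed
  then have big: "(4 / \<rho>)\<^sup>2 \<le> 2 ^ card ((\<lambda>l. n - 1 - l) ` L)" using L(3) by (simp add: card_image)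
  have heights: "(\<lambda>l. n - 1 - l) ` L \<subseteq> {..<n}" "\<And>i. i \<in> (\<lambda>l. n - 1 - l) ` L \<Longrightarrow> 1 \<le> a i" using L(1,2) by auto
  obtain i f' where i: "i \<in> (\<lambda>l. n - 1 - l) ` L" and f': "f' \<in> zigzags D q i X"
    and large: "stage_loss \<rho> n D q * card H \<le> card {h\<in>H. \<forall>j\<le>q. f' j \<in> S h}"
    by (rule common_zigzag[OF H \<rho> S heights big])
  obtain l where l: "l \<in> L" "i = n - 1 - l" using i by blast
  have "shared_zigzags D q n X S (insert l F) (f(l := f')) {h\<in>H. \<forall>j\<le>q. f' j \<in> S h}"
    using shared f' by (auto simp: shared_zigzags_def l(2))
  then show ?thesis by (intro that[OF l(1) _ large]) auto
qed

lemma thick_insert_plus: "thick n P (insert l F + A) = thick n P ((+) l ` A) \<union> thick n P (F + A)"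
  by (auto simp: thick_def set_plus_def)

lemma card_thick_le: "card (thick n P A) \<le> n"
  using card_mono[OF _ thick_subset] by fastforce

definition fresh_levels :: "nat \<Rightarrow> nat \<Rightarrow> nat set \<Rightarrow> nat set \<Rightarrow> real \<Rightarrow> nat set \<Rightarrow> nat set" where
  "fresh_levels n P A L \<epsilon> F =
     {l\<in>L. \<epsilon> * real n < real (card (thick n (2 * P) ((+) l ` A) - thick n (2 * P) (F + A)))}"

lemma fresh_levels_subset: "fresh_levels n P A L \<epsilon> F \<subseteq> L"
  by (auto simp: fresh_levels_def)

lemma card_thick_insert_fresh:
  fixes \<epsilon> :: real
  assumes "l \<in> fresh_levels n P A L \<epsilon> F"
  shows "card (thick n (2 * P) (F + A)) + \<epsilon> * n \<le> card (thick n (2 * P) (insert l F + A))"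
proof -
  let ?old = "thick n (2 * P) (F + A)" and ?new = "thick n (2 * P) ((+) l ` A)"
  have "card (?old \<union> (?new - ?old)) = card ?old + card (?new - ?old)"
    by (intro card_Un_disjoint) (auto simp: finite_thick)
  then show ?thesis using assms by (simp add: thick_insert_plus fresh_levels_def Un_commute)
qed

definition greedy_selection ::
  "real \<Rightarrow> nat \<Rightarrow> nat \<Rightarrow> nat \<Rightarrow> nat set \<Rightarrow> ('h \<Rightarrow> nat set) \<Rightarrow> nat set \<Rightarrow> 'h set \<Rightarrow> nat \<Rightarrow>
    nat set \<Rightarrow> (nat \<Rightarrow> nat \<Rightarrow> nat) \<Rightarrow> 'h set \<Rightarrow> bool" where
  "greedy_selection \<kappa> D q n X S L H t F f H' \<longleftrightarrow> F \<subseteq> L \<and> card F \<le> t \<and> H' \<subseteq> H \<and> \<kappa> ^ t * card H \<le> card H' \<and>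
     shared_zigzags D q n X S F f H'"

lemma greedy_selection_Suc:
  assumes "greedy_selection \<kappa> D q n X S L H t F f H'" "0 \<le> \<kappa>" "\<kappa> \<le> 1"
  shows "greedy_selection \<kappa> D q n X S L H (Suc t) F f H'"
proof -
  have "\<kappa> ^ Suc t * card H \<le> \<kappa> ^ t * card H" using assms(2,3) by (intro mult_right_mono power_decreasing) auto
  then show ?thesis using assms(1) unfolding greedy_selection_def by linarith
qed

lemma (in rooted_uniform_tree) greedy_selection_step:
  fixes S :: "'h \<Rightarrow> nat set" and \<rho> \<epsilon> :: real
  assumes H: "finite H" "H \<noteq> {}" and \<rho>: "0 < \<rho>"
    and S: "\<And>h. h \<in> H \<Longrightarrow> S h \<subseteq> X" "\<And>h. h \<in> H \<Longrightarrow> \<rho> * card X \<le> card (S h)"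
    and L: "L \<subseteq> {..<n}" "\<And>l. l \<in> L \<Longrightarrow> 1 \<le> a (n - 1 - l)"
    and sel: "greedy_selection (stage_loss \<rho> n D q) D q n X S L H t F f H'"
    and big: "(4 / \<rho>)\<^sup>2 \<le> 2 ^ card (fresh_levels m P A L \<epsilon> F)"
  obtains l f' H'' where "l \<in> fresh_levels m P A L \<epsilon> F"
    "greedy_selection (stage_loss \<rho> n D q) D q n X S L H (Suc t) (insert l F) f' H''"
proof -
  let ?\<kappa> = "stage_loss \<rho> n D q" and ?L = "fresh_levels m P A L \<epsilon> F"
  have \<kappa>: "0 < ?\<kappa>" using \<rho> D_pos by (simp add: stage_loss_pos)
  have H': "H' \<subseteq> H" "finite H'" using sel H finite_subset by (auto simp: greedy_selection_def)
  have "0 < ?\<kappa> ^ t * card H" using \<kappa> H by (simp add: card_gt_0_iff)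
  then have nonempty': "H' \<noteq> {}" using sel by (auto simp: greedy_selection_def)
  have S': "\<And>h. h \<in> H' \<Longrightarrow> S h \<subseteq> X" "\<And>h. h \<in> H' \<Longrightarrow> \<rho> * card X \<le> card (S h)" using S H'(1) by blast+
  have L': "?L \<subseteq> {..<n}" "\<And>l. l \<in> ?L \<Longrightarrow> 1 \<le> a (n - 1 - l)" using L fresh_levels_subset by blast+
  have shared: "shared_zigzags D q n X S F f H'" using sel by (simp add: greedy_selection_def)
  obtain l H'' f' where l: "l \<in> ?L" and H'': "H'' \<subseteq> H'" "?\<kappa> * card H' \<le> card H''"
    and shared': "shared_zigzags D q n X S (insert l F) f' H''"
    by (rule extend_shared_zigzags[OF H'(2) nonempty' \<rho> S' L' big shared])
  have "finite F" using sel L(1) finite_subset[of F "{..<n}"] by (auto simp: greedy_selection_def)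
  then have "card (insert l F) \<le> Suc t" using sel by (simp add: greedy_selection_def card_insert_if)
  moreover have "?\<kappa> ^ Suc t * card H \<le> ?\<kappa> * card H'" using sel \<kappa> by (simp add: greedy_selection_def mult.assoc)
  ultimately have "greedy_selection ?\<kappa> D q n X S L H (Suc t) (insert l F) f' H''"
    using sel H'' shared' l fresh_levels_subset[of m P A L \<epsilon> F] unfolding greedy_selection_def by auto
  then show ?thesis by (rule that[OF l])
qed

theorem (in rooted_uniform_tree) greedy_zigzags:
  fixes S :: "'h \<Rightarrow> nat set" and \<rho> \<epsilon> :: real
  assumes H: "finite H" "H \<noteq> {}" and \<rho>: "0 < \<rho>" "\<rho> \<le> 1"
    and S: "\<And>h. h \<in> H \<Longrightarrow> S h \<subseteq> X" "\<And>h. h \<in> H \<Longrightarrow> \<rho> * card X \<le> card (S h)"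
    and m: "0 < m" and L: "L \<subseteq> {..<n}" "\<And>l. l \<in> L \<Longrightarrow> 1 \<le> a (n - 1 - l)"
    and big: "\<And>y::nat. \<epsilon> * m < y \<Longrightarrow> (4 / \<rho>)\<^sup>2 \<le> 2 ^ y" and r: "1 < r * \<epsilon>"
  obtains F f H' where "greedy_selection (stage_loss \<rho> n D q) D q n X S L H r F f H'"
    "card (fresh_levels m P A L \<epsilon> F) \<le> \<epsilon> * m"
proof -
  let ?\<kappa> = "stage_loss \<rho> n D q" and ?covered = "\<lambda>F. card (thick m (2 * P) (F + A))"
  have \<kappa>: "0 \<le> ?\<kappa>" "?\<kappa> \<le> 1" using \<rho> D_pos by (simp_all add: stage_loss_pos stage_loss_le_1 less_imp_le)
  have "\<exists>F f H'. greedy_selection ?\<kappa> D q n X S L H t F f H' \<and>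
      (card (fresh_levels m P A L \<epsilon> F) \<le> \<epsilon> * m \<or> t * (\<epsilon> * m) \<le> ?covered F)" for t
  proof (induction t)
    case 0
    have "greedy_selection ?\<kappa> D q n X S L H 0 {} f H" for f by (simp add: greedy_selection_def shared_zigzags_def)
    then show ?case by (metis mult_zero_left of_nat_0 of_nat_0_le_iff)
  next
    case (Suc t)
    then obtain F f H' where sel: "greedy_selection ?\<kappa> D q n X S L H t F f H'"
      and progress: "card (fresh_levels m P A L \<epsilon> F) \<le> \<epsilon> * m \<or> t * (\<epsilon> * m) \<le> ?covered F" by blast
    show ?case
    proof (cases "card (fresh_levels m P A L \<epsilon> F) \<le> \<epsilon> * m")
      case True
      then show ?thesis using greedy_selection_Suc[OF sel \<kappa>] by blast
    next
      case False
      then have large: "(4 / \<rho>)\<^sup>2 \<le> 2 ^ card (fresh_levels m P A L \<epsilon> F)" by (intro big) simp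
      obtain l f' H'' where l: "l \<in> fresh_levels m P A L \<epsilon> F"
        and sel': "greedy_selection ?\<kappa> D q n X S L H (Suc t) (insert l F) f' H''"
        by (rule greedy_selection_step[OF H \<rho>(1) S L sel large])
      have "Suc t * (\<epsilon> * m) \<le> ?covered (insert l F)"
        using progress False card_thick_insert_fresh[OF l] by (simp add: distrib_right)
      then show ?thesis using sel' by blast
    qed
  qed
  from this[of r] obtain F f H' where sel: "greedy_selection ?\<kappa> D q n X S L H r F f H'"
    and progress: "card (fresh_levels m P A L \<epsilon> F) \<le> \<epsilon> * m \<or> r * (\<epsilon> * m) \<le> ?covered F" by blast
  have "real m < r * (\<epsilon> * m)" using mult_strict_right_mono[OF r, of "real m"] m by (simp add: mult.assoc)
  moreover have "real (?covered F) \<le> real m" using card_thick_le by (rule of_nat_mono)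
  ultimately have "card (fresh_levels m P A L \<epsilon> F) \<le> \<epsilon> * m" using progress by linarith
  then show ?thesis by (rule that[OF sel])
qed

definition spaced :: "nat \<Rightarrow> nat set \<Rightarrow> nat \<Rightarrow> (nat \<Rightarrow> nat) \<Rightarrow> bool" where
  "spaced g G N T \<longleftrightarrow> (\<forall>r<N. T r \<in> G) \<and> (\<forall>r. Suc r < N \<longrightarrow> T r + g \<le> T (Suc r))"

lemma spaced_Cons:
  assumes "spaced g {t\<in>G. t0 + g \<le> t} N T" "t0 \<in> G"
  shows "spaced g G (Suc N) (case_nat t0 T)"
  unfolding spaced_def
proof (intro conjI allI impI)
  show "case_nat t0 T r \<in> G" if "r < Suc N" for r
    using that assms by (cases r) (auto simp: spaced_def)
  show "case_nat t0 T r + g \<le> case_nat t0 T (Suc r)" if "Suc r < Suc N" for r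
    using that assms by (cases r) (auto simp: spaced_def)
qed

lemma exists_spaced:
  assumes "finite G" "E \<subseteq> (\<Union>t\<in>G. {t..<t + w})" "0 < g"
  shows "\<exists>N T. spaced g G N T \<and> card E \<le> N * (g + w)"
  using assms(1,2)
proof (induction "card G" arbitrary: G E rule: less_induct)
  case less
  show ?case
  proof (cases "G = {}")
    case True
    then show ?thesis using less.prems by (intro exI[of _ 0]) (simp add: spaced_def)
  next
    case False
    define t0 where "t0 = Min G"
    have t0: "t0 \<in> G" "\<And>t. t \<in> G \<Longrightarrow> t0 \<le> t" using False less.prems(1) by (auto simp: t0_def)
    let ?G = "{t\<in>G. t0 + g \<le> t}" and ?E = "E - {t0..<t0 + (g + w)}"
    have "t0 \<notin> ?G" "?G \<subseteq> G" using assms(3) by auto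
    then have "?G \<subset> G" using t0(1) by blast
    then have smaller: "card ?G < card G" using less.prems(1) by (rule psubset_card_mono[rotated])
    have covered: "?E \<subseteq> (\<Union>t\<in>?G. {t..<t + w})"
    proof
      fix x assume x: "x \<in> ?E"
      then obtain t where t: "t \<in> G" "t \<le> x" "x < t + w" using less.prems(2) by auto
      then have "t0 + g \<le> t" using x t0(2)[OF t(1)] by auto
      then show "x \<in> (\<Union>t\<in>?G. {t..<t + w})" using t by auto
    qed
    have "\<exists>N T. spaced g ?G N T \<and> card ?E \<le> N * (g + w)"
      by (rule less.hyps[OF smaller _ covered]) (use less.prems(1) in simp)
    then obtain N T where NT: "spaced g ?G N T" "card ?E \<le> N * (g + w)" by blast
    have "finite E" using less.prems by (intro finite_subset[OF less.prems(2)]) auto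
    then have "card E \<le> card (?E \<union> {t0..<t0 + (g + w)})" by (intro card_mono) auto
    also have "\<dots> \<le> card ?E + card {t0..<t0 + (g + w)}" by (rule card_Un_le)
    finally have "card E \<le> Suc N * (g + w)" using NT(2) by simp
    then show ?thesis using spaced_Cons[OF NT(1) t0(1)] by blast
  qed
qed

section \<open>Walks along zigzags\<close>

definition katz_tao_ints :: "real \<Rightarrow> int set \<Rightarrow> bool" where
  "katz_tao_ints s A \<longleftrightarrow> (\<forall>z r. 1 \<le> r \<longrightarrow> real (card {x\<in>A. \<bar>real_of_int x - real_of_int z\<bar> \<le> r}) \<le> r powr s)"

lemma katz_tao_intsD:
  "katz_tao_ints s A \<Longrightarrow> 1 \<le> r \<Longrightarrow> real (card {x\<in>A. \<bar>real_of_int x - real_of_int z\<bar> \<le> r}) \<le> r powr s"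
  by (simp add: katz_tao_ints_def)

locale zigzag_sequence = rooted_uniform_tree +
  fixes F :: "nat set" and lv :: "nat \<Rightarrow> nat" and f :: "nat \<Rightarrow> nat \<Rightarrow> nat" and q :: nat
  assumes F: "F \<subseteq> {..<n}" "F \<noteq> {}" and lv: "bij_betw lv {..<card F} F"
    and zigzag: "\<And>l. l \<in> F \<Longrightarrow> f l \<in> zigzags D q (n - 1 - l) X" and q_pos: "0 < q" and D_gt_1: "1 < D"
begin

definition position :: "nat \<Rightarrow> nat" where
  "position i = f (lv (i div (q + 1))) (i mod (q + 1))"

definition level :: "nat \<Rightarrow> nat" where
  "level i = (if i mod (q + 1) < q then lv (i div (q + 1)) else 0)"

definition steps :: nat where
  "steps = card F * (q + 1) - 1"

lemma card_F_pos: "0 < card F"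
  using F finite_subset[of F "{..<n}"] by (simp add: card_gt_0_iff)

lemma Suc_steps: "steps + 1 = card F * (q + 1)"
  using card_F_pos by (simp add: steps_def)

lemma steps_pos: "0 < steps"
proof -
  have "1 * 2 \<le> card F * (q + 1)" using card_F_pos q_pos by (intro mult_le_mono) auto
  then show ?thesis using Suc_steps by linarith
qed

lemma block_mem:
  assumes "i \<le> steps"
  shows "lv (i div (q + 1)) \<in> F" "i mod (q + 1) \<le> q"
proof -
  have "i < card F * (q + 1)" using assms Suc_steps by linarith
  then have "i div (q + 1) < card F" by (simp add: less_mult_imp_div_less)
  then show "lv (i div (q + 1)) \<in> F" using lv by (auto simp: bij_betw_def)
  show "i mod (q + 1) \<le> q" using mod_less_divisor[of "q + 1" i] by linarith
qed

lemma position_mem: "i \<le> steps \<Longrightarrow> position i \<in> X"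
  unfolding position_def using zigzag_mem[OF zigzag] block_mem by blast

lemma position_zigzag:
  assumes i: "i < steps" "i mod (q + 1) < q"
  shows "level i \<in> F" "position i = f (level i) (i mod (q + 1))" "position (Suc i) = f (level i) (Suc (i mod (q + 1)))"
  using block_mem(1)[of i] i by (auto simp: level_def position_def div_Suc mod_Suc)

lemma step_le:
  assumes i: "i < steps"
  shows "\<bar>real (position (Suc i)) - real (position i)\<bar> \<le> real D ^ n / real D ^ level i"
proof -
  have "\<bar>real (position (Suc i)) - real (position i)\<bar> \<le> real D ^ (n - level i) \<and> level i \<le> n"
  proof (cases "i mod (q + 1) < q")
    case True
    note pos = position_zigzag[OF i True]
    then have height: "Suc (n - 1 - level i) = n - level i" "level i \<le> n" using F(1) by auto
    have "position (Suc i) div D ^ (n - level i) = position i div D ^ (n - level i)"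
      using zigzag_same_parent[OF zigzag[OF pos(1)], of "Suc (i mod (q + 1))" "i mod (q + 1)"] True
      unfolding pos(2,3) height(1) by simp
    then show ?thesis using same_node_diff[OF D_pos, of "position (Suc i)"] height(2) by fastforce
  next
    case False
    have "position (Suc i) div D ^ n = position i div D ^ n" using i by (intro root position_mem) auto
    then show ?thesis using False same_node_diff[OF D_pos, of "position (Suc i)" n] by (fastforce simp: level_def)
  qed
  then show ?thesis using power_diff[of "real D" "level i" n] D_pos by simp
qed

lemma step_ge:
  assumes i: "i < steps" "i mod (q + 1) < q"
  shows "real D ^ n / real D ^ (level i + 2) \<le> \<bar>real (position (Suc i)) - real (position i)\<bar>"
proof -
  note pos = position_zigzag[OF i]
  have lt: "level i < n" using pos(1) F(1) by auto
  have "real D ^ n / real D ^ (level i + 2) \<le> real D ^ n / real D ^ (level i + 1)"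
    using D_gt_1 by (intro divide_left_mono power_increasing) auto
  also have "\<dots> = real D ^ (n - (level i + 1))" using lt D_pos by (simp add: power_diff)
  also have "\<dots> \<le> \<bar>real (position (Suc i)) - real (position i)\<bar>"
    using zigzag_gap[OF _ zigzag[OF pos(1)] i(2)] lt by (simp add: pos(2,3))
  finally show ?thesis .
qed

lemma block_of_level:
  assumes "l \<in> F"
  obtains Q where "Q \<subseteq> {..<steps}" "card Q = q" "\<And>i. i \<in> Q \<Longrightarrow> i mod (q + 1) < q" "\<And>i. i \<in> Q \<Longrightarrow> level i = l"
proof -
  obtain x where x: "x < card F" "lv x = l" using bij_betw_imp_surj_on[OF lv] assms by (metis imageE lessThan_iff)
  define Q where "Q = (\<lambda>y. y + x * (q + 1)) ` {..<q}"
  have Q: "i div (q + 1) = x \<and> i mod (q + 1) < q \<and> i < steps" if i: "i \<in> Q" for i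
  proof -
    obtain y where y: "y < q" "i = y + x * (q + 1)" using i by (auto simp: Q_def)
    have "(x + 1) * (q + 1) \<le> card F * (q + 1)" using x(1) by (intro mult_le_mono1) simp
    then have "i < steps" using y Suc_steps by simp
    moreover have "i div (q + 1) = x" unfolding y(2) using y(1) by (subst div_mult_self1) simp_all
    moreover have "i mod (q + 1) = y" unfolding y(2) using y(1) by (subst mod_mult_self1) simp
    ultimately show ?thesis using y(1) by simp
  qed
  then have "\<And>i. i \<in> Q \<Longrightarrow> level i = l" using x(2) by (simp add: level_def)
  moreover have "card Q = q" unfolding Q_def by (subst card_image) (auto simp: inj_on_def)
  ultimately show ?thesis using that[of Q] Q by blast
qed

lemma weighted_tree_sum_slope:
  assumes B: "uniform_tree D B b m" and M: "0 < M" and h: "0 < h"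
  shows "weighted_tree_sum D B b m (slope M position) level steps (real D ^ (m + n) / real M) h"
proof (intro weighted_tree_sum.intro weighted_tree_sum_axioms.intro)
  fix i assume "i < steps"
  then have "\<bar>real (position (Suc i)) - real (position i)\<bar> * (real D ^ m / M) \<le>
      real D ^ n / real D ^ level i * (real D ^ m / M)"
    by (intro mult_right_mono step_le) auto
  then show "\<bar>slope M position i\<bar> * real D ^ m \<le> real D ^ (m + n) / real M / real D ^ level i"
    by (simp add: slope_def power_add mult.commute abs_divide)
qed (use B M h D_gt_1 steps_pos in auto)

lemma close_tuples_le:
  assumes B: "uniform_tree D B b m" and M: "0 < M" and h: "0 < h" and s: "0 \<le> s"
    and gap: "wide_gap D h steps g" and q: "q = 2 * v"
    and T: "\<And>r. r < N \<Longrightarrow> \<exists>e l. T r = l + e \<and> e < m \<and> 1 \<le> b (m - 1 - e) \<and> l \<in> F"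
      "\<And>r. r < N \<Longrightarrow> T r + g \<le> T (Suc r)" "T N \<le> m" "real D ^ T N \<le> real D ^ (m + n) / real M"
  shows "card (close_tuples B steps (slope M position) z) \<le> exp (3 * steps) * decay_factor v h s ^ N * card B ^ steps"
proof -
  define R where "R = real D ^ (m + n) / real M"
  interpret B: weighted_tree_sum D B b m "slope M position" level steps R h
    unfolding R_def by (rule weighted_tree_sum_slope[OF B M h])
  have "B.checkpoint v (T r)" if r: "r < N" for r
  proof -
    obtain e l where l: "T r = l + e" "e < m" "1 \<le> b (m - 1 - e)" "l \<in> F" using T(1)[OF r] by blast
    obtain Q where Q: "Q \<subseteq> {..<steps}" "card Q = 2 * v" "\<And>i. i \<in> Q \<Longrightarrow> i mod (q + 1) < q" "\<And>i. i \<in> Q \<Longrightarrow> level i = l"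
      using block_of_level[OF l(4)] q by metis
    have "R / real D ^ (level i + 2) \<le> \<bar>slope M position i\<bar> * real D ^ m" if i: "i \<in> Q" for i
    proof -
      have "real D ^ n / real D ^ (level i + 2) * (real D ^ m / M) \<le>
          \<bar>real (position (Suc i)) - real (position i)\<bar> * (real D ^ m / M)"
        using i Q(1,3) by (intro mult_right_mono step_ge) auto
      moreover have "R / real D ^ (level i + 2) = real D ^ n / real D ^ (level i + 2) * (real D ^ m / M)"
        by (simp only: R_def power_add times_divide_eq_right times_divide_eq_left divide_divide_eq_left mult_ac)
      ultimately show ?thesis by (simp add: slope_def abs_divide)
    qed
    then show ?thesis
      unfolding B.checkpoint_def using Q l by (intro exI[of _ Q] exI[of _ e]) auto
  qed
  then show ?thesis using T(2-4) unfolding R_def[symmetric] by (intro B.anticoncentration[OF gap s]) auto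
qed

lemma slope_spread:
  assumes B: "rooted_uniform_tree D B b m" and M: "0 < M" and i: "i < steps" and b: "x \<in> B" "y \<in> B"
  shows "\<bar>slope M position i * (real y - real x)\<bar> \<le> real D ^ (m + n) / real M"
proof -
  interpret B: rooted_uniform_tree D B b m by (rule B)
  interpret S: weighted_tree_sum D B b m "slope M position" level steps "real D ^ (m + n) / real M" 1
    by (rule weighted_tree_sum_slope[OF B.uniform_tree_axioms M]) simp
  have "\<bar>real y - real x\<bar> \<le> real D ^ m" using same_node_diff[OF D_pos B.root[OF b(2,1)]] by simp
  then have "\<bar>slope M position i * (real y - real x)\<bar> \<le> \<bar>slope M position i\<bar> * real D ^ m"
    unfolding abs_mult by (intro mult_left_mono) auto
  also have "\<dots> \<le> real D ^ (m + n) / real M / real D ^ level i" by (rule S.coefficient[OF i])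
  also have "\<dots> \<le> real D ^ (m + n) / real M / 1" using D_gt_1 by (intro divide_left_mono) auto
  finally show ?thesis by simp
qed

theorem zigzag_walks_bound:
  fixes A :: "int set" and H :: "(int \<times> nat \<times> nat) set" and \<alpha> R :: real
  assumes A: "finite A" "katz_tao_ints \<alpha> A" and \<alpha>: "0 \<le> \<alpha>" and B: "rooted_uniform_tree D B b m"
    and H: "finite H" "H \<noteq> {}" "H \<subseteq> UNIV \<times> B \<times> B"
    and twist: "\<And>l j x. l \<in> F \<Longrightarrow> j \<le> q \<Longrightarrow> x \<in> H \<Longrightarrow> twist M (f l j) x \<in> A"
    and M: "0 < M" and h: "0 < h" and s: "0 \<le> s" and gap: "wide_gap D h steps g" and q: "q = 2 * v"
    and T: "\<And>r. r < N \<Longrightarrow> \<exists>e l. T r = l + e \<and> e < m \<and> 1 \<le> b (m - 1 - e) \<and> l \<in> F"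
      "\<And>r. r < N \<Longrightarrow> T r + g \<le> T (Suc r)" "T N \<le> m" "real D ^ T N \<le> R"
    and R: "R = real D ^ (m + n) / real M"
  shows "(card H / (2 * (real steps + 1) * card A)) ^ steps \<le>
    (3 * steps * R) powr \<alpha> * (exp (3 * steps) * decay_factor v h s ^ N) * (real (card B) ^ steps)\<^sup>2"
proof -
  interpret B: rooted_uniform_tree D B b m by (rule B)
  define t where "t = card H / (2 * (real steps + 1) * card A)"
  define K where "K = exp (3 * steps) * decay_factor v h s ^ N"
  have twist_position: "twist M (position i) x \<in> A" if "i \<le> steps" "x \<in> H" for i x
    unfolding position_def using twist block_mem that by blast
  then have "A \<noteq> {}" using H(2) by blast
  then have card_pos: "0 < card A" "0 < card H" using A(1) H by (simp_all add: card_gt_0_iff)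
  then have "t * ((real steps + 1) * card A) = card H / 2" unfolding t_def by (simp only: mult.assoc) simp
  then have big: "t * real ((steps + 1) * card A) < card H" using card_pos by (simp only: of_nat_mult of_nat_add of_nat_1)
  have "\<exists>a\<in>A. t ^ steps \<le> card {x\<in>A. \<bar>real_of_int x - real_of_int a\<bar> \<le> steps * (R + 2)} *
      card B ^ steps * (K * card B ^ steps)"
  proof (rule walk_count[OF A(1) B.finite_leaves H(1,3) M steps_pos _ twist_position big])
    show "\<bar>slope M position i * (real y - real x)\<bar> \<le> R" if "i < steps" "x \<in> B" "y \<in> B" for i x y
      unfolding R by (rule slope_spread[OF B M that])
    show "card (close_tuples B steps (slope M position) z) \<le> K * card B ^ steps" for z
      unfolding K_def by (rule close_tuples_le[OF B.uniform_tree_axioms M h s gap q T[unfolded R]])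
  qed (simp add: t_def)
  then obtain a' where walk: "t ^ steps \<le>
      card {x\<in>A. \<bar>real_of_int x - real_of_int a'\<bar> \<le> steps * (R + 2)} * card B ^ steps * (K * card B ^ steps)" by blast
  have R_ge_1: "1 \<le> R" using T(4) D_gt_1 by (intro order_trans[OF _ T(4)]) simp
  have steps_ge_1: "1 \<le> real steps" using steps_pos by simp
  have "1 * 1 \<le> steps * (R + 2)" using R_ge_1 steps_ge_1 by (intro mult_mono) auto
  then have "card {x\<in>A. \<bar>real_of_int x - real_of_int a'\<bar> \<le> steps * (R + 2)} \<le> (steps * (R + 2)) powr \<alpha>"
    by (intro katz_tao_intsD[OF A(2)]) simp
  also have "\<dots> \<le> (3 * steps * R) powr \<alpha>"
    using R_ge_1 steps_ge_1 \<alpha> by (intro powr_mono2) (simp_all add: algebra_simps)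
  finally have "card {x\<in>A. \<bar>real_of_int x - real_of_int a'\<bar> \<le> steps * (R + 2)} * (K * (real (card B) ^ steps)\<^sup>2) \<le>
      (3 * steps * R) powr \<alpha> * (K * (real (card B) ^ steps)\<^sup>2)"
    using decay_factor_nonneg by (intro mult_right_mono) (auto simp: K_def)
  then show ?thesis using walk unfolding t_def[symmetric] K_def[symmetric] by (simp add: power2_eq_square mult_ac)
qed

end

section \<open>Twist configurations\<close>

definition active_levels :: "(nat \<Rightarrow> nat) \<Rightarrow> nat \<Rightarrow> nat \<Rightarrow> nat set" where
  "active_levels a n t = {l. l < t \<and> 1 \<le> a (n - 1 - l)}"

lemma almost_dense_Diff:
  fixes \<epsilon> \<sigma> :: real
  assumes A: "A \<subseteq> {..<n}" "\<And>t. t \<le> n \<Longrightarrow> \<sigma> * t \<le> card (A \<inter> {..<t})" and X: "finite X" "card X \<le> \<epsilon> * n"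
  shows "almost_dense n \<epsilon> \<sigma> (A - X)"
  unfolding almost_dense_def
proof (intro conjI allI impI)
  fix t assume t: "t \<le> n"
  have "card (A \<inter> {..<t}) \<le> card (((A - X) \<inter> {..<t}) \<union> X)" using X(1) by (intro card_mono) auto
  also have "\<dots> \<le> card ((A - X) \<inter> {..<t}) + card X" by (rule card_Un_le)
  finally show "\<sigma> * real t - \<epsilon> * real n \<le> real (card ((A - X) \<inter> {..<t}))" using A(2)[OF t] X(2) by linarith
qed (use A(1) in blast)

lemma thick_spaced:
  assumes "0 < card (thick n P X)" and g: "0 < g"
  obtains N T where "\<And>r. r \<le> N \<Longrightarrow> T r \<in> X" "\<And>r. r \<le> N \<Longrightarrow> T r < n" "\<And>r. r < N \<Longrightarrow> T r + g \<le> T (Suc r)"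
    "card (thick n P X) \<le> (N + 1) * (g + P)"
proof -
  have "thick n P X \<subseteq> (\<Union>t\<in>X \<inter> {..<n}. {t..<t + P})" by (auto simp: thick_def)
  then have "\<exists>N T. spaced g (X \<inter> {..<n}) N T \<and> card (thick n P X) \<le> N * (g + P)"
    by (intro exists_spaced g) auto
  then obtain N T where NT: "spaced g (X \<inter> {..<n}) N T" "card (thick n P X) \<le> N * (g + P)" by blast
  then have "N \<noteq> 0" using assms(1) by (intro notI) simp
  then obtain N' where "N = Suc N'" by (cases N) auto
  then show ?thesis using NT by (intro that[of N' T]) (auto simp: spaced_def)
qed

lemma normalized_walk_bound:
  fixes c p q h Y d :: real
  assumes pos: "0 \<le> c" "0 < p" "0 < q" "0 < d" and c: "c * (p * q\<^sup>2) \<le> h" and h: "(h / (d * p)) ^ k \<le> Y * (q ^ k)\<^sup>2"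
  shows "(c / d) ^ k \<le> Y"
proof -
  have "(c / d) ^ k * (q ^ k)\<^sup>2 = (c * (p * q\<^sup>2) / (d * p)) ^ k"
    using pos by (simp add: power_mult_distrib power_divide power_commutes mult.commute flip: power_mult)
  also have "\<dots> \<le> (h / (d * p)) ^ k" using pos c by (intro power_mono divide_right_mono) auto
  also have "\<dots> \<le> Y * (q ^ k)\<^sup>2" by (rule h)
  finally show ?thesis using pos by (simp add: mult_le_cancel_right)
qed

locale twist_config = B: rooted_uniform_tree D B a nB + C: rooted_uniform_tree D C a' nC
  for D B a nB C a' nC +
  fixes \<alpha> \<epsilon>\<^sub>1 \<sigma>\<^sub>0 \<eta> :: real and n m M :: nat and A :: "int set"
    and H :: "(int \<times> nat \<times> nat) set" and S :: "int \<times> nat \<times> nat \<Rightarrow> nat set" and \<rho> \<sigma> \<tau> :: real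
  assumes A: "finite A" "A \<noteq> {}" "katz_tao_ints \<alpha> A"
    and heights: "nC \<le> n" "m \<le> nB" "m \<le> nC" "\<eta> * n \<le> m"
    and M: "0 < M" "real D ^ m \<le> real D ^ (nB + nC) / real M" "real D ^ (nB + nC) / real M \<le> real D ^ (m + 1)"
    and H: "finite H" "H \<noteq> {}" "H \<subseteq> UNIV \<times> B \<times> B" "\<rho> * (real (card A) * (real (card B))\<^sup>2) \<le> card H"
    and S: "\<And>x. x \<in> H \<Longrightarrow> S x \<subseteq> C" "\<And>x. x \<in> H \<Longrightarrow> \<rho> * card C \<le> card (S x)"
      "\<And>x c. x \<in> H \<Longrightarrow> c \<in> S x \<Longrightarrow> twist M c x \<in> A"
    and \<rho>: "0 < \<rho>" "\<rho> \<le> 1"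
    and slopes: "\<sigma>\<^sub>0 \<le> \<sigma>" "\<sigma>\<^sub>0 \<le> \<tau>" "\<alpha> + \<epsilon>\<^sub>1 \<le> \<sigma> + \<tau>" "\<alpha> + \<epsilon>\<^sub>1 \<le> 1"
    and active: "\<And>t. t \<le> m \<Longrightarrow> \<sigma> * t \<le> card (active_levels a nB t)"
      "\<And>t. t \<le> m \<Longrightarrow> \<tau> * t \<le> card (active_levels a' nC t)"
begin

lemma exists_covering_zigzags:
  fixes \<epsilon> \<zeta> :: real
  assumes mann: "mann_bound \<zeta> \<sigma>\<^sub>0 P \<epsilon> m" and \<epsilon>: "0 < \<epsilon>" "1 < r * \<epsilon>"
    and big: "\<And>y::nat. \<epsilon> * m < y \<Longrightarrow> (4 / \<rho>)\<^sup>2 \<le> 2 ^ y" and m: "0 < m"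
  obtains F f H' where
    "greedy_selection (stage_loss \<rho> nC D q) D q nC C S (active_levels a' nC m) H r F f H'"
    "(\<alpha> + \<epsilon>\<^sub>1 - \<zeta>) * m \<le> card (thick m (2 * P) (F + active_levels a nB m))"
proof -
  let ?LB = "active_levels a nB m" and ?LC = "active_levels a' nC m"
  have LC: "?LC \<subseteq> {..<nC}" "\<And>l. l \<in> ?LC \<Longrightarrow> 1 \<le> a' (nC - 1 - l)"
    using heights(3) by (auto simp: active_levels_def)
  obtain F f H' where sel: "greedy_selection (stage_loss \<rho> nC D q) D q nC C S ?LC H r F f H'"
    and fresh: "card (fresh_levels m P ?LB ?LC \<epsilon> F) \<le> \<epsilon> * m"
    by (rule C.greedy_zigzags[OF H(1,2) \<rho> S(1,2) m LC big \<epsilon>(2)])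
  let ?X = "fresh_levels m P ?LB ?LC \<epsilon> F" and ?E = "thick m (2 * P) (F + ?LB)"
  have initial: "active_levels b i m \<inter> {..<t} = active_levels b i t" if "t \<le> m" for b i t
    using that by (auto simp: active_levels_def)
  have sub: "active_levels b i m \<subseteq> {..<m}" for b i by (auto simp: active_levels_def)
  have "finite ?X" using finite_subset[OF fresh_levels_subset finite_subset[OF LC(1)]] by simp
  then have "almost_dense m \<epsilon> \<tau> (?LC - ?X)"
    using fresh by (intro almost_dense_Diff sub) (simp_all add: initial active(2))
  moreover have "almost_dense m \<epsilon> \<sigma> (?LB - {})"
    using \<epsilon>(1) by (intro almost_dense_Diff sub) (simp_all add: initial active(1))
  moreover have "\<forall>b\<in>?LC - ?X. card (thick m (2 * P) ((+) b ` ?LB) - ?E) \<le> \<epsilon> * m"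
    by (auto simp: fresh_levels_def not_less)
  ultimately have "(min 1 (\<sigma> + \<tau>) - \<zeta>) * m \<le> card ?E"
    using mann slopes(1,2) finite_thick[of m "2 * P"] unfolding mann_bound_def Diff_empty by blast
  moreover have "(\<alpha> + \<epsilon>\<^sub>1 - \<zeta>) * m \<le> (min 1 (\<sigma> + \<tau>) - \<zeta>) * m" using slopes by (intro mult_right_mono) auto
  ultimately show ?thesis by (intro that[OF sel]) linarith
qed

lemma zigzag_inequality:
  fixes \<kappa> h s y :: real
  assumes sel: "greedy_selection \<kappa> D (2 * v) nC C S (active_levels a' nC m) H r F f H'" and F: "F \<noteq> {}" and \<kappa>: "0 < \<kappa>"
    and v: "0 < v" and h: "0 < h" and s: "0 \<le> s" and gap: "wide_gap D h (r * (2 * v + 1)) g"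
    and decay: "decay_factor v h s \<le> exp (- y)" and D: "1 < D" and \<alpha>: "0 < \<alpha>"
    and T: "\<And>r. r \<le> N \<Longrightarrow> T r \<in> F + active_levels a nB m" "\<And>r. r \<le> N \<Longrightarrow> T r < m" "\<And>r. r < N \<Longrightarrow> T r + g \<le> T (Suc r)"
  obtains k where "0 < k" "k \<le> r * (2 * v + 1)"
    "(\<kappa> ^ r * \<rho> / (2 * (real k + 1))) ^ k \<le> (3 * real k * real D ^ (m + 1)) powr \<alpha> * (exp (3 * real k) * exp (- y) ^ N)"
proof -
  have card_F: "card F \<le> r" and H': "H' \<subseteq> H" "\<kappa> ^ r * card H \<le> card H'"
    and shared: "shared_zigzags D (2 * v) nC C S F f H'"
    using sel by (simp_all add: greedy_selection_def)
  have FC: "F \<subseteq> {..<nC}" using sel heights(3) by (auto simp: active_levels_def greedy_selection_def)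
  then have "finite F" by (rule finite_subset) simp
  then obtain lv where lv: "bij_betw lv {..<card F} F"
    using ex_bij_betw_nat_finite[of F] by (auto simp: atLeast0LessThan)
  interpret Z: zigzag_sequence D C a' nC F lv f "2 * v"
    by unfold_locales (use FC F lv shared v D in \<open>auto simp: shared_zigzags_def\<close>)
  let ?k = "Z.steps"
  define R where "R = real D ^ (nB + nC) / real M"
  have "card F * (2 * v + 1) \<le> r * (2 * v + 1)" using card_F by (rule mult_le_mono1)
  then have k_le: "?k \<le> r * (2 * v + 1)" unfolding Z.steps_def by linarith
  have card_pos: "0 < card A" "0 < card B" "0 < card H" using A B.card_X_pos H by (simp_all add: card_gt_0_iff)
  then have "0 < \<kappa> ^ r * card H" using \<kappa> by simp
  then have H'_nonempty: "H' \<noteq> {}" using H'(2) by auto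
  have checkpoint: "\<exists>e l. T r = l + e \<and> e < nB \<and> 1 \<le> a (nB - 1 - e) \<and> l \<in> F" if "r < N" for r
    using T(1)[of r] that heights(2) by (fastforce simp: active_levels_def elim!: set_plus_elim)
  have bound: "(card H' / (2 * (real ?k + 1) * card A)) ^ ?k \<le>
      (3 * ?k * R) powr \<alpha> * (exp (3 * ?k) * decay_factor v h s ^ N) * (real (card B) ^ ?k)\<^sup>2"
  proof (rule Z.zigzag_walks_bound[where b = a and T = T and v = v and g = g,
      OF A(1,3) less_imp_le[OF \<alpha>] B.rooted_uniform_tree_axioms _ H'_nonempty _ _ M(1) h s
      wide_gap_mono[OF gap k_le h] refl checkpoint T(3) _ _ R_def])
    show "finite H'" "H' \<subseteq> UNIV \<times> B \<times> B" using H' H finite_subset by blast+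
    show "twist M (f l j) x \<in> A" if "l \<in> F" "j \<le> 2 * v" "x \<in> H'" for l j x
      using shared that H'(1) by (intro S(3)) (auto simp: shared_zigzags_def)
    show "T N \<le> nB" using T(2)[of N] heights(2) by simp
    have "real D ^ T N \<le> real D ^ m" using T(2)[of N] D by (intro power_increasing) auto
    then show "real D ^ T N \<le> R" using M(2) by (simp add: R_def)
  qed
  have "\<kappa> ^ r * \<rho> * (card A * (real (card B))\<^sup>2) \<le> \<kappa> ^ r * card H"
    unfolding mult.assoc using H(4) \<kappa> by (intro mult_left_mono) auto
  then have ratio: "\<kappa> ^ r * \<rho> * (card A * (real (card B))\<^sup>2) \<le> card H'" using H'(2) by linarith
  have "(\<kappa> ^ r * \<rho> / (2 * (real ?k + 1))) ^ ?k \<le> (3 * ?k * R) powr \<alpha> * (exp (3 * ?k) * decay_factor v h s ^ N)"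
    by (rule normalized_walk_bound[OF _ _ _ _ ratio bound]) (use card_pos \<kappa> \<rho> in auto)
  also have "\<dots> \<le> (3 * real ?k * real D ^ (m + 1)) powr \<alpha> * (exp (3 * real ?k) * exp (- y) ^ N)"
    using M decay decay_factor_nonneg \<alpha> by (intro mult_mono powr_mono2 power_mono) (auto simp: R_def)
  finally show ?thesis by (rule that[OF Z.steps_pos k_le])
qed

lemma walk_inequality:
  fixes \<epsilon> \<zeta> h s y :: real
  assumes mann: "mann_bound \<zeta> \<sigma>\<^sub>0 P \<epsilon> m" and \<epsilon>: "0 < \<epsilon>" "1 < r * \<epsilon>"
    and big: "\<And>y::nat. \<epsilon> * m < y \<Longrightarrow> (4 / \<rho>)\<^sup>2 \<le> 2 ^ y" and m: "0 < m"
    and v: "0 < v" and h: "0 < h" and s: "0 \<le> s" and gap: "wide_gap D h (r * (2 * v + 1)) g" and g: "0 < g"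
    and decay: "decay_factor v h s \<le> exp (- y)" and D: "1 < D" and \<alpha>: "0 < \<alpha>" and \<zeta>: "\<zeta> < \<alpha> + \<epsilon>\<^sub>1"
  obtains k N where "0 < k" "k \<le> r * (2 * v + 1)" "(\<alpha> + \<epsilon>\<^sub>1 - \<zeta>) * m \<le> (real N + 1) * real (g + 2 * P)"
    "(stage_loss \<rho> nC D (2 * v) ^ r * \<rho> / (2 * (real k + 1))) ^ k \<le>
      (3 * real k * real D ^ (m + 1)) powr \<alpha> * (exp (3 * real k) * exp (- y) ^ N)"
proof -
  let ?LB = "active_levels a nB m"
  obtain F f H' where sel: "greedy_selection (stage_loss \<rho> nC D (2 * v)) D (2 * v) nC C S (active_levels a' nC m) H r F f H'"
    and covering: "(\<alpha> + \<epsilon>\<^sub>1 - \<zeta>) * m \<le> card (thick m (2 * P) (F + ?LB))"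
    by (rule exists_covering_zigzags[OF mann \<epsilon> big m])
  have "0 < (\<alpha> + \<epsilon>\<^sub>1 - \<zeta>) * m" using \<zeta> m by simp
  then have "0 < card (thick m (2 * P) (F + ?LB))" using covering by linarith
  then obtain N T where T: "\<And>r. r \<le> N \<Longrightarrow> T r \<in> F + ?LB" "\<And>r. r \<le> N \<Longrightarrow> T r < m" "\<And>r. r < N \<Longrightarrow> T r + g \<le> T (Suc r)"
    and count: "card (thick m (2 * P) (F + ?LB)) \<le> (N + 1) * (g + 2 * P)"
    using thick_spaced[OF _ g] by blast
  have "F \<noteq> {}" using T(1)[of 0] by (auto elim: set_plus_elim)
  have loss: "0 < stage_loss \<rho> nC D (2 * v)" using \<rho>(1) D by (simp add: stage_loss_pos)
  obtain k where k: "0 < k" "k \<le> r * (2 * v + 1)"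
    "(stage_loss \<rho> nC D (2 * v) ^ r * \<rho> / (2 * (real k + 1))) ^ k \<le>
      (3 * real k * real D ^ (m + 1)) powr \<alpha> * (exp (3 * real k) * exp (- y) ^ N)"
    by (rule zigzag_inequality[where T = T and N = N and y = y, OF sel \<open>F \<noteq> {}\<close> loss v h s gap decay D \<alpha> T])
  have "real (card (thick m (2 * P) (F + ?LB))) \<le> real ((N + 1) * (g + 2 * P))" using count by (rule of_nat_mono)
  also have "\<dots> = (real N + 1) * real (g + 2 * P)" by (simp only: of_nat_mult of_nat_add of_nat_1)
  finally have "(\<alpha> + \<epsilon>\<^sub>1 - \<zeta>) * m \<le> (real N + 1) * real (g + 2 * P)" using covering by linarith
  then show ?thesis by (rule that[OF k(1,2) _ k(3)])
qed

end

section \<open>Choice of parameters\<close>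

lemma polynomial_below_exp:
  fixes c b Q :: real
  assumes c: "0 < c"
  obtains n0 :: nat where "\<And>n. n0 \<le> n \<Longrightarrow> Q * (b * (real n + 1)) ^ K < exp (c * n)"
proof -
  define x where "x n = c * (1 + real n)" for n :: nat
  have "filterlim (\<lambda>n. 1 + real n) at_top sequentially"
    by (rule filterlim_tendsto_add_at_top[OF tendsto_const filterlim_real_sequentially])
  then have "filterlim x at_top sequentially"
    unfolding x_def using c by (intro filterlim_tendsto_pos_mult_at_top[OF tendsto_const]) auto
  then have "(\<lambda>n. x n ^ K / exp (x n)) \<longlonglongrightarrow> 0" by (rule filterlim_compose[OF tendsto_power_div_exp_0])
  then have "(\<lambda>n. Q * (b / c) ^ K * exp c * (x n ^ K / exp (x n))) \<longlonglongrightarrow> 0" by (rule tendsto_mult_right_zero)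
  then have "\<forall>\<^sub>F n in sequentially. Q * (b / c) ^ K * exp c * (x n ^ K / exp (x n)) < 1"
    by (rule order_tendstoD) simp
  then obtain n0 where n0: "\<And>n. n0 \<le> n \<Longrightarrow> Q * (b / c) ^ K * exp c * (x n ^ K / exp (x n)) < 1"
    by (auto simp: eventually_sequentially)
  have "Q * (b * (real n + 1)) ^ K < exp (c * n)" if n: "n0 \<le> n" for n
  proof -
    have "Q * (b * (real n + 1)) ^ K = Q * (b / c) ^ K * x n ^ K"
      using c by (simp add: x_def power_divide power_mult_distrib add.commute)
    also have "\<dots> = Q * (b / c) ^ K * exp c * (x n ^ K / exp (x n)) * exp (c * n)"
      by (simp add: x_def distrib_left exp_add)
    also have "\<dots> < 1 * exp (c * n)" using n0[OF n] by (intro mult_strict_right_mono) auto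
    finally show ?thesis by simp
  qed
  then show ?thesis by (rule that)
qed

lemma decay_factor_le:
  fixes h :: real and v :: nat
  assumes h: "0 < h"
  defines "L \<equiv> ln (sqrt (2 * real v + 1))"
  shows "decay_factor v h (L / (h + 1)) \<le> exp (- (h / (h + 1) * L - ln 18))"
proof -
  have exponents: "L / (h + 1) - L = - (h / (h + 1) * L)" "- h * (L / (h + 1)) = - (h / (h + 1) * L)"
    using h by (simp_all add: field_simps)
  have "sqrt (2 * real v + 1) = exp L" by (simp add: L_def)
  then have "decay_factor v h (L / (h + 1)) = 12 * exp (L / (h + 1) - L) + 6 * exp (- h * (L / (h + 1)))"
    by (simp add: decay_factor_def exp_diff)
  also have "\<dots> = exp (- (h / (h + 1) * L - ln 18))"
    unfolding exponents by (simp add: exp_diff exp_minus field_simps)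
  finally show ?thesis by simp
qed

lemma exists_wide_gap:
  assumes D: "1 < D" and h: "0 < h" and k: "0 < k"
  obtains g where "0 < g" "wide_gap D h k g" "g * ln (real D) \<le> ln (2 * (1 + h) * sqrt k) + 4 * ln (real D)"
proof -
  define L where "L = ln (real D)"
  have L: "0 < L" using D by (simp add: L_def)
  define X where "X = 2 * (1 + h) * sqrt k * real D ^ 3"
  have "1 * 1 < (2 * (1 + h)) * sqrt k" using h k by (intro mult_less_le_imp_less) auto
  moreover have "1 \<le> real D ^ 3" using D by simp
  ultimately have X: "1 < X" using mult_less_le_imp_less[of 1 "2 * (1 + h) * sqrt k" 1 "real D ^ 3"] by (simp add: X_def)
  define g where "g = nat \<lceil>ln X / L\<rceil>"
  have "0 < ln X / L" using X L by simp
  then have g: "0 < ln X / L" "ln X / L \<le> g" "g < ln X / L + 1" unfolding g_def by linarith+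
  have "ln X \<le> g * L" using g(2) L by (simp add: pos_divide_le_eq)
  then have "exp (ln X) \<le> exp (g * L)" by simp
  then have "wide_gap D h k g" using X D by (simp add: wide_gap_def X_def L_def exp_of_nat_mult)
  moreover have "g * L \<le> ln X + L"
    using mult_strict_right_mono[OF g(3) L] L unfolding distrib_right by simp
  moreover have "ln X = ln (2 * (1 + h) * sqrt k) + 3 * L"
    unfolding X_def L_def using h k D by (simp add: ln_mult ln_realpow)
  moreover have "0 < g" using g(1,2) by (cases g) auto
  ultimately show ?thesis using that by (simp add: L_def)
qed

text \<open>Both the gap and the decay exponent are affine functions of \<open>ln (2 * v + 1) / 2\<close>, the second one with
  the slope \<open>h / (h + 1)\<close>; hence a large \<open>v\<close> does the job.\<close>

lemma parameter_choice:
  fixes h x x' :: real and D r P :: nat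
  assumes D: "1 < D" and h: "0 < h" and r: "0 < r" and x: "0 < x'" "x' < x * (h / (h + 1))"
  obtains v g :: nat and s y :: real where "0 < v" "0 < g" "0 \<le> s" "wide_gap D h (r * (2 * v + 1)) g"
    "decay_factor v h s \<le> exp (- y)" "x' * (real (g + 2 * P) * ln (real D)) \<le> x * y"
proof -
  define \<theta> where "\<theta> = h / (h + 1)"
  have gain: "0 < x * \<theta> - x'" using x by (simp add: \<theta>_def)
  define c where "c = ln (2 * (1 + h) * sqrt r) + (4 + 2 * P) * ln (real D)"
  define Z where "Z = max 1 ((x' * c + x * ln 18) / (x * \<theta> - x'))"
  have "(x' * c + x * ln 18) / (x * \<theta> - x') \<le> Z" "1 \<le> Z" by (auto simp: Z_def)
  then have Z: "1 \<le> Z" "x' * c + x * ln 18 \<le> Z * (x * \<theta> - x')" using gain by (simp_all only: pos_divide_le_eq)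
  define v where "v = nat \<lceil>exp (2 * Z)\<rceil>"
  define L where "L = ln (sqrt (2 * real v + 1))"
  have v_ge: "exp (2 * Z) \<le> v" by (simp add: v_def real_nat_ceiling_ge)
  then have v: "0 < v" using exp_gt_zero[of "2 * Z"] by (metis of_nat_0 not_gr_zero not_le)
  have "exp Z = sqrt (exp (2 * Z))" by (simp add: exp_double)
  also have "\<dots> \<le> sqrt (2 * real v + 1)" using v_ge by simp
  finally have L_ge: "Z \<le> L" by (simp add: L_def ln_ge_iff)
  have "0 < r * (2 * v + 1)" using r by simp
  then obtain g where g: "0 < g" "wide_gap D h (r * (2 * v + 1)) g"
    "g * ln (real D) \<le> ln (2 * (1 + h) * sqrt (r * (2 * v + 1))) + 4 * ln (real D)"
    by (rule exists_wide_gap[OF D h])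
  have "sqrt (r * (2 * v + 1)) = sqrt r * sqrt (2 * real v + 1)"
    by (simp only: of_nat_mult of_nat_add of_nat_1 of_nat_numeral real_sqrt_mult)
  then have "ln (2 * (1 + h) * sqrt (r * (2 * v + 1))) = ln (2 * (1 + h) * sqrt r) + L"
    using h r by (simp add: L_def ln_mult)
  then have gap_length: "real (g + 2 * P) * ln (real D) \<le> L + c" using g(3) by (simp add: c_def algebra_simps)
  have "x' * c + x * ln 18 \<le> L * (x * \<theta> - x')"
    using Z(2) mult_right_mono[OF L_ge, of "x * \<theta> - x'"] gain by linarith
  then have "x' * (L + c) \<le> x * (\<theta> * L - ln 18)" by (simp add: algebra_simps)
  then have "x' * (real (g + 2 * P) * ln (real D)) \<le> x * (\<theta> * L - ln 18)"
    using mult_left_mono[OF gap_length, of x'] x(1) by linarith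
  moreover have "0 \<le> L / (h + 1)" using Z(1) L_ge h by simp
  ultimately show ?thesis
    using that[OF v g(1) _ g(2)] decay_factor_le[OF h] unfolding L_def \<theta>_def by blast
qed

lemma stage_loss_ge:
  assumes \<rho>: "0 < \<rho>" "\<rho> \<le> 1" and N: "N \<le> n" and D: "0 < D"
  shows "(\<rho> / (8 * real D * (real n + 1))) ^ (q + 3) \<le> stage_loss \<rho> N D q"
proof -
  let ?x = "\<rho> / (8 * real D * (real n + 1))"
  have D_ge_1: "1 \<le> real D" using D by simp
  have "1 * 1 \<le> real D * (real n + 1)" using D_ge_1 by (intro mult_mono) auto
  then have first_factor: "?x \<le> \<rho> / 8" using \<rho> by (intro divide_left_mono) auto
  have "(2 * (real N + 1)) * real D \<le> (8 * (real n + 1)) * real D" using N by (intro mult_right_mono) auto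
  then have "2 * (real N + 1) * real D \<le> 8 * real D * (real n + 1)" by (simp only: mult_ac)
  then have middle_factor: "?x \<le> \<rho> / (2 * (real N + 1) * real D)" using \<rho> D_ge_1 by (intro divide_left_mono) auto
  have "1 * (real N + 1) \<le> 8 * real D * (real n + 1)" using N D_ge_1 by (intro mult_mono) auto
  then have last_factor: "?x \<le> 1 / (real N + 1)" using \<rho> D_ge_1 by (intro frac_le) auto
  have "?x ^ (q + 3) = ?x * ?x ^ Suc q * ?x" by (simp add: power_add power3_eq_cube mult_ac)
  also have "\<dots> \<le> \<rho> / 8 * (\<rho> / (2 * (real N + 1) * real D)) ^ Suc q * (1 / (real N + 1))"
    using first_factor middle_factor last_factor \<rho> D_ge_1
    by (intro mult_mono power_mono mult_nonneg_nonneg zero_le_power) auto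
  finally show ?thesis by (simp add: stage_loss_def zigzag_share_def)
qed

lemma walk_upper_bound:
  fixes \<alpha> x x' y :: real and k K N D g P m :: nat
  assumes \<alpha>: "0 < \<alpha>" "\<alpha> \<le> 1" and D: "1 < D" and k: "0 < k" "k \<le> K" and x: "0 < x" "0 < x'"
    and N: "x * m \<le> (real N + 1) * real (g + 2 * P)" and xy: "x' * (real (g + 2 * P) * ln (real D)) \<le> x * y"
  shows "(3 * real k * real D ^ (m + 1)) powr \<alpha> * (exp (3 * real k) * exp (- y) ^ N) \<le>
    3 * K * exp (ln (real D) + 3 * K + y) * exp (- ((x' - \<alpha>) * ln (real D) * m))"
proof -
  define L where "L = ln (real D)"
  have L: "0 < L" using D by (simp add: L_def)
  have "(x' * L) * (x * m) \<le> (x' * L) * ((real N + 1) * real (g + 2 * P))" using N x L by (intro mult_left_mono) auto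
  also have "\<dots> = (real N + 1) * (x' * (real (g + 2 * P) * L))" by (simp only: mult_ac)
  also have "\<dots> \<le> (real N + 1) * (x * y)" using xy by (intro mult_left_mono) (simp_all add: L_def)
  finally have "x * (x' * L * m) \<le> x * ((real N + 1) * y)" by (simp add: mult_ac)
  then have "x' * L * m \<le> (real N + 1) * y" using x by simp
  then have decay: "exp (- y) ^ N \<le> exp (y - x' * L * m)"
    by (simp add: exp_of_nat_mult[symmetric] algebra_simps)
  have "\<alpha> * L \<le> L" using \<alpha> L by simp
  then have "exp (\<alpha> * (L * real (m + 1))) \<le> exp (L + \<alpha> * L * m)" by (simp add: algebra_simps)
  moreover have "real D ^ (m + 1) = exp (L * real (m + 1))" using D unfolding exp_of_nat2_mult L_def by simp
  ultimately have "(real D ^ (m + 1)) powr \<alpha> \<le> exp (L + \<alpha> * L * m)" by (simp add: exp_powr_real mult.commute)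
  moreover have "(3 * real k) powr \<alpha> \<le> (3 * real k) powr 1" using k \<alpha> by (intro powr_mono) auto
  then have "(3 * real k) powr \<alpha> \<le> 3 * K" using k by simp
  ultimately have "(3 * real k * real D ^ (m + 1)) powr \<alpha> \<le> 3 * K * exp (L + \<alpha> * L * m)"
    unfolding powr_mult by (intro mult_mono) auto
  then have "(3 * real k * real D ^ (m + 1)) powr \<alpha> * (exp (3 * real k) * exp (- y) ^ N) \<le>
      3 * K * exp (L + \<alpha> * L * m) * (exp (3 * K) * exp (y - x' * L * m))"
    using decay k by (intro mult_mono) auto
  also have "\<dots> = 3 * K * exp (L + 3 * K + y) * exp (- ((x' - \<alpha>) * L * m))"
    by (simp add: mult.assoc exp_add[symmetric]) (simp add: algebra_simps)
  finally show ?thesis by (simp only: L_def)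
qed

lemma walk_lower_bound:
  fixes \<rho> :: real and k K n N D q r :: nat
  assumes \<rho>: "0 < \<rho>" "\<rho> \<le> 1" and D: "0 < D" and N: "N \<le> n" and k: "k \<le> K"
  shows "(\<rho> / (8 * real D * (real n + 1))) ^ (((q + 3) * r + 1) * K) / (2 * (real K + 1)) ^ K \<le>
    (stage_loss \<rho> N D q ^ r * \<rho> / (2 * (real k + 1))) ^ k"
proof -
  define z where "z = \<rho> / (8 * real D * (real n + 1))"
  let ?e = "(q + 3) * r + 1"
  have "1 * 1 \<le> (8 * real D) * (real n + 1)" using D by (intro mult_mono) auto
  then have "z \<le> \<rho> / 1" unfolding z_def using \<rho> by (intro divide_left_mono) auto
  then have z: "0 \<le> z" "z \<le> \<rho>" "z \<le> 1" using \<rho> by (simp_all add: z_def)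
  then have ze: "0 \<le> z ^ ?e" "z ^ ?e \<le> 1" by (auto intro: power_le_one simp del: power_Suc)
  have "z ^ ?e = (z ^ (q + 3)) ^ r * z" by (simp add: power_mult)
  also have "\<dots> \<le> stage_loss \<rho> N D q ^ r * \<rho>"
    using z(1,2) stage_loss_ge[OF \<rho> N D, of q, folded z_def] stage_loss_pos[OF \<rho>(1) D, of N q]
    by (intro mult_mono power_mono) auto
  finally have mono: "z ^ ?e / (2 * (real K + 1)) \<le> stage_loss \<rho> N D q ^ r * \<rho> / (2 * (real k + 1))"
    using k ze(1) by (intro frac_le) auto
  have "z ^ ?e \<le> 2 * (real K + 1)" by (rule order_trans[OF ze(2)]) simp
  then have unit: "0 \<le> z ^ ?e / (2 * (real K + 1))" "z ^ ?e / (2 * (real K + 1)) \<le> 1"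
    using ze by (simp_all only: divide_le_eq_1 zero_le_divide_iff) auto
  have "(z ^ ?e / (2 * (real K + 1))) ^ K \<le> (z ^ ?e / (2 * (real K + 1))) ^ k"
    by (rule power_decreasing[OF k unit])
  also have "\<dots> \<le> (stage_loss \<rho> N D q ^ r * \<rho> / (2 * (real k + 1))) ^ k"
    by (rule power_mono[OF mono unit(1)])
  finally show ?thesis by (simp only: power_divide power_mult z_def)
qed

lemma power_two_ge_of_loss:
  fixes l \<rho> \<epsilon> \<eta> :: real and n m y :: nat
  assumes loss: "2 powr (- l * n) \<le> \<rho>" and l: "l \<le> \<epsilon> * \<eta> / 4" and n: "8 \<le> \<epsilon> * \<eta> * n" and m: "\<eta> * n \<le> m"
    and \<epsilon>: "0 < \<epsilon>" and y: "\<epsilon> * m < y"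
  shows "(4 / \<rho>)\<^sup>2 \<le> 2 ^ y"
proof -
  have \<rho>: "0 < \<rho>" using loss powr_gt_zero[of 2 "- l * n"] by linarith
  have "4 / \<rho> \<le> 4 / 2 powr (- l * n)" using loss \<rho> by (intro divide_left_mono) auto
  also have "\<dots> = 2 powr 2 * 2 powr (l * n)" by (simp add: powr_minus field_simps)
  also have "\<dots> = 2 powr (2 + l * n)" by (rule powr_add[symmetric])
  finally have "(4 / \<rho>)\<^sup>2 \<le> (2 powr (2 + l * n))\<^sup>2" using \<rho> by (intro power_mono) auto
  also have "\<dots> = 2 powr (2 * (2 + l * n))" by (simp add: powr_power mult.commute)
  also have "\<dots> \<le> 2 powr y"
  proof (rule powr_mono)
    have "l * n \<le> \<epsilon> * \<eta> / 4 * n" using l by (intro mult_right_mono) auto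
    moreover have "\<epsilon> * (\<eta> * n) \<le> \<epsilon> * m" using m \<epsilon> by (intro mult_left_mono) auto
    ultimately show "2 * (2 + l * n) \<le> y" using n y by (simp add: algebra_simps)
  qed simp
  also have "\<dots> = 2 ^ y" by (simp add: powr_realpow)
  finally show ?thesis .
qed

lemma exists_walk_parameters:
  fixes \<alpha> \<epsilon>\<^sub>1 :: real and D r P :: nat
  assumes \<alpha>: "0 < \<alpha>" "0 < \<epsilon>\<^sub>1" "\<alpha> + \<epsilon>\<^sub>1 \<le> 1" and D: "1 < D" and r: "0 < r"
  obtains v g :: nat and h s y :: real where "0 < v" "0 < g" "0 < h" "0 \<le> s" "wide_gap D h (r * (2 * v + 1)) g"
    "decay_factor v h s \<le> exp (- y)" "(\<alpha> + \<epsilon>\<^sub>1 / 4) * (real (g + 2 * P) * ln (real D)) \<le> (\<alpha> + \<epsilon>\<^sub>1 / 2) * y"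
proof -
  define h x x' where "h = 8 / \<epsilon>\<^sub>1" and "x = \<alpha> + \<epsilon>\<^sub>1 / 2" and "x' = \<alpha> + \<epsilon>\<^sub>1 / 4"
  have h: "0 < h" and x: "0 < x'" using \<alpha> by (auto simp: h_def x_def x'_def)
  have "x' * \<epsilon>\<^sub>1 \<le> 1 * \<epsilon>\<^sub>1" using \<alpha> by (intro mult_right_mono) (auto simp: x'_def)
  moreover have "x * 8 = x' * 8 + 2 * \<epsilon>\<^sub>1" by (simp add: x_def x'_def)
  ultimately have "x' * (8 + \<epsilon>\<^sub>1) < x * 8" using \<alpha>(2) unfolding distrib_left by linarith
  moreover have "h / (h + 1) = 8 / (8 + \<epsilon>\<^sub>1)" using \<alpha> by (simp add: h_def field_simps)
  ultimately have "x' < x * (h / (h + 1))" using \<alpha> by (simp add: pos_less_divide_eq)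
  then obtain v g s y where "0 < v" "0 < g" "0 \<le> s" "wide_gap D h (r * (2 * v + 1)) g"
    "decay_factor v h s \<le> exp (- y)" "x' * (real (g + 2 * P) * ln (real D)) \<le> x * y"
    by (rule parameter_choice[where P = P, OF D h r x])
  then show ?thesis using h that unfolding x_def x'_def by blast
qed

lemma exp_le_of_walk:
  fixes \<alpha> \<epsilon>\<^sub>1 \<eta> l \<rho> y c :: real and n m D N k K r v g P nC E :: nat
  assumes \<alpha>: "0 < \<alpha>" "0 < \<epsilon>\<^sub>1" "\<alpha> + \<epsilon>\<^sub>1 \<le> 1" and D: "1 < D" and k: "0 < k" "k \<le> K"
    and N: "(\<alpha> + \<epsilon>\<^sub>1 / 2) * m \<le> (real N + 1) * real (g + 2 * P)"
    and y: "(\<alpha> + \<epsilon>\<^sub>1 / 4) * (real (g + 2 * P) * ln (real D)) \<le> (\<alpha> + \<epsilon>\<^sub>1 / 2) * y"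
    and walk: "(stage_loss \<rho> nC D (2 * v) ^ r * \<rho> / (2 * (real k + 1))) ^ k \<le>
      (3 * real k * real D ^ (m + 1)) powr \<alpha> * (exp (3 * real k) * exp (- y) ^ N)"
    and \<rho>: "0 < \<rho>" "\<rho> \<le> 1" "2 powr (- l * n) \<le> \<rho>" and n: "nC \<le> n" "\<eta> * n \<le> m"
    and c: "c = \<epsilon>\<^sub>1 / 8 * \<eta> * ln (real D)" and E: "E = ((2 * v + 3) * r + 1) * K" and l: "l * ln 2 * E \<le> c"
  shows "exp (c * n) \<le> 3 * K * exp (ln (real D) + 3 * K + y) * (2 * (real K + 1)) ^ K * (8 * real D * (real n + 1)) ^ E"
proof -
  define Q where "Q = 3 * K * exp (ln (real D) + 3 * K + y) * (2 * (real K + 1)) ^ K"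
  define w where "w = 8 * real D * (real n + 1)"
  have w: "0 < w" using D by (simp add: w_def)
  have "0 < \<alpha> + \<epsilon>\<^sub>1 / 2" "0 < \<alpha> + \<epsilon>\<^sub>1 / 4" "\<alpha> \<le> 1" using \<alpha> by simp_all
  note upper = walk_upper_bound[OF \<alpha>(1) \<open>\<alpha> \<le> 1\<close> D k this(1,2) N y]
  have "2 * c * n = \<epsilon>\<^sub>1 / 4 * ln (real D) * (\<eta> * n)" by (simp add: c)
  also have "\<dots> \<le> \<epsilon>\<^sub>1 / 4 * ln (real D) * m" using n(2) \<alpha> D by (intro mult_left_mono) auto
  finally have rate: "exp (- ((\<alpha> + \<epsilon>\<^sub>1 / 4 - \<alpha>) * ln (real D) * m)) \<le> exp (- (2 * c * n))" by simp
  have "(\<rho> / w) ^ E / (2 * (real K + 1)) ^ K \<le> (3 * real k * real D ^ (m + 1)) powr \<alpha> * (exp (3 * real k) * exp (- y) ^ N)"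
    using walk_lower_bound[OF \<rho>(1,2) _ n(1) k(2), of D "2 * v" r] D walk by (simp add: E w_def)
  also have "\<dots> \<le> 3 * K * exp (ln (real D) + 3 * K + y) * exp (- (2 * c * n))"
    using upper mult_left_mono[OF rate, of "3 * K * exp (ln (real D) + 3 * K + y)"] by simp
  finally have "(\<rho> / w) ^ E \<le> Q * exp (- (2 * c * n))" by (simp add: Q_def pos_divide_le_eq mult_ac)
  then have "\<rho> ^ E \<le> Q * exp (- (2 * c * n)) * w ^ E" using w by (simp add: power_divide pos_divide_le_eq)
  moreover have "exp (- (c * n)) \<le> \<rho> ^ E"
  proof -
    have "l * ln 2 * E * n \<le> c * n" using l by (intro mult_right_mono) auto
    then have "exp (- (c * n)) \<le> exp (E * (- l * n * ln 2))" by (simp add: algebra_simps)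
    also have "\<dots> = (2 powr (- l * n)) ^ E" by (simp only: powr_def exp_of_nat_mult) simp
    also have "\<dots> \<le> \<rho> ^ E" using \<rho>(3) by (intro power_mono) auto
    finally show ?thesis .
  qed
  ultimately have loss_le: "exp (- (c * n)) \<le> Q * exp (- (2 * c * n)) * w ^ E" by (rule order_trans[rotated])
  have "exp (c * n) = exp (- (c * n)) * exp (2 * c * n)" by (simp add: exp_add[symmetric])
  also have "\<dots> \<le> Q * exp (- (2 * c * n)) * w ^ E * exp (2 * c * n)" using loss_le by (rule mult_right_mono) simp
  also have "\<dots> = Q * w ^ E" by (simp add: exp_minus)
  finally show ?thesis by (simp only: Q_def w_def)
qed

theorem no_twist_config:
  fixes \<alpha> \<epsilon>\<^sub>1 \<sigma>\<^sub>0 \<eta> :: real and D :: nat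
  assumes \<alpha>: "0 < \<alpha>" "0 < \<epsilon>\<^sub>1" "\<alpha> + \<epsilon>\<^sub>1 \<le> 1" and \<sigma>\<^sub>0: "0 < \<sigma>\<^sub>0" and \<eta>: "0 < \<eta>" and D: "1 < D"
  obtains l :: real and n\<^sub>0 :: nat where "0 < l"
    "\<And>n A B C a a' nB nC m M S H \<rho> \<sigma> \<tau>. n\<^sub>0 \<le> n \<Longrightarrow> 2 powr (- l * n) \<le> \<rho> \<Longrightarrow>
      \<not> twist_config D B a nB C a' nC \<alpha> \<epsilon>\<^sub>1 \<sigma>\<^sub>0 \<eta> n m M A H S \<rho> \<sigma> \<tau>"
proof -
  have half: "0 < \<epsilon>\<^sub>1 / 2" "\<epsilon>\<^sub>1 / 2 < \<alpha> + \<epsilon>\<^sub>1" "\<alpha> + \<epsilon>\<^sub>1 - \<epsilon>\<^sub>1 / 2 = \<alpha> + \<epsilon>\<^sub>1 / 2" using \<alpha> by simp_all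
  obtain \<epsilon> :: real and n\<^sub>1 P :: nat where \<epsilon>: "0 < \<epsilon>" and mann: "\<And>m. n\<^sub>1 \<le> m \<Longrightarrow> mann_bound (\<epsilon>\<^sub>1 / 2) \<sigma>\<^sub>0 P \<epsilon> m"
    by (rule approximate_mann[OF half(1) \<sigma>\<^sub>0]) blast
  define r where "r = nat \<lceil>1 / \<epsilon>\<rceil> + 1"
  have "1 / \<epsilon> < r" unfolding r_def by linarith
  then have r: "1 < r * \<epsilon>" "0 < r" using \<epsilon> by (simp_all add: pos_divide_less_eq r_def)
  obtain v g :: nat and h s y :: real where v: "0 < v" and g: "0 < g" and h: "0 < h" and s: "0 \<le> s"
    and gap: "wide_gap D h (r * (2 * v + 1)) g" and decay: "decay_factor v h s \<le> exp (- y)"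
    and y: "(\<alpha> + \<epsilon>\<^sub>1 / 4) * (real (g + 2 * P) * ln (real D)) \<le> (\<alpha> + \<epsilon>\<^sub>1 / 2) * y"
    by (rule exists_walk_parameters[OF \<alpha> D r(2)])
  define K where "K = r * (2 * v + 1)"
  define c where "c = \<epsilon>\<^sub>1 / 8 * \<eta> * ln (real D)"
  have c: "0 < c" using \<alpha> \<eta> D by (simp add: c_def)
  define E where "E = ((2 * v + 3) * r + 1) * K"
  have E: "0 < E" using r by (simp add: E_def K_def)
  define l where "l = min (\<epsilon> * \<eta> / 4) (c / (ln 2 * E))"
  have "l \<le> \<epsilon> * \<eta> / 4" "l \<le> c / (ln 2 * E)" unfolding l_def by (rule min.cobounded1, rule min.cobounded2)
  moreover have "0 < l" using \<epsilon> \<eta> c E by (simp add: l_def)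
  ultimately have l: "0 < l" "l \<le> \<epsilon> * \<eta> / 4" "l * ln 2 * E \<le> c"
    using E by (simp_all add: pos_le_divide_eq mult.assoc)
  define Q where "Q = 3 * K * exp (ln (real D) + 3 * K + y) * (2 * (real K + 1)) ^ K"
  obtain n\<^sub>2 where n\<^sub>2: "\<And>n. n\<^sub>2 \<le> n \<Longrightarrow> Q * (8 * real D * (real n + 1)) ^ E < exp (c * n)"
    by (rule polynomial_below_exp[OF c]) blast
  define n\<^sub>0 where "n\<^sub>0 = max (max n\<^sub>2 (nat \<lceil>8 / (\<epsilon> * \<eta>)\<rceil>)) (nat \<lceil>(real n\<^sub>1 + 1) / \<eta>\<rceil>)"
  have False if n: "n\<^sub>0 \<le> n" and loss: "2 powr (- l * n) \<le> \<rho>"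
    and config: "twist_config D B a nB C a' nC \<alpha> \<epsilon>\<^sub>1 \<sigma>\<^sub>0 \<eta> n m M A H S \<rho> \<sigma> \<tau>"
    for n A B C a a' nB nC m M S H \<rho> \<sigma> \<tau>
  proof -
    interpret twist_config D B a nB C a' nC \<alpha> \<epsilon>\<^sub>1 \<sigma>\<^sub>0 \<eta> n m M A H S \<rho> \<sigma> \<tau> by (rule config)
    have "n\<^sub>2 \<le> n" "8 / (\<epsilon> * \<eta>) \<le> n" "(real n\<^sub>1 + 1) / \<eta> \<le> n" using n unfolding n\<^sub>0_def by linarith+
    then have n_ge: "n\<^sub>2 \<le> n" "8 \<le> \<epsilon> * \<eta> * n" "real n\<^sub>1 + 1 \<le> \<eta> * n"
      using \<epsilon> \<eta> by (simp_all add: pos_divide_le_eq mult.commute)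
    then have m: "n\<^sub>1 \<le> m" "0 < m" using heights(4) by linarith+
    obtain k N where k: "0 < k" "k \<le> K" and N: "(\<alpha> + \<epsilon>\<^sub>1 - \<epsilon>\<^sub>1 / 2) * m \<le> (real N + 1) * real (g + 2 * P)"
      and walk: "(stage_loss \<rho> nC D (2 * v) ^ r * \<rho> / (2 * (real k + 1))) ^ k \<le>
        (3 * real k * real D ^ (m + 1)) powr \<alpha> * (exp (3 * real k) * exp (- y) ^ N)"
      unfolding K_def
      by (rule walk_inequality[OF mann[OF m(1)] \<epsilon> r(1) power_two_ge_of_loss[OF loss l(2) n_ge(2) heights(4) \<epsilon>]
          m(2) v h s gap g decay D \<alpha>(1) half(2)])
    have "exp (c * n) \<le> Q * (8 * real D * (real n + 1)) ^ E"
      unfolding Q_def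
      by (rule exp_le_of_walk[OF \<alpha> D k N[unfolded half] y walk \<rho> loss heights(1,4) c_def E_def l(3)])
    then show False using n\<^sub>2[OF n_ge(1)] by simp
  qed
  then show ?thesis by (intro that[OF l(1)]) blast
qed

section \<open>Energy\<close>

definition cell :: "nat \<Rightarrow> nat \<Rightarrow> int \<times> nat \<Rightarrow> int" where
  "cell M c g = fst g + int (c * snd g div M)"

definition twists :: "nat \<Rightarrow> nat \<Rightarrow> (int \<times> nat) set \<Rightarrow> (int \<times> nat \<times> nat) set" where
  "twists M c G = {(a', b, b') |a' b b'. (a', b') \<in> G \<and> (twist M c (a', b, b'), b) \<in> G}"

lemma twists_subset: "G \<subseteq> A \<times> B \<Longrightarrow> twists M c G \<subseteq> A \<times> B \<times> B"
  by (auto simp: twists_def)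

lemma twist_mem: "x \<in> twists M c G \<Longrightarrow> G \<subseteq> A \<times> B \<Longrightarrow> twist M c x \<in> A"
  by (auto simp: twists_def)

lemma card_squared_le_energy:
  assumes "finite G"
  shows "(real (card G))\<^sup>2 \<le> card (f ` G) * (\<Sum>u\<in>f ` G. (real (card (fibre G f u)))\<^sup>2)"
  using sum_squared_le_sum_of_squares[of "\<lambda>u. real (card (fibre G f u))" "f ` G"]
  by (simp add: card_by_fibres[OF assms, of f] mult.commute)

lemma energy_le_card_twists:
  assumes fin: "finite G"
  shows "(\<Sum>u\<in>cell M c ` G. (real (card (fibre G (cell M c) u)))\<^sup>2) \<le> card (twists M c G)"
proof -
  let ?F = "fibre G (cell M c)"
  let ?E = "SIGMA u:cell M c ` G. ?F u \<times> ?F u"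
  define t where "t e = (fst (snd (snd e)), snd (fst (snd e)), snd (snd (snd e)))" for e :: "int \<times> (int \<times> nat) \<times> int \<times> nat"
  have "(\<Sum>u\<in>cell M c ` G. (real (card (?F u)))\<^sup>2) = card ?E"
    using fin by (simp add: card_SigmaI finite_fibre card_cartesian_product power2_eq_square)
  also have "\<dots> \<le> card (twists M c G)"
  proof (rule of_nat_mono, rule card_inj_on_le[of t])
    show "inj_on t ?E" by (rule inj_onI) (auto simp: t_def cell_def fibre_def)
    show "t ` ?E \<subseteq> twists M c G"
    proof (rule image_subsetI)
      fix e assume "e \<in> ?E"
      then obtain u g g' where e: "e = (u, g, g')" "g \<in> G" "g' \<in> G" "cell M c g = cell M c g'"
        by (auto simp: fibre_def)
      then have "twist M c (t e) = fst g" by (simp add: t_def twist_def cell_def)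
      then show "t e \<in> twists M c G" using e by (simp add: twists_def t_def)
    qed
    have "twists M c G \<subseteq> (\<lambda>(g, g'). (fst g', snd g, snd g')) ` (G \<times> G)"
      by (force simp: twists_def)
    then show "finite (twists M c G)" using fin finite_subset by blast
  qed
  finally show ?thesis .
qed

lemma card_squared_le_twists:
  assumes "finite G"
  shows "(real (card G))\<^sup>2 \<le> card (cell M c ` G) * real (card (twists M c G))"
  using card_squared_le_energy[OF assms] energy_le_card_twists[OF assms]
  by (rule order_trans[OF _ mult_left_mono]) simp

lemma dense_points:
  fixes f :: "'a \<Rightarrow> real" and F p :: real
  assumes fin: "finite S" and F: "0 < F" "\<And>s. s \<in> S \<Longrightarrow> f s \<le> F" and p: "0 < p"
    and sum: "p * F * card S \<le> (\<Sum>s\<in>S. f s)"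
  shows "p / 2 * card S \<le> card {s\<in>S. p / 2 * F \<le> f s}"
proof -
  let ?T = "{s\<in>S. p / 2 * F \<le> f s}"
  have "(\<Sum>s\<in>S. f s) = (\<Sum>s\<in>?T. f s) + (\<Sum>s\<in>S - ?T. f s)" using sum.subset_diff[of ?T S f] fin by simp
  also have "(\<Sum>s\<in>?T. f s) \<le> (\<Sum>s\<in>?T. F)" using F(2) by (intro sum_mono) auto
  also have "(\<Sum>s\<in>S - ?T. f s) \<le> (\<Sum>s\<in>S - ?T. p / 2 * F)" by (intro sum_mono) auto
  also have "(\<Sum>s\<in>S - ?T. p / 2 * F) \<le> card S * (p / 2 * F)"
    using fin p F(1) by (auto intro!: mult_right_mono card_mono)
  finally have "F * (p / 2 * card S) \<le> F * card ?T" using sum by (simp add: algebra_simps)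
  then show ?thesis using F(1) by simp
qed

lemma sum_card_twists_ge:
  fixes p q :: real and G :: "nat \<Rightarrow> (int \<times> nat) set"
  assumes fin: "finite A" "finite B" "finite C" and ne: "A \<noteq> {}" "C \<noteq> {}" and p: "0 < p" and q: "0 < q"
    and G: "\<And>c. c \<in> C \<Longrightarrow> G c \<subseteq> A \<times> B" "\<And>c. c \<in> C \<Longrightarrow> p * card (cell M c ` G c) \<le> card A"
    and sum: "q * (card A * card B * card C) \<le> (\<Sum>c\<in>C. real (card (G c)))"
  shows "p * q\<^sup>2 * card C * (card A * (real (card B))\<^sup>2) \<le> (\<Sum>c\<in>C. real (card (twists M c (G c))))"
proof -
  have card_pos: "0 < card A" "0 < card C" using fin ne by (auto simp: card_gt_0_iff)
  have one: "p / card A * (real (card (G c)))\<^sup>2 \<le> card (twists M c (G c))" if c: "c \<in> C" for c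
  proof -
    have "finite (G c)" using G(1)[OF c] fin(1,2) by (rule finite_subset[OF _ finite_cartesian_product])
    then have "p * (real (card (G c)))\<^sup>2 \<le> p * (card (cell M c ` G c) * real (card (twists M c (G c))))"
      using p by (intro mult_left_mono card_squared_le_twists) auto
    also have "\<dots> \<le> card A * real (card (twists M c (G c)))"
      unfolding mult.assoc[symmetric] using G(2)[OF c] by (rule mult_right_mono) simp
    finally show ?thesis using card_pos by (simp add: field_simps)
  qed
  have "p * q\<^sup>2 * card C * (card A * (real (card B))\<^sup>2) = p / card A * ((q * (card A * card B * card C))\<^sup>2 / card C)"
    using card_pos by (simp add: power2_eq_square)
  also have "\<dots> \<le> p / card A * ((\<Sum>c\<in>C. real (card (G c)))\<^sup>2 / card C)"
    using sum p q by (intro mult_left_mono divide_right_mono power_mono) auto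
  also have "\<dots> \<le> p / card A * (\<Sum>c\<in>C. (real (card (G c)))\<^sup>2)"
    using sum_squared_le_sum_of_squares[of "\<lambda>c. real (card (G c))" C] card_pos p
    by (intro mult_left_mono) (simp_all add: pos_divide_le_eq)
  also have "\<dots> \<le> (\<Sum>c\<in>C. real (card (twists M c (G c))))"
    unfolding sum_distrib_left using one by (rule sum_mono)
  finally show ?thesis .
qed

lemma dense_twists:
  fixes p q :: real and G :: "nat \<Rightarrow> (int \<times> nat) set"
  assumes fin: "finite A" "finite B" "finite C" and ne: "A \<noteq> {}" "B \<noteq> {}" "C \<noteq> {}" and p: "0 < p" and q: "0 < q"
    and G: "\<And>c. c \<in> C \<Longrightarrow> G c \<subseteq> A \<times> B" "\<And>c. c \<in> C \<Longrightarrow> p * card (cell M c ` G c) \<le> card A"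
    and sum: "q * (card A * card B * card C) \<le> (\<Sum>c\<in>C. real (card (G c)))"
  obtains H S where "H \<noteq> {}" "H \<subseteq> A \<times> B \<times> B" "p * q\<^sup>2 / 2 * (real (card A) * (real (card B))\<^sup>2) \<le> card H"
    "\<And>x. x \<in> H \<Longrightarrow> S x \<subseteq> C" "\<And>x. x \<in> H \<Longrightarrow> p * q\<^sup>2 / 2 * card C \<le> card (S x)"
    "\<And>x c. x \<in> H \<Longrightarrow> c \<in> S x \<Longrightarrow> twist M c x \<in> A"
proof -
  define X where "X = A \<times> B \<times> B"
  define S where "S x = {c\<in>C. x \<in> twists M c (G c)}" for x
  have finX: "finite X" using fin by (simp add: X_def)
  have card_X: "real (card X) = real (card A) * (real (card B))\<^sup>2"
    by (simp add: X_def card_cartesian_product power2_eq_square)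
  have card_pos: "0 < card C" "0 < card X" using fin ne by (simp_all add: card_gt_0_iff X_def)
  have "twists M c (G c) = {x\<in>X. x \<in> twists M c (G c)}" if "c \<in> C" for c
    using twists_subset[OF G(1)[OF that], of M c] unfolding X_def by blast
  then have "(\<Sum>c\<in>C. card (twists M c (G c))) = (\<Sum>c\<in>C. card {x\<in>X. x \<in> twists M c (G c)})" by simp
  also have "\<dots> = (\<Sum>x\<in>X. card (S x))"
    unfolding S_def using sum_multicount_gen[OF fin(3) finX, of "\<lambda>c x. x \<in> twists M c (G c)"] by simp
  finally have incidences: "(\<Sum>c\<in>C. real (card (twists M c (G c)))) = (\<Sum>x\<in>X. real (card (S x)))"
    unfolding of_nat_sum[symmetric] by simp
  define H where "H = {x\<in>X. p * q\<^sup>2 / 2 * card C \<le> card (S x)}"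
  have large: "p * q\<^sup>2 / 2 * card X \<le> card H"
    unfolding H_def
  proof (rule dense_points[OF finX])
    show "real (card (S x)) \<le> card C" for x using fin(3) by (auto simp: S_def intro!: card_mono)
    show "p * q\<^sup>2 * real (card C) * real (card X) \<le> (\<Sum>x\<in>X. real (card (S x)))"
      using sum_card_twists_ge[OF fin ne(1,3) p q G sum] by (simp add: incidences card_X)
  qed (use card_pos p q in auto)
  have "0 < p * q\<^sup>2 / 2 * card X" using p q card_pos by simp
  then have "H \<noteq> {}" using large by auto
  then show ?thesis
  proof (rule that[of H S])
    show "H \<subseteq> A \<times> B \<times> B" by (auto simp: H_def X_def)
    show "p * q\<^sup>2 / 2 * (real (card A) * (real (card B))\<^sup>2) \<le> card H" using large by (simp add: card_X)
    show "S x \<subseteq> C" for x by (auto simp: S_def)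
    show "p * q\<^sup>2 / 2 * card C \<le> card (S x)" if "x \<in> H" for x using that by (simp add: H_def)
    show "twist M c x \<in> A" if "c \<in> S x" for x c using that by (auto simp: S_def intro: twist_mem[OF _ G(1)])
  qed
qed

section \<open>Passing to uniform trees\<close>

lemma dense_uniform_subset:
  fixes f :: "nat \<Rightarrow> real" and F p :: real
  assumes X: "finite X" "X \<noteq> {}" and D: "D = 2 ^ W" and F: "0 < F" "\<And>x. x \<in> X \<Longrightarrow> f x \<le> F" and p: "0 < p"
    and sum: "p * F * card X \<le> (\<Sum>x\<in>X. f x)"
  obtains Y a where "Y \<subseteq> X" "Y \<noteq> {}" "uniform_tree D Y a n" "p / 2 * card X \<le> (4 * (real W + 1)) ^ n * card Y"
    "p / 2 * F * card Y \<le> (\<Sum>x\<in>Y. f x)"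
proof -
  define X' where "X' = {x\<in>X. p / 2 * F \<le> f x}"
  have large: "p / 2 * card X \<le> card X'" unfolding X'_def by (rule dense_points[OF X(1) F p sum])
  have "0 < p / 2 * card X" using p X by (simp add: card_gt_0_iff)
  then have "0 < card X'" using large by linarith
  then have X': "finite X'" "X' \<noteq> {}" using card_gt_0_iff by blast+
  obtain Y a where Y: "Y \<subseteq> X'" "Y \<noteq> {}" "uniform_tree D Y a n" "card X' \<le> (4 * (W + 1)) ^ n * card Y"
    using uniform_subset[OF X' D, of n] by blast
  have "real (card X') \<le> real ((4 * (W + 1)) ^ n * card Y)" using Y(4) by (rule of_nat_mono)
  then have "p / 2 * card X \<le> (4 * (real W + 1)) ^ n * card Y" using large by (simp add: add.commute)
  moreover have "p / 2 * F * card Y \<le> (\<Sum>x\<in>Y. f x)"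
    using sum_bounded_below[of Y "p / 2 * F" f] Y(1) by (auto simp: X'_def mult.commute)
  ultimately show ?thesis using Y(1-3) by (intro that[of Y a]) (auto simp: X'_def)
qed

lemma dense_uniform_pair:
  fixes w :: "nat \<Rightarrow> nat \<Rightarrow> real" and F p :: real
  assumes B: "finite B" "B \<noteq> {}" and C: "finite C" "C \<noteq> {}" and D: "D = 2 ^ W" and p: "0 < p"
    and w: "0 < F" "\<And>b c. b \<in> B \<Longrightarrow> c \<in> C \<Longrightarrow> w b c \<le> F"
    and sum: "p * (F * card B * card C) \<le> (\<Sum>b\<in>B. \<Sum>c\<in>C. w b c)"
  obtains B' C' a a' where "B' \<subseteq> B" "B' \<noteq> {}" "C' \<subseteq> C" "C' \<noteq> {}" "uniform_tree D B' a n" "uniform_tree D C' a' n"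
    "p / 2 * card B \<le> (4 * (real W + 1)) ^ n * card B'" "p / 4 * card C \<le> (4 * (real W + 1)) ^ n * card C'"
    "p / 4 * F * (card B' * card C') \<le> (\<Sum>b\<in>B'. \<Sum>c\<in>C'. w b c)"
proof -
  have pos: "0 < F * card C" using w(1) C by (simp add: card_gt_0_iff)
  have bound: "(\<Sum>c\<in>C. w b c) \<le> F * card C" if "b \<in> B" for b
    using sum_bounded_above[of C "w b" F] w(2) that by (simp add: mult.commute)
  have sum_B: "p * (F * card C) * card B \<le> (\<Sum>b\<in>B. \<Sum>c\<in>C. w b c)" using sum by (simp add: mult_ac)
  obtain B' a where B': "B' \<subseteq> B" "B' \<noteq> {}" "uniform_tree D B' a n"
      "p / 2 * card B \<le> (4 * (real W + 1)) ^ n * card B'"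
    and sum_B': "p / 2 * (F * card C) * card B' \<le> (\<Sum>b\<in>B'. \<Sum>c\<in>C. w b c)"
    by (rule dense_uniform_subset[OF B D pos bound p sum_B])
  have pos': "0 < p / 2" "0 < F * card B'"
    using p w(1) B'(2) finite_subset[OF B'(1) B(1)] by (simp_all add: card_gt_0_iff)
  have bound': "(\<Sum>b\<in>B'. w b c) \<le> F * card B'" if "c \<in> C" for c
    using sum_bounded_above[of B' "\<lambda>b. w b c" F] w(2) that B'(1) by (auto simp: mult.commute)
  have sum_C: "p / 2 * (F * card B') * card C \<le> (\<Sum>c\<in>C. \<Sum>b\<in>B'. w b c)"
    using sum_B' by (subst sum.swap) (simp add: mult_ac)
  obtain C' a' where C': "C' \<subseteq> C" "C' \<noteq> {}" "uniform_tree D C' a' n"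
      "p / 2 / 2 * card C \<le> (4 * (real W + 1)) ^ n * card C'"
    and sum_C': "p / 2 / 2 * (F * card B') * card C' \<le> (\<Sum>c\<in>C'. \<Sum>b\<in>B'. w b c)"
    by (rule dense_uniform_subset[OF C D pos'(2) bound' pos'(1) sum_C])
  have "p / 4 * F * (card B' * card C') \<le> (\<Sum>b\<in>B'. \<Sum>c\<in>C'. w b c)"
    using sum_C' by (subst sum.swap) (simp add: mult_ac)
  then show ?thesis using C'(4) by (intro that[OF B'(1,2) C'(1,2) B'(3) C'(3) B'(4)]) simp_all
qed

lemma exists_dense_node:
  fixes f :: "nat \<Rightarrow> real" and q :: real
  assumes fin: "finite X" "X \<noteq> {}" and q: "q * card X \<le> (\<Sum>x\<in>X. f x)"
  shows "\<exists>x\<in>X. q * card (node D X e x) \<le> (\<Sum>y\<in>node D X e x. f y)"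
proof -
  have "q * card X \<le> (\<Sum>x\<in>X. fibre_avg X (\<lambda>b. b div D ^ e) f x)"
    unfolding sum_fibre_avg[OF fin(1)] by (rule q)
  then obtain x where x: "x \<in> X" "q \<le> fibre_avg X (\<lambda>b. b div D ^ e) f x" using exists_ge_average[OF fin] by blast
  have "0 < card (node D X e x)" unfolding node_def by (rule card_fibre_pos[OF fin(1) x(1)])
  then have "q * card (node D X e x) \<le> (\<Sum>y\<in>node D X e x. f y)"
    using x(2) unfolding fibre_avg_def node_def by (simp add: pos_le_divide_eq)
  then show ?thesis using x(1) by blast
qed

lemma localize_pair:
  fixes w :: "nat \<Rightarrow> nat \<Rightarrow> real" and q :: real
  assumes B: "finite B" "B \<noteq> {}" and C: "finite C" "C \<noteq> {}"
    and sum: "q * (card B * card C) \<le> (\<Sum>b\<in>B. \<Sum>c\<in>C. w b c)"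
  obtains x y where "x \<in> B" "y \<in> C"
    "q * (card (node D B i x) * card (node D C j y)) \<le> (\<Sum>b\<in>node D B i x. \<Sum>c\<in>node D C j y. w b c)"
proof -
  have "(q * card C) * card B \<le> (\<Sum>b\<in>B. \<Sum>c\<in>C. w b c)" using sum by (simp add: mult_ac)
  then obtain x where x: "x \<in> B" "(q * card C) * card (node D B i x) \<le> (\<Sum>b\<in>node D B i x. \<Sum>c\<in>C. w b c)"
    using exists_dense_node[OF B] by blast
  then have "(q * card (node D B i x)) * card C \<le> (\<Sum>c\<in>C. \<Sum>b\<in>node D B i x. w b c)"
    by (subst sum.swap) (simp add: mult_ac)
  then obtain y where y: "y \<in> C"
    "(q * card (node D B i x)) * card (node D C j y) \<le> (\<Sum>c\<in>node D C j y. \<Sum>b\<in>node D B i x. w b c)"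
    using exists_dense_node[OF C] by blast
  have "q * (card (node D B i x) * card (node D C j y)) \<le> (\<Sum>b\<in>node D B i x. \<Sum>c\<in>node D C j y. w b c)"
    using y(2) by (subst sum.swap) (simp add: mult_ac)
  then show ?thesis by (rule that[OF x(1) y(1)])
qed

definition log_count :: "(nat \<Rightarrow> nat) \<Rightarrow> nat \<Rightarrow> real" where
  "log_count a i = (\<Sum>j<i. real (a j))"

lemma log_leaf_count: "log 2 (leaf_count a i) = log_count a i"
  by (simp add: leaf_count_def log_count_def log_nat_power)

lemma (in rooted_uniform_tree) log_card: "log 2 (card X) = log_count a n"
  by (simp add: card_X log_leaf_count)

context uniform_tree
begin

lemma branching_le:
  assumes D: "D = 2 ^ W" and X: "X \<noteq> {}" and j: "j < n"
  shows "a j \<le> W"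
proof -
  obtain x where x: "x \<in> X" using X by blast
  have "2 ^ a j = card (children D X j x)" using card_children[OF j x] by simp
  also have "\<dots> \<le> 2 ^ W" using children_card_le[OF D_pos] D by metis
  finally show ?thesis by simp
qed

lemma card_active_levels_ge:
  fixes s :: real
  assumes D: "D = 2 ^ W" "0 < W" and X: "X \<noteq> {}" and h: "h = top_height (log_count a) n s" and t: "t \<le> h"
  shows "s / W * t \<le> card (active_levels a h t)"
proof (cases "t = 0")
  case False
  define i where "i = h - t"
  have i: "i < h" "h \<le> n" using t False top_height_le[of "log_count a" n s] by (auto simp: i_def h)
  have "s * (real h - i) < log_count a h - log_count a i"
    using top_height_slope[of i "log_count a" n s] i(1) by (simp add: h)
  also have "\<dots> = (\<Sum>j\<in>{i..<h}. real (a j))"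
    unfolding log_count_def using i by (simp add: sum_diff_nat_ivl atLeast0LessThan[symmetric])
  also have "\<dots> \<le> (\<Sum>j\<in>{i..<h}. real W * (if 1 \<le> a j then 1 else 0))"
    using branching_le[OF D(1) X] i by (intro sum_mono) auto
  also have "\<dots> = W * real (card {j\<in>{i..<h}. 1 \<le> a j})"
    by (simp add: sum_distrib_left[symmetric] sum.If_cases Int_def)
  also have "card {j\<in>{i..<h}. 1 \<le> a j} = card (active_levels a h t)"
    by (rule bij_betw_same_card[OF bij_betwI[where f = "\<lambda>j. h - 1 - j" and g = "\<lambda>l. h - 1 - l"]])
      (use t in \<open>auto simp: i_def active_levels_def\<close>)
  finally have "s * t \<le> W * real (card (active_levels a h t))" using t by (simp add: i_def)
  then show ?thesis using D(2) by (simp add: field_simps)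
qed simp

lemma log_count_le:
  assumes D: "D = 2 ^ W" and X: "X \<subseteq> Y" "X \<noteq> {}" and Y: "finite Y" "katz_tao_ints s (int ` Y)" and i: "i \<le> n"
  shows "log_count a i \<le> s * W * i"
proof -
  obtain x where x: "x \<in> X" using X(2) by blast
  have "real (card (node D X i x)) \<le> real (card {y\<in>int ` Y. \<bar>real_of_int y - real_of_int (int x)\<bar> \<le> real D ^ i})"
  proof (rule of_nat_mono, rule card_inj_on_le[of int])
    show "int ` node D X i x \<subseteq> {y\<in>int ` Y. \<bar>real_of_int y - real_of_int (int x)\<bar> \<le> real D ^ i}"
      using same_node_diff[OF D_pos, of _ i x] X(1) by (fastforce simp: node_iff)
  qed (use Y in auto)
  also have "\<dots> \<le> (real D ^ i) powr s" using D_pos by (intro katz_tao_intsD[OF Y(2)]) simp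
  finally have "leaf_count a i \<le> (real D ^ i) powr s" using card_node[OF i x] by simp
  also have "\<dots> = 2 powr (s * W * i)"
    by (simp add: D power_mult[symmetric] powr_realpow[symmetric] powr_powr mult_ac)
  finally have "log 2 (leaf_count a i) \<le> log 2 (2 powr (s * W * i))"
    using leaf_count_pos[of a i] by (intro log_mono) auto
  then show ?thesis by (simp add: log_leaf_count)
qed

end

section \<open>Choice of heights\<close>

lemma scaled_log_ge:
  fixes \<alpha> \<eta> \<epsilon>\<^sub>1 b x e y :: real
  assumes \<alpha>: "0 < \<alpha>" "\<alpha> \<le> b" and \<eta>: "0 < \<eta>" "\<eta> \<le> 1" and \<epsilon>\<^sub>1: "0 < \<epsilon>\<^sub>1" "\<epsilon>\<^sub>1 \<le> \<alpha> * \<eta> / 8"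
    and x: "0 \<le> x" "0 \<le> e" "x - e \<le> y"
  shows "(1 - \<eta> / 8) * (x / b) - e / \<alpha> \<le> y / (b + \<epsilon>\<^sub>1)"
proof -
  have b: "0 < b" using \<alpha> by linarith
  have "\<alpha> * \<eta> \<le> b * \<eta>" using \<alpha> \<eta> by (intro mult_right_mono) auto
  then have "\<epsilon>\<^sub>1 \<le> b * \<eta> / 8" using \<epsilon>\<^sub>1(2) by linarith
  moreover have "0 \<le> \<eta> / 8 * \<epsilon>\<^sub>1" using \<eta> \<epsilon>\<^sub>1 by simp
  ultimately have "(1 - \<eta> / 8) * (b + \<epsilon>\<^sub>1) \<le> b" by (simp add: algebra_simps)
  then have "(1 - \<eta> / 8) / b \<le> 1 / (b + \<epsilon>\<^sub>1)" using b \<epsilon>\<^sub>1 by (simp add: divide_simps)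
  then have "x * ((1 - \<eta> / 8) / b) \<le> x * (1 / (b + \<epsilon>\<^sub>1))" using x(1) by (rule mult_left_mono)
  then have "(1 - \<eta> / 8) * (x / b) \<le> x / (b + \<epsilon>\<^sub>1)" by (simp add: mult.commute)
  moreover have "e / (b + \<epsilon>\<^sub>1) \<le> e / \<alpha>" using x(2) \<alpha> \<epsilon>\<^sub>1 by (intro divide_left_mono) auto
  moreover have "(x - e) / (b + \<epsilon>\<^sub>1) \<le> y / (b + \<epsilon>\<^sub>1)" using x(3) b \<epsilon>\<^sub>1 by (intro divide_right_mono) auto
  ultimately show ?thesis unfolding diff_divide_distrib by linarith
qed

lemma normalized_product_condition:
  fixes \<beta> \<gamma> \<eta> x y m :: real
  assumes \<beta>: "0 < \<beta>" "\<beta> \<le> 1" and \<gamma>: "0 < \<gamma>" "\<gamma> \<le> 1" and \<eta>: "0 < \<eta>" "\<eta> \<le> 1" and m: "0 \<le> m"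
    and product: "m * (\<beta> * \<gamma> + \<eta>) \<le> \<gamma> * x + \<beta> * y"
  shows "(1 + 3 * \<eta> / 4) * m \<le> (1 - \<eta> / 8) * (x / \<beta> + y / \<gamma>)"
proof -
  have "\<beta> * \<gamma> \<le> 1" using \<beta> \<gamma> by (intro mult_le_one) auto
  then have "m * (\<eta> * (\<beta> * \<gamma>)) \<le> m * (\<eta> * 1)" using m \<eta> by (intro mult_left_mono) auto
  then have "(m * (1 + \<eta>)) * (\<beta> * \<gamma>) \<le> m * (\<beta> * \<gamma> + \<eta>)" by (simp add: algebra_simps)
  also have "\<dots> \<le> \<gamma> * x + \<beta> * y" by (rule product)
  also have "\<dots> = (x / \<beta> + y / \<gamma>) * (\<beta> * \<gamma>)" using \<beta> \<gamma> by (simp add: field_simps)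
  finally have "m * (1 + \<eta>) \<le> x / \<beta> + y / \<gamma>" using \<beta> \<gamma> by simp
  then have scaled: "(1 - \<eta> / 8) * (m * (1 + \<eta>)) \<le> (1 - \<eta> / 8) * (x / \<beta> + y / \<gamma>)" using \<eta> by (intro mult_left_mono) auto
  have "\<eta> * \<eta> \<le> \<eta>" using \<eta> by (simp add: mult_left_le)
  moreover have "(1 - \<eta> / 8) * (1 + \<eta>) = 1 + 7 * \<eta> / 8 - \<eta> * \<eta> / 8" by (simp add: field_simps)
  ultimately have "1 + 3 * \<eta> / 4 \<le> (1 - \<eta> / 8) * (1 + \<eta>)" by linarith
  then have "(1 + 3 * \<eta> / 4) * m \<le> (1 - \<eta> / 8) * (1 + \<eta>) * m" using m by (rule mult_right_mono)
  then show ?thesis using scaled by (simp add: mult_ac)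
qed

lemma rounded_length_ge:
  fixes \<alpha> \<eta> m n W :: real
  assumes \<alpha>: "0 < \<alpha>" and \<eta>: "0 < \<eta>" "\<eta> \<le> 1" and W: "1 \<le> W" and n: "W * (n - 1) \<le> m" "2 + 3 / \<alpha> \<le> \<eta> / 16 * n"
  shows "(1 + \<eta> / 2) * (W * n) \<le> (1 + 5 * \<eta> / 8) * m - 3 / \<alpha> - \<eta> / 16 * (W * n)"
proof -
  define k where "k = 3 / \<alpha>"
  have "0 \<le> k" using \<alpha> by (simp add: k_def)
  then have "1 * k \<le> W * k" using W by (intro mult_right_mono) auto
  define v where "v = \<eta> * (W * n)"
  have "\<eta> * W \<le> W" using \<eta> W by simp
  moreover have "2 * W + W * k \<le> v / 16"
    using mult_left_mono[OF n(2), of W] W by (simp add: v_def k_def algebra_simps)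
  ultimately have "W * n + 9 / 16 * v + k \<le> W * n + 5 / 8 * v - W - 5 / 8 * (\<eta> * W)"
    using \<open>1 * k \<le> W * k\<close> W by linarith
  also have "\<dots> = (1 + 5 * \<eta> / 8) * (W * (n - 1))" by (simp add: v_def field_simps)
  also have "\<dots> \<le> (1 + 5 * \<eta> / 8) * m" using n(1) \<eta> by (intro mult_left_mono) auto
  finally show ?thesis by (simp add: v_def k_def algebra_simps)
qed

lemma total_height_ge:
  fixes \<alpha> \<beta> \<gamma> \<eta> \<epsilon>\<^sub>1 \<epsilon> x y gB gC \<omega> :: real and m n W :: nat
  assumes \<alpha>: "0 < \<alpha>" "\<alpha> \<le> \<beta>" "\<beta> \<le> 1" "\<alpha> \<le> \<gamma>" "\<gamma> \<le> 1" and \<eta>: "0 < \<eta>" "\<eta> \<le> 1" and \<epsilon>\<^sub>1: "0 < \<epsilon>\<^sub>1" "\<epsilon>\<^sub>1 \<le> \<alpha> * \<eta> / 8"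
    and \<epsilon>: "0 < \<epsilon>" "\<epsilon> \<le> \<alpha> * \<eta> / 16" and \<omega>: "0 \<le> \<omega>" "\<omega> \<le> \<alpha> * \<eta> / 32 * W" and xy: "0 \<le> x" "0 \<le> y"
    and product: "m * (\<beta> * \<gamma> + \<eta>) \<le> \<gamma> * x + \<beta> * y"
    and gB: "x - (\<epsilon> * m + 1 + n * \<omega>) \<le> gB" and gC: "y - (\<epsilon> * m + 2 + n * \<omega>) \<le> gC"
    and n: "W * (real n - 1) \<le> m" "2 + 3 / \<alpha> \<le> \<eta> / 16 * n" and W: "1 \<le> W"
  shows "(1 + \<eta> / 2) * n \<le> gB / ((\<beta> + \<epsilon>\<^sub>1) * W) + gC / ((\<gamma> + \<epsilon>\<^sub>1) * W)"
proof -
  let ?eB = "\<epsilon> * m + 1 + n * \<omega>" and ?eC = "\<epsilon> * m + 2 + n * \<omega>"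
  have "0 \<le> ?eB" "0 \<le> ?eC" using \<epsilon> \<omega> by simp_all
  then have B: "(1 - \<eta> / 8) * (x / \<beta>) - ?eB / \<alpha> \<le> gB / (\<beta> + \<epsilon>\<^sub>1)" and C: "(1 - \<eta> / 8) * (y / \<gamma>) - ?eC / \<alpha> \<le> gC / (\<gamma> + \<epsilon>\<^sub>1)"
    using scaled_log_ge[OF \<alpha>(1,2) \<eta> \<epsilon>\<^sub>1 xy(1) _ gB] scaled_log_ge[OF \<alpha>(1,4) \<eta> \<epsilon>\<^sub>1 xy(2) _ gC] by blast+
  have sum: "(1 + 3 * \<eta> / 4) * m \<le> (1 - \<eta> / 8) * (x / \<beta> + y / \<gamma>)"
    using \<alpha> product by (intro normalized_product_condition[OF _ _ _ _ \<eta>]) auto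
  have "?eB / \<alpha> + ?eC / \<alpha> = 2 * \<epsilon> / \<alpha> * m + 3 / \<alpha> + 2 * \<omega> / \<alpha> * n"
    by (simp add: add_divide_distrib[symmetric] algebra_simps)
  moreover have "2 * \<epsilon> / \<alpha> * m \<le> \<eta> / 8 * m" using \<epsilon> \<alpha> by (intro mult_right_mono) (auto simp: field_simps)
  moreover have "2 * \<omega> / \<alpha> * n \<le> \<eta> / 16 * W * n" using \<omega> \<alpha> by (intro mult_right_mono) (auto simp: field_simps)
  ultimately have loss: "?eB / \<alpha> + ?eC / \<alpha> \<le> \<eta> / 8 * m + 3 / \<alpha> + \<eta> / 16 * (real W * n)" by (simp only: mult.assoc)
  have "(1 + \<eta> / 2) * (real W * n) \<le> (1 + 5 * \<eta> / 8) * m - 3 / \<alpha> - \<eta> / 16 * (real W * n)"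
    using rounded_length_ge[OF \<alpha>(1) \<eta> _ n] W by simp
  also have "\<dots> = (1 + 3 * \<eta> / 4) * m - (\<eta> / 8 * m + 3 / \<alpha> + \<eta> / 16 * (real W * n))" by (simp add: algebra_simps)
  also have "\<dots> \<le> gB / (\<beta> + \<epsilon>\<^sub>1) + gC / (\<gamma> + \<epsilon>\<^sub>1)" using B C sum loss unfolding distrib_left by linarith
  finally have "(1 + \<eta> / 2) * n \<le> (gB / (\<beta> + \<epsilon>\<^sub>1) + gC / (\<gamma> + \<epsilon>\<^sub>1)) / W"
    using W by (simp add: pos_le_divide_eq mult_ac)
  then show ?thesis by (simp add: add_divide_distrib)
qed

lemma log_loss:
  fixes p d w :: real and x y n :: nat
  assumes pos: "0 < p" "0 < x" "0 < y" "0 < d" "0 < w" and le: "p / d * real x \<le> w ^ n * real y"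
  shows "log 2 x + log 2 p - log 2 d - n * log 2 w \<le> log 2 y"
proof -
  have "log 2 (p / d * real x) \<le> log 2 (w ^ n * real y)" using pos le by (intro log_mono) auto
  moreover have "log 2 (p / d * real x) = log 2 p - log 2 d + log 2 x" using pos by (simp add: log_mult log_divide)
  moreover have "log 2 (w ^ n * real y) = n * log 2 w + log 2 y" using pos by (simp add: log_mult log_nat_power)
  ultimately show ?thesis by linarith
qed

section \<open>Integer configurations\<close>

locale integer_config =
  fixes \<alpha> \<beta> \<gamma> \<eta> \<epsilon> :: real and m :: nat and A :: "int set" and B C :: "nat set" and G :: "nat \<Rightarrow> (int \<times> nat) set"
  assumes A: "finite A" "A \<noteq> {}" "katz_tao_ints \<alpha> A"
    and B: "B \<subseteq> {..2 ^ m}" "katz_tao_ints \<beta> (int ` B)" and C: "C \<subseteq> {..2 ^ m}" "katz_tao_ints \<gamma> (int ` C)"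
    and product: "2 powr (m * (\<beta> * \<gamma> + \<eta>)) \<le> card B powr \<gamma> * card C powr \<beta>"
    and G: "\<And>c. c \<in> C \<Longrightarrow> G c \<subseteq> A \<times> B" "\<And>c. c \<in> C \<Longrightarrow> 2 powr (- \<epsilon> * m) * (card A * card B) \<le> card (G c)"
      "\<And>c. c \<in> C \<Longrightarrow> card (cell (2 ^ m) c ` G c) \<le> 2 powr (\<epsilon> * m) * card A"
begin

definition density :: real where
  "density = 2 powr (- \<epsilon> * m)"

definition weight :: "nat \<Rightarrow> nat \<Rightarrow> real" where
  "weight b c = card (fibre (G c) snd b)"

lemma density_pos: "0 < density"
  by (simp add: density_def)

lemma finite_BC: "finite B" "finite C"
  using B(1) C(1) finite_subset by blast+

lemma card_BC_pos: "0 < card B" "0 < card C"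
proof -
  have "0 < (2::real) powr (m * (\<beta> * \<gamma> + \<eta>))" by simp
  then have "0 < card B powr \<gamma> * card C powr \<beta>" using product by (rule less_le_trans)
  then show "0 < card B" "0 < card C" by (auto intro: Nat.gr0I)
qed

lemma finite_G: "c \<in> C \<Longrightarrow> finite (G c)"
  using G(1) A(1) finite_BC(1) finite_subset[OF _ finite_cartesian_product] by blast

lemma weight_le:
  assumes "c \<in> C"
  shows "weight b c \<le> card A"
proof -
  have "card (fibre (G c) snd b) \<le> card A"
    by (rule card_inj_on_le[of fst]) (use G(1)[OF assms] A(1) in \<open>auto simp: inj_on_def fibre_def\<close>)
  then show ?thesis by (simp add: weight_def)
qed

lemma sum_weight:
  assumes c: "c \<in> C" and X: "finite X"
  shows "(\<Sum>b\<in>X. weight b c) = card {g\<in>G c. snd g \<in> X}"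
proof -
  let ?S = "{g\<in>G c. snd g \<in> X}"
  have "(\<Sum>b\<in>X. card (fibre (G c) snd b)) = (\<Sum>b\<in>X. \<Sum>g\<in>{g\<in>?S. snd g = b}. 1)"
    by (intro sum.cong refl) (auto simp: fibre_def intro!: arg_cong[where f = card])
  also have "\<dots> = (\<Sum>g\<in>?S. 1)" using finite_G[OF c] X by (intro sum.group) auto
  finally show ?thesis by (simp add: weight_def flip: of_nat_sum)
qed

lemma total_weight_ge: "density * (card A * card B * card C) \<le> (\<Sum>b\<in>B. \<Sum>c\<in>C. weight b c)"
proof -
  have "density * (card A * card B * card C) = (\<Sum>c\<in>C. density * (card A * card B))" by simp
  also have "\<dots> \<le> (\<Sum>c\<in>C. real (card {g\<in>G c. snd g \<in> B}))"
  proof (rule sum_mono)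
    fix c assume c: "c \<in> C"
    have "{g\<in>G c. snd g \<in> B} = G c" using G(1)[OF c] by auto
    then show "density * (card A * card B) \<le> card {g\<in>G c. snd g \<in> B}" using G(2)[OF c] by (simp add: density_def)
  qed
  also have "\<dots> = (\<Sum>c\<in>C. \<Sum>b\<in>B. weight b c)" using sum_weight finite_BC by simp
  also have "\<dots> = (\<Sum>b\<in>B. \<Sum>c\<in>C. weight b c)" by (rule sum.swap)
  finally show ?thesis .
qed

lemma exists_dense_trees:
  assumes D: "D = 2 ^ W"
  obtains B' C' a a' where "B' \<subseteq> B" "B' \<noteq> {}" "C' \<subseteq> C" "C' \<noteq> {}" "uniform_tree D B' a n" "uniform_tree D C' a' n"
    "log 2 (card B) - (\<epsilon> * m + 1 + n * log 2 (4 * (real W + 1))) \<le> log 2 (card B')"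
    "log 2 (card C) - (\<epsilon> * m + 2 + n * log 2 (4 * (real W + 1))) \<le> log 2 (card C')"
    "density / 4 * card A * (card B' * card C') \<le> (\<Sum>b\<in>B'. \<Sum>c\<in>C'. weight b c)"
proof -
  have ne: "B \<noteq> {}" "C \<noteq> {}" "0 < real (card A)" using card_BC_pos A by (auto simp: card_gt_0_iff)
  have total: "density * (real (card A) * card B * card C) \<le> (\<Sum>b\<in>B. \<Sum>c\<in>C. weight b c)" using total_weight_ge by simp
  obtain B' C' a a' where B': "B' \<subseteq> B" "B' \<noteq> {}" and C': "C' \<subseteq> C" "C' \<noteq> {}"
    and trees: "uniform_tree D B' a n" "uniform_tree D C' a' n"
    and large: "density / 2 * card B \<le> (4 * (real W + 1)) ^ n * card B'"
      "density / 4 * card C \<le> (4 * (real W + 1)) ^ n * card C'"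
    and dense: "density / 4 * card A * (card B' * card C') \<le> (\<Sum>b\<in>B'. \<Sum>c\<in>C'. weight b c)"
    by (rule dense_uniform_pair[OF finite_BC(1) ne(1) finite_BC(2) ne(2) D density_pos ne(3) weight_le total])
  have card_pos: "0 < card B'" "0 < card C'" using B' C' finite_BC finite_subset by (auto simp: card_gt_0_iff)
  have "log 2 density = - \<epsilon> * m" by (simp add: density_def)
  moreover have "log 2 (4::real) = 2" using log_nat_power[of 2 2 2] by simp
  ultimately have "log 2 (card B) - (\<epsilon> * m + 1 + n * log 2 (4 * (real W + 1))) \<le> log 2 (card B')"
    "log 2 (card C) - (\<epsilon> * m + 2 + n * log 2 (4 * (real W + 1))) \<le> log 2 (card C')"
    using log_loss[OF density_pos card_BC_pos(1) card_pos(1) _ _ large(1)]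
      log_loss[OF density_pos card_BC_pos(2) card_pos(2) _ _ large(2)]
    by simp_all
  then show ?thesis by (rule that[OF B' C' trees _ _ dense])
qed

lemma localized_twists:
  assumes B': "B' \<subseteq> B" "B' \<noteq> {}" and C': "C' \<subseteq> C" "C' \<noteq> {}"
    and dense: "density / 4 * card A * (card B' * card C') \<le> (\<Sum>b\<in>B'. \<Sum>c\<in>C'. weight b c)"
  obtains H S where "H \<noteq> {}" "H \<subseteq> A \<times> B' \<times> B'" "density ^ 3 / 32 * (real (card A) * (real (card B'))\<^sup>2) \<le> card H"
    "\<And>x. x \<in> H \<Longrightarrow> S x \<subseteq> C'" "\<And>x. x \<in> H \<Longrightarrow> density ^ 3 / 32 * card C' \<le> card (S x)"
    "\<And>x c. x \<in> H \<Longrightarrow> c \<in> S x \<Longrightarrow> twist (2 ^ m) c x \<in> A"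
proof -
  have fin: "finite B'" "finite C'" using B'(1) C'(1) finite_BC finite_subset by blast+
  define G' where "G' c = {g\<in>G c. snd g \<in> B'}" for c
  have CC: "c \<in> C" if "c \<in> C'" for c using that C'(1) by blast
  have sub: "G' c \<subseteq> A \<times> B'" if "c \<in> C'" for c using G(1)[OF CC[OF that]] by (auto simp: G'_def)
  have small: "density * card (cell (2 ^ m) c ` G' c) \<le> card A" if c: "c \<in> C'" for c
  proof -
    have "card (cell (2 ^ m) c ` G' c) \<le> card (cell (2 ^ m) c ` G c)"
      using finite_G[OF CC[OF c]] by (intro card_mono) (auto simp: G'_def)
    then have "card (cell (2 ^ m) c ` G' c) \<le> 2 powr (\<epsilon> * m) * card A" using G(3)[OF CC[OF c]] by linarith
    then have "density * card (cell (2 ^ m) c ` G' c) \<le> density * (2 powr (\<epsilon> * m) * card A)"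
      using density_pos by (intro mult_left_mono) auto
    also have "\<dots> = density * 2 powr (\<epsilon> * m) * card A" by simp
    also have "density * 2 powr (\<epsilon> * m) = 1" by (simp add: density_def powr_minus)
    finally show ?thesis by simp
  qed
  have "density / 4 * (card A * card B' * card C') \<le> (\<Sum>b\<in>B'. \<Sum>c\<in>C'. weight b c)" using dense by (simp add: mult.assoc)
  also have "\<dots> = (\<Sum>c\<in>C'. \<Sum>b\<in>B'. weight b c)" by (rule sum.swap)
  also have "\<dots> = (\<Sum>c\<in>C'. real (card (G' c)))" using sum_weight[OF CC fin(1)] by (simp add: G'_def)
  finally have sum: "density / 4 * (card A * card B' * card C') \<le> (\<Sum>c\<in>C'. real (card (G' c)))" .
  have loss: "density * (density / 4)\<^sup>2 / 2 = density ^ 3 / 32" by (simp add: power2_eq_square power3_eq_cube)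
  have "0 < density / 4" using density_pos by simp
  note dense = dense_twists[OF A(1) fin A(2) B'(2) C'(2) density_pos this sub small sum, unfolded loss]
  show ?thesis by (rule dense, assumption, assumption) (use that in blast)
qed

lemma exists_twist_config:
  fixes D :: nat and \<eta>' \<sigma>\<^sub>0 \<epsilon>\<^sub>1 \<sigma> \<tau> :: real
  assumes B': "B' \<subseteq> B" "B' \<noteq> {}" "uniform_tree D B' a n" and C': "C' \<subseteq> C" "C' \<noteq> {}" "uniform_tree D C' a' n"
    and dense: "density / 4 * card A * (card B' * card C') \<le> (\<Sum>b\<in>B'. \<Sum>c\<in>C'. weight b c)"
    and D: "D ^ (n - 1) \<le> 2 ^ m" "2 ^ m < D ^ n" "0 < n" and \<epsilon>: "0 \<le> \<epsilon>"
    and heights: "nB \<le> n" "nC \<le> n" "nB + nC = k + n" "\<eta>' * n \<le> k"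
    and slopes: "\<sigma>\<^sub>0 \<le> \<sigma>" "\<sigma>\<^sub>0 \<le> \<tau>" "\<alpha> + \<epsilon>\<^sub>1 \<le> \<sigma> + \<tau>" "\<alpha> + \<epsilon>\<^sub>1 \<le> 1"
    and active: "\<And>t. t \<le> nB \<Longrightarrow> \<sigma> * t \<le> card (active_levels a nB t)" "\<And>t. t \<le> nC \<Longrightarrow> \<tau> * t \<le> card (active_levels a' nC t)"
  obtains Bs Cs H S where
    "twist_config D Bs a nB Cs a' nC \<alpha> \<epsilon>\<^sub>1 \<sigma>\<^sub>0 \<eta>' n k (2 ^ m) A H S (density ^ 3 / 32) \<sigma> \<tau>"
proof -
  interpret B: uniform_tree D B' a n by (rule B'(3))
  interpret C: uniform_tree D C' a' n by (rule C'(3))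
  obtain x y where x: "x \<in> B'" and y: "y \<in> C'" and local_dense:
      "density / 4 * card A * (card (node D B' nB x) * card (node D C' nC y)) \<le>
        (\<Sum>b\<in>node D B' nB x. \<Sum>c\<in>node D C' nC y. weight b c)"
    by (rule localize_pair[OF B.finite_leaves B'(2) C.finite_leaves C'(2) dense])
  define Bs Cs where "Bs = node D B' nB x" and "Cs = node D C' nC y"
  have Bs: "Bs \<subseteq> B" "Bs \<noteq> {}" and Cs: "Cs \<subseteq> C" "Cs \<noteq> {}"
    using x y B'(1) C'(1) node_subset node_refl unfolding Bs_def Cs_def by blast+
  obtain H S where H: "H \<noteq> {}" "H \<subseteq> A \<times> Bs \<times> Bs" "density ^ 3 / 32 * (real (card A) * (real (card Bs))\<^sup>2) \<le> card H"
    and S: "\<And>x. x \<in> H \<Longrightarrow> S x \<subseteq> Cs" "\<And>x. x \<in> H \<Longrightarrow> density ^ 3 / 32 * card Cs \<le> card (S x)"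
      "\<And>x c. x \<in> H \<Longrightarrow> c \<in> S x \<Longrightarrow> twist (2 ^ m) c x \<in> A"
    by (rule localized_twists[OF Bs Cs local_dense[folded Bs_def Cs_def]]) blast
  have rooted: "rooted_uniform_tree D Bs a nB" "rooted_uniform_tree D Cs a' nC"
    using B.uniform_tree_node[OF heights(1), of x] C.uniform_tree_node[OF heights(2), of y] Bs(2) Cs(2)
    by (auto simp: rooted_uniform_tree_def rooted_uniform_tree_axioms_def Bs_def Cs_def node_iff)
  have "twist_config D Bs a nB Cs a' nC \<alpha> \<epsilon>\<^sub>1 \<sigma>\<^sub>0 \<eta>' n k (2 ^ m) A H S (density ^ 3 / 32) \<sigma> \<tau>"
  proof (intro twist_config.intro twist_config_axioms.intro rooted A heights(2,4) H(1,3) S slopes)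
    show "finite H" using finite_subset[OF H(2)] A(1) finite_subset[OF Bs(1) finite_BC(1)] by simp
    show "H \<subseteq> UNIV \<times> Bs \<times> Bs" using H(2) by blast
    show "k \<le> nB" "k \<le> nC" using heights by simp_all
    then show "\<sigma> * t \<le> card (active_levels a nB t)" "\<tau> * t \<le> card (active_levels a' nC t)" if "t \<le> k" for t
      using that by (auto intro: active)
    show "(0::nat) < 2 ^ m" "0 < density ^ 3 / 32" using density_pos by simp_all
    have "2 powr (- \<epsilon> * m) \<le> 2 powr 0" using \<epsilon> by (intro powr_mono) auto
    then have "density \<le> 1" by (simp add: density_def)
    then show "density ^ 3 / 32 \<le> 1" using density_pos power_le_one[of density 3] by simp
    have "real (2 ^ m) \<le> real D ^ n" using D(2) of_nat_mono[of "2 ^ m" "D ^ n", where 'a = real] by simp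
    then show "real D ^ k \<le> real D ^ (nB + nC) / real (2 ^ m)"
      by (simp add: heights(3) power_add pos_le_divide_eq mult_left_mono)
    have "real (D ^ n) = real (D ^ (n - 1)) * D" using D(3) by (cases n) auto
    also have "\<dots> \<le> real (2 ^ m) * D" using D(1) by (intro mult_right_mono of_nat_mono) auto
    finally have "real D ^ k * real D ^ n \<le> real D ^ k * (2 ^ m * real D)" by (intro mult_left_mono) auto
    then show "real D ^ (nB + nC) / real (2 ^ m) \<le> real D ^ (k + 1)"
      by (simp add: heights(3) power_add pos_divide_le_eq mult_ac)
  qed
  then show ?thesis by (rule that)
qed

end

lemma exists_base_exponent:
  fixes c :: real
  assumes "0 < c"
  obtains W :: nat where "1 \<le> W" "log 2 (4 * (real W + 1)) \<le> c * W"
proof -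
  have c: "0 < ln 2 * c" using assms by simp
  obtain w :: nat where w: "\<And>n. w \<le> n \<Longrightarrow> 1 * (4 * (real n + 1)) ^ 1 < exp (ln 2 * c * n)"
    by (rule polynomial_below_exp[OF c]) blast
  define W where "W = max w 1"
  have "4 * (real W + 1) < exp (ln 2 * c * W)" using w[of W] by (simp add: W_def)
  then have "ln (4 * (real W + 1)) < ln (exp (ln 2 * c * W))" by (subst ln_less_cancel_iff) simp_all
  then show ?thesis by (intro that[of W]) (simp_all add: W_def log_def divide_le_eq mult_ac)
qed

lemma split_slopes:
  fixes \<alpha> \<beta> \<gamma> \<epsilon>\<^sub>1 :: real and j R :: nat
  assumes \<alpha>: "0 < \<alpha>" "\<alpha> \<le> \<beta>" "\<alpha> \<le> \<gamma>" and \<epsilon>\<^sub>1: "0 < \<epsilon>\<^sub>1" and j: "1 \<le> j" "j + 2 \<le> R" and R: "(\<alpha> + \<epsilon>\<^sub>1) / R \<le> \<epsilon>\<^sub>1 / 2"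
  shows "\<alpha> / R \<le> (\<beta> + \<epsilon>\<^sub>1) * j / R" "\<alpha> / R \<le> (\<gamma> + \<epsilon>\<^sub>1) * (R - 1 - j) / R"
    "\<alpha> + \<epsilon>\<^sub>1 / 2 \<le> (\<beta> + \<epsilon>\<^sub>1) * j / R + (\<gamma> + \<epsilon>\<^sub>1) * (R - 1 - j) / R"
proof -
  have "\<alpha> * 1 \<le> (\<beta> + \<epsilon>\<^sub>1) * j" "\<alpha> * 1 \<le> (\<gamma> + \<epsilon>\<^sub>1) * real (R - 1 - j)"
    using \<alpha> \<epsilon>\<^sub>1 j by (intro mult_mono; simp)+
  then show "\<alpha> / R \<le> (\<beta> + \<epsilon>\<^sub>1) * j / R" "\<alpha> / R \<le> (\<gamma> + \<epsilon>\<^sub>1) * (R - 1 - j) / R"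
    by (simp_all add: divide_right_mono)
  have "(\<alpha> + \<epsilon>\<^sub>1) * (real R - 1) = (\<alpha> + \<epsilon>\<^sub>1) * j + (\<alpha> + \<epsilon>\<^sub>1) * real (R - 1 - j)"
    using j by (simp add: of_nat_diff algebra_simps)
  also have "\<dots> \<le> (\<beta> + \<epsilon>\<^sub>1) * j + (\<gamma> + \<epsilon>\<^sub>1) * real (R - 1 - j)" using \<alpha> by (intro add_mono mult_right_mono) auto
  finally have "(\<alpha> + \<epsilon>\<^sub>1) * (real R - 1) / R \<le> (\<beta> + \<epsilon>\<^sub>1) * j / R + (\<gamma> + \<epsilon>\<^sub>1) * real (R - 1 - j) / R"
    unfolding add_divide_distrib[symmetric] by (rule divide_right_mono) simp
  moreover have "(\<alpha> + \<epsilon>\<^sub>1) * (real R - 1) / R = \<alpha> + \<epsilon>\<^sub>1 - (\<alpha> + \<epsilon>\<^sub>1) / R" using j by (simp add: field_simps)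
  ultimately show "\<alpha> + \<epsilon>\<^sub>1 / 2 \<le> (\<beta> + \<epsilon>\<^sub>1) * j / R + (\<gamma> + \<epsilon>\<^sub>1) * (R - 1 - j) / R" using R by linarith
qed

lemma exponential_scale:
  fixes m W :: nat
  assumes "1 \<le> W" and n: "n = m div W + 1"
  shows "(2 ^ W) ^ (n - 1) \<le> (2::nat) ^ m" "(2::nat) ^ m < (2 ^ W) ^ n" "W * (n - 1) \<le> m" "m < W * n"
proof -
  show le: "W * (n - 1) \<le> m" by (simp add: n)
  have "m = W * (m div W) + m mod W" by simp
  moreover have "m mod W < W" using assms(1) by simp
  ultimately show lt: "m < W * n" by (simp only: n distrib_left mult_1_right)
  show "(2 ^ W) ^ (n - 1) \<le> (2::nat) ^ m" "(2::nat) ^ m < (2 ^ W) ^ n"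
    using le lt by (simp_all only: power_mult[symmetric] power_increasing_iff power_strict_increasing_iff)
qed

context integer_config
begin

lemma log_product: "m * (\<beta> * \<gamma> + \<eta>) \<le> \<gamma> * log 2 (card B) + \<beta> * log 2 (card C)"
proof -
  have "log 2 (2 powr (m * (\<beta> * \<gamma> + \<eta>))) \<le> log 2 (card B powr \<gamma> * card C powr \<beta>)"
    using product card_BC_pos by (subst log_le_cancel_iff) auto
  then show ?thesis using card_BC_pos by (simp add: log_mult log_powr)
qed

lemma exists_heights:
  fixes \<epsilon>\<^sub>1 :: real and W R n :: nat
  assumes \<alpha>: "0 < \<alpha>" "\<alpha> \<le> \<beta>" "\<beta> \<le> 1" "\<alpha> \<le> \<gamma>" "\<gamma> \<le> 1" and \<eta>: "0 < \<eta>" "\<eta> \<le> 1"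
    and \<epsilon>\<^sub>1: "0 < \<epsilon>\<^sub>1" "\<epsilon>\<^sub>1 \<le> \<alpha> * \<eta> / 8" and \<epsilon>: "0 < \<epsilon>" "\<epsilon> \<le> \<alpha> * \<eta> / 16"
    and W: "1 \<le> W" "log 2 (4 * (real W + 1)) \<le> \<alpha> * \<eta> / 32 * W" and R: "2 \<le> R" "8 < \<eta> / 2 * R"
    and n: "W * (n - 1) \<le> m" "(2::nat) ^ m < (2 ^ W) ^ n" "0 < n" "2 + 3 / \<alpha> \<le> \<eta> / 16 * n"
    and B': "B' \<subseteq> B" "B' \<noteq> {}" "uniform_tree (2 ^ W) B' a n" and C': "C' \<subseteq> C" "C' \<noteq> {}" "uniform_tree (2 ^ W) C' a' n"
    and large: "log 2 (card B) - (\<epsilon> * m + 1 + n * log 2 (4 * (real W + 1))) \<le> log 2 (card B')"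
      "log 2 (card C) - (\<epsilon> * m + 2 + n * log 2 (4 * (real W + 1))) \<le> log 2 (card C')"
  obtains j where "1 \<le> j" "j + 2 \<le> R"
    "(1 + \<eta> / 4) * n \<le> top_height (log_count a) n ((\<beta> + \<epsilon>\<^sub>1) * W * j / R) +
      top_height (log_count a') n ((\<gamma> + \<epsilon>\<^sub>1) * W * (R - 1 - j) / R)"
proof -
  have root: "x div (2 ^ W) ^ n = 0" if x: "x \<in> B' \<union> C'" for x
  proof -
    have "x \<le> 2 ^ m" using x B'(1) C'(1) B(1) C(1) by blast
    then show ?thesis using n(2) by (intro div_less) linarith
  qed
  interpret B': rooted_uniform_tree "2 ^ W" B' a n
    using B' root by (simp add: rooted_uniform_tree_def rooted_uniform_tree_axioms_def)
  interpret C': rooted_uniform_tree "2 ^ W" C' a' n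
    using C' root by (simp add: rooted_uniform_tree_def rooted_uniform_tree_axioms_def)
  have "real (W * (n - 1)) \<le> real m" using n(1) by (rule of_nat_mono)
  then have n': "W * (real n - 1) \<le> m" using n(3) by (simp add: of_nat_diff)
  have "(1 + \<eta> / 2) * n \<le> log_count a n / ((\<beta> + \<epsilon>\<^sub>1) * W) + log_count a' n / ((\<gamma> + \<epsilon>\<^sub>1) * W)"
    unfolding B'.log_card[symmetric] C'.log_card[symmetric] using card_BC_pos
    by (intro total_height_ge[OF \<alpha> \<eta> \<epsilon>\<^sub>1 \<epsilon> _ W(2) _ _ log_product large n' n(4) W(1)]) simp_all
  moreover have "log_count a i \<le> (\<beta> + \<epsilon>\<^sub>1) * W * i" if "i \<le> n" for i
    by (rule order_trans[OF B'.log_count_le[OF refl B'(1,2) finite_BC(1) B(2) that]])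
      (use \<epsilon>\<^sub>1 in \<open>auto intro!: mult_right_mono\<close>)
  moreover have "log_count a' i \<le> (\<gamma> + \<epsilon>\<^sub>1) * W * i" if "i \<le> n" for i
    by (rule order_trans[OF C'.log_count_le[OF refl C'(1,2) finite_BC(2) C(2) that]])
      (use \<epsilon>\<^sub>1 in \<open>auto intro!: mult_right_mono\<close>)
  ultimately obtain j where "1 \<le> j" "j + 2 \<le> R"
    "(1 + \<eta> / 2 / 2) * n \<le> top_height (log_count a) n ((\<beta> + \<epsilon>\<^sub>1) * W * j / R) +
      top_height (log_count a') n ((\<gamma> + \<epsilon>\<^sub>1) * W * (R - 1 - j) / R)"
    using level_selection[of n "log_count a" "(\<beta> + \<epsilon>\<^sub>1) * W" "log_count a'" "(\<gamma> + \<epsilon>\<^sub>1) * W" "\<eta> / 2" R] \<alpha> \<epsilon>\<^sub>1 W R n(3)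
    by auto
  then show ?thesis using that by simp
qed

lemma yields_twist_config:
  fixes \<epsilon>\<^sub>1 :: real and W R n :: nat
  assumes \<alpha>: "0 < \<alpha>" "\<alpha> \<le> \<beta>" "\<beta> \<le> 1" "\<alpha> \<le> \<gamma>" "\<gamma> \<le> 1" and \<eta>: "0 < \<eta>" "\<eta> \<le> 1"
    and \<epsilon>\<^sub>1: "0 < \<epsilon>\<^sub>1" "\<epsilon>\<^sub>1 \<le> \<alpha> * \<eta> / 8" "\<epsilon>\<^sub>1 \<le> 1 - \<alpha>" and \<epsilon>: "0 < \<epsilon>" "\<epsilon> \<le> \<alpha> * \<eta> / 16"
    and W: "1 \<le> W" "log 2 (4 * (real W + 1)) \<le> \<alpha> * \<eta> / 32 * W"
    and R: "2 \<le> R" "8 < \<eta> / 2 * R" "(\<alpha> + \<epsilon>\<^sub>1) / R \<le> \<epsilon>\<^sub>1 / 2" and n: "n = m div W + 1" "2 + 3 / \<alpha> \<le> \<eta> / 16 * n"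
  obtains B' C' a a' nB nC k H S \<sigma> \<tau> where
    "twist_config (2 ^ W) B' a nB C' a' nC \<alpha> (\<epsilon>\<^sub>1 / 2) (\<alpha> / R) (\<eta> / 4) n k (2 ^ m) A H S (density ^ 3 / 32) \<sigma> \<tau>"
proof -
  note scale = exponential_scale[OF W(1) n(1)]
  have "0 < n" by (simp add: n)
  obtain B' C' a a' where B': "B' \<subseteq> B" "B' \<noteq> {}" and C': "C' \<subseteq> C" "C' \<noteq> {}"
    and trees: "uniform_tree (2 ^ W) B' a n" "uniform_tree (2 ^ W) C' a' n"
    and large: "log 2 (card B) - (\<epsilon> * m + 1 + n * log 2 (4 * (real W + 1))) \<le> log 2 (card B')"
      "log 2 (card C) - (\<epsilon> * m + 2 + n * log 2 (4 * (real W + 1))) \<le> log 2 (card C')"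
    and dense: "density / 4 * card A * (card B' * card C') \<le> (\<Sum>b\<in>B'. \<Sum>c\<in>C'. weight b c)"
    by (rule exists_dense_trees[OF refl])
  obtain j where j: "1 \<le> j" "j + 2 \<le> R" and heights:
      "(1 + \<eta> / 4) * n \<le> top_height (log_count a) n ((\<beta> + \<epsilon>\<^sub>1) * W * j / R) +
        top_height (log_count a') n ((\<gamma> + \<epsilon>\<^sub>1) * W * (R - 1 - j) / R)"
    by (rule exists_heights[OF \<alpha> \<eta> \<epsilon>\<^sub>1(1,2) \<epsilon> W R(1,2) scale(3,2) \<open>0 < n\<close> n(2) B' trees(1) C' trees(2) large])
  define nB nC where "nB = top_height (log_count a) n ((\<beta> + \<epsilon>\<^sub>1) * W * j / R)"
    and "nC = top_height (log_count a') n ((\<gamma> + \<epsilon>\<^sub>1) * W * (R - 1 - j) / R)"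
  define \<sigma> \<tau> where "\<sigma> = (\<beta> + \<epsilon>\<^sub>1) * j / R" and "\<tau> = (\<gamma> + \<epsilon>\<^sub>1) * (R - 1 - j) / R"
  define k where "k = nB + nC - n"
  have le: "nB \<le> n" "nC \<le> n" unfolding nB_def nC_def by (rule top_height_le)+
  have "n + \<eta> / 4 * n \<le> real (nB + nC)" using heights by (simp add: nB_def nC_def algebra_simps)
  moreover have "0 \<le> \<eta> / 4 * n" using \<eta> by simp
  ultimately have "real n \<le> real (nB + nC)" by linarith
  then have "n \<le> nB + nC" by (simp only: of_nat_le_iff)
  then have k: "nB + nC = k + n" "\<eta> / 4 * n \<le> k"
    using \<open>n + \<eta> / 4 * n \<le> real (nB + nC)\<close> by (simp_all add: k_def of_nat_diff)
  have slopes: "(\<beta> + \<epsilon>\<^sub>1) * W * j / R / W = \<sigma>" "(\<gamma> + \<epsilon>\<^sub>1) * W * (R - 1 - j) / R / W = \<tau>"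
    using W(1) by (simp_all add: \<sigma>_def \<tau>_def)
  have active: "\<sigma> * t \<le> card (active_levels a nB t)" if "t \<le> nB" for t
    using uniform_tree.card_active_levels_ge[OF trees(1) refl _ B'(2) nB_def that] W(1) unfolding slopes by simp
  have active': "\<tau> * t \<le> card (active_levels a' nC t)" if "t \<le> nC" for t
    using uniform_tree.card_active_levels_ge[OF trees(2) refl _ C'(2) nC_def that] W(1) unfolding slopes by simp
  have slope_bounds: "\<alpha> / R \<le> \<sigma>" "\<alpha> / R \<le> \<tau>" "\<alpha> + \<epsilon>\<^sub>1 / 2 \<le> \<sigma> + \<tau>"
    unfolding \<sigma>_def \<tau>_def by (rule split_slopes[OF \<alpha>(1,2,4) \<epsilon>\<^sub>1(1) j R(3)])+
  have "\<alpha> + \<epsilon>\<^sub>1 / 2 \<le> 1" using \<epsilon>\<^sub>1 by simp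
  show ?thesis
    by (rule exists_twist_config[OF B' trees(1) C' trees(2) dense scale(1,2) \<open>0 < n\<close> less_imp_le[OF \<epsilon>(1)] le k
      slope_bounds \<open>\<alpha> + \<epsilon>\<^sub>1 / 2 \<le> 1\<close> active active']) (assumption | rule that)+
qed

end

theorem integer_abc:
  fixes \<alpha> \<beta> \<gamma> \<eta> :: real
  assumes \<alpha>: "0 < \<alpha>" "\<alpha> < 1" and \<beta>: "\<alpha> \<le> \<beta>" "\<beta> \<le> 1" and \<gamma>: "\<alpha> \<le> \<gamma>" "\<gamma> \<le> 1" and \<eta>: "0 < \<eta>" "\<eta> \<le> 1"
  obtains \<epsilon> :: real and m\<^sub>0 :: nat where "0 < \<epsilon>" "\<And>m A B C G. m\<^sub>0 \<le> m \<Longrightarrow> \<not> integer_config \<alpha> \<beta> \<gamma> \<eta> \<epsilon> m A B C G"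
proof -
  define \<epsilon>\<^sub>1 where "\<epsilon>\<^sub>1 = min (1 - \<alpha>) (\<alpha> * \<eta> / 8)"
  have \<epsilon>\<^sub>1: "0 < \<epsilon>\<^sub>1" "\<epsilon>\<^sub>1 \<le> \<alpha> * \<eta> / 8" "\<epsilon>\<^sub>1 \<le> 1 - \<alpha>"
    using \<alpha> \<eta> min.cobounded1 min.cobounded2 by (simp_all only: \<epsilon>\<^sub>1_def) auto
  have "0 < \<alpha> * \<eta> / 32" using \<alpha> \<eta> by simp
  then obtain W :: nat where W: "1 \<le> W" "log 2 (4 * (real W + 1)) \<le> \<alpha> * \<eta> / 32 * W"
    by (rule exists_base_exponent)
  define R where "R = nat \<lceil>max (16 / \<eta>) (2 / \<epsilon>\<^sub>1)\<rceil> + 2"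
  have "max (16 / \<eta>) (2 / \<epsilon>\<^sub>1) < R" unfolding R_def by linarith
  then have "16 < R * \<eta>" "2 < R * \<epsilon>\<^sub>1" using \<eta> \<epsilon>\<^sub>1(1) by (simp_all add: pos_divide_less_eq)
  then have R: "2 \<le> R" "8 < \<eta> / 2 * R" "(\<alpha> + \<epsilon>\<^sub>1) / R \<le> \<epsilon>\<^sub>1 / 2"
    using \<epsilon>\<^sub>1(3) by (simp_all add: R_def divide_le_eq mult.commute)
  have D: "(1::nat) < 2 ^ W" using W(1) by (intro one_less_power) auto
  have pos: "0 < \<epsilon>\<^sub>1 / 2" "\<alpha> + \<epsilon>\<^sub>1 / 2 \<le> 1" "0 < \<alpha> / R" "0 < \<eta> / 4" using \<epsilon>\<^sub>1 \<alpha> \<eta> R(1) by simp_all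
  obtain l :: real and n\<^sub>0 :: nat where l: "0 < l"
    and no_config: "\<And>n A B C a a' nB nC k M S H \<rho> \<sigma> \<tau>. n\<^sub>0 \<le> n \<Longrightarrow> 2 powr (- l * n) \<le> \<rho> \<Longrightarrow>
      \<not> twist_config (2 ^ W) B a nB C a' nC \<alpha> (\<epsilon>\<^sub>1 / 2) (\<alpha> / R) (\<eta> / 4) n k M A H S \<rho> \<sigma> \<tau>"
    by (rule no_twist_config[OF \<alpha>(1) pos D]) blast
  define \<epsilon> where "\<epsilon> = min (\<alpha> * \<eta> / 16) (l / (6 * W))"
  have \<epsilon>: "0 < \<epsilon>" "\<epsilon> \<le> \<alpha> * \<eta> / 16" "\<epsilon> \<le> l / (6 * W)"
    using \<alpha> \<eta> l W min.cobounded1 min.cobounded2 by (simp_all only: \<epsilon>_def) auto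
  define n\<^sub>1 where "n\<^sub>1 = max (max n\<^sub>0 (nat \<lceil>10 / l\<rceil>)) (nat \<lceil>16 / \<eta> * (2 + 3 / \<alpha>)\<rceil>)"
  have "\<not> integer_config \<alpha> \<beta> \<gamma> \<eta> \<epsilon> m A B C G" if m: "W * n\<^sub>1 \<le> m" for m A B C G
  proof
    assume "integer_config \<alpha> \<beta> \<gamma> \<eta> \<epsilon> m A B C G"
    then interpret integer_config \<alpha> \<beta> \<gamma> \<eta> \<epsilon> m A B C G .
    define n where "n = m div W + 1"
    have "n\<^sub>1 \<le> m div W" using m W(1) by (simp add: less_eq_div_iff_mult_less_eq mult.commute)
    then have "n\<^sub>0 \<le> n" "10 / l \<le> n" "16 / \<eta> * (2 + 3 / \<alpha>) \<le> n" unfolding n\<^sub>1_def n_def by linarith+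
    then have n: "n\<^sub>0 \<le> n" "10 \<le> l * n" "2 + 3 / \<alpha> \<le> \<eta> / 16 * n" using l \<eta> by (simp_all add: field_simps)
    obtain B' C' a a' nB nC k H S \<sigma> \<tau> where config:
        "twist_config (2 ^ W) B' a nB C' a' nC \<alpha> (\<epsilon>\<^sub>1 / 2) (\<alpha> / R) (\<eta> / 4) n k (2 ^ m) A H S (density ^ 3 / 32) \<sigma> \<tau>"
      by (rule yields_twist_config[OF \<alpha>(1) \<beta> \<gamma> \<eta> \<epsilon>\<^sub>1 \<epsilon>(1,2) W R n_def n(3)])
    have "\<epsilon> * m \<le> l / (6 * W) * (W * n)"
      using \<epsilon> exponential_scale(4)[OF W(1) n_def] by (intro mult_mono) (auto simp flip: of_nat_mult)
    then have "3 * (\<epsilon> * m) + 5 \<le> l * n" using W(1) n(2) by simp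
    then have "2 powr (- l * n) \<le> 2 powr (3 * (- \<epsilon> * m) - 5)" by (intro powr_mono) auto
    also have "\<dots> = density ^ 3 / 32" by (simp add: density_def powr_diff powr_power mult.commute)
    finally show False using no_config[OF n(1)] config by blast
  qed
  then show ?thesis by (rule that[OF \<epsilon>(1)])
qed

section \<open>From integers to reals\<close>

definition dyadic_interval :: "real \<Rightarrow> int \<Rightarrow> real set" where
  "dyadic_interval \<delta> k = {x. \<delta> * of_int k \<le> x \<and> x < \<delta> * (of_int k + 1)}"

lemma mem_dyadic_interval: "0 < \<delta> \<Longrightarrow> x \<in> dyadic_interval \<delta> k \<longleftrightarrow> \<lfloor>x / \<delta>\<rfloor> = k"
  by (auto simp: dyadic_interval_def floor_eq_iff field_simps)

lemma dyadic_cubes_real: "dyadic_cubes \<delta> = range (dyadic_interval \<delta>)"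
proof
  show "dyadic_cubes \<delta> \<subseteq> range (dyadic_interval \<delta>)" by (auto simp: dyadic_cubes_def dyadic_interval_def)
  have "dyadic_interval \<delta> k \<in> dyadic_cubes \<delta>" for k
    unfolding dyadic_cubes_def dyadic_interval_def by (intro CollectI exI[of _ "\<lambda>_. k"]) simp
  then show "range (dyadic_interval \<delta>) \<subseteq> dyadic_cubes \<delta>" by blast
qed

lemma dyadic_number_real:
  fixes X :: "real set"
  assumes \<delta>: "0 < \<delta>"
  shows "dyadic_number \<delta> X = card ((\<lambda>x. \<lfloor>x / \<delta>\<rfloor>) ` X)"
proof -
  have "inj (dyadic_interval \<delta>)"
  proof (rule injI)
    fix k l assume eq: "dyadic_interval \<delta> k = dyadic_interval \<delta> l"
    have "\<delta> * of_int k \<in> dyadic_interval \<delta> k" using \<delta> by (simp add: mem_dyadic_interval)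
    then show "k = l" using \<delta> unfolding eq by (simp add: mem_dyadic_interval)
  qed
  moreover have "{P\<in>dyadic_cubes \<delta>. P \<inter> X \<noteq> {}} = dyadic_interval \<delta> ` ((\<lambda>x. \<lfloor>x / \<delta>\<rfloor>) ` X)"
    unfolding dyadic_cubes_real using mem_dyadic_interval[OF \<delta>] by (auto simp: image_iff)
  ultimately show ?thesis
    unfolding dyadic_number_def by (simp add: card_image inj_on_subset)
qed

definition int_points :: "real \<Rightarrow> real set \<Rightarrow> int set" where
  "int_points \<delta> X = {k. \<delta> * of_int k \<in> X}"

definition nat_points :: "real \<Rightarrow> real set \<Rightarrow> nat set" where
  "nat_points \<delta> X = {k. \<delta> * real k \<in> X}"

definition int_graph :: "real \<Rightarrow> (real \<times> real) set \<Rightarrow> (int \<times> nat) set" where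
  "int_graph \<delta> G = {(k, l). (\<delta> * of_int k, \<delta> * real l) \<in> G}"

lemma katz_tao_int_points:
  fixes A :: "real set"
  assumes \<delta>: "0 < \<delta>" and KT: "katz_tao \<delta> s A"
  shows "katz_tao_ints s (int_points \<delta> A)"
  unfolding katz_tao_ints_def
proof (intro allI impI)
  fix z :: int and r :: real assume r: "1 \<le> r"
  let ?K = "{k\<in>int_points \<delta> A. \<bar>real_of_int k - real_of_int z\<bar> \<le> r}" and ?X = "A \<inter> cball (\<delta> * z) (\<delta> * r)"
  have "?K \<subseteq> (\<lambda>x. \<lfloor>x / \<delta>\<rfloor>) ` ?X"
  proof
    fix k assume k: "k \<in> ?K"
    have "dist (\<delta> * z) (\<delta> * k) = \<delta> * \<bar>real_of_int k - real_of_int z\<bar>"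
      using \<delta> by (simp add: dist_real_def abs_mult abs_minus_commute flip: right_diff_distrib)
    then have "\<delta> * k \<in> ?X" using k \<delta> by (simp add: int_points_def)
    then show "k \<in> (\<lambda>x. \<lfloor>x / \<delta>\<rfloor>) ` ?X" using \<delta> by (intro image_eqI[of _ _ "\<delta> * k"]) auto
  qed
  moreover have "(\<lambda>x. \<lfloor>x / \<delta>\<rfloor>) ` ?X \<subseteq> {\<lfloor>z - r\<rfloor>..\<lfloor>z + r\<rfloor>}"
  proof (rule image_subsetI)
    fix x assume "x \<in> ?X"
    then have "z - r \<le> x / \<delta>" "x / \<delta> \<le> z + r" using \<delta> by (auto simp: dist_real_def field_simps abs_le_iff)
    then show "\<lfloor>x / \<delta>\<rfloor> \<in> {\<lfloor>z - r\<rfloor>..\<lfloor>z + r\<rfloor>}" by (simp only: atLeastAtMost_iff floor_mono)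
  qed
  then have "finite ((\<lambda>x. \<lfloor>x / \<delta>\<rfloor>) ` ?X)" by (rule finite_subset) simp
  ultimately have "real (card ?K) \<le> dyadic_number \<delta> ?X"
    unfolding dyadic_number_real[OF \<delta>] by (intro of_nat_mono card_mono)
  moreover have "\<delta> \<le> \<delta> * r" using \<delta> r by simp
  then have "real (dyadic_number \<delta> ?X) \<le> 1 * (\<delta> * r / \<delta>) powr s"
    using KT unfolding katz_tao_def katz_tao_const_def by blast
  ultimately show "card ?K \<le> r powr s" using \<delta> by simp
qed

lemma int_nat_points:
  assumes "0 < \<delta>" "X \<subseteq> {0..1}"
  shows "int ` nat_points \<delta> X = int_points \<delta> X"
proof -
  have "\<exists>j. k = int j \<and> \<delta> * real j \<in> X" if k: "\<delta> * of_int k \<in> X" for k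
  proof -
    have "0 \<le> \<delta> * of_int k" using k assms(2) by auto
    then have "0 \<le> k" using assms(1) by (simp add: zero_le_mult_iff)
    then show ?thesis using k by (intro exI[of _ "nat k"]) simp
  qed
  then show ?thesis by (auto simp: int_points_def nat_points_def)
qed

lemma nat_points_le:
  assumes \<delta>: "\<delta> = 1 / 2 ^ m" and X: "X \<subseteq> {0..1}"
  shows "nat_points \<delta> X \<subseteq> {..2 ^ m}"
proof
  fix k assume "k \<in> nat_points \<delta> X"
  then have "\<delta> * real k \<le> 1" using X by (auto simp: nat_points_def)
  then have "real k \<le> real (2 ^ m)" by (simp add: \<delta> pos_divide_le_eq)
  then show "k \<in> {..2 ^ m}" by (simp only: of_nat_le_iff atMost_iff)
qed

lemma int_points_image: "X \<subseteq> scaled_ints \<delta> \<Longrightarrow> (\<lambda>k. \<delta> * real_of_int k) ` int_points \<delta> X = X"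
  by (auto simp: int_points_def scaled_ints_def)

lemma card_int_points:
  assumes "0 < \<delta>" "X \<subseteq> scaled_ints \<delta>"
  shows "card (int_points \<delta> X) = card X"
proof -
  have "inj_on (\<lambda>k. \<delta> * real_of_int k) (int_points \<delta> X)" using assms(1) by (auto simp: inj_on_def)
  then show ?thesis using card_image int_points_image[OF assms(2)] by fastforce
qed

lemma card_nat_points:
  assumes "0 < \<delta>" "X \<subseteq> scaled_ints \<delta> \<inter> {0..1}"
  shows "card (nat_points \<delta> X) = card X"
proof -
  have "card (int ` nat_points \<delta> X) = card (nat_points \<delta> X)" by (simp add: card_image)
  then show ?thesis using assms by (simp add: int_nat_points card_int_points)
qed

lemma int_graph_image:
  assumes \<delta>: "0 < \<delta>" and A: "A \<subseteq> scaled_ints \<delta>" and B: "B \<subseteq> scaled_ints \<delta> \<inter> {0..1}" and G: "G \<subseteq> A \<times> B"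
  shows "(\<lambda>(k, l). (\<delta> * of_int k, \<delta> * real l)) ` int_graph \<delta> G = G"
proof
  show "G \<subseteq> (\<lambda>(k, l). (\<delta> * of_int k, \<delta> * real l)) ` int_graph \<delta> G"
  proof
    fix g assume g: "g \<in> G"
    obtain a b where ab: "g = (a, b)" "a \<in> A" "b \<in> B" using g G by auto
    obtain k where k: "a = \<delta> * of_int k" using ab(2) A by (auto simp: scaled_ints_def)
    obtain i where i: "b = \<delta> * of_int i" "i \<in> int_points \<delta> B" using ab(3) B by (auto simp: scaled_ints_def int_points_def)
    have "B \<subseteq> {0..1}" using B by simp
    then obtain l where "i = int l" using i(2) int_nat_points[OF \<delta>, of B, symmetric] by blast
    then have "b = \<delta> * real l" using i(1) by simp
    then show "g \<in> (\<lambda>(k, l). (\<delta> * of_int k, \<delta> * real l)) ` int_graph \<delta> G"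
      using g k by (intro image_eqI[of _ _ "(k, l)"]) (auto simp: int_graph_def ab(1))
  qed
qed (auto simp: int_graph_def)

lemma card_int_graph:
  assumes "0 < \<delta>" "A \<subseteq> scaled_ints \<delta>" "B \<subseteq> scaled_ints \<delta> \<inter> {0..1}" "G \<subseteq> A \<times> B"
  shows "card (int_graph \<delta> G) = card G"
proof -
  have "inj_on (\<lambda>(k, l). (\<delta> * real_of_int k, \<delta> * real l)) (int_graph \<delta> G)" using assms(1) by (auto simp: inj_on_def)
  then show ?thesis using card_image int_graph_image[OF assms] by fastforce
qed

lemma dyadic_number_graph:
  assumes \<delta>: "\<delta> = 1 / 2 ^ m" and A: "A \<subseteq> scaled_ints \<delta>" and B: "B \<subseteq> scaled_ints \<delta> \<inter> {0..1}" and G: "G \<subseteq> A \<times> B"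
  shows "dyadic_number \<delta> {a + \<delta> * real c * b |a b. (a, b) \<in> G} = card (cell (2 ^ m) c ` int_graph \<delta> G)"
proof -
  have \<delta>0: "0 < \<delta>" using \<delta> by simp
  let ?h = "\<lambda>(k, l). (\<delta> * real_of_int k, \<delta> * real l)"
  have floor: "\<lfloor>(\<delta> * real_of_int k + \<delta> * real c * (\<delta> * real l)) / \<delta>\<rfloor> = k + int (c * l div 2 ^ m)" for k l
  proof -
    have "(\<delta> * real_of_int k + \<delta> * real c * (\<delta> * real l)) / \<delta> = real_of_int k + real (c * l) / real (2 ^ m)"
      using \<delta>0 by (simp add: \<delta> field_simps)
    then show ?thesis by (simp only: floor_divide_of_nat_eq int_add_floor[symmetric])
  qed
  have "{a + \<delta> * real c * b |a b. (a, b) \<in> G} = (\<lambda>(a, b). a + \<delta> * real c * b) ` G" by force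
  also have "\<dots> = (\<lambda>(a, b). a + \<delta> * real c * b) ` (?h ` int_graph \<delta> G)" by (simp only: int_graph_image[OF \<delta>0 A B G])
  finally have "(\<lambda>x. \<lfloor>x / \<delta>\<rfloor>) ` {a + \<delta> * real c * b |a b. (a, b) \<in> G} = cell (2 ^ m) c ` int_graph \<delta> G"
    unfolding cell_def by (simp only: image_image split_beta fst_conv snd_conv floor)
  then show ?thesis unfolding dyadic_number_real[OF \<delta>0] by (simp only:)
qed

lemma integer_config_of_reals:
  fixes A B C :: "real set" and G :: "real \<Rightarrow> (real \<times> real) set" and \<alpha> \<beta> \<gamma> \<eta> \<epsilon> \<delta> :: real
  assumes \<delta>: "\<delta> = 1 / 2 ^ m" and A: "A \<subseteq> scaled_ints \<delta> \<inter> {0..1}" "A \<noteq> {}" "katz_tao \<delta> \<alpha> A"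
    and B: "B \<subseteq> scaled_ints \<delta> \<inter> {0..1}" "katz_tao \<delta> \<beta> B" and C: "C \<subseteq> scaled_ints \<delta> \<inter> {0..1}" "katz_tao \<delta> \<gamma> C"
    and product: "\<delta> powr (- \<eta>) \<le> real (card B) powr \<gamma> * real (card C) powr \<beta> * \<delta> powr (\<beta> * \<gamma>)"
    and G: "\<And>c. c \<in> C \<Longrightarrow> G c \<subseteq> A \<times> B" "\<And>c. c \<in> C \<Longrightarrow> \<delta> powr \<epsilon> * real (card A) * real (card B) \<le> real (card (G c))"
      "\<And>c. c \<in> C \<Longrightarrow> real (dyadic_number \<delta> {a + c * b |a b. (a, b) \<in> G c}) \<le> \<delta> powr (- \<epsilon>) * real (card A)"
  shows "integer_config \<alpha> \<beta> \<gamma> \<eta> \<epsilon> m (int_points \<delta> A) (nat_points \<delta> B) (nat_points \<delta> C)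
    (\<lambda>c. int_graph \<delta> (G (\<delta> * real c)))"
proof
  have \<delta>0: "0 < \<delta>" using \<delta> by simp
  have "\<delta> = 2 powr (- real m)" by (simp add: \<delta> powr_minus powr_realpow divide_simps)
  then have powr: "\<delta> powr e = 2 powr (- (real m * e))" for e by (simp add: powr_powr)
  have sub: "A \<subseteq> {0..1}" "B \<subseteq> {0..1}" "C \<subseteq> {0..1}" "A \<subseteq> scaled_ints \<delta>" using A B C by auto
  have card: "card (int_points \<delta> A) = card A" "card (nat_points \<delta> B) = card B" "card (nat_points \<delta> C) = card C"
    using card_int_points[OF \<delta>0 sub(4)] card_nat_points[OF \<delta>0 B(1)] card_nat_points[OF \<delta>0 C(1)] by simp_all
  show "finite (int_points \<delta> A)"
    unfolding int_nat_points[OF \<delta>0 sub(1), symmetric] using finite_subset[OF nat_points_le[OF \<delta> sub(1)]] by simp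
  show "int_points \<delta> A \<noteq> {}" using int_points_image[OF sub(4)] A(2) by auto
  show "katz_tao_ints \<alpha> (int_points \<delta> A)" "katz_tao_ints \<beta> (int ` nat_points \<delta> B)" "katz_tao_ints \<gamma> (int ` nat_points \<delta> C)"
    using katz_tao_int_points[OF \<delta>0] A(3) B(2) C(2) int_nat_points[OF \<delta>0] sub by simp_all
  show "nat_points \<delta> B \<subseteq> {..2 ^ m}" "nat_points \<delta> C \<subseteq> {..2 ^ m}" using nat_points_le[OF \<delta>] sub by simp_all
  have "2 powr (m * \<eta>) * 2 powr (m * (\<beta> * \<gamma>)) \<le>
      real (card B) powr \<gamma> * real (card C) powr \<beta> * 2 powr (- (real m * (\<beta> * \<gamma>))) * 2 powr (m * (\<beta> * \<gamma>))"
    using product unfolding powr by (intro mult_right_mono) simp_all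
  then show "2 powr (m * (\<beta> * \<gamma> + \<eta>)) \<le> card (nat_points \<delta> B) powr \<gamma> * card (nat_points \<delta> C) powr \<beta>"
    unfolding card by (simp add: powr_add[symmetric] powr_minus distrib_left mult.assoc add.commute)
  fix c assume "c \<in> nat_points \<delta> C"
  then have c: "\<delta> * real c \<in> C" by (simp add: nat_points_def)
  let ?G = "G (\<delta> * real c)"
  show "int_graph \<delta> ?G \<subseteq> int_points \<delta> A \<times> nat_points \<delta> B"
    using G(1)[OF c] by (auto simp: int_graph_def int_points_def nat_points_def)
  show "2 powr (- \<epsilon> * m) * (card (int_points \<delta> A) * card (nat_points \<delta> B)) \<le> card (int_graph \<delta> ?G)"
    using G(2)[OF c] unfolding powr card card_int_graph[OF \<delta>0 sub(4) B(1) G(1)[OF c]] by (simp add: mult_ac)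
  show "card (cell (2 ^ m) c ` int_graph \<delta> ?G) \<le> 2 powr (\<epsilon> * m) * card (int_points \<delta> A)"
    using G(3)[OF c] unfolding powr card dyadic_number_graph[OF \<delta> sub(4) B(1) G(1)[OF c]] by (simp add: mult.commute)
qed

lemma exists_expanding_slope:
  fixes A B C :: "real set" and \<alpha> \<beta> \<gamma> \<eta> \<epsilon> \<delta> :: real
  assumes no_config: "\<And>A B C G. \<not> integer_config \<alpha> \<beta> \<gamma> \<eta> \<epsilon> m A B C G" and \<delta>: "\<delta> = 1 / 2 ^ m"
    and A: "A \<subseteq> scaled_ints \<delta> \<inter> {0..1}" "katz_tao \<delta> \<alpha> A"
    and B: "B \<subseteq> scaled_ints \<delta> \<inter> {0..1}" "katz_tao \<delta> \<beta> B" and C: "C \<subseteq> scaled_ints \<delta> \<inter> {0..1}" "katz_tao \<delta> \<gamma> C"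
    and product: "\<delta> powr (- \<eta>) \<le> real (card B) powr \<gamma> * real (card C) powr \<beta> * \<delta> powr (\<beta> * \<gamma>)"
  shows "\<exists>c\<in>C. \<forall>G. G \<subseteq> A \<times> B \<and> real (card G) \<ge> \<delta> powr \<epsilon> * real (card A) * real (card B) \<longrightarrow>
    real (dyadic_number \<delta> {a + c * b | a b. (a, b) \<in> G}) \<ge> \<delta> powr (- \<epsilon>) * real (card A)"
proof (rule ccontr)
  assume "\<not> ?thesis"
  then have "\<forall>c\<in>C. \<exists>G. G \<subseteq> A \<times> B \<and> \<delta> powr \<epsilon> * real (card A) * real (card B) \<le> real (card G) \<and>
      real (dyadic_number \<delta> {a + c * b | a b. (a, b) \<in> G}) < \<delta> powr (- \<epsilon>) * real (card A)"
    by (meson not_le)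
  from bchoice[OF this] obtain G where G: "\<And>c. c \<in> C \<Longrightarrow> G c \<subseteq> A \<times> B"
    "\<And>c. c \<in> C \<Longrightarrow> \<delta> powr \<epsilon> * real (card A) * real (card B) \<le> real (card (G c))"
    "\<And>c. c \<in> C \<Longrightarrow> real (dyadic_number \<delta> {a + c * b | a b. (a, b) \<in> G c}) < \<delta> powr (- \<epsilon>) * real (card A)"
    by blast
  have "0 < \<delta> powr (- \<eta>)" using \<delta> by simp
  then have "C \<noteq> {}" using product by auto
  then obtain c where c: "c \<in> C" by blast
  have "0 < \<delta> powr (- \<epsilon>) * real (card A)" by (rule le_less_trans[OF of_nat_0_le_iff G(3)[OF c]])
  then have "A \<noteq> {}" by auto
  then have "integer_config \<alpha> \<beta> \<gamma> \<eta> \<epsilon> m (int_points \<delta> A) (nat_points \<delta> B) (nat_points \<delta> C)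
      (\<lambda>c. int_graph \<delta> (G (\<delta> * real c)))"
    by (intro integer_config_of_reals \<delta> A B C product G(1,2) less_imp_le[OF G(3)])
  then show False using no_config by blast
qed

theorem theorem1p6:
  fixes \<alpha> \<beta> \<gamma> \<eta> :: real
  assumes "\<alpha> \<in> {0<..<1}" and "\<beta> \<in> {\<alpha>..1}" and "\<gamma> \<in> {\<alpha>..1}" and "\<eta> > 0"
  shows "\<exists>\<delta>\<^sub>0 > 0. \<exists>\<epsilon> > 0. \<forall>\<delta> \<in> dyadic_scales \<inter> {0<..\<delta>\<^sub>0}.
    \<forall>A B C :: real set.
      A \<subseteq> scaled_ints \<delta> \<inter> {0..1} \<and> B \<subseteq> scaled_ints \<delta> \<inter> {0..1} \<and> C \<subseteq> scaled_ints \<delta> \<inter> {0..1} \<and>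
      katz_tao \<delta> \<alpha> A \<and> katz_tao \<delta> \<beta> B \<and> katz_tao \<delta> \<gamma> C \<and>
      real (card B) powr \<gamma> * real (card C) powr \<beta> * \<delta> powr (\<beta> * \<gamma>) \<ge> \<delta> powr (- \<eta>)
      \<longrightarrow> (\<exists>c\<in>C. \<forall>G. G \<subseteq> A \<times> B \<and> real (card G) \<ge> \<delta> powr \<epsilon> * real (card A) * real (card B) \<longrightarrow>
             real (dyadic_number \<delta> {a + c * b | a b. (a, b) \<in> G}) \<ge> \<delta> powr (- \<epsilon>) * real (card A))"
proof -
  have range: "0 < \<alpha>" "\<alpha> < 1" "\<alpha> \<le> \<beta>" "\<beta> \<le> 1" "\<alpha> \<le> \<gamma>" "\<gamma> \<le> 1" "0 < min \<eta> 1" "min \<eta> 1 \<le> 1" using assms by auto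
  obtain \<epsilon> :: real and m\<^sub>0 :: nat where \<epsilon>: "0 < \<epsilon>"
    and no_config: "\<And>m A B C G. m\<^sub>0 \<le> m \<Longrightarrow> \<not> integer_config \<alpha> \<beta> \<gamma> (min \<eta> 1) \<epsilon> m A B C G"
    by (rule integer_abc[OF range]) blast
  show ?thesis
  proof (rule exI[of _ "1 / 2 ^ m\<^sub>0"], rule conjI, simp, rule exI[of _ \<epsilon>], intro conjI ballI allI impI)
    fix \<delta> :: real and A B C :: "real set"
    assume \<delta>: "\<delta> \<in> dyadic_scales \<inter> {0<..1 / 2 ^ m\<^sub>0}"
      and ABC: "A \<subseteq> scaled_ints \<delta> \<inter> {0..1} \<and> B \<subseteq> scaled_ints \<delta> \<inter> {0..1} \<and> C \<subseteq> scaled_ints \<delta> \<inter> {0..1} \<and>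
        katz_tao \<delta> \<alpha> A \<and> katz_tao \<delta> \<beta> B \<and> katz_tao \<delta> \<gamma> C \<and>
        real (card B) powr \<gamma> * real (card C) powr \<beta> * \<delta> powr (\<beta> * \<gamma>) \<ge> \<delta> powr (- \<eta>)"
    obtain m where m: "\<delta> = 1 / 2 ^ m" using \<delta> by (auto simp: dyadic_scales_def)
    have "(2::real) ^ m\<^sub>0 \<le> 2 ^ m" using \<delta> by (simp add: m divide_simps)
    then have "m\<^sub>0 \<le> m" by simp
    have "0 \<le> \<delta>" "\<delta> \<le> 1" by (simp_all add: m)
    then have "\<delta> powr (- min \<eta> 1) \<le> \<delta> powr (- \<eta>)" by (intro powr_mono') auto
    then show "\<exists>c\<in>C. \<forall>G. G \<subseteq> A \<times> B \<and> real (card G) \<ge> \<delta> powr \<epsilon> * real (card A) * real (card B) \<longrightarrow>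
        real (dyadic_number \<delta> {a + c * b | a b. (a, b) \<in> G}) \<ge> \<delta> powr (- \<epsilon>) * real (card A)"
      using ABC by (intro exists_expanding_slope[OF no_config[OF \<open>m\<^sub>0 \<le> m\<close>] m]) linarith+
  qed (rule \<epsilon>)
qed

end
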